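(* For any asymptotic manifold with corners $X$ and any $f\in C^\infty(X)$, the set $\mathbb R\setminus\mathrm{Reg}(f)$ has Lebesgue measure $0$, where $\mathrm{Reg}(f)\subseteq\mathbb R$ is the set of regular values for $f$.
   Context: **$C^\infty$-schemes.** $C^\infty\mathrm{Sch}$ is the opposite of the category of finitely generated $C^\infty$-rings (quotients $C^\infty(\mathbb R^n)/I$); its objects are called $C^\infty$-schemes; $X\leftrightarrow C^\infty(X)$, $\emptyset:=\mathrm{Spec}(0)$. Open subschemes of $X$ are $X_{f\ne0}:=\mathrm{Spec}(C^\infty(X)\{f^{-1}\})$. Intersections are fibre products over $X$. The closure $\overline U$ of $U\subseteq X$ is $\mathrm{Spec}(C^\infty(X)/\mathrm{Ker}(C^\infty(X)\to C^\infty(U)))$. For an ideal $I$, $\sqrt[\infty]I:=\{a\mid(C^\infty(X)/I)\{a^{-1}\}=0\}$; $X_{red}:=\mathrm{Spec}(C^\infty(X)/\sqrt[\infty]0)$. For $r\in\mathbb R$ and $\alpha_r\in C^\infty(\mathbb R)$ with zero set $(-\infty,r]$: $X_{f\le r}:=\mathrm{Spec}(C^\infty(X)/\sqrt[\infty]{(\alpha_r(f))})$, $X_{f>r}:=X_{\alpha_r(f)\ne0}$, similarly $X_{f\ge r}$, $X_{f<r}$; $X_{f=r}:=X_{f\le r}\cap X_{f\ge r}$. Manifolds are non-empty, Hausdorff, second countable. **Manifolds with corners.** For a manifold $M$ and $\{f_1,\dots,f_m\}\subseteq C^\infty(M)$, $0$ is a regular value for $\{f_j\}$ if for each $j$ it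 is a regular value for $f_j$ and for the restrictions of $f_j$ to $\bigcap_{i\in T}M_{f_i=0}$ for all $T\subseteq\{1,\dots,m\}\setminus\{j\}$. A non-empty $X$ is an $n$-dimensional manifold with corners if $X\cong\bigcap_{j}M_{f_j\le0}=\overline{\bigcap_jM_{f_j<0}}$ for some $n$-dimensional manifold $M$ and $\{f_1,\dots,f_m\}$ having $0$ as a regular value; $\{M,f_1,\dots,f_m\}$ is a realization of $X$. An $r\in\mathbb R$ is a regular value for $f\in C^\infty(X)$ if there are a realization $\{M,f_1,\dots,f_m\}$ of $X$ and an extension $\tilde f\in C^\infty(M)$ of $f$ such that $0$ is a regular value for $\{\tilde f-r,f_1,\dots,f_m\}$. **Asymptotic manifolds with corners.** A regular system of open subschemes of $M$ is a family $\{U_i\}_{i\in D}$ of non-empty open subschemes indexed by a non-empty directed poset $D$ with $\overline U_j\subseteq U_i$ for all $i<j$; $\bigcap_{i\in D}U_i:=\lim_iU_i$ in $C^\infty\mathrm{Sch}$. For $n\ge0$, $X$ is an $n$-dimensional asymptotic manifold with corners if $X_{red}\cong\bigcap_{i\in D}U_i$ for some regular system of open subschemes of an $n$-dimensional manifold with corners $M$; $\{M,\{U_i\}\}$ is a presentation of $X$. The $-1$-dimensional one is $\emptyset$. For $f\in C^\infty(X)$, $r\in\mathbb R$ is a regular value if there is a presentation $\{M,\{U_i\}\}$ of $X$ such that $r$ is a regular value for a preimage in $C^\infty(M)$ of the image of $f$ in $C^\infty(X_{red})$.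
   Formalization: For X empty, which has no presentation, every real counts as a regular value (literally Reg(f) would be empty); the loci where f_i=0 are taken reduced in "regular value"; manifolds and index posets range over fixed sets containing, up to isomorphism and reindexing, all instances. *)

theory Defs
  imports "HOL-Analysis.Analysis" "HOL-Algebra.QuotRing"
begin

section \<open>Smooth functions on open subsets of Euclidean spaces\<close>

text \<open>The arity of an operation of a \<open>C\<^sup>\<infinity>\<close>-ring is a number, not a type, so \<open>\<real>\<^sup>n\<close> is the space of
  sequences that vanish from index \<open>n\<close> on, as in \<^const>\<open>Euclidean_space\<close>.\<close>

abbreviation Rn :: "nat \<Rightarrow> (nat \<Rightarrow> real) set" where
  "Rn n \<equiv> topspace (Euclidean_space n)"

definition tuple :: "nat \<Rightarrow> (nat \<Rightarrow> real) \<Rightarrow> nat \<Rightarrow> real" where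
  "tuple n a = (\<lambda>i. if i < n then a i else 0)"

text \<open>For \<open>V\<close> open in \<open>\<real>\<^sup>n\<close>: all iterated partial derivatives exist and are continuous on \<open>V\<close>.
  The definition is coinductive: \<open>D i\<close> is the \<open>i\<close>-th partial derivative.\<close>

coinductive smooth_on :: "nat \<Rightarrow> (nat \<Rightarrow> real) set \<Rightarrow> ((nat \<Rightarrow> real) \<Rightarrow> real) \<Rightarrow> bool"
  for n :: nat and V :: "(nat \<Rightarrow> real) set"
where
  "\<lbrakk> continuous_map (subtopology (Euclidean_space n) V) euclideanreal f;
     \<forall>i<n. (\<forall>x\<in>V. ((\<lambda>t. f (x(i := t))) has_real_derivative D i x) (at (x i))) \<and>
           smooth_on n V (D i) \<rbrakk>
   \<Longrightarrow> smooth_on n V f"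


section \<open>\<open>C\<^sup>\<infinity>\<close>-rings\<close>

text \<open>\<open>cop A n g a\<close> is the result of the \<open>n\<close>-ary operation given by \<open>g \<in> C\<^sup>\<infinity>(\<real>\<^sup>n)\<close> on the arguments
  \<open>a 0, \<dots>, a (n - 1)\<close>; the values of \<open>a\<close> at other indices are irrelevant.\<close>

record 'a cinf = "'a partial_object" +
  cop :: "nat \<Rightarrow> ((nat \<Rightarrow> real) \<Rightarrow> real) \<Rightarrow> (nat \<Rightarrow> 'a) \<Rightarrow> 'a"

definition function_cinf :: "'p set \<Rightarrow> ('p \<Rightarrow> real) set \<Rightarrow> ('p \<Rightarrow> real) cinf" where
  "function_cinf P F = \<lparr>carrier = F, cop = (\<lambda>n g a. \<lambda>p\<in>P. g (tuple n (\<lambda>i. a i p)))\<rparr>"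

definition CinfR :: "nat \<Rightarrow> ((nat \<Rightarrow> real) \<Rightarrow> real) cinf" where
  "CinfR n = function_cinf (Rn n) {f \<in> extensional (Rn n). smooth_on n (Rn n) f}"

definition real_cinf :: "real cinf" where
  "real_cinf = \<lparr>carrier = UNIV, cop = (\<lambda>n g a. g (tuple n a))\<rparr>"

definition cinf_ring :: "'a cinf \<Rightarrow> bool" where
  "cinf_ring A \<longleftrightarrow>
     (\<forall>n g a. g \<in> carrier (CinfR n) \<and> (\<forall>i<n. a i \<in> carrier A) \<longrightarrow> cop A n g a \<in> carrier A) \<and>
     (\<forall>n g a b. g \<in> carrier (CinfR n) \<and> (\<forall>i<n. a i \<in> carrier A \<and> a i = b i)
        \<longrightarrow> cop A n g a = cop A n g b) \<and>
     (\<forall>n a i. i < n \<and> (\<forall>j<n. a j \<in> carrier A) \<longrightarrow> cop A n (\<lambda>x\<in>Rn n. x i) a = a i) \<and>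
     (\<forall>m n f g a. f \<in> carrier (CinfR m) \<and> (\<forall>j<m. g j \<in> carrier (CinfR n)) \<and>
        (\<forall>i<n. a i \<in> carrier A)
        \<longrightarrow> cop A n (\<lambda>x\<in>Rn n. f (tuple m (\<lambda>j. g j x))) a = cop A m f (\<lambda>j. cop A n (g j) a))"

text \<open>Homomorphisms are extensional, so that equality of homomorphisms is equality of functions.\<close>

definition chom :: "'a cinf \<Rightarrow> 'b cinf \<Rightarrow> ('a \<Rightarrow> 'b) set" where
  "chom A B = {h \<in> carrier A \<rightarrow>\<^sub>E carrier B.
     \<forall>n g a. g \<in> carrier (CinfR n) \<and> (\<forall>i<n. a i \<in> carrier A)
       \<longrightarrow> h (cop A n g a) = cop B n g (\<lambda>i. h (a i))}"

definition ciso :: "'a cinf \<Rightarrow> 'b cinf \<Rightarrow> ('a \<Rightarrow> 'b) set" where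
  "ciso A B = {h \<in> chom A B. bij_betw h (carrier A) (carrier B)}"

definition op1 :: "'a cinf \<Rightarrow> (real \<Rightarrow> real) \<Rightarrow> 'a \<Rightarrow> 'a" where
  "op1 A \<alpha> x = cop A 1 (\<lambda>v\<in>Rn 1. \<alpha> (v 0)) (\<lambda>_. x)"

definition op2 :: "'a cinf \<Rightarrow> (real \<Rightarrow> real \<Rightarrow> real) \<Rightarrow> 'a \<Rightarrow> 'a \<Rightarrow> 'a" where
  "op2 A \<beta> x y = cop A 2 (\<lambda>v\<in>Rn 2. \<beta> (v 0) (v 1)) (\<lambda>i. if i = 0 then x else y)"

definition const :: "'a cinf \<Rightarrow> real \<Rightarrow> 'a" where
  "const A c = cop A 0 (\<lambda>v\<in>Rn 0. c) (\<lambda>_. undefined)"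

definition as_ring :: "'a cinf \<Rightarrow> 'a ring" where
  "as_ring A = \<lparr>carrier = carrier A, mult = op2 A (*), one = const A 1,
                zero = const A 0, add = op2 A (+)\<rparr>"

definition zero_ring :: "'a cinf \<Rightarrow> bool" where
  "zero_ring A \<longleftrightarrow> carrier A = {const A 0}"

text \<open>Every ideal of the underlying ring is a congruence for all smooth operations (Hadamard), so
  the operations on cosets do not depend on the chosen representatives.\<close>

definition quot :: "'a cinf \<Rightarrow> 'a set \<Rightarrow> 'a set cinf" where
  "quot A I = \<lparr>carrier = a_rcosets\<^bsub>as_ring A\<^esub> I,
     cop = (\<lambda>n g a. I +>\<^bsub>as_ring A\<^esub> cop A n g (\<lambda>i. SOME x. x \<in> a i))\<rparr>"

definition quot_map :: "'a cinf \<Rightarrow> 'a set \<Rightarrow> 'a \<Rightarrow> 'a set" where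
  "quot_map A I = (\<lambda>x\<in>carrier A. I +>\<^bsub>as_ring A\<^esub> x)"


section \<open>\<open>C\<^sup>\<infinity>\<close>-schemes\<close>

text \<open>A \<open>C\<^sup>\<infinity>\<close>-scheme \<open>X\<close> is represented by the finitely generated ring \<open>C\<^sup>\<infinity>(X)\<close>, and a morphism
  \<open>X \<rightarrow> Y\<close> by a homomorphism \<open>C\<^sup>\<infinity>(Y) \<rightarrow> C\<^sup>\<infinity>(X)\<close>; a subscheme of \<open>X\<close> is given by \<open>B\<close> and
  \<open>\<phi> \<in> chom C\<^sup>\<infinity>(X) B\<close>.\<close>

definition cinf_scheme :: "'a cinf \<Rightarrow> bool" where
  "cinf_scheme A \<longleftrightarrow> cinf_ring A \<and>
     (\<exists>n I. ideal I (as_ring (CinfR n)) \<and> ciso A (quot (CinfR n) I) \<noteq> {})"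

text \<open>Every \<open>C\<^sup>\<infinity>\<close>-scheme is isomorphic to one with elements of the following type. So existential
  quantification over \<open>C\<^sup>\<infinity>\<close>-schemes, and the test objects of universal properties, may be
  restricted to this type.\<close>

type_synonym std = "((nat \<Rightarrow> real) \<Rightarrow> real) set"

definition subscheme_le :: "'a cinf \<Rightarrow> 'b cinf \<Rightarrow> ('a \<Rightarrow> 'b) \<Rightarrow> 'c cinf \<Rightarrow> ('a \<Rightarrow> 'c) \<Rightarrow> bool" where
  "subscheme_le A B \<phi> C \<psi> \<longleftrightarrow> (\<exists>u\<in>chom C B. \<forall>x\<in>carrier A. u (\<psi> x) = \<phi> x)"

definition subscheme_eq :: "'a cinf \<Rightarrow> 'b cinf \<Rightarrow> ('a \<Rightarrow> 'b) \<Rightarrow> 'c cinf \<Rightarrow> ('a \<Rightarrow> 'c) \<Rightarrow> bool" where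
  "subscheme_eq A B \<phi> C \<psi> \<longleftrightarrow> (\<exists>u\<in>ciso C B. \<forall>x\<in>carrier A. u (\<psi> x) = \<phi> x)"

text \<open>\<open>(L, \<phi>)\<close> is \<open>A{a\<^sup>-\<^sup>1}\<close>, i.e. the open subscheme where \<open>a\<close> does not vanish.\<close>

definition is_localization :: "'a cinf \<Rightarrow> 'a \<Rightarrow> 'b cinf \<Rightarrow> ('a \<Rightarrow> 'b) \<Rightarrow> bool" where
  "is_localization A a L \<phi> \<longleftrightarrow>
     cinf_scheme L \<and> \<phi> \<in> chom A L \<and> \<phi> a \<in> Units (as_ring L) \<and>
     (\<forall>T :: std cinf. cinf_scheme T \<longrightarrow>
        (\<forall>\<tau>\<in>chom A T. \<tau> a \<in> Units (as_ring T) \<longrightarrow>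
           (\<exists>!u. u \<in> chom L T \<and> (\<forall>x\<in>carrier A. u (\<phi> x) = \<tau> x))))"

definition is_open_subscheme :: "'a cinf \<Rightarrow> 'b cinf \<Rightarrow> ('a \<Rightarrow> 'b) \<Rightarrow> bool" where
  "is_open_subscheme A B \<phi> \<longleftrightarrow> (\<exists>a\<in>carrier A. is_localization A a B \<phi>)"

text \<open>\<open>(N, \<psi>)\<close> is the fibre product over \<open>Spec A\<close> of the family \<open>(B j, \<phi> j)\<close>, \<open>j \<in> J\<close>.\<close>

definition is_intersection ::
  "'a cinf \<Rightarrow> 'j set \<Rightarrow> ('j \<Rightarrow> 'b cinf) \<Rightarrow> ('j \<Rightarrow> 'a \<Rightarrow> 'b) \<Rightarrow> 'c cinf \<Rightarrow> ('a \<Rightarrow> 'c) \<Rightarrow> bool" where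
  "is_intersection A J B \<phi> N \<psi> \<longleftrightarrow>
     cinf_scheme N \<and> \<psi> \<in> chom A N \<and>
     (\<exists>\<iota>. (\<forall>j\<in>J. \<iota> j \<in> chom (B j) N \<and> (\<forall>x\<in>carrier A. \<iota> j (\<phi> j x) = \<psi> x)) \<and>
        (\<forall>T :: std cinf. cinf_scheme T \<longrightarrow>
           (\<forall>\<tau>\<in>chom A T. \<forall>\<kappa>.
              (\<forall>j\<in>J. \<kappa> j \<in> chom (B j) T \<and> (\<forall>x\<in>carrier A. \<kappa> j (\<phi> j x) = \<tau> x)) \<longrightarrow>
              (\<exists>!u. u \<in> chom N T \<and> (\<forall>x\<in>carrier A. u (\<psi> x) = \<tau> x) \<and>
                    (\<forall>j\<in>J. \<forall>y\<in>carrier (B j). u (\<iota> j y) = \<kappa> j y)))))"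

text \<open>\<open>(L, \<iota>)\<close> is the limit of the diagram of schemes \<open>Spec (B i)\<close>, \<open>i \<in> D\<close>, whose morphism
  \<open>Spec (B j) \<rightarrow> Spec (B i)\<close> for \<open>(i, j) \<in> r\<close> is given by \<open>\<rho> i j\<close>.\<close>

definition is_limit ::
  "'i set \<Rightarrow> 'i rel \<Rightarrow> ('i \<Rightarrow> 'b cinf) \<Rightarrow> ('i \<Rightarrow> 'i \<Rightarrow> 'b \<Rightarrow> 'b) \<Rightarrow> 'c cinf \<Rightarrow> ('i \<Rightarrow> 'b \<Rightarrow> 'c) \<Rightarrow> bool" where
  "is_limit D r B \<rho> L \<iota> \<longleftrightarrow>
     cinf_scheme L \<and> (\<forall>i\<in>D. \<iota> i \<in> chom (B i) L) \<and>
     (\<forall>(i, j)\<in>r. \<forall>x\<in>carrier (B i). \<iota> j (\<rho> i j x) = \<iota> i x) \<and>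
     (\<forall>T :: std cinf. cinf_scheme T \<longrightarrow>
        (\<forall>\<kappa>. (\<forall>i\<in>D. \<kappa> i \<in> chom (B i) T) \<and>
             (\<forall>(i, j)\<in>r. \<forall>x\<in>carrier (B i). \<kappa> j (\<rho> i j x) = \<kappa> i x) \<longrightarrow>
             (\<exists>!u. u \<in> chom L T \<and> (\<forall>i\<in>D. \<forall>x\<in>carrier (B i). u (\<iota> i x) = \<kappa> i x))))"

text \<open>The closure of the subscheme \<open>(B, \<phi>)\<close> is \<open>quot A (closure_ideal A B \<phi>)\<close>.\<close>

definition closure_ideal :: "'a cinf \<Rightarrow> 'b cinf \<Rightarrow> ('a \<Rightarrow> 'b) \<Rightarrow> 'a set" where
  "closure_ideal A B \<phi> = a_kernel (as_ring A) (as_ring B) \<phi>"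

definition inf_radical :: "'a cinf \<Rightarrow> 'a set \<Rightarrow> 'a set" where
  "inf_radical A I = {a \<in> carrier A. \<exists>(L :: std cinf) \<phi>.
     is_localization (quot A I) (quot_map A I a) L \<phi> \<and> zero_ring L}"

definition nil_radical :: "'a cinf \<Rightarrow> 'a set" where
  "nil_radical A = inf_radical A {const A 0}"

definition red :: "'a cinf \<Rightarrow> 'a set cinf" where
  "red A = quot A (nil_radical A)"

definition red_map :: "'a cinf \<Rightarrow> 'a \<Rightarrow> 'a set" where
  "red_map A = quot_map A (nil_radical A)"

definition cutoff :: "real \<Rightarrow> real \<Rightarrow> real" where
  "cutoff r = (SOME \<alpha>. (\<lambda>v\<in>Rn 1. \<alpha> (v 0)) \<in> carrier (CinfR 1) \<and> {t. \<alpha> t = 0} = {..r})"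

text \<open>The subschemes \<open>X\<^bsub>f \<ge> r\<^esub>\<close> and \<open>X\<^bsub>f < r\<^esub>\<close> are obtained from \<open>cutoff (- r) (- f)\<close>: the function
  \<open>t \<mapsto> cutoff (- r) (- t)\<close> has zero set \<open>{r..}\<close>.\<close>

definition le_ideal :: "'a cinf \<Rightarrow> 'a \<Rightarrow> real \<Rightarrow> 'a set" where
  "le_ideal A f r = inf_radical A (PIdl\<^bsub>as_ring A\<^esub> (op1 A (cutoff r) f))"

definition ge_ideal :: "'a cinf \<Rightarrow> 'a \<Rightarrow> real \<Rightarrow> 'a set" where
  "ge_ideal A f r = inf_radical A (PIdl\<^bsub>as_ring A\<^esub> (op1 A (\<lambda>t. cutoff (- r) (- t)) f))"

definition is_lt_locus :: "'a cinf \<Rightarrow> 'a \<Rightarrow> real \<Rightarrow> 'b cinf \<Rightarrow> ('a \<Rightarrow> 'b) \<Rightarrow> bool" where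
  "is_lt_locus A f r B \<phi> \<longleftrightarrow> is_localization A (op1 A (\<lambda>t. cutoff (- r) (- t)) f) B \<phi>"

definition is_eq_locus :: "'a cinf \<Rightarrow> 'a \<Rightarrow> real \<Rightarrow> 'b cinf \<Rightarrow> ('a \<Rightarrow> 'b) \<Rightarrow> bool" where
  "is_eq_locus A f r B \<phi> \<longleftrightarrow>
     is_intersection A {le_ideal A f r, ge_ideal A f r} (quot A) (quot_map A) B \<phi>"


section \<open>Manifolds\<close>

text \<open>An \<open>n\<close>-dimensional manifold is given by a topology \<open>S\<close> and a smooth atlas \<open>\<A>\<close> of pairs of an open
  set and a chart. It has at most continuum many points, so points of type \<^typ>\<open>nat \<Rightarrow> real\<close> suffice.\<close>

definition is_manifold ::
  "nat \<Rightarrow> 'p topology \<Rightarrow> ('p set \<times> ('p \<Rightarrow> nat \<Rightarrow> real)) set \<Rightarrow> bool" where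
  "is_manifold n S \<A> \<longleftrightarrow>
     topspace S \<noteq> {} \<and> Hausdorff_space S \<and> second_countable S \<and>
     topspace S = (\<Union>(U, \<phi>)\<in>\<A>. U) \<and>
     (\<forall>(U, \<phi>)\<in>\<A>. openin S U \<and> openin (Euclidean_space n) (\<phi> ` U) \<and>
        homeomorphic_map (subtopology S U) (subtopology (Euclidean_space n) (\<phi> ` U)) \<phi>) \<and>
     (\<forall>(U, \<phi>)\<in>\<A>. \<forall>(W, \<psi>)\<in>\<A>. \<forall>i<n.
        smooth_on n (\<phi> ` (U \<inter> W)) (\<lambda>x. \<psi> (inv_into U \<phi> x) i))"

definition CinfM ::
  "nat \<Rightarrow> 'p topology \<Rightarrow> ('p set \<times> ('p \<Rightarrow> nat \<Rightarrow> real)) set \<Rightarrow> ('p \<Rightarrow> real) cinf" where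
  "CinfM n S \<A> = function_cinf (topspace S)
     {f \<in> extensional (topspace S).
        \<forall>(U, \<phi>)\<in>\<A>. smooth_on n (\<phi> ` U) (\<lambda>x. f (inv_into U \<phi> x))}"


section \<open>Regular values on manifolds with corners\<close>

text \<open>The points of a manifold are the homomorphisms from its ring of smooth functions to \<open>\<real>\<close>, and
  the tangent vectors at a point \<open>p\<close> are the \<open>\<real>\<close>-linear derivations at \<open>p\<close>. So \<open>r\<close> is a regular
  value of \<open>h\<close> iff the differential of \<open>h\<close> is nonzero at each point where \<open>h\<close> is \<open>r\<close>.\<close>

definition points :: "'a cinf \<Rightarrow> ('a \<Rightarrow> real) set" where
  "points B = chom B real_cinf"

definition tangent_vectors :: "'a cinf \<Rightarrow> ('a \<Rightarrow> real) \<Rightarrow> ('a \<Rightarrow> real) set" where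
  "tangent_vectors B p = {v.
     (\<forall>x\<in>carrier B. \<forall>y\<in>carrier B.
        v (x \<oplus>\<^bsub>as_ring B\<^esub> y) = v x + v y \<and>
        v (x \<otimes>\<^bsub>as_ring B\<^esub> y) = p x * v y + p y * v x) \<and>
     (\<forall>c. \<forall>x\<in>carrier B. v (op1 B ((*) c) x) = c * v x)}"

definition regular_value :: "'a cinf \<Rightarrow> 'a \<Rightarrow> real \<Rightarrow> bool" where
  "regular_value B h r \<longleftrightarrow>
     (\<forall>p\<in>points B. p h = r \<longrightarrow> (\<exists>v\<in>tangent_vectors B p. v h \<noteq> 0))"

text \<open>\<open>\<Inter>\<^bsub>i \<in> K\<^esub> M\<^bsub>f\<^sub>i = 0\<^esub>\<close> is taken with its reduced structure. Without reduction \<open>M\<^bsub>f = 0\<^esub>\<close> is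
  the formal neighbourhood in \<open>M\<close> of the zero set of \<open>f\<close> (functions vanishing on \<open>M\<^bsub>f \<le> 0\<^esub>\<close> and
  functions vanishing on \<open>M\<^bsub>f \<ge> 0\<^esub>\<close> only add up to functions flat along the zero set), whose tangent
  spaces are those of \<open>M\<close>. The reduction is the submanifold meant here.\<close>

definition zero_regular :: "'a cinf \<Rightarrow> 'a list \<Rightarrow> bool" where
  "zero_regular A fs \<longleftrightarrow>
     (\<forall>j<length fs. regular_value A (fs ! j) 0 \<and>
        (\<forall>K \<subseteq> {..<length fs} - {j}. \<exists>(E :: nat \<Rightarrow> std cinf) \<epsilon> (N :: std cinf) \<psi>.
           (\<forall>i\<in>K. is_eq_locus A (fs ! i) 0 (E i) (\<epsilon> i)) \<and>
           is_intersection A K E \<epsilon> N \<psi> \<and>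
           regular_value (red N) (red_map N (\<psi> (fs ! j))) 0))"

text \<open>\<open>(M, fs)\<close> with \<open>M = (S, \<A>)\<close> is a realization of \<open>X\<close>, where \<open>q\<close> is the restriction map
  \<open>C\<^sup>\<infinity>(M) \<rightarrow> C\<^sup>\<infinity>(X)\<close>. As a member of the category of \<open>C\<^sup>\<infinity>\<close>-schemes, \<open>M\<close> has a finitely generated ring of
  smooth functions; this holds for every manifold, by Whitney's embedding theorem.\<close>

definition realization ::
  "nat \<Rightarrow> 'a cinf \<Rightarrow> (nat \<Rightarrow> real) topology \<Rightarrow>
   ((nat \<Rightarrow> real) set \<times> ((nat \<Rightarrow> real) \<Rightarrow> nat \<Rightarrow> real)) set \<Rightarrow>
   ((nat \<Rightarrow> real) \<Rightarrow> real) list \<Rightarrow> (((nat \<Rightarrow> real) \<Rightarrow> real) \<Rightarrow> 'a) \<Rightarrow> bool" where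
  "realization n X S \<A> fs q \<longleftrightarrow>
     is_manifold n S \<A> \<and> cinf_scheme (CinfM n S \<A>) \<and>
     set fs \<subseteq> carrier (CinfM n S \<A>) \<and> zero_regular (CinfM n S \<A>) fs \<and>
     is_intersection (CinfM n S \<A>) {..<length fs}
       (\<lambda>j. quot (CinfM n S \<A>) (le_ideal (CinfM n S \<A>) (fs ! j) 0))
       (\<lambda>j. quot_map (CinfM n S \<A>) (le_ideal (CinfM n S \<A>) (fs ! j) 0)) X q \<and>
     (\<exists>(G :: nat \<Rightarrow> std cinf) \<gamma> (U :: std cinf) \<omega>.
        (\<forall>j<length fs. is_lt_locus (CinfM n S \<A>) (fs ! j) 0 (G j) (\<gamma> j)) \<and>
        is_intersection (CinfM n S \<A>) {..<length fs} G \<gamma> U \<omega> \<and>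
        subscheme_eq (CinfM n S \<A>) X q
          (quot (CinfM n S \<A>) (closure_ideal (CinfM n S \<A>) U \<omega>))
          (quot_map (CinfM n S \<A>) (closure_ideal (CinfM n S \<A>) U \<omega>)))"

definition manifold_with_corners :: "nat \<Rightarrow> 'a cinf \<Rightarrow> bool" where
  "manifold_with_corners n X \<longleftrightarrow>
     cinf_scheme X \<and> \<not> zero_ring X \<and> (\<exists>S \<A> fs q. realization n X S \<A> fs q)"

definition corners_regular_value :: "'a cinf \<Rightarrow> 'a \<Rightarrow> real \<Rightarrow> bool" where
  "corners_regular_value X f r \<longleftrightarrow>
     (\<exists>n S \<A> fs q. realization n X S \<A> fs q \<and>
        (\<exists>F\<in>carrier (CinfM n S \<A>). q F = f \<and>
           zero_regular (CinfM n S \<A>) ((\<lambda>p\<in>topspace S. F p - r) # fs)))"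


section \<open>Asymptotic manifolds with corners\<close>

text \<open>A regular system \<open>(B i, \<phi> i)\<close>, \<open>i \<in> D\<close>, of open subschemes of \<open>M\<close> with transition maps \<open>\<rho>\<close>,
  where \<open>(i, j) \<in> r\<close> means \<open>i \<le> j\<close>. The \<open>\<rho> i j\<close> exist by the closure condition and are unique because
  localizations are epimorphisms.\<close>

definition regular_system ::
  "'a cinf \<Rightarrow> 'i set \<Rightarrow> 'i rel \<Rightarrow> ('i \<Rightarrow> 'b cinf) \<Rightarrow> ('i \<Rightarrow> 'a \<Rightarrow> 'b) \<Rightarrow> ('i \<Rightarrow> 'i \<Rightarrow> 'b \<Rightarrow> 'b) \<Rightarrow> bool" where
  "regular_system M D r B \<phi> \<rho> \<longleftrightarrow>
     D \<noteq> {} \<and> partial_order_on D r \<and> (\<forall>i\<in>D. \<forall>j\<in>D. \<exists>k\<in>D. (i, k) \<in> r \<and> (j, k) \<in> r) \<and>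
     (\<forall>i\<in>D. is_open_subscheme M (B i) (\<phi> i) \<and> \<not> zero_ring (B i)) \<and>
     (\<forall>(i, j)\<in>r. i \<noteq> j \<longrightarrow>
        subscheme_le M (quot M (closure_ideal M (B j) (\<phi> j)))
          (quot_map M (closure_ideal M (B j) (\<phi> j))) (B i) (\<phi> i)) \<and>
     (\<forall>(i, j)\<in>r. \<rho> i j \<in> chom (B i) (B j) \<and> (\<forall>x\<in>carrier M. \<rho> i j (\<phi> i x) = \<phi> j x))"

text \<open>\<open>\<kappa>\<close> is the resulting map \<open>C\<^sup>\<infinity>(M) \<rightarrow> C\<^sup>\<infinity>(X\<^sub>r\<^sub>e\<^sub>d)\<close>. Replacing the index set by the set of the
  open subschemes that occur, ordered by \<open>V < W\<close> iff \<open>V \<noteq> W\<close> and \<open>V\<close> contains the closure of \<open>W\<close>,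
  changes neither the limit nor \<open>\<kappa>\<close>. An open subscheme of \<open>M\<close> is determined by its set of points, and
  \<open>M\<close> embeds in some \<open>\<real>\<^sup>N\<close>, so index sets of type \<^typ>\<open>(nat \<Rightarrow> real) set set\<close> cover all
  directed posets.\<close>

definition presentation ::
  "nat \<Rightarrow> 'a cinf \<Rightarrow> std cinf \<Rightarrow> (nat \<Rightarrow> real) set set \<Rightarrow> (nat \<Rightarrow> real) set rel \<Rightarrow>
   ((nat \<Rightarrow> real) set \<Rightarrow> std cinf) \<Rightarrow> ((nat \<Rightarrow> real) set \<Rightarrow> std \<Rightarrow> std) \<Rightarrow> (std \<Rightarrow> 'a set) \<Rightarrow> bool" where
  "presentation n X M D r B \<phi> \<kappa> \<longleftrightarrow>
     manifold_with_corners n M \<and> \<kappa> \<in> chom M (red X) \<and>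
     (\<exists>\<rho> \<iota>. regular_system M D r B \<phi> \<rho> \<and> is_limit D r B \<rho> (red X) \<iota> \<and>
        (\<forall>i\<in>D. \<forall>x\<in>carrier M. \<iota> i (\<phi> i x) = \<kappa> x))"

definition asymptotic_manifold_dim :: "int \<Rightarrow> 'a cinf \<Rightarrow> bool" where
  "asymptotic_manifold_dim n X \<longleftrightarrow> cinf_scheme X \<and>
     (n = -1 \<and> zero_ring X \<or>
      n \<ge> 0 \<and> (\<exists>M D r B \<phi> \<kappa>. presentation (nat n) X M D r B \<phi> \<kappa>))"

definition asymptotic_manifold :: "'a cinf \<Rightarrow> bool" where
  "asymptotic_manifold X \<longleftrightarrow> (\<exists>n. asymptotic_manifold_dim n X)"

text \<open>The empty scheme has no presentation. As it has no points, every real number is a regular value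
  of the unique function on it.\<close>

definition Reg :: "'a cinf \<Rightarrow> 'a \<Rightarrow> real set" where
  "Reg X f = {r. zero_ring X \<or>
     (\<exists>n M D ord B \<phi> \<kappa>. presentation n X M D ord B \<phi> \<kappa> \<and>
        (\<exists>F\<in>carrier M. \<kappa> F = red_map X f \<and> corners_regular_value M F r))}"

end

theory Submission
  imports Defs "HOL-Computational_Algebra.Polynomial"
begin

text \<open>The complement of \<open>Reg f\<close> is a set of critical values. Choose a presentation of \<open>X\<close> in which \<open>f\<close> extends to
 the ambient manifold with corners \<open>M\<close>, and then to the manifold of a realization of \<open>M\<close>. If the directed system of
 open sets has no greatest element, restriction from \<open>U\<^sub>i\<close> to a smaller \<open>U\<^sub>j\<close> factors through the closure of \<open>U\<^sub>j\<close>,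
 so every function on the limit comes from \<open>M\<close>. If it has a greatest element, \<open>X\<^sub>r\<^sub>e\<^sub>d\<close> is itself an open subscheme of
 \<open>M\<close>, hence a manifold with corners, and is presented by itself; that \<open>C\<^sup>\<infinity>\<close> of the open set \<open>a \<noteq> 0\<close> is generated by
 restrictions and \<open>1/a\<close> comes from bump functions, and a relation between these generators is moved to \<open>M\<close> by
 multiplying with a positive function that decays rapidly at \<open>a = 0\<close>.

 On a manifold, regularity of a family means that at each point the differentials of the functions vanishing there
 are linearly independent. If this holds for \<open>f\<^sub>1, \<dots>, f\<^sub>m\<close> but fails for \<open>F - r, f\<^sub>1, \<dots>, f\<^sub>m\<close> at a point \<open>p\<close>, then \<open>F p = r\<close>
 and \<open>dF = \<Sum>\<^sub>T \<mu>\<^sub>j df\<^sub>j\<close> at \<open>p\<close> for the set \<open>T\<close> of those \<open>j\<close> with \<open>f\<^sub>j p = 0\<close>. Then \<open>(p, \<mu>)\<close> is a critical point of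
 \<open>F - \<Sum>\<^sub>T \<mu>\<^sub>j f\<^sub>j\<close> with value \<open>r\<close>, and Sard's theorem for real-valued functions applies in countably many charts.\<close>

section \<open>Calculus of smooth functions\<close>

text \<open>Rings such as those of \<open>X\<close> or of a zero locus are known only through
  universal properties, tested against rings of type \<open>std\<close>. Geometry enters by using
  homomorphisms to the reals as points, derivations as tangent vectors, and kernels as ideals of
  vanishing functions.

  The closure condition concerns distinct indices only. A system with a greatest element may
  therefore end in an arbitrary open subscheme, on which a function like \<open>1 / a\<close> does
  not extend to \<open>M\<close>; this forces a change of presentation, and with it a realization of
  the open subscheme. The delicate clause there is that the ring is the intersection of the loci
  where the constraints are at most 0: it asks for membership in an ideal generated by several
  ideals, not just for vanishing on a set. Such a membership is moved between \<open>M\<close> and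
  its open part by a weight that decays rapidly but is positive, hence a unit that can be cancelled
  afterwards.

  On the locus where a constraint is zero only its cutoffs are known to vanish; the constraint
  itself dies in the reduction.\<close>

abbreviation Sm :: "nat => ((nat => real) => real) => bool" where
 "Sm n \<equiv> smooth_on n (Rn n)"

abbreviation opn :: "nat => (nat => real) set => bool" where
 "opn n V \<equiv> openin (Euclidean_space n) V"

definition cub :: "nat => (nat => real) => real => (nat => real) set" where
 "cub n x e = {y \<in> Rn n. \<forall>i<n. \<bar>y i - x i\<bar> < e}"

text \<open>\<open>deriv\<close> makes this a total function, so the witness \<open>D\<close> of
  \<open>smooth_on\<close> need not be carried along.\<close>

definition pd :: "nat => ((nat => real) => real) => (nat => real) => real" where
 "pd i f x = deriv (%t. f (x(i := t))) (x i)"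

section \<open>Open sets, cubes and continuity in \<open>Rn n\<close>\<close>

lemma Euclidean_space_eq: "Euclidean_space n = top_of_set {x. \<forall>i\<ge>n. x i = 0}"
 unfolding Euclidean_space_def by (simp only: euclidean_product_topology)

lemma opn_open: "opn n V \<longleftrightarrow> (\<exists>U. open U \<and> V = Rn n \<inter> U)"
 by (simp only: Euclidean_space_eq openin_open topspace_euclidean_subtopology)

lemma subtopology_Euclidean_space: "V \<subseteq> Rn n ==> subtopology (Euclidean_space n) V = top_of_set V"
 by (simp only: Euclidean_space_eq subtopology_subtopology topspace_euclidean_subtopology Int_absorb1)

lemma in_Rn: "x \<in> Rn n \<longleftrightarrow> (\<forall>i\<ge>n. x i = 0)"
 by (simp add: topspace_Euclidean_space)

lemma tuple_in_Rn [simp]: "tuple n a \<in> Rn n"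
 by (simp add: in_Rn tuple_def)

lemma tuple_apply [simp]: "i < n ==> tuple n a i = a i" "\<not> i < n ==> tuple n a i = 0"
 by (simp_all add: tuple_def)

lemma tuple_id [simp]: "x \<in> Rn n ==> tuple n x = x"
 by (auto simp: in_Rn tuple_def)

lemma upd_in_Rn [simp]: "x \<in> Rn n ==> i < n ==> x(i := t) \<in> Rn n"
 by (auto simp: in_Rn)

lemma opn_Rn [simp]: "opn n (Rn n)"
 using openin_topspace by blast

lemma opn_subset: "opn n V ==> V \<subseteq> Rn n"
 using openin_subset by blast

lemma cub_mono: "d \<le> e ==> cub n x d \<subseteq> cub n x e"
 unfolding cub_def by fastforce

lemma cub_center: "x \<in> Rn n ==> e > 0 ==> x \<in> cub n x e"
 unfolding cub_def by auto

lemma continuous_map_opn_iff: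
 "V \<subseteq> Rn n ==> continuous_map (subtopology (Euclidean_space n) V) euclideanreal f \<longleftrightarrow> continuous_on V f"
 by (simp add: subtopology_Euclidean_space)

lemma continuous_on_coord: "continuous_on V (%x::nat=>real. x i)"
 by (rule continuous_on_product_then_coordinatewise[of V "%x. x"]) (rule continuous_on_id)

lemma opn_box: "opn n {y \<in> Rn n. \<forall>i<n. \<bar>y i - x i\<bar> < r i}"
proof -
 have "{y \<in> Rn n. \<forall>i<n. \<bar>y i - x i\<bar> < r i} = Rn n \<inter> (\<Inter>i\<in>{..<n}. {y. \<bar>y i - x i\<bar> < r i})"
  by auto
 moreover have "open (\<Inter>i\<in>{..<n}. {y::nat=>real. \<bar>y i - x i\<bar> < r i})"
  by (intro open_INT ballI open_Collect_less continuous_intros continuous_on_coord) auto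
 ultimately show ?thesis
  using opn_open by blast
qed

lemma opn_cub: "opn n (cub n x e)"
 using opn_box[of n x "%_. e"] by (simp add: cub_def)

text \<open>Points of \<open>Rn n\<close> agree from index \<open>n\<close> on, so a basic open set
  of the infinite product has to be respected in the first \<open>n\<close> coordinates
  only.\<close>

lemma opn_contains_cub:
 assumes "opn n V" "x \<in> V"
 obtains e where "e > 0" "cub n x e \<subseteq> V"
proof -
 obtain U where U: "open U" "V = Rn n \<inter> U"
  using assms(1) unfolding opn_open by blast
 have "openin (product_topology (%i. euclideanreal) (UNIV::nat set)) U"
  using U(1) by (simp add: euclidean_product_topology)
 from product_topology_open_contains_basis[OF this] assms U
 obtain X where X: "x \<in> (\<Pi>\<^sub>E i\<in>UNIV. X i)" "\<And>i. open (X i)" "(\<Pi>\<^sub>E i\<in>UNIV. X i) \<subseteq> U"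
  by (metis IntD2 open_openin)
 have "\<exists>d>0. \<forall>s. \<bar>s - x i\<bar> < d --> s \<in> X i" for i
  using X(1,2) by (force simp: open_dist dist_real_def PiE_UNIV_domain)
 then obtain d where d: "\<And>i. d i > 0" "\<And>i s. \<bar>s - x i\<bar> < d i ==> s \<in> X i"
  by metis
 \<comment> \<open>The \<open>1\<close> keeps the minimum defined for \<open>n = 0\<close>.\<close>
 define e where "e = Min (insert 1 (d ` {..<n}))"
 have e: "e > 0" "\<And>i. i < n ==> e \<le> d i"
  using d(1) by (auto simp: e_def)
 have "cub n x e \<subseteq> V"
 proof
  fix y assume y: "y \<in> cub n x e"
  have "y i \<in> X i" for i
  proof (cases "i < n")
   case True
   then show ?thesis using y e(2)[OF True] d(2)[of "y i" i] unfolding cub_def by fastforce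
  next
   case False
   then have "y i = x i" using y assms(2) U(2) by (auto simp: cub_def in_Rn)
   then show ?thesis using d by simp
  qed
  then show "y \<in> V" using X(3) y U(2) by (auto simp: cub_def PiE_UNIV_domain)
 qed
 with e that show ?thesis by blast
qed

lemma continuous_on_cubD:
 assumes "opn n V" "continuous_on V f" "x \<in> V" "(e::real) > 0"
 obtains d where "d > 0" "cub n x d \<subseteq> V" "\<And>y. y \<in> cub n x d ==> \<bar>f y - f x\<bar> < e"
proof -
 have "openin (top_of_set V) (V \<inter> f -` ball (f x) e)"
  using assms(2) by (simp add: continuous_openin_preimage_gen)
 then have "opn n (V \<inter> f -` ball (f x) e)"
  using assms(1) openin_trans_full[of "Euclidean_space n" V] subtopology_Euclidean_space[OF opn_subset[OF assms(1)]] by simp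
 then obtain d where "d > 0" "cub n x d \<subseteq> V \<inter> f -` ball (f x) e"
  using assms opn_contains_cub[of n _ x] by (metis IntI centre_in_ball vimage_eq)
 moreover have "\<bar>f y - f x\<bar> < e" if "y \<in> cub n x d" for y
  using calculation that by (fastforce simp: dist_real_def abs_minus_commute)
 ultimately show ?thesis using that[of d] by blast
qed

lemma continuous_on_cubI:
 assumes "V \<subseteq> Rn n"
  "\<And>x e. x \<in> V ==> (e::real) > 0 ==> \<exists>d>0. \<forall>y \<in> V \<inter> cub n x d. \<bar>f y - f x\<bar> < e"
 shows "continuous_on V f"
proof (subst continuous_on_topological, intro ballI allI impI)
 fix x B assume x: "x \<in> V" and B: "open B" "f x \<in> B"
 then obtain e where e: "e > 0" "ball (f x) e \<subseteq> B" using open_contains_ball by blast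
 obtain d where d: "d > 0" "\<forall>y \<in> V \<inter> cub n x d. \<bar>f y - f x\<bar> < e"
  using assms(2)[OF x e(1)] by blast
 obtain A where A: "open A" "cub n x d = Rn n \<inter> A"
  using opn_cub[of n x d] unfolding opn_open by blast
 have "x \<in> A" using cub_center[of x n d] d(1) x assms(1) A(2) by auto
 moreover have "\<forall>y\<in>V. y \<in> A --> f y \<in> B"
  using d(2) e(2) A(2) assms(1) by (fastforce simp: dist_real_def abs_minus_commute)
 ultimately show "\<exists>A. open A \<and> x \<in> A \<and> (\<forall>y\<in>V. y \<in> A --> f y \<in> B)"
  using A(1) by blast
qed

lemma upd_in_cub: "x \<in> cub n y e ==> i < n ==> \<bar>t - y i\<bar> < e ==> x(i := t) \<in> cub n y e"
 by (auto simp: cub_def)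

section \<open>Smoothness: locality and coinduction\<close>

lemma eventually_upd:
 assumes "opn n V" "x \<in> V" "i < n"
 shows "\<forall>\<^sub>F t in nhds (x i). x(i := t) \<in> V"
proof -
 obtain e where e: "e > 0" "cub n x e \<subseteq> V" using opn_contains_cub[OF assms(1,2)] .
 have "x \<in> Rn n" using assms opn_subset by blast
 then have "\<And>t. dist t (x i) < e ==> x(i := t) \<in> V"
  using e upd_in_cub[OF cub_center[of x n e]] assms(3) by (auto simp: dist_real_def)
 then show ?thesis using e(1) by (auto simp: eventually_nhds_metric)
qed

lemma deriv_cong_opn:
 assumes "opn n V" "x \<in> V" "i < n" "\<And>y. y \<in> V ==> f y = g y"
  "((%t. f (x(i := t))) has_real_derivative D) (at (x i))"
 shows "((%t. g (x(i := t))) has_real_derivative D) (at (x i))"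
proof -
 have "\<forall>\<^sub>F t in nhds (x i). f (x(i := t)) = g (x(i := t))"
  using eventually_upd[OF assms(1-3)] by eventually_elim (use assms(4) in auto)
 then show ?thesis
  using assms(5) DERIV_cong_ev[OF refl, of "%t. f (x(i := t))" "%t. g (x(i := t))" "x i" D D] by blast
qed

text \<open>Coinduction up to \<open>smooth_on\<close> itself. A proof of smoothness reduces to
  finding a class of functions that is stable under partial derivatives; the later smoothness proofs
  differ mainly in the class they choose.\<close>

lemma smooth_on_coinductI:
 assumes "opn n V" "X f"
  "\<And>g. X g ==> continuous_on V g \<and> (\<exists>D. \<forall>i<n. (\<forall>x\<in>V. ((%t. g (x(i := t))) has_real_derivative D i x) (at (x i))) \<and> (X (D i) \<or> smooth_on n V (D i)))"
 shows "smooth_on n V f"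
 using assms(2)
proof (coinduction arbitrary: f rule: smooth_on.coinduct)
 case smooth_on
 then have "continuous_map (subtopology (Euclidean_space n) V) euclideanreal f"
  using assms(3) continuous_map_opn_iff opn_subset[OF assms(1)] by blast
 then show ?case using assms(3)[OF smooth_on] by blast
qed

lemma smooth_on_cong:
 assumes "opn n V" "smooth_on n V f" "\<And>x. x \<in> V ==> f x = g x"
 shows "smooth_on n V g"
proof (rule smooth_on_coinductI[OF assms(1), of "%g. \<exists>f. smooth_on n V f \<and> (\<forall>x\<in>V. f x = g x)"])
 show "\<exists>f. smooth_on n V f \<and> (\<forall>x\<in>V. f x = g x)" using assms by blast
next
 fix g assume "\<exists>f. smooth_on n V f \<and> (\<forall>x\<in>V. f x = g x)"
 then obtain f where f: "smooth_on n V f" "\<forall>x\<in>V. f x = g x" by blast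
 from f(1) obtain D where D: "continuous_on V f"
  "\<forall>i<n. (\<forall>x\<in>V. ((%t. f (x(i := t))) has_real_derivative D i x) (at (x i))) \<and> smooth_on n V (D i)"
  by (cases rule: smooth_on.cases) (use continuous_map_opn_iff opn_subset[OF assms(1)] in blast)
 have "continuous_on V g" using D(1) f(2) continuous_on_cong by (metis (no_types, lifting))
 moreover have "\<forall>i<n. (\<forall>x\<in>V. ((%t. g (x(i := t))) has_real_derivative D i x) (at (x i)))"
  using D(2) deriv_cong_opn[OF assms(1)] f(2) by metis
 ultimately show "continuous_on V g \<and> (\<exists>D. \<forall>i<n. (\<forall>x\<in>V. ((%t. g (x(i := t))) has_real_derivative D i x) (at (x i))) \<and>
   ((\<exists>f. smooth_on n V f \<and> (\<forall>x\<in>V. f x = D i x)) \<or> smooth_on n V (D i)))"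
  using D(2) by blast
qed

lemma smooth_onD:
 assumes "smooth_on n V f" "opn n V"
 shows "continuous_on V f"
  "\<And>i x. i < n ==> x \<in> V ==> ((%t. f (x(i := t))) has_real_derivative pd i f x) (at (x i))"
  "\<And>i. i < n ==> smooth_on n V (pd i f)"
proof -
 from assms(1) obtain D where D: "continuous_on V f"
  "\<forall>i<n. (\<forall>x\<in>V. ((%t. f (x(i := t))) has_real_derivative D i x) (at (x i))) \<and> smooth_on n V (D i)"
  by (cases rule: smooth_on.cases) (use continuous_map_opn_iff opn_subset[OF assms(2)] in blast)
 have pd: "pd i f x = D i x" if "i < n" "x \<in> V" for i x
  using D that unfolding pd_def by (blast intro: DERIV_imp_deriv)
 show "continuous_on V f" by (rule D)
 show "((%t. f (x(i := t))) has_real_derivative pd i f x) (at (x i))" if "i < n" "x \<in> V" for i x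
  using D(2) pd[OF that] that by simp
 show "smooth_on n V (pd i f)" if "i < n" for i
  using D(2) pd that smooth_on_cong[OF assms(2), of "D i"] by simp
qed

lemma pd_eqI:
 "((%t. f (x(i := t))) has_real_derivative D) (at (x i)) ==> pd i f x = D"
 unfolding pd_def by (rule DERIV_imp_deriv)

lemma smooth_on_subset:
 assumes "smooth_on n V f" "opn n V" "opn n W" "W \<subseteq> V"
 shows "smooth_on n W f"
proof (rule smooth_on_coinductI[OF assms(3), of "%f. smooth_on n V f"])
 fix g assume g: "smooth_on n V g"
 show "continuous_on W g \<and> (\<exists>D. \<forall>i<n. (\<forall>x\<in>W. ((%t. g (x(i := t))) has_real_derivative D i x) (at (x i))) \<and> (smooth_on n V (D i) \<or> smooth_on n W (D i)))"
  using smooth_onD[OF g assms(2)] assms(4)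
  by (intro conjI exI[of _ "%i. pd i g"]) (auto intro: continuous_on_subset)
qed (rule assms)

lemma smooth_on_local:
 assumes "opn n V" "\<And>x. x \<in> V ==> \<exists>W. opn n W \<and> x \<in> W \<and> smooth_on n W f"
 shows "smooth_on n V f"
proof (rule smooth_on_coinductI[OF assms(1), of "%f. \<forall>x\<in>V. \<exists>W. opn n W \<and> x \<in> W \<and> smooth_on n W f"])
 show "\<forall>x\<in>V. \<exists>W. opn n W \<and> x \<in> W \<and> smooth_on n W f" using assms by blast
next
 fix g assume g: "\<forall>x\<in>V. \<exists>W. opn n W \<and> x \<in> W \<and> smooth_on n W g"
 have "continuous_on V g"
 proof (rule continuous_on_cubI[OF opn_subset[OF assms(1)]])
  fix x and e :: real assume "x \<in> V" "e > 0"
  then obtain W where W: "opn n W" "x \<in> W" "smooth_on n W g" using g by blast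
  obtain d where "d > 0" "\<And>y. y \<in> cub n x d ==> \<bar>g y - g x\<bar> < e"
   using continuous_on_cubD[OF W(1) smooth_onD(1)[OF W(3,1)] W(2) \<open>e > 0\<close>] by metis
  then show "\<exists>d>0. \<forall>y\<in>V \<inter> cub n x d. \<bar>g y - g x\<bar> < e" by blast
 qed
 moreover have "((%t. g (x(i := t))) has_real_derivative pd i g x) (at (x i))" if "i < n" "x \<in> V" for i x
  using g that smooth_onD(2) by metis
 moreover have "\<forall>x\<in>V. \<exists>W. opn n W \<and> x \<in> W \<and> smooth_on n W (pd i g)" if "i < n" for i
  using g that smooth_onD(3) by metis
 ultimately show "continuous_on V g \<and> (\<exists>D. \<forall>i<n. (\<forall>x\<in>V. ((%t. g (x(i := t))) has_real_derivative D i x) (at (x i))) \<and>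
   ((\<forall>x\<in>V. \<exists>W. opn n W \<and> x \<in> W \<and> smooth_on n W (D i)) \<or> smooth_on n V (D i)))"
  by (intro conjI exI[of _ "%i. pd i g"]) simp_all
qed

lemma pd_cong:
 assumes "opn n V" "x \<in> V" "i < n" "\<And>y. y \<in> V ==> f y = g y" "smooth_on n V f"
 shows "pd i f x = pd i g x"
 using deriv_cong_opn[OF assms(1-4) smooth_onD(2)[OF assms(5,1,3,2)]] by (metis pd_eqI)

section \<open>Increments along coordinate directions and the chain rule\<close>

lemma mvt_coord:
 assumes "opn n V" "smooth_on n V g" "i < n" "\<And>s. s \<in> closed_segment a b ==> u(i := s) \<in> V"
 obtains c where "c \<in> closed_segment a b" "g (u(i := b)) - g (u(i := a)) = pd i g (u(i := c)) * (b - a)"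
proof -
 have der: "((%t. g (u(i := t))) has_real_derivative pd i g (u(i := s))) (at s)" if "s \<in> closed_segment a b" for s
  using smooth_onD(2)[OF assms(2,1,3) assms(4)[OF that]] unfolding fun_upd_upd fun_upd_same .
 consider "a < b" | "a = b" | "b < a" by linarith
 then show thesis
 proof cases
  case 1
  then have "\<exists>z>a. z < b \<and> g (u(i := b)) - g (u(i := a)) = (b - a) * pd i g (u(i := z))"
   by (intro MVT2 der) (auto simp: closed_segment_eq_real_ivl)
  then obtain z where "a < z" "z < b" "g (u(i := b)) - g (u(i := a)) = (b - a) * pd i g (u(i := z))" by blast
  then show ?thesis using that[of z] 1 by (simp add: closed_segment_eq_real_ivl mult.commute)
 next
  case 2 then show ?thesis using that[of a] by simp
 next
  case 3
  then have "\<exists>z>b. z < a \<and> g (u(i := a)) - g (u(i := b)) = (a - b) * pd i g (u(i := z))"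
   by (intro MVT2 der) (auto simp: closed_segment_eq_real_ivl)
  then obtain z where "b < z" "z < a" "g (u(i := a)) - g (u(i := b)) = (a - b) * pd i g (u(i := z))" by blast
  then show ?thesis using that[of z] 3 by (simp add: closed_segment_eq_real_ivl algebra_simps)
 qed
qed

text \<open>Corner \<open>k\<close> of the staircase from \<open>x\<close> to \<open>y\<close> whose
  edges are parallel to the axes. It reduces increments in several variables to mean values in one
  variable.\<close>

definition mix :: "(nat => real) => (nat => real) => nat => nat => real" where
 "mix x y k = (%i. if i < k then y i else x i)"

lemma mix_simps:
 "mix x y 0 = x" "x \<in> Rn n ==> y \<in> Rn n ==> mix x y n = y"
 "mix x y (Suc k) = (mix x y k)(k := y k)" "(mix x y k)(k := x k) = mix x y k"
 by (auto simp: mix_def in_Rn fun_eq_iff)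

lemma mix_in_cub: "x \<in> cub n p e ==> y \<in> cub n p e ==> mix x y k \<in> cub n p e"
 by (auto simp: mix_def cub_def in_Rn)

lemma telescope:
 assumes "x \<in> Rn n" "y \<in> Rn n"
 shows "(g y - g x :: real) = (\<Sum>k<n. g ((mix x y k)(k := y k)) - g ((mix x y k)(k := x k)))"
proof -
 have "(\<Sum>k<n. g (mix x y (Suc k)) - g (mix x y k)) = g (mix x y n) - g (mix x y 0)"
  by (rule sum_lessThan_telescope)
 then show ?thesis using assms by (simp add: mix_simps)
qed

lemma segment_in_cub:
 assumes "x \<in> cub n p e" "y \<in> cub n p e" "k < n" "s \<in> closed_segment (x k) (y k)"
 shows "(mix x y k)(k := s) \<in> cub n p e"
proof -
 have "\<bar>x k - p k\<bar> < e" "\<bar>y k - p k\<bar> < e" using assms by (auto simp: cub_def)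
 then have "\<bar>s - p k\<bar> < e" using assms(4) by (auto simp: closed_segment_eq_real_ivl split: if_splits)
 then show ?thesis using mix_in_cub[OF assms(1,2), of k] assms(3) by (rule_tac upd_in_cub)
qed

text \<open>This form of differentiability makes the chain rule a limit of products.\<close>

lemma caratheodory:
 assumes V: "opn n V" "smooth_on n V g" "x \<in> V"
 obtains e q where "e > 0" "cub n x e \<subseteq> V"
  "\<And>y. y \<in> cub n x e ==> g y - g x = (\<Sum>k<n. q k y * (y k - x k))"
  "\<And>k \<epsilon>. k < n ==> \<epsilon> > 0 ==> \<exists>d>0. d \<le> e \<and> (\<forall>y\<in>cub n x d. \<bar>q k y - pd k g x\<bar> < \<epsilon>)"
proof -
 obtain e where e: "e > 0" "cub n x e \<subseteq> V" using opn_contains_cub V by metis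
 have xR: "x \<in> Rn n" using V opn_subset by blast
 have "\<exists>c. c \<in> closed_segment (x k) (y k) \<and> g ((mix x y k)(k := y k)) - g ((mix x y k)(k := x k)) = pd k g ((mix x y k)(k := c)) * (y k - x k)"
  if "k < n" "y \<in> cub n x e" for k y
  using mvt_coord[OF V(1,2) that(1), of "x k" "y k" "mix x y k"]
   segment_in_cub[OF cub_center[OF xR e(1)] that(2,1)] e(2) by (metis subsetD)
 then obtain c where c: "\<And>k y. k < n ==> y \<in> cub n x e ==> c k y \<in> closed_segment (x k) (y k)"
  "\<And>k y. k < n ==> y \<in> cub n x e ==> g ((mix x y k)(k := y k)) - g ((mix x y k)(k := x k)) = pd k g ((mix x y k)(k := c k y)) * (y k - x k)"
  by metis
 \<comment> \<open>\<open>q k\<close> is the partial derivative at the mean value point of the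
   \<open>k\<close>-th edge of the staircase; that point tends to \<open>x\<close> together with
   \<open>y\<close>.\<close>
 define q where "q = (%k y. pd k g ((mix x y k)(k := c k y)))"
 show thesis
 proof (rule that[of e q])
  show "g y - g x = (\<Sum>k<n. q k y * (y k - x k))" if "y \<in> cub n x e" for y
   using telescope[of x n y g] xR that c(2) by (auto simp: q_def cub_def)
  fix k and \<epsilon> :: real assume k: "k < n" "\<epsilon> > 0"
  obtain d where d: "d > 0" "\<And>y. y \<in> cub n x d ==> \<bar>pd k g y - pd k g x\<bar> < \<epsilon>"
   using continuous_on_cubD[OF V(1) smooth_onD(1)[OF smooth_onD(3)[OF V(2,1) k(1)] V(1)] V(3) k(2)] by metis
  have "\<bar>q k y - pd k g x\<bar> < \<epsilon>" if "y \<in> cub n x (min d e)" for y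
  proof -
   have "y \<in> cub n x d" "y \<in> cub n x e" using that cub_mono[of "min d e" d n x] cub_mono[of "min d e" e n x] by auto
   then show ?thesis using d(2) c(1)[OF k(1)] segment_in_cub[OF cub_center[OF xR d(1)] _ k(1)] by (simp add: q_def)
  qed
  then show "\<exists>d>0. d \<le> e \<and> (\<forall>y\<in>cub n x d. \<bar>q k y - pd k g x\<bar> < \<epsilon>)"
   using d(1) e(1) by (intro exI[of _ "min d e"]) auto
 qed (use e in auto)
qed

lemma chain_rule:
 assumes V: "opn m V" "smooth_on m V g" "c t0 \<in> V"
  and c: "\<And>t. c t \<in> Rn m" "\<And>k. k < m ==> ((%t. c t k) has_real_derivative c' k) (at t0)"
 shows "((%t. g (c t)) has_real_derivative (\<Sum>k<m. pd k g (c t0) * c' k)) (at t0)"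
proof -
 show ?thesis
 proof (rule caratheodory[OF V])
 fix e q assume q: "e > 0" "cub m (c t0) e \<subseteq> V"
  "\<And>y. y \<in> cub m (c t0) e ==> g y - g (c t0) = (\<Sum>k<m. q k y * (y k - c t0 k))"
  "\<And>k \<epsilon>. k < m ==> \<epsilon> > 0 ==> \<exists>d>0. d \<le> e \<and> (\<forall>y\<in>cub m (c t0) d. \<bar>q k y - pd k g (c t0)\<bar> < \<epsilon>)"
 have ev: "\<forall>\<^sub>F t in at t0. c t \<in> cub m (c t0) d" if "d > 0" for d
 proof -
  have "\<forall>\<^sub>F t in at t0. \<forall>k\<in>{..<m}. \<bar>c t k - c t0 k\<bar> < d"
  proof (intro eventually_ball_finite ballI)
   fix k assume "k \<in> {..<m}"
   then have "((%t. c t k) \<longlongrightarrow> c t0 k) (at t0)" using c(2)[of k] DERIV_isCont isCont_def by blast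
   then show "\<forall>\<^sub>F t in at t0. \<bar>c t k - c t0 k\<bar> < d" using that by (auto simp: tendsto_iff dist_real_def)
  qed simp
  then show ?thesis by eventually_elim (use c(1) in \<open>auto simp: cub_def\<close>)
 qed
 have qlim: "((%t. q k (c t)) \<longlongrightarrow> pd k g (c t0)) (at t0)" if km: "k < m" for k
 proof (rule tendstoI)
  fix \<epsilon> :: real assume "\<epsilon> > 0"
  then obtain d where d: "d > 0" "\<forall>y\<in>cub m (c t0) d. \<bar>q k y - pd k g (c t0)\<bar> < \<epsilon>" using q(4)[OF km] by blast
  show "\<forall>\<^sub>F t in at t0. dist (q k (c t)) (pd k g (c t0)) < \<epsilon>"
   using ev[OF d(1)] by eventually_elim (use d(2) in \<open>auto simp: dist_real_def\<close>)
 qed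
 have "((%t. \<Sum>k<m. q k (c t) * ((c t k - c t0 k) / (t - t0))) \<longlongrightarrow> (\<Sum>k<m. pd k g (c t0) * c' k)) (at t0)"
  using c(2) by (intro tendsto_sum tendsto_mult qlim) (auto simp: has_field_derivative_iff)
 moreover have "\<forall>\<^sub>F t in at t0. (\<Sum>k<m. q k (c t) * ((c t k - c t0 k) / (t - t0))) = (g (c t) - g (c t0)) / (t - t0)"
  using ev[OF q(1)] by eventually_elim (simp add: q(3) sum_divide_distrib)
 ultimately show ?thesis
  unfolding has_field_derivative_iff by (rule Lim_transform_eventually)
 qed
qed

section \<open>Closure of the smooth functions under arithmetic and composition\<close>

inductive_set Alg :: "nat => (nat => real) set => ((nat => real) => real) set" for n V where
 base: "smooth_on n V f ==> f \<in> Alg n V"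
| const: "(%x. c) \<in> Alg n V"
| add: "f \<in> Alg n V ==> g \<in> Alg n V ==> (%x. f x + g x) \<in> Alg n V"
| mult: "f \<in> Alg n V ==> g \<in> Alg n V ==> (%x. f x * g x) \<in> Alg n V"
| inv: "f \<in> Alg n V ==> (\<And>x. x \<in> V ==> f x \<noteq> 0) ==> (%x. inverse (f x)) \<in> Alg n V"
| comp: "opn m W ==> smooth_on m W g ==> (\<And>k. k < m ==> h k \<in> Alg n V) ==>
  (\<And>x. x \<in> V ==> tuple m (%k. h k x) \<in> W) ==> (%x. g (tuple m (%k. h k x))) \<in> Alg n V"

lemma Alg_sum: "finite K ==> (\<And>k. k \<in> K ==> f k \<in> Alg n V) ==> (%x. \<Sum>k\<in>K. f k x) \<in> Alg n V"
 by (induction K rule: finite_induct) (auto intro: Alg.const Alg.add)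

text \<open>The derivative of a product, an inverse or a composite mixes several operations, so no
  single operation yields a class stable under derivatives. The closure under all of them
  does.\<close>

lemma Alg_step:
 assumes V: "opn n V" and "f \<in> Alg n V"
 shows "continuous_on V f \<and> (\<exists>D. \<forall>i<n. (\<forall>x\<in>V. ((%t. f (x(i := t))) has_real_derivative D i x) (at (x i))) \<and> D i \<in> Alg n V)"
 using assms(2)
proof induction
 case (base f)
 then show ?case using smooth_onD[OF base V]
  by (intro conjI exI[of _ "%i. pd i f"] allI impI ballI) (simp_all only: Alg.base)
next
 case (const c)
 then show ?case by (auto intro!: exI[of _ "%i x. 0"] Alg.const)
next
 case (add f g)
 then obtain D E where "\<forall>i<n. (\<forall>x\<in>V. ((%t. f (x(i := t))) has_real_derivative D i x) (at (x i))) \<and> D i \<in> Alg n V"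
  "\<forall>i<n. (\<forall>x\<in>V. ((%t. g (x(i := t))) has_real_derivative E i x) (at (x i))) \<and> E i \<in> Alg n V" by blast
 moreover from this have "((%t. f (x(i := t)) + g (x(i := t))) has_real_derivative D i x + E i x) (at (x i))"
  if "i < n" "x \<in> V" for i x
  using that by (intro derivative_intros) blast+
 ultimately show ?case using add
  by (intro conjI exI[of _ "%i x. D i x + E i x"] continuous_intros) (simp_all add: Alg.add del: fun_upd_apply)
next
 case (mult f g)
 then obtain D E where "\<forall>i<n. (\<forall>x\<in>V. ((%t. f (x(i := t))) has_real_derivative D i x) (at (x i))) \<and> D i \<in> Alg n V"
  "\<forall>i<n. (\<forall>x\<in>V. ((%t. g (x(i := t))) has_real_derivative E i x) (at (x i))) \<and> E i \<in> Alg n V" by blast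
 moreover from this have "((%t. f (x(i := t)) * g (x(i := t))) has_real_derivative D i x * g x + E i x * f x) (at (x i))"
  if "i < n" "x \<in> V" for i x
  using DERIV_mult[of "%t. f (x(i := t))" "D i x" "x i" UNIV "%t. g (x(i := t))" "E i x"] that by simp
 ultimately show ?case using mult
  by (intro conjI exI[of _ "%i x. D i x * g x + E i x * f x"] continuous_intros)
   (simp_all add: Alg.add Alg.mult del: fun_upd_apply)
next
 case (inv f)
 then obtain D where D: "\<forall>i<n. (\<forall>x\<in>V. ((%t. f (x(i := t))) has_real_derivative D i x) (at (x i))) \<and> D i \<in> Alg n V" by blast
 have i: "(%x. inverse (f x)) \<in> Alg n V" using inv by (intro Alg.inv)
 have "continuous_on V (%x. inverse (f x))" using inv by (intro continuous_intros) auto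
 moreover have "((%t. inverse (f (x(i := t)))) has_real_derivative - 1 * (inverse (f x) * D i x * inverse (f x))) (at (x i))"
  if "i < n" "x \<in> V" for i x
  using D that inv(2)[OF that(2)] by (auto intro!: derivative_eq_intros)
 moreover have "(%x. - 1 * (inverse (f x) * D i x * inverse (f x))) \<in> Alg n V" if "i < n" for i
  using D that i by (intro Alg.mult Alg.const) auto
 ultimately show ?case
  by (intro conjI exI[of _ "%i x. - 1 * (inverse (f x) * D i x * inverse (f x))"] allI impI ballI)
next
 case (comp m W g h)
 have IH: "continuous_on V (h k) \<and> (\<exists>D. \<forall>i<n. (\<forall>x\<in>V. ((%t. h k (x(i := t))) has_real_derivative D i x) (at (x i))) \<and> D i \<in> Alg n V)"
  if "k < m" for k using comp that by - assumption
 have "\<forall>k<m. \<exists>D. \<forall>i<n. (\<forall>x\<in>V. ((%t. h k (x(i := t))) has_real_derivative D i x) (at (x i))) \<and> D i \<in> Alg n V"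
  by (intro allI impI, rule conjunct2[OF IH])
 then obtain D where D: "\<And>k i x. k < m ==> i < n ==> x \<in> V ==> ((%t. h k (x(i := t))) has_real_derivative D k i x) (at (x i))"
  "\<And>k i. k < m ==> i < n ==> D k i \<in> Alg n V" by metis
 have "continuous_on V (%x. if k < m then h k x else 0)" for k
  using IH[of k] by (cases "k < m") simp_all
 then have "continuous_on V (%x. tuple m (%k. h k x))"
  unfolding tuple_def by (rule continuous_on_coordinatewise_then_product)
 then have "continuous_on V (%x. g (tuple m (%k. h k x)))"
  using continuous_on_compose2[OF smooth_onD(1)[OF comp.hyps(2,1)]] comp.hyps(4) by blast
 moreover have "((%t. g (tuple m (%k. h k (x(i := t))))) has_real_derivative
   (\<Sum>k<m. pd k g (tuple m (%k. h k x)) * D k i x)) (at (x i))" if "i < n" "x \<in> V" for i x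
  using chain_rule[OF comp.hyps(1,2), of "%t. tuple m (%k. h k (x(i := t)))" "x i" "%k. D k i x"] D(1)[OF _ that] comp.hyps(4)[OF that(2)]
  by simp
 moreover have "(%x. \<Sum>k<m. pd k g (tuple m (%k. h k x)) * D k i x) \<in> Alg n V" if "i < n" for i
  using D(2) that smooth_onD(3)[OF comp.hyps(2,1)] comp.hyps(3,4)
  by (intro Alg_sum Alg.mult Alg.comp[OF comp.hyps(1)]) simp_all
 ultimately show ?case
  by (intro conjI exI[of _ "%i x. \<Sum>k<m. pd k g (tuple m (%k. h k x)) * D k i x"] allI impI ballI)
qed

lemma Alg_smooth: "opn n V ==> f \<in> Alg n V ==> smooth_on n V f"
proof (rule smooth_on_coinductI[of n V "%f. f \<in> Alg n V"])
 fix g assume V: "opn n V" and g: "g \<in> Alg n V"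
 from Alg_step[OF this] obtain D where c: "continuous_on V g"
  and D: "\<forall>i<n. (\<forall>x\<in>V. ((%t. g (x(i := t))) has_real_derivative D i x) (at (x i))) \<and> D i \<in> Alg n V"
  by (elim conjE exE)
 then show "continuous_on V g \<and> (\<exists>D. \<forall>i<n. (\<forall>x\<in>V. ((%t. g (x(i := t))) has_real_derivative D i x) (at (x i))) \<and>
   (D i \<in> Alg n V \<or> smooth_on n V (D i)))"
  by (intro conjI exI[of _ D]) (simp_all del: fun_upd_apply)
qed

named_theorems smooth_intros

lemma smooth_const [smooth_intros]: "opn n V ==> smooth_on n V (%x. c)"
 by (intro Alg_smooth Alg.const)

lemma smooth_add [smooth_intros]:
 "opn n V ==> smooth_on n V f ==> smooth_on n V g ==> smooth_on n V (%x. f x + g x)"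
 by (rule Alg_smooth, assumption, rule Alg.add) (erule Alg.base)+

lemma smooth_mult [smooth_intros]:
 "opn n V ==> smooth_on n V f ==> smooth_on n V g ==> smooth_on n V (%x. f x * g x)"
 by (rule Alg_smooth, assumption, rule Alg.mult) (erule Alg.base)+

lemma smooth_inverse [smooth_intros]:
 "opn n V ==> smooth_on n V f ==> (\<And>x. x \<in> V ==> f x \<noteq> 0) ==> smooth_on n V (%x. inverse (f x))"
 by (rule Alg_smooth, assumption, rule Alg.inv, erule Alg.base)

lemma smooth_minus [smooth_intros]: "opn n V ==> smooth_on n V f ==> smooth_on n V (%x. - f x)"
 using smooth_mult[of n V "%x. -1" f] smooth_const[of n V "-1"] by simp

lemma smooth_diff [smooth_intros]:
 "opn n V ==> smooth_on n V f ==> smooth_on n V g ==> smooth_on n V (%x. f x - g x)"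
 using smooth_add[of n V f "%x. - g x"] smooth_minus[of n V g] by simp

lemma smooth_divide [smooth_intros]:
 "opn n V ==> smooth_on n V f ==> smooth_on n V g ==> (\<And>x. x \<in> V ==> g x \<noteq> 0) ==> smooth_on n V (%x. f x / g x)"
 unfolding divide_inverse by (rule smooth_mult[of n V f "%x. inverse (g x)"]) (auto intro: smooth_inverse)

lemma smooth_power [smooth_intros]: "opn n V ==> smooth_on n V f ==> smooth_on n V (%x. f x ^ k)"
 using smooth_mult[of n V f] smooth_const[of n V 1] by (induction k) simp_all

lemma smooth_sum [smooth_intros]:
 assumes "opn n V" "\<And>k. k \<in> K ==> smooth_on n V (f k)"
 shows "smooth_on n V (%x. \<Sum>k\<in>K. f k x)"
 using assms(2)
proof (induction K rule: infinite_finite_induct)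
 case (insert k K)
 then show ?case using smooth_add[OF assms(1), of "f k" "%x. \<Sum>k\<in>K. f k x"] by simp
qed (simp_all add: smooth_const[OF assms(1), of 0])

lemma smooth_comp:
 "opn n V ==> opn m W ==> smooth_on m W g ==> (\<And>k. k < m ==> smooth_on n V (h k)) ==>
  (\<And>x. x \<in> V ==> tuple m (%k. h k x) \<in> W) ==> smooth_on n V (%x. g (tuple m (%k. h k x)))"
 by (rule Alg_smooth, assumption, rule Alg.comp[of m W g]) (simp_all add: Alg.base)

lemma smooth_coord [smooth_intros]:
 assumes "opn n V" shows "smooth_on n V (%x. x j)"
proof (rule smooth_on_coinductI[OF assms, of "%f. f = (%x. x j)"])
 fix g assume "g = (%x::nat=>real. x j)"
 moreover have "((%t. (x(i := t)) j) has_real_derivative (if i = j then 1 else 0)) (at (x i))" for x :: "nat => real" and i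
  by auto
 ultimately show "continuous_on V g \<and> (\<exists>D. \<forall>i<n. (\<forall>x\<in>V. ((%t. g (x(i := t))) has_real_derivative D i x) (at (x i))) \<and>
   (D i = (%x. x j) \<or> smooth_on n V (D i)))"
  using assms by (intro conjI exI[of _ "%i x. if i = j then 1 else 0"]) (auto intro!: continuous_on_coord smooth_const)
qed simp

section \<open>The implicit function of one equation\<close>

lemma continuous_on_upd_line:
 assumes "opn n V" "smooth_on n V h" "l < n" "\<And>s. s \<in> {a..b} ==> u(l := s) \<in> V"
 shows "continuous_on {a..b} (%t. h (u(l := t)))"
proof (rule continuous_at_imp_continuous_on, rule ballI)
 fix s assume "s \<in> {a..b}"
 then have "((%t. h ((u(l := s))(l := t))) has_real_derivative pd l h (u(l := s))) (at ((u(l := s)) l))"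
  by (rule smooth_onD(2)[OF assms(2,1,3) assms(4)])
 then show "isCont (%t. h (u(l := t))) s"
  using DERIV_isCont unfolding fun_upd_upd fun_upd_same by blast
qed

text \<open>On a cube where \<open>pd l h\<close> is positive, \<open>h\<close> increases along
  lines in direction \<open>l\<close>, so the intermediate value theorem gives exactly one zero on
  each short line. The clauses on \<open>x(l := p l)\<close> say that \<open>\<phi>\<close> ignores
  coordinate \<open>l\<close>; this lets Sard's theorem move points of the graph into a coordinate
  slice.\<close>

lemma implicit_graph_pos:
 assumes V: "opn n V" "smooth_on n V h" "p \<in> V" "l < n" and hp: "h p = 0" "pd l h p > 0"
 shows "\<exists>W \<phi>. opn n W \<and> p \<in> W \<and> \<phi> p = p l \<and>
  (\<forall>x\<in>W. x \<in> V \<and> x(l := \<phi> x) \<in> V \<and> pd l h (x(l := \<phi> x)) \<noteq> 0 \<and> h (x(l := \<phi> x)) = 0 \<and>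
    (h x = 0 --> \<phi> x = x l) \<and> x(l := p l) \<in> W \<and> \<phi> (x(l := p l)) = \<phi> x) \<and>
  (\<forall>g. smooth_on n V g --> smooth_on n W (%x. g (x(l := \<phi> x))) \<and>
    (\<forall>x\<in>W. \<forall>j<n. pd j (%x. g (x(l := \<phi> x))) x =
     (if j = l then 0 else pd j g (x(l := \<phi> x)) - pd l g (x(l := \<phi> x)) * pd j h (x(l := \<phi> x)) / pd l h (x(l := \<phi> x)))))"
proof -
 have pR: "p \<in> Rn n" using V opn_subset by blast
 obtain e where e: "e > 0" "cub n p e \<subseteq> V" "\<And>y. y \<in> cub n p e ==> \<bar>pd l h y - pd l h p\<bar> < pd l h p"
  using continuous_on_cubD[OF V(1) smooth_onD(1)[OF smooth_onD(3)[OF V(2,1,4)] V(1)] V(3) hp(2)] by metis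
 have pos: "pd l h y > 0" if "y \<in> cub n p e" for y using e(3)[OF that] by linarith
 have mono: "h (x(l := s)) < h (x(l := t))"
  if "x \<in> cub n p e" "s < t" "\<bar>s - p l\<bar> < e" "\<bar>t - p l\<bar> < e" for x s t
 proof -
  have "x(l := u) \<in> cub n p e" if "u \<in> closed_segment s t" for u
   using that \<open>s < t\<close> \<open>\<bar>s - p l\<bar> < e\<close> \<open>\<bar>t - p l\<bar> < e\<close> upd_in_cub[OF \<open>x \<in> cub n p e\<close> V(4), of u]
   by (auto simp: closed_segment_eq_real_ivl)
  then obtain c where "c \<in> closed_segment s t" "h (x(l := t)) - h (x(l := s)) = pd l h (x(l := c)) * (t - s)"
   "pd l h (x(l := c)) > 0"
   using mvt_coord[OF V(1,2,4), of s t x] e(2) pos by (metis subsetD)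
  then show ?thesis using that(2) by (smt (verit) mult_pos_pos)
 qed
 \<comment> \<open>Less than \<open>e\<close>, so that the end points \<open>p l - a\<close> and
   \<open>p l + a\<close> stay in the cube, where \<open>h\<close> takes opposite signs at
   them.\<close>
 define a where "a = e / 2"
 have a: "0 < a" "a < e" using e(1) by (auto simp: a_def)
 have pc: "p \<in> cub n p e" using cub_center pR e(1) .
 have pm: "h (p(l := p l - a)) < 0" "h (p(l := p l + a)) > 0"
  using mono[OF pc, of "p l - a" "p l"] mono[OF pc, of "p l" "p l + a"] a hp(1) by auto
 have ends: "p(l := p l - a) \<in> V" "p(l := p l + a) \<in> V"
  using upd_in_cub[OF pc V(4)] a e(2) by auto
 obtain d1 where d1: "d1 > 0" "\<And>y. y \<in> cub n (p(l := p l - a)) d1 ==> h y < 0"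
  using continuous_on_cubD[OF V(1) smooth_onD(1)[OF V(2,1)] ends(1), of "- h (p(l := p l - a))"] pm(1)
  by (smt (verit, best))
 obtain d2 where d2: "d2 > 0" "\<And>y. y \<in> cub n (p(l := p l + a)) d2 ==> h y > 0"
  using continuous_on_cubD[OF V(1) smooth_onD(1)[OF V(2,1)] ends(2), of "h (p(l := p l + a))"] pm(2)
  by (smt (verit, best))
 define d where "d = min e (min d1 d2)"
 have d: "d > 0" "d \<le> e" "d \<le> d1" "d \<le> d2" using e d1(1) d2(1) by (auto simp: d_def)
 \<comment> \<open>Width \<open>d\<close> in the other coordinates preserves the signs of
   \<open>h\<close> at both ends of each line in direction \<open>l\<close>; width \<open>a\<close>
   in direction \<open>l\<close> is the range in which the zero is sought.\<close>
 define W where "W = {y \<in> Rn n. \<forall>i<n. \<bar>y i - p i\<bar> < (if i = l then a else d)}"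
 have W: "opn n W" unfolding W_def by (rule opn_box)
 have We: "W \<subseteq> cub n p e" unfolding W_def cub_def using a(2) d(2) by (fastforce split: if_splits)
 have pW: "p \<in> W" using pR a d by (auto simp: W_def)
 have updW: "x(l := t) \<in> W" if "x \<in> W" "\<bar>t - p l\<bar> < a" for x t
  using that V(4) by (auto simp: W_def)
 have ex1: "\<exists>!t. \<bar>t - p l\<bar> < a \<and> h (x(l := t)) = 0" if x: "x \<in> W" for x
 proof -
  have "x(l := p l - a) \<in> cub n (p(l := p l - a)) d1" "x(l := p l + a) \<in> cub n (p(l := p l + a)) d2"
   using x d V(4) by (force simp: W_def cub_def)+
  then have sg: "h (x(l := p l - a)) < 0" "h (x(l := p l + a)) > 0" using d1 d2 by auto
  have "x(l := s) \<in> V" if "s \<in> {p l - a..p l + a}" for s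
  proof -
   have "\<bar>s - p l\<bar> < e" using that a(2) by auto
   then show ?thesis using upd_in_cub[OF subsetD[OF We x] V(4)] e(2) by blast
  qed
  from continuous_on_upd_line[OF V(1,2,4) this]
  obtain t where t: "p l - a \<le> t" "t \<le> p l + a" "h (x(l := t)) = 0"
   using IVT'[of "%t. h (x(l := t))" "p l - a" 0 "p l + a"] sg a by (metis add_increasing2 diff_le_eq less_eq_real_def)
  then have "t \<noteq> p l - a" "t \<noteq> p l + a" using sg by auto
  then have "\<bar>t - p l\<bar> < a" using t by auto
  moreover have "s = t'" if "\<bar>s - p l\<bar> < a" "h (x(l := s)) = 0" "\<bar>t' - p l\<bar> < a" "h (x(l := t')) = 0" for s t'
   using mono[OF subsetD[OF We x], of s t'] mono[OF subsetD[OF We x], of t' s] that a by (cases s t' rule: linorder_cases) auto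
  ultimately show ?thesis using t(3) by blast
 qed
 define \<phi> where "\<phi> x = (THE t. \<bar>t - p l\<bar> < a \<and> h (x(l := t)) = 0)" for x
 have \<phi>: "\<bar>\<phi> x - p l\<bar> < a" "h (x(l := \<phi> x)) = 0" if "x \<in> W" for x
  using theI'[OF ex1[OF that]] by (auto simp: \<phi>_def)
 have \<phi>u: "\<phi> x = t" if "x \<in> W" "\<bar>t - p l\<bar> < a" "h (x(l := t)) = 0" for x t
  using ex1[OF that(1)] \<phi>[OF that(1)] that by blast
 have \<psi>: "x(l := \<phi> x) \<in> cub n p e" if "x \<in> W" for x
  using We updW[OF that \<phi>(1)[OF that]] by blast
 have \<phi>c: "\<phi> (x(l := t)) = \<phi> x" if "x \<in> W" "\<bar>t - p l\<bar> < a" for x t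
  using \<phi>u[OF updW[OF that], of "\<phi> x"] \<phi>[OF that(1)] by simp
 have \<phi>cont: "continuous_on W \<phi>"
 proof (rule continuous_on_cubI)
  show "W \<subseteq> Rn n" using W opn_subset by blast
  fix x and \<epsilon> :: real assume x: "x \<in> W" and \<epsilon>: "\<epsilon> > 0"
  \<comment> \<open>Small enough for \<open>\<phi> x - b\<close> and \<open>\<phi> x + b\<close> to
    be admissible. The signs of \<open>h\<close> there persist for nearby points \<open>y\<close>
    and trap \<open>\<phi> y\<close> between the two.\<close>
  define b where "b = min \<epsilon> (a - \<bar>\<phi> x - p l\<bar>) / 2"
  have b: "0 < b" "b < \<epsilon>" "\<bar>\<phi> x + b - p l\<bar> < a" "\<bar>\<phi> x - b - p l\<bar> < a"
   using \<epsilon> \<phi>(1)[OF x] by (auto simp: b_def min_def field_simps)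
  have xe: "x \<in> cub n p e" using We x by blast
  have "h (x(l := \<phi> x - b)) < 0" "0 < h (x(l := \<phi> x + b))"
   using mono[OF xe, of "\<phi> x - b" "\<phi> x"] mono[OF xe, of "\<phi> x" "\<phi> x + b"] \<phi>[OF x] b a by auto
  moreover have Vx: "x(l := \<phi> x - b) \<in> V" "x(l := \<phi> x + b) \<in> V" using updW[OF x] b We e(2) by blast+
  ultimately obtain c1 c2 where c1: "c1 > 0" "\<And>y. y \<in> cub n (x(l := \<phi> x - b)) c1 ==> h y < 0"
   and c2: "c2 > 0" "\<And>y. y \<in> cub n (x(l := \<phi> x + b)) c2 ==> h y > 0"
   using continuous_on_cubD[OF V(1) smooth_onD(1)[OF V(2,1)] Vx(1), of "- h (x(l := \<phi> x - b))"]
    continuous_on_cubD[OF V(1) smooth_onD(1)[OF V(2,1)] Vx(2), of "h (x(l := \<phi> x + b))"]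
   by (smt (verit, best))
  have "\<bar>\<phi> y - \<phi> x\<bar> < \<epsilon>" if y: "y \<in> W \<inter> cub n x (min c1 c2)" for y
  proof -
   have "y(l := \<phi> x - b) \<in> cub n (x(l := \<phi> x - b)) c1" "y(l := \<phi> x + b) \<in> cub n (x(l := \<phi> x + b)) c2"
    using y c1(1) c2(1) V(4) by (auto simp: cub_def)
   then have "h (y(l := \<phi> x - b)) < h (y(l := \<phi> y))" "h (y(l := \<phi> y)) < h (y(l := \<phi> x + b))"
    using c1 c2 \<phi>[of y] y by auto
   then have "\<phi> x - b < \<phi> y" "\<phi> y < \<phi> x + b"
    using mono[of y "\<phi> y" "\<phi> x - b"] mono[of y "\<phi> x + b" "\<phi> y"] We y b a \<phi>(1)[of y]
    by (smt (verit, best) IntD1 subsetD)+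
   then show ?thesis using b by auto
  qed
  then show "\<exists>d>0. \<forall>y\<in>W \<inter> cub n x d. \<bar>\<phi> y - \<phi> x\<bar> < \<epsilon>"
   using c1(1) c2(1) by (intro exI[of _ "min c1 c2"]) auto
 qed
 define \<phi>' where "\<phi>' j x = (if j = l then 0 else - pd j h (x(l := \<phi> x)) / pd l h (x(l := \<phi> x)))" for j x
 have \<phi>d: "((%t. \<phi> (x(j := t))) has_real_derivative \<phi>' j x) (at (x j))" if x: "x \<in> W" and j: "j < n" for j x
 proof (cases "j = l")
  case True
  have "\<forall>\<^sub>F t in nhds (x j). x(j := t) \<in> W" by (rule eventually_upd[OF W x j])
  then have "\<forall>\<^sub>F t in nhds (x j). \<phi> (x(j := t)) = \<phi> x"
  proof eventually_elim
   case (elim t)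
   then have "\<bar>t - p l\<bar> < a" using True V(4) by (auto simp: W_def)
   then show ?case using \<phi>c[OF x] True by simp
  qed
  then show ?thesis
   using DERIV_cong_ev[OF refl, of "%t. \<phi> (x(j := t))" "%_. \<phi> x" "x j" 0 0] True by (simp add: \<phi>'_def)
 next
  case False
  define c where "c t = (x(j := t))(l := \<phi> (x(j := t)))" for t
  have cx: "c (x j) = x(l := \<phi> x)" by (simp add: c_def)
  have cV: "c (x j) \<in> V" using \<psi>[OF x] e(2) cx by auto
  show ?thesis
  proof (rule caratheodory[OF V(1,2) cV])
   fix e' q assume q: "0 < e'" "cub n (c (x j)) e' \<subseteq> V"
    "\<And>y. y \<in> cub n (c (x j)) e' ==> h y - h (c (x j)) = (\<Sum>k<n. q k y * (y k - c (x j) k))"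
    "\<And>k \<epsilon>. k < n ==> 0 < \<epsilon> ==> \<exists>d>0. d \<le> e' \<and> (\<forall>y\<in>cub n (c (x j)) d. \<bar>q k y - pd k h (c (x j))\<bar> < \<epsilon>)"
   have cev: "\<forall>\<^sub>F t in at (x j). c t \<in> cub n (c (x j)) b \<and> x(j := t) \<in> W" if b: "b > 0" for b
   proof -
    obtain b' where b': "b' > 0" "\<And>y. y \<in> cub n x b' ==> \<bar>\<phi> y - \<phi> x\<bar> < b"
     using continuous_on_cubD[OF W \<phi>cont x b] by metis
    have "\<forall>\<^sub>F t in nhds (x j). x(j := t) \<in> W \<inter> cub n x (min b b')"
     by (rule eventually_upd[OF _ _ j]) (use W opn_cub x cub_center[of x n "min b b'"] opn_subset[OF W] b b'(1) in auto)
    then have "\<forall>\<^sub>F t in at (x j). x(j := t) \<in> W \<inter> cub n x (min b b')"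
     by (simp add: eventually_at_filter eventually_mono)
    then show ?thesis
    proof eventually_elim
     case (elim t)
     then have 1: "x(j := t) \<in> cub n x b" "x(j := t) \<in> cub n x b'"
      using cub_mono[of "min b b'" b n x] cub_mono[of "min b b'" b' n x] by auto
     have "c t \<in> cub n (c (x j)) b"
      using 1(1) b'(2)[OF 1(2)] V(4) b False j by (auto simp: c_def cub_def in_Rn)
     then show ?case using elim by blast
    qed
   qed
   have qlim: "((%t. q k (c t)) \<longlongrightarrow> pd k h (c (x j))) (at (x j))" if k: "k < n" for k
   proof (rule tendstoI)
    fix \<epsilon> :: real assume "\<epsilon> > 0"
    then obtain b where b: "b > 0" "\<forall>y\<in>cub n (c (x j)) b. \<bar>q k y - pd k h (c (x j))\<bar> < \<epsilon>" using q(4)[OF k] by blast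
    show "\<forall>\<^sub>F t in at (x j). dist (q k (c t)) (pd k h (c (x j))) < \<epsilon>"
     using cev[OF b(1)] by eventually_elim (use b(2) in \<open>auto simp: dist_real_def\<close>)
   qed
   have pdl: "pd l h (c (x j)) > 0" using pos \<psi>[OF x] cx by simp
   \<comment> \<open>Along the graph \<open>h\<close> is constantly zero, so its increment formula
     expresses the difference quotient of \<open>\<phi>\<close> as
     \<open>- q j / q l\<close>.\<close>
   have "((%t. - q j (c t) / q l (c t)) \<longlongrightarrow> - pd j h (c (x j)) / pd l h (c (x j))) (at (x j))"
    using pdl by (intro tendsto_intros qlim j V(4)) auto
   moreover have "\<forall>\<^sub>F t in at (x j). q l (c t) > 0"
    using order_tendstoD(1)[OF qlim[OF V(4)] pdl] .
   then have "\<forall>\<^sub>F t in at (x j). - q j (c t) / q l (c t) = (\<phi> (x(j := t)) - \<phi> x) / (t - x j)"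
    using cev[OF q(1)] eventually_neq_at_within[of "x j" "x j" UNIV]
   proof eventually_elim
    case (elim t)
    have "h (c t) = 0" "h (c (x j)) = 0"
     using \<phi>(2)[of "x(j := t)"] \<phi>(2)[OF x] elim cx by (auto simp: c_def)
    then have "0 = (\<Sum>k<n. q k (c t) * (c t k - c (x j) k))" using q(3)[of "c t"] elim by auto
    also have "\<dots> = (\<Sum>k\<in>{j,l}. q k (c t) * (c t k - c (x j) k))"
     using j V(4) by (intro sum.mono_neutral_right) (auto simp: c_def)
    also have "\<dots> = q j (c t) * (t - x j) + q l (c t) * (\<phi> (x(j := t)) - \<phi> x)"
     using False by (simp add: c_def)
    finally show ?case using elim by (simp add: field_simps)
   qed
   ultimately have "((%t. (\<phi> (x(j := t)) - \<phi> x) / (t - x j)) \<longlongrightarrow> - pd j h (c (x j)) / pd l h (c (x j))) (at (x j))"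
    by (rule Lim_transform_eventually)
   then show ?thesis
    using False cx unfolding has_field_derivative_iff \<phi>'_def by simp
  qed
 qed
 have comp: "((%t. g ((x(j := t))(l := \<phi> (x(j := t))))) has_real_derivative
   (if j = l then 0 else pd j g (x(l := \<phi> x)) - pd l g (x(l := \<phi> x)) * pd j h (x(l := \<phi> x)) / pd l h (x(l := \<phi> x)))) (at (x j))"
  if g: "smooth_on n (cub n p e) g" and x: "x \<in> W" and j: "j < n" for g x j
 proof -
  define c where "c t = (x(j := t))(l := \<phi> (x(j := t)))" for t
  have cx: "c (x j) = x(l := \<phi> x)" by (simp add: c_def)
  have "c t \<in> Rn n" for t using x W opn_subset j V(4) by (auto simp: c_def in_Rn W_def)
  moreover have "((%t. c t k) has_real_derivative (if k = l then \<phi>' j x else if k = j then 1 else 0)) (at (x j))" for k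
   using \<phi>d[OF x j] by (auto simp: c_def)
  ultimately have "((%t. g (c t)) has_real_derivative (\<Sum>k<n. pd k g (c (x j)) * (if k = l then \<phi>' j x else if k = j then 1 else 0))) (at (x j))"
   using \<psi>[OF x] cx by (intro chain_rule[OF opn_cub g]) auto
  also have "(\<Sum>k<n. pd k g (c (x j)) * (if k = l then \<phi>' j x else if k = j then 1 else 0)) =
    (\<Sum>k\<in>{j,l}. pd k g (c (x j)) * (if k = l then \<phi>' j x else if k = j then 1 else 0))"
   using j V(4) by (intro sum.mono_neutral_right) auto
  also have "\<dots> = (if j = l then 0 else pd j g (x(l := \<phi> x)) - pd l g (x(l := \<phi> x)) * pd j h (x(l := \<phi> x)) / pd l h (x(l := \<phi> x)))"
   by (simp add: cx \<phi>'_def)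
  finally show ?thesis by (simp only: c_def)
 qed
 have he: "smooth_on n (cub n p e) h" using smooth_on_subset[OF V(2,1) opn_cub e(2)] .
 \<comment> \<open>The class for coinduction consists of all pullbacks along the graph map. The
   derivative of a pullback is the pullback of a smooth combination of derivatives, so smoothness of
   \<open>\<phi>\<close> needs no separate proof.\<close>
 have smooth: "smooth_on n W (%x. g (x(l := \<phi> x)))" if g: "smooth_on n (cub n p e) g" for g
 proof (rule smooth_on_coinductI[OF W, of "%f. \<exists>g. smooth_on n (cub n p e) g \<and> f = (%x. g (x(l := \<phi> x)))"])
  show "\<exists>g'. smooth_on n (cub n p e) g' \<and> (%x. g (x(l := \<phi> x))) = (%x. g' (x(l := \<phi> x)))" using g by blast
  fix f assume "\<exists>g. smooth_on n (cub n p e) g \<and> f = (%x. g (x(l := \<phi> x)))"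
  then obtain g where g: "smooth_on n (cub n p e) g" and f: "f = (%x. g (x(l := \<phi> x)))" by blast
  define G where "G j = (if j = l then (%x. 0) else (%x. pd j g x - pd l g x * pd j h x / pd l h x))" for j
  have "continuous_on W (%x. (x(l := \<phi> x)) i)" for i
   using \<phi>cont continuous_on_coord by (cases "i = l") auto
  then have "continuous_on W (%x. x(l := \<phi> x))"
   by (rule continuous_on_coordinatewise_then_product)
  then have "continuous_on W f"
   unfolding f using continuous_on_compose2[OF smooth_onD(1)[OF g opn_cub]] \<psi> by blast
  moreover have "smooth_on n (cub n p e) (G j)" if "j < n" for j
   using that pos smooth_onD(3)[OF g opn_cub] smooth_onD(3)[OF he opn_cub] V(4)
   unfolding G_def by (auto intro!: smooth_const smooth_diff smooth_mult smooth_divide opn_cub) (metis less_irrefl pos)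
  moreover have "((%t. f (x(j := t))) has_real_derivative G j (x(l := \<phi> x))) (at (x j))" if "j < n" "x \<in> W" for j x
   using comp[OF g that(2,1)] unfolding f G_def by (cases "j = l") simp_all
  ultimately show "continuous_on W f \<and> (\<exists>D. \<forall>i<n. (\<forall>x\<in>W. ((%t. f (x(i := t))) has_real_derivative D i x) (at (x i))) \<and>
    ((\<exists>g. smooth_on n (cub n p e) g \<and> D i = (%x. g (x(l := \<phi> x)))) \<or> smooth_on n W (D i)))"
   by (intro conjI exI[of _ "%j x. G j (x(l := \<phi> x))"] allI impI ballI disjI1) blast+
 qed
 have "\<phi> p = p l" using \<phi>u[OF pW, of "p l"] hp a by simp
 moreover have "x \<in> V \<and> x(l := \<phi> x) \<in> V \<and> pd l h (x(l := \<phi> x)) \<noteq> 0 \<and> h (x(l := \<phi> x)) = 0 \<and>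
    (h x = 0 --> \<phi> x = x l) \<and> x(l := p l) \<in> W \<and> \<phi> (x(l := p l)) = \<phi> x" if x: "x \<in> W" for x
 proof -
  have "\<bar>x l - p l\<bar> < a" using x V(4) by (auto simp: W_def)
  then show ?thesis using x We e(2) \<psi>[OF x] pos[OF \<psi>[OF x]] \<phi>[OF x] \<phi>u[OF x, of "x l"] updW[OF x, of "p l"] \<phi>c[OF x, of "p l"] a
   by auto
 qed
 moreover have "smooth_on n W (%x. g (x(l := \<phi> x))) \<and>
    (\<forall>x\<in>W. \<forall>j<n. pd j (%x. g (x(l := \<phi> x))) x =
     (if j = l then 0 else pd j g (x(l := \<phi> x)) - pd l g (x(l := \<phi> x)) * pd j h (x(l := \<phi> x)) / pd l h (x(l := \<phi> x))))"
  if "smooth_on n V g" for g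
  using smooth comp smooth_on_subset[OF that V(1) opn_cub e(2)] by (intro conjI ballI allI impI pd_eqI) blast+
 ultimately show ?thesis using W pW by (intro exI[of _ W] exI[of _ \<phi>]) blast
qed

text \<open>A negative derivative is reduced to a positive one by passing to \<open>- h\<close>; the
  quotient of derivatives in the last clause does not change.\<close>

lemma implicit_graph:
 assumes V: "opn n V" "smooth_on n V h" "p \<in> V" "l < n" and hp: "h p = 0" "pd l h p \<noteq> 0"
 obtains W \<phi> where "opn n W" "p \<in> W" "\<phi> p = p l"
  "\<And>x. x \<in> W ==> x \<in> V" "\<And>x. x \<in> W ==> x(l := \<phi> x) \<in> V" "\<And>x. x \<in> W ==> h (x(l := \<phi> x)) = 0"
  "\<And>x. x \<in> W ==> h x = 0 ==> \<phi> x = x l" "\<And>x. x \<in> W ==> x(l := p l) \<in> W"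
  "\<And>x. x \<in> W ==> \<phi> (x(l := p l)) = \<phi> x"
  "\<And>g. smooth_on n V g ==> smooth_on n W (%x. g (x(l := \<phi> x)))"
  "\<And>g x j. smooth_on n V g ==> x \<in> W ==> j < n ==> pd j (%x. g (x(l := \<phi> x))) x =
     (if j = l then 0 else pd j g (x(l := \<phi> x)) - pd l g (x(l := \<phi> x)) * pd j h (x(l := \<phi> x)) / pd l h (x(l := \<phi> x)))"
proof (cases "pd l h p > 0")
 case True
 from implicit_graph_pos[OF V hp(1) True]
 obtain W \<phi> where H: "opn n W" "p \<in> W" "\<phi> p = p l" and H4:
  "\<forall>x\<in>W. x \<in> V \<and> x(l := \<phi> x) \<in> V \<and> pd l h (x(l := \<phi> x)) \<noteq> 0 \<and> h (x(l := \<phi> x)) = 0 \<and>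
    (h x = 0 --> \<phi> x = x l) \<and> x(l := p l) \<in> W \<and> \<phi> (x(l := p l)) = \<phi> x"
  and H5: "\<forall>g. smooth_on n V g --> smooth_on n W (%x. g (x(l := \<phi> x))) \<and>
    (\<forall>x\<in>W. \<forall>j<n. pd j (%x. g (x(l := \<phi> x))) x =
     (if j = l then 0 else pd j g (x(l := \<phi> x)) - pd l g (x(l := \<phi> x)) * pd j h (x(l := \<phi> x)) / pd l h (x(l := \<phi> x))))"
  by (elim exE conjE) (rule that, assumption+)
 show thesis
  by (rule that[of W \<phi>, OF H]) (use H4 H5 in \<open>simp_all del: fun_upd_apply\<close>)
next
 case False
 have sm: "smooth_on n V (%x. - h x)" by (rule smooth_minus[OF V(1,2)])
 have pm: "pd j (%x. - h x) x = - pd j h x" if "j < n" "x \<in> V" for j x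
  using smooth_onD(2)[OF V(2,1) that] by (intro pd_eqI DERIV_minus)
 have "pd l (%x. - h x) p > 0" using pm[OF V(4,3)] False hp(2) by simp
 moreover have "- h p = 0" using hp(1) by simp
 ultimately have ex: "pd l (%x. - h x) p > 0" "- h p = 0" by blast+
 from implicit_graph_pos[OF V(1) sm V(3,4) ex(2,1)]
 obtain W \<phi> where H: "opn n W" "p \<in> W" "\<phi> p = p l" and H4:
  "\<forall>x\<in>W. x \<in> V \<and> x(l := \<phi> x) \<in> V \<and> pd l (%x. - h x) (x(l := \<phi> x)) \<noteq> 0 \<and> - h (x(l := \<phi> x)) = 0 \<and>
    (- h x = 0 --> \<phi> x = x l) \<and> x(l := p l) \<in> W \<and> \<phi> (x(l := p l)) = \<phi> x"
  and H5: "\<forall>g. smooth_on n V g --> smooth_on n W (%x. g (x(l := \<phi> x))) \<and>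
    (\<forall>x\<in>W. \<forall>j<n. pd j (%x. g (x(l := \<phi> x))) x =
     (if j = l then 0 else pd j g (x(l := \<phi> x)) - pd l g (x(l := \<phi> x)) * pd j (%x. - h x) (x(l := \<phi> x)) / pd l (%x. - h x) (x(l := \<phi> x))))"
  by (elim exE conjE) (rule that, assumption+)
 show thesis
  by (rule that[of W \<phi>, OF H]) (use H4 H5 pm V(4) in \<open>simp_all del: fun_upd_apply\<close>)
qed

section \<open>Vectors tangent to a common zero set\<close>

definition dd :: "nat => ((nat => real) => real) => (nat => real) => (nat => real) => real" where
 "dd n f x w = (\<Sum>i<n. pd i f x * w i)"

text \<open>Eliminating one function at a time avoids an implicit function theorem for systems.\<close>

lemma tangent_kill:
 assumes "finite K"
  and "opn n V" "p \<in> V" "\<And>i. i \<in> K ==> smooth_on n V (g i)" "\<And>i. i \<in> K ==> g i p = 0"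
  and "smooth_on n V a" "\<And>x. x \<in> V ==> (\<forall>i\<in>K. g i x = 0) ==> a x = 0"
  and "\<And>i. i \<in> K ==> dd n (g i) p w = 0"
  and "\<And>i k. i \<in> K ==> k \<in> K ==> i \<noteq> k ==> dd n (g k) p (u i) = 0"
  and "\<And>i. i \<in> K ==> dd n (g i) p (u i) \<noteq> 0"
 shows "dd n a p w = 0"
 using assms
proof (induction K arbitrary: V g a rule: finite_induct)
 case empty
 then have "\<And>x. x \<in> V ==> 0 = a x" by simp
 then have "pd i a p = pd i (%x. 0) p" if "i < n" for i
  using pd_cong[OF empty.prems(1,2) that, of a "%x. 0"] empty.prems(5) by simp
 moreover have "pd i (%x. 0) p = 0" for i by (rule pd_eqI) simp
 ultimately show ?case by (simp add: dd_def)
next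
 case (insert k K)
 have "\<exists>l<n. pd l (g k) p \<noteq> 0"
  using insert.prems(9)[of k] unfolding dd_def by (metis (no_types, lifting) insertI1 lessThan_iff mult_zero_left sum.neutral)
 then obtain l where l: "l < n" "pd l (g k) p \<noteq> 0" by blast
 show ?case
 proof (rule implicit_graph[OF insert.prems(1) insert.prems(3)[of k] insert.prems(2) l(1) _ l(2)])
  show "k \<in> insert k K" "g k p = 0" using insert.prems(4) by auto
  fix W \<phi> assume W: "opn n W" "p \<in> W" "\<phi> p = p l"
  "\<And>x. x \<in> W ==> x \<in> V" "\<And>x. x \<in> W ==> x(l := \<phi> x) \<in> V" "\<And>x. x \<in> W ==> g k (x(l := \<phi> x)) = 0"
  and sm: "\<And>f. smooth_on n V f ==> smooth_on n W (%x. f (x(l := \<phi> x)))"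
  and pd: "\<And>f x j. smooth_on n V f ==> x \<in> W ==> j < n ==> pd j (%x. f (x(l := \<phi> x))) x =
     (if j = l then 0 else pd j f (x(l := \<phi> x)) - pd l f (x(l := \<phi> x)) * pd j (g k) (x(l := \<phi> x)) / pd l (g k) (x(l := \<phi> x)))"
  \<comment> \<open>The graph map changes a differential at \<open>p\<close> only by a multiple of
    that of \<open>g k\<close>, so nothing changes on vectors killed by \<open>g k\<close>. Both
    \<open>w\<close> and the dual vectors of the remaining functions are of this kind, and the
    hypotheses survive the elimination.\<close>
  have dd: "dd n (%x. f (x(l := \<phi> x))) p v = dd n f p v" if f: "smooth_on n V f" and v: "dd n (g k) p v = 0" for f v
  proof -
   have "pd j (%x. f (x(l := \<phi> x))) p = pd j f p - pd l f p / pd l (g k) p * pd j (g k) p" if "j < n" for j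
    using pd[OF f W(2) that] W(3) l(2) by (auto simp: fun_upd_idem)
   then have "dd n (%x. f (x(l := \<phi> x))) p v = (\<Sum>j<n. pd j f p * v j - pd l f p / pd l (g k) p * (pd j (g k) p * v j))"
    unfolding dd_def by (intro sum.cong refl) (simp only: lessThan_iff left_diff_distrib mult.assoc)
   also have "\<dots> = dd n f p v - pd l f p / pd l (g k) p * dd n (g k) p v"
    by (simp add: dd_def sum_subtractf sum_distrib_left)
   finally show ?thesis using v by simp
  qed
  have pp: "p(l := \<phi> p) = p" using W(3) by (simp add: fun_upd_idem)
  have ne: "i \<noteq> k" if "i \<in> K" for i using that insert.hyps(2) by blast
  have "dd n (%x. a (x(l := \<phi> x))) p w = 0"
  proof (rule insert.IH[OF W(1,2), of "%i x. g i (x(l := \<phi> x))"])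
   show "smooth_on n W (%x. g i (x(l := \<phi> x)))" if "i \<in> K" for i using sm insert.prems(3) that by blast
   show "g i (p(l := \<phi> p)) = 0" if "i \<in> K" for i unfolding pp using insert.prems(4) that by blast
   show "smooth_on n W (%x. a (x(l := \<phi> x)))" using sm insert.prems(5) by blast
   show "a (x(l := \<phi> x)) = 0" if "x \<in> W" "\<forall>i\<in>K. g i (x(l := \<phi> x)) = 0" for x
    using insert.prems(6)[OF W(5)[OF that(1)]] W(6)[OF that(1)] that(2) by blast
   show "dd n (%x. g i (x(l := \<phi> x))) p w = 0" if "i \<in> K" for i
    using dd[OF insert.prems(3)[of i], of w] insert.prems(7) that by (simp del: fun_upd_apply)
   show "dd n (%x. g j (x(l := \<phi> x))) p (u i) = 0" if "i \<in> K" "j \<in> K" "i \<noteq> j" for i j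
    using dd[OF insert.prems(3)[of j], of "u i"] insert.prems(8)[of i j] insert.prems(8)[of i k] ne that by (simp del: fun_upd_apply)
   show "dd n (%x. g i (x(l := \<phi> x))) p (u i) \<noteq> 0" if "i \<in> K" for i
    using dd[OF insert.prems(3)[of i], of "u i"] insert.prems(9)[of i] insert.prems(8)[of i k] ne that by (simp del: fun_upd_apply)
  qed
  then show ?thesis using dd[OF insert.prems(5), of w] insert.prems(7)[of k] by (simp del: fun_upd_apply)
 qed
qed

section \<open>Sard's theorem for real-valued functions\<close>

lemma negligible_local:
 fixes F :: "(nat => real) => real"
 assumes "\<And>x. x \<in> A ==> \<exists>W. opn n W \<and> x \<in> W \<and> negligible (F ` (A \<inter> W))" "A \<subseteq> Rn n"
 shows "negligible (F ` A)"
proof -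
 have "\<forall>x\<in>A. \<exists>U. open U \<and> x \<in> U \<and> negligible (F ` (A \<inter> U))"
 proof
  fix x assume x: "x \<in> A"
  then obtain W where W: "opn n W" "x \<in> W" "negligible (F ` (A \<inter> W))" using assms(1) by blast
  then obtain U where "open U" "W = Rn n \<inter> U" using opn_open by blast
  then show "\<exists>U. open U \<and> x \<in> U \<and> negligible (F ` (A \<inter> U))"
   using W assms(2) by (metis IntD2 Int_assoc inf.absorb1)
 qed
 then obtain U where U: "\<And>x. x \<in> A ==> open (U x)" "\<And>x. x \<in> A ==> x \<in> U x"
  "\<And>x. x \<in> A ==> negligible (F ` (A \<inter> U x))" by metis
 obtain C where C: "C \<subseteq> U ` A" "countable C" "\<Union>C = \<Union>(U ` A)"
  using Lindelof[of "U ` A"] U(1) by blast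
 have "negligible (\<Union>S\<in>C. F ` (A \<inter> S))"
  using C U(3) by (intro negligible_countable_Union) auto
 moreover have "F ` A \<subseteq> (\<Union>S\<in>C. F ` (A \<inter> S))" using C(3) U(2) by fastforce
 ultimately show ?thesis using negligible_subset by blast
qed

text \<open>Vanishing of all derivatives of order below \<open>k\<close> in the directions
  \<open>I\<close>, unfolded one derivative at a time to match the inductive Taylor
  estimate.\<close>

primrec flat :: "nat => nat set => ((nat => real) => real) => (nat => real) => bool" where
 "flat 0 I G x \<longleftrightarrow> True"
| "flat (Suc k) I G x \<longleftrightarrow> G x = 0 \<and> (\<forall>i\<in>I. flat k I (pd i G) x)"

primrec itpd :: "nat list => ((nat => real) => real) => (nat => real) => real" where
 "itpd [] F = F"
| "itpd (i # is) F = itpd is (pd i F)"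

lemma smooth_itpd: "opn n V ==> smooth_on n V F ==> set is \<subseteq> {..<n} ==> smooth_on n V (itpd is F)"
 by (induction "is" arbitrary: F) (auto intro: smooth_onD(3))

text \<open>On the way to a derivative that does not vanish there is a last one that does. Its zero
  set is a graph near \<open>x\<close>, which is what the inductive step of Sard's theorem
  uses.\<close>

lemma not_flat:
 "\<not> flat k I G x ==> G x = 0 ==> \<exists>is l. set is \<subseteq> I \<and> l \<in> I \<and> itpd is G x = 0 \<and> pd l (itpd is G) x \<noteq> 0"
proof (induction k arbitrary: G)
 case (Suc k)
 then obtain i where i: "i \<in> I" "\<not> flat k I (pd i G) x" by auto
 show ?case
 proof (cases "pd i G x = 0")
  case True
  from Suc.IH[OF i(2) True] obtain "is" l where "set is \<subseteq> I \<and> l \<in> I \<and> itpd is (pd i G) x = 0 \<and> pd l (itpd is (pd i G)) x \<noteq> 0"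
   by blast
  then show ?thesis using i(1) by (intro exI[of _ "i # is"] exI[of _ l]) auto
 next
  case False
  then show ?thesis using i(1) Suc.prems(2) by (intro exI[of _ "[]"] exI[of _ i]) auto
 qed
qed simp

definition l1 :: "nat => (nat => real) => (nat => real) => real" where
 "l1 n x y = (\<Sum>i<n. \<bar>y i - x i\<bar>)"

text \<open>The induction in Sard's theorem freezes coordinates instead of passing to a space of
  lower dimension, so that \<open>n\<close> stays fixed.\<close>

definition sliced :: "nat => nat set => (nat => real) => (nat => real) => bool" where
 "sliced n I c x \<longleftrightarrow> (\<forall>i<n. i \<notin> I --> x i = c i)"

lemma compact_closed_cube: "compact {y \<in> Rn n. \<forall>i<n. \<bar>y i - p i\<bar> \<le> e}"
proof -
 have "compactin (product_topology (%i. euclideanreal) (UNIV::nat set)) (PiE UNIV (%i. if i < n then {p i - e..p i + e} else {0}))"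
  by (subst compactin_PiE) auto
 moreover have "PiE UNIV (%i. if i < n then {p i - e..p i + e} else {0}) = {y \<in> Rn n. \<forall>i<n. \<bar>y i - p i\<bar> \<le> e}"
  by (auto simp: PiE_UNIV_domain in_Rn abs_le_iff Pi_iff split: if_splits) (smt (verit))+
 ultimately show ?thesis by (simp add: euclidean_product_topology)
qed

lemma bounded_on_cube:
 fixes G :: "(nat => real) => real"
 assumes "opn n V" "continuous_on V G" "cub n p e' \<subseteq> V" "e < e'"
 shows "\<exists>C\<ge>0. \<forall>y\<in>cub n p e. \<bar>G y\<bar> \<le> C"
proof -
 let ?Q = "{y \<in> Rn n. \<forall>i<n. \<bar>y i - p i\<bar> \<le> e}"
 have "?Q \<subseteq> cub n p e'" using assms(4) by (auto simp: cub_def)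
 then have "continuous_on ?Q G"
  by (intro continuous_on_subset[OF assms(2)]) (use assms(3) in blast)
 from compact_imp_bounded[OF compact_continuous_image[OF this compact_closed_cube]]
 obtain C where C: "\<forall>v\<in>G ` ?Q. norm v \<le> C"
  unfolding bounded_iff by (rule exE)
 moreover have "cub n p e \<subseteq> ?Q" by (auto simp: cub_def)
 ultimately have "\<bar>G y\<bar> \<le> \<bar>C\<bar>" if "y \<in> cub n p e" for y
  using that by (smt (verit, best) image_eqI real_norm_def subsetD)
 then show ?thesis by (metis abs_ge_zero)
qed

lemma l1_mono: "(\<And>i. i < n ==> \<bar>y i - x i\<bar> \<le> \<bar>z i - x i\<bar>) ==> l1 n x y \<le> l1 n x z"
 unfolding l1_def by (intro sum_mono) auto

text \<open>Each edge of the staircase from \<open>x\<close> to \<open>y\<close> contributes at most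
  the bound on one derivative times its length. Edges in directions outside \<open>I\<close> are
  trivial because both points lie in the same slice.\<close>

lemma flat_step:
 assumes V: "opn n V" "smooth_on n V G" "cub n p e \<subseteq> V" "I \<subseteq> {..<n}"
  and C: "C \<ge> 0" "\<And>i x y. i \<in> I ==> x \<in> cub n p e ==> y \<in> cub n p e ==> sliced n I x y ==> flat k I (pd i G) x ==>
    \<bar>pd i G y\<bar> \<le> C * l1 n x y ^ k"
  and xy: "x \<in> cub n p e" "y \<in> cub n p e" "sliced n I x y" "\<forall>i\<in>I. flat k I (pd i G) x"
 shows "\<bar>G y - G x\<bar> \<le> C * l1 n x y ^ Suc k"
proof -
 have 1: "\<bar>G ((mix x y i)(i := y i)) - G ((mix x y i)(i := x i))\<bar> \<le> C * l1 n x y ^ k * \<bar>y i - x i\<bar>" if i: "i < n" for i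
 proof (cases "i \<in> I")
  case False
  then have "y i = x i" using xy(3) i by (auto simp: sliced_def)
  then show ?thesis by simp
 next
  case True
  have seg: "(mix x y i)(i := s) \<in> cub n p e" if "s \<in> closed_segment (x i) (y i)" for s
   using segment_in_cub[OF xy(1,2) i that] .
  obtain s where s: "s \<in> closed_segment (x i) (y i)"
   "G ((mix x y i)(i := y i)) - G ((mix x y i)(i := x i)) = pd i G ((mix x y i)(i := s)) * (y i - x i)"
   using mvt_coord[OF V(1,2) i, of "x i" "y i" "mix x y i"] seg V(3) by (metis subsetD)
  have "sliced n I x ((mix x y i)(i := s))" using xy(3) True by (auto simp: sliced_def mix_def)
  then have "\<bar>pd i G ((mix x y i)(i := s))\<bar> \<le> C * l1 n x ((mix x y i)(i := s)) ^ k"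
   using C(2)[OF True xy(1) seg[OF s(1)]] xy(4) True by blast
  also have "l1 n x ((mix x y i)(i := s)) \<le> l1 n x y"
   using s(1) by (intro l1_mono) (auto simp: mix_def closed_segment_eq_real_ivl split: if_splits)
  then have "C * l1 n x ((mix x y i)(i := s)) ^ k \<le> C * l1 n x y ^ k"
   using C(1) by (intro mult_left_mono power_mono) (auto simp: l1_def sum_nonneg)
  finally show ?thesis unfolding s(2) abs_mult by (intro mult_right_mono) auto
 qed
 have "\<bar>G y - G x\<bar> \<le> (\<Sum>i<n. \<bar>G ((mix x y i)(i := y i)) - G ((mix x y i)(i := x i))\<bar>)"
  using telescope[of x n y G] xy(1,2) by (auto simp: cub_def)
 also have "\<dots> \<le> (\<Sum>i<n. C * l1 n x y ^ k * \<bar>y i - x i\<bar>)" by (intro sum_mono 1) auto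
 also have "\<dots> = C * l1 n x y ^ Suc k" unfolding sum_distrib_left[symmetric] l1_def[symmetric] by simp
 finally show ?thesis .
qed

text \<open>Taylor's estimate without the Taylor polynomial, which is zero here. The constant is
  uniform on the smaller cube because the derivatives of order \<open>k\<close> are bounded on a
  compact cube.\<close>

lemma flat_bound:
 assumes V: "opn n V" "cub n p e' \<subseteq> V" "e < e'" "I \<subseteq> {..<n}" and G: "smooth_on n V G"
 shows "\<exists>C\<ge>0. \<forall>x\<in>cub n p e. \<forall>y\<in>cub n p e. sliced n I x y --> flat k I G x --> \<bar>G y\<bar> \<le> C * l1 n x y ^ k"
 using G
proof (induction k arbitrary: G)
 case 0
 then show ?case using bounded_on_cube[OF V(1) smooth_onD(1)[OF 0 V(1)] V(2,3)] by auto
next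
 case (Suc k)
 have "\<forall>i\<in>I. \<exists>C\<ge>0. \<forall>x\<in>cub n p e. \<forall>y\<in>cub n p e. sliced n I x y --> flat k I (pd i G) x --> \<bar>pd i G y\<bar> \<le> C * l1 n x y ^ k"
  using Suc.IH smooth_onD(3)[OF Suc.prems V(1)] V(4) by blast
 then obtain C where C: "\<And>i. i \<in> I ==> C i \<ge> 0"
  "\<And>i x y. i \<in> I ==> x \<in> cub n p e ==> y \<in> cub n p e ==> sliced n I x y ==> flat k I (pd i G) x ==> \<bar>pd i G y\<bar> \<le> C i * l1 n x y ^ k"
  by metis
 have fI: "finite I" using V(4) finite_subset by blast
 define D where "D = (\<Sum>i\<in>I. C i)"
 have D: "D \<ge> 0" "\<And>i. i \<in> I ==> C i \<le> D"
  using C(1) fI by (auto simp: D_def intro: sum_nonneg member_le_sum)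
 have l1: "l1 n x y ^ k \<ge> 0" for x y by (simp add: l1_def sum_nonneg)
 have "\<bar>G y\<bar> \<le> D * l1 n x y ^ Suc k" if xy: "x \<in> cub n p e" "y \<in> cub n p e" "sliced n I x y" "flat (Suc k) I G x" for x y
 proof -
  have cs: "cub n p e \<subseteq> V" using cub_mono[of e e' n p] V(2,3) by auto
  have "\<bar>G y - G x\<bar> \<le> D * l1 n x y ^ Suc k"
  proof (rule flat_step[OF V(1) Suc.prems cs V(4) D(1)])
   show "\<bar>pd i G y\<bar> \<le> D * l1 n x y ^ k" if "i \<in> I" "x \<in> cub n p e" "y \<in> cub n p e" "sliced n I x y" "flat k I (pd i G) x" for i x y
    using C(2)[OF that] D(2)[OF that(1)] l1[of x y] by (meson mult_right_mono order_trans)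
  qed (use xy in auto)
  then show ?thesis using xy(4) by simp
 qed
 then show ?case using D(1) by blast
qed

text \<open>The flat part of the critical set: the image of a cell of diameter \<open>O(1/N)\<close> has length
 \<open>O(1/N\<^bsup>m+1\<^esup>)\<close>, and there are only \<open>O(N\<^sup>m)\<close> cells.\<close>

lemma negligible_flat_image:
 fixes F :: "(nat => real) => real"
 assumes e: "e > 0" and I: "I \<subseteq> {..<n}" "card I = m" and S: "S \<subseteq> cub n p e" "\<And>x y. x \<in> S ==> y \<in> S ==> sliced n I x y"
  and C: "C \<ge> 0" "\<And>x y. x \<in> S ==> y \<in> S ==> \<bar>F y - F x\<bar> \<le> C * l1 n x y ^ Suc m"
 shows "negligible (F ` S)"
proof (subst negligible_outer_le, intro allI impI)
 fix \<epsilon> :: real assume \<epsilon>: "\<epsilon> > 0"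
 have fI: "finite I" using I(1) finite_subset by blast
 \<comment> \<open>Chosen so that the covering intervals have total length \<open>K / N\<close>:
   there are \<open>N ^ m\<close> of them, each twice as long as
   \<open>C * (real m * (2 * e / N)) ^ Suc m\<close>.\<close>
 define K where "K = 2 * C * (real m * (2 * e)) ^ Suc m"
 have K0: "K \<ge> 0" using C(1) e by (simp add: K_def)
 obtain N :: nat where N: "N > 0" "K / real N \<le> \<epsilon>"
 proof -
  obtain N' :: nat where "max 0 (K / \<epsilon>) < N'" using reals_Archimedean2 by blast
  then have "real N' > K / \<epsilon>" "N' > 0" by auto
  then show thesis using that[of N'] \<epsilon> by (simp add: field_simps)
 qed
 \<comment> \<open>Position in a grid with \<open>N\<close> cells per direction in \<open>I\<close>;
   the other coordinates are constant on \<open>S\<close>.\<close>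
 define cell where "cell x = (\<lambda>i\<in>I. nat \<lfloor>(x i - p i + e) / (2 * e) * N\<rfloor>)" for x
 have rng: "cell x \<in> PiE I (%_. {..<N})" if x: "x \<in> S" for x
 proof -
  have "nat \<lfloor>(x i - p i + e) / (2 * e) * N\<rfloor> < N" if "i \<in> I" for i
  proof -
   have "\<bar>x i - p i\<bar> < e" using x S(1) that I(1) by (auto simp: cub_def)
   then have "0 \<le> (x i - p i + e) / (2 * e)" "(x i - p i + e) / (2 * e) < 1" using e by (auto simp: field_simps)
   then have "0 \<le> (x i - p i + e) / (2 * e) * N" "(x i - p i + e) / (2 * e) * N < N"
    using N(1) mult_strict_right_mono[of "(x i - p i + e) / (2 * e)" 1 "real N"]
     mult_nonneg_nonneg[of "(x i - p i + e) / (2 * e)" "real N"] by simp_all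
   then show ?thesis by (simp add: floor_less_iff nat_less_iff)
  qed
  then show ?thesis by (auto simp: cell_def)
 qed
 have close: "l1 n x y \<le> real m * (2 * e / N)" if xy: "x \<in> S" "y \<in> S" "cell x = cell y" for x y
 proof -
  have "\<bar>y i - x i\<bar> \<le> (if i \<in> I then 2 * e / N else 0)" if i: "i < n" for i
  proof (cases "i \<in> I")
   case True
   let ?u = "%x. (x i - p i + e) / (2 * e) * N"
   have nn: "0 \<le> ?u x" "0 \<le> ?u y" using xy(1,2) S(1) i e by (auto simp: cub_def zero_le_divide_iff abs_less_iff intro!: mult_nonneg_nonneg) force+
   have "cell x i = cell y i" using xy(3) by simp
   then have "nat \<lfloor>?u x\<rfloor> = nat \<lfloor>?u y\<rfloor>" using True by (simp add: cell_def)
   then have "\<lfloor>?u x\<rfloor> = \<lfloor>?u y\<rfloor>" using nn by (simp add: eq_nat_nat_iff)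
   then have "\<bar>?u y - ?u x\<bar> \<le> 1" by linarith
   moreover have "?u y - ?u x = (y i - x i) * (N / (2 * e))" using e by (simp add: field_simps)
   ultimately have "\<bar>y i - x i\<bar> * (N / (2 * e)) \<le> 1" using e by (simp add: abs_mult)
   then show ?thesis using True e N(1) by (simp add: field_simps)
  next
   case False
   then show ?thesis using S(2)[OF xy(1,2)] i by (simp add: sliced_def)
  qed
  then have "l1 n x y \<le> (\<Sum>i<n. if i \<in> I then 2 * e / N else 0)" unfolding l1_def by (intro sum_mono) auto
  also have "\<dots> = real m * (2 * e / N)" using I by (simp add: sum.If_cases Int_absorb1)
  finally show ?thesis .
 qed
 define \<delta> where "\<delta> = C * (real m * (2 * e / N)) ^ Suc m"
 have \<delta>0: "\<delta> \<ge> 0" using C(1) e by (simp add: \<delta>_def)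
 \<comment> \<open>A point of \<open>S\<close> in each occupied cell. For an empty cell the value is
   arbitrary, which only adds an interval to the cover.\<close>
 define rep where "rep k = (SOME x. x \<in> S \<and> cell x = k)" for k
 have rep: "rep (cell x) \<in> S \<and> cell (rep (cell x)) = cell x" if "x \<in> S" for x
  unfolding rep_def using that by (intro someI[of "%y. y \<in> S \<and> cell y = cell x" x]) auto
 define T where "T = (\<Union>k\<in>PiE I (%_. {..<N}). {F (rep k) - \<delta>..F (rep k) + \<delta>})"
 have fin: "finite (PiE I (%_. {..<N}))" using fI by (intro finite_PiE) auto
 have "F ` S \<subseteq> T"
 proof
  fix v assume "v \<in> F ` S"
  then obtain x where x: "x \<in> S" "v = F x" by blast
  have "\<bar>F x - F (rep (cell x))\<bar> \<le> C * l1 n (rep (cell x)) x ^ Suc m" using C(2) rep[OF x(1)] x(1) by blast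
  also have "\<dots> \<le> \<delta>" unfolding \<delta>_def using close[of "rep (cell x)" x] rep[OF x(1)] x(1) C(1)
   by (intro mult_left_mono power_mono) (auto simp: l1_def sum_nonneg)
  finally show "v \<in> T" unfolding T_def x(2) using rng[OF x(1)] by (intro UN_I[of "cell x"]) (auto simp: abs_le_iff)
 qed
 moreover have "T \<in> lmeasurable" unfolding T_def using fin by (intro fmeasurable.finite_UN) auto
 moreover have "measure lebesgue T \<le> \<epsilon>"
 proof -
  have "measure lebesgue T \<le> (\<Sum>k\<in>PiE I (%_. {..<N}). measure lebesgue {F (rep k) - \<delta>..F (rep k) + \<delta>})"
   unfolding T_def using fin by (intro measure_UNION_le) auto
  also have "\<dots> = real (N ^ m) * (2 * \<delta>)" using \<delta>0 I(2) fI by (simp add: card_PiE)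
  also have "\<dots> = K / N"
  proof -
   have "real (N ^ m) * (2 * \<delta>) = real N ^ m * (2 * C * ((real m * (2 * e)) ^ Suc m / real N ^ Suc m))"
    by (simp add: \<delta>_def power_divide)
   also have "\<dots> = K / N" using N(1) by (simp add: K_def field_simps)
   finally show ?thesis .
  qed
  finally show ?thesis using N(2) by linarith
 qed
 ultimately show "\<exists>T. F ` S \<subseteq> T \<and> T \<in> lmeasurable \<and> measure lebesgue T \<le> \<epsilon>" by blast
qed

text \<open>Sard's theorem on coordinate slices, by induction on the number of free coordinates \<open>I\<close>: where some
 iterated derivative \<open>h\<close> vanishes but \<open>pd l h\<close> does not, the zero set of \<open>h\<close> is a graph over the
 remaining coordinates; the other critical points are flat.\<close>

lemma sard_slice:
 assumes "I \<subseteq> {..<n}" "opn n V" "smooth_on n V F"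
 shows "negligible (F ` {x\<in>V. sliced n I c x \<and> (\<forall>i\<in>I. pd i F x = 0)})"
 using assms
proof (induction "card I" arbitrary: I V F c rule: less_induct)
 case less
 note I = less.prems(1) and V = less.prems(2,3)
 have fI: "finite I" using I finite_subset by blast
 define A where "A = {x\<in>V. sliced n I c x \<and> (\<forall>i\<in>I. pd i F x = 0)}"
 \<comment> \<open>Flatness of order \<open>card I\<close> of the first derivatives gives the
   exponent \<open>Suc (card I)\<close> in the increments of \<open>F\<close>, one more than the
   dimension of the slice.\<close>
 define A0 where "A0 = {x\<in>A. \<forall>i\<in>I. flat (card I) I (pd i F) x}"
 define A1 where "A1 L l = {x\<in>A. itpd L F x = 0 \<and> pd l (itpd L F) x \<noteq> 0}" for L l
 have AR: "A \<subseteq> Rn n" using V(1) opn_subset by (auto simp: A_def)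
 have sub: "A \<subseteq> A0 \<union> (\<Union>L\<in>lists I. \<Union>l\<in>I. A1 L l)"
 proof
  fix x assume x: "x \<in> A"
  show "x \<in> A0 \<union> (\<Union>L\<in>lists I. \<Union>l\<in>I. A1 L l)"
  proof (cases "x \<in> A0")
   case False
   then obtain i where i: "i \<in> I" "\<not> flat (card I) I (pd i F) x" using x by (auto simp: A0_def)
   have "pd i F x = 0" using x i(1) by (auto simp: A_def)
   from not_flat[OF i(2) this] obtain "is" l where
    L: "set is \<subseteq> I" "l \<in> I" "itpd is (pd i F) x = 0" "pd l (itpd is (pd i F)) x \<noteq> 0" by blast
   then have "x \<in> A1 (i # is) l" "i # is \<in> lists I" using x i(1) by (auto simp: A1_def)
   then show ?thesis using L(2) by blast
  qed simp
 qed
 have "negligible (F ` A0)"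
 proof (rule negligible_local[where n = n])
  fix p assume p: "p \<in> A0"
  then have pV: "p \<in> V" by (auto simp: A0_def A_def)
  obtain e' where e': "e' > 0" "cub n p e' \<subseteq> V" using opn_contains_cub[OF V(1) pV] .
  define e where "e = e' / 2"
  have e: "0 < e" "e < e'" using e'(1) by (auto simp: e_def)
  have cs: "cub n p e \<subseteq> V" using cub_mono[of e e' n p] e e'(2) by auto
  have "\<forall>i\<in>I. \<exists>C\<ge>0. \<forall>x\<in>cub n p e. \<forall>y\<in>cub n p e. sliced n I x y --> flat (card I) I (pd i F) x --> \<bar>pd i F y\<bar> \<le> C * l1 n x y ^ card I"
   using flat_bound[OF V(1) e'(2) e(2) I] smooth_onD(3)[OF V(2,1)] I by blast
  then obtain C where C: "\<And>i. i \<in> I ==> C i \<ge> 0"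
   "\<And>i x y. i \<in> I ==> x \<in> cub n p e ==> y \<in> cub n p e ==> sliced n I x y ==> flat (card I) I (pd i F) x ==> \<bar>pd i F y\<bar> \<le> C i * l1 n x y ^ card I"
   by metis
  define D where "D = (\<Sum>i\<in>I. C i)"
  have D: "D \<ge> 0" "\<And>i. i \<in> I ==> C i \<le> D"
   using C(1) fI by (auto simp: D_def intro: sum_nonneg member_le_sum)
  have D2: "\<bar>pd i F y\<bar> \<le> D * l1 n x y ^ card I"
   if "i \<in> I" "x \<in> cub n p e" "y \<in> cub n p e" "sliced n I x y" "flat (card I) I (pd i F) x" for i x y
  proof -
   have "C i * l1 n x y ^ card I \<le> D * l1 n x y ^ card I"
    using D(2)[OF that(1)] by (intro mult_right_mono) (auto simp: l1_def sum_nonneg)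
   then show ?thesis using C(2)[OF that] by linarith
  qed
  have sl: "sliced n I x y" if "x \<in> A" "y \<in> A" for x y using that by (auto simp: A_def sliced_def)
  have "negligible (F ` (A0 \<inter> cub n p e))"
  proof (rule negligible_flat_image[OF e(1) I refl _ _ D(1)])
   show "sliced n I x y" if "x \<in> A0 \<inter> cub n p e" "y \<in> A0 \<inter> cub n p e" for x y
    using that sl by (auto simp: A0_def)
   show "\<bar>F y - F x\<bar> \<le> D * l1 n x y ^ Suc (card I)" if "x \<in> A0 \<inter> cub n p e" "y \<in> A0 \<inter> cub n p e" for x y
   proof (rule flat_step[OF V cs I D(1)])
    show "\<bar>pd i F y\<bar> \<le> D * l1 n x y ^ card I"
     if "i \<in> I" "x \<in> cub n p e" "y \<in> cub n p e" "sliced n I x y" "flat (card I) I (pd i F) x" for i x y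
     using D2[OF that] .
    show "sliced n I x y" using sl that unfolding A0_def by blast
   qed (use that in \<open>unfold A0_def, blast+\<close>)
  qed auto
  then show "\<exists>W. opn n W \<and> p \<in> W \<and> negligible (F ` (A0 \<inter> W))"
   using cub_center[of p n e] pV opn_subset[OF V(1)] e(1) by (intro exI[of _ "cub n p e"] conjI opn_cub) auto
 qed (use AR in \<open>auto simp: A0_def\<close>)
 moreover have "negligible (F ` A1 L l)" if L: "L \<in> lists I" and l: "l \<in> I" for L l
 proof (rule negligible_local[where n = n])
  fix p assume p: "p \<in> A1 L l"
  then have pV: "p \<in> V" by (auto simp: A1_def A_def)
  have ln: "l < n" using l I by auto
  have "set L \<subseteq> {..<n}" using L I by auto
  then have h: "smooth_on n V (itpd L F)" using smooth_itpd V by blast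
  have hp: "itpd L F p = 0" "pd l (itpd L F) p \<noteq> 0" using p by (auto simp: A1_def)
  show "\<exists>W. opn n W \<and> p \<in> W \<and> negligible (F ` (A1 L l \<inter> W))"
  proof (rule implicit_graph[OF V(1) h pV ln hp])
   fix W \<phi> assume W: "opn n W" "p \<in> W" "\<And>x. x \<in> W ==> itpd L F x = 0 ==> \<phi> x = x l"
    "\<And>x. x \<in> W ==> x(l := p l) \<in> W" "\<And>x. x \<in> W ==> \<phi> (x(l := p l)) = \<phi> x"
    and sm: "\<And>g. smooth_on n V g ==> smooth_on n W (%x. g (x(l := \<phi> x)))"
    and pd: "\<And>g x j. smooth_on n V g ==> x \<in> W ==> j < n ==> pd j (%x. g (x(l := \<phi> x))) x =
     (if j = l then 0 else pd j g (x(l := \<phi> x)) - pd l g (x(l := \<phi> x)) * pd j (itpd L F) (x(l := \<phi> x)) / pd l (itpd L F) (x(l := \<phi> x)))"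
   define F' where "F' = (%x. F (x(l := \<phi> x)))"
   \<comment> \<open>The induction hypothesis is applied to the pullback of \<open>F\<close> along
     the graph map, in the slice where coordinate \<open>l\<close> is frozen at
     \<open>p l\<close>.\<close>
   have "card (I - {l}) < card I" using l fI by (metis card_Diff1_less)
   from less.hyps[OF this _ W(1) sm[OF V(2)], of "c(l := p l)"]
   have neg: "negligible (F' ` {x \<in> W. sliced n (I - {l}) (c(l := p l)) x \<and> (\<forall>i\<in>I - {l}. pd i F' x = 0)})"
    using I unfolding F'_def by blast
   have "F ` (A1 L l \<inter> W) \<subseteq> F' ` {x \<in> W. sliced n (I - {l}) (c(l := p l)) x \<and> (\<forall>i\<in>I - {l}. pd i F' x = 0)}"
   proof
    fix v assume "v \<in> F ` (A1 L l \<inter> W)"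
    then obtain x where x: "x \<in> A" "itpd L F x = 0" "x \<in> W" "v = F x" by (auto simp: A1_def)
    \<comment> \<open>As \<open>\<phi>\<close> ignores coordinate \<open>l\<close>, the graph map
      sends the flattened point back to \<open>x\<close>. At \<open>x\<close> all derivatives of
      \<open>F\<close> in directions \<open>I\<close> vanish, including the one in direction
      \<open>l\<close>, so the pullback is critical at \<open>x'\<close>.\<close>
    define x' where "x' = x(l := p l)"
    have x': "x' \<in> W" "x'(l := \<phi> x') = x" using W(3-5) x by (auto simp: x'_def)
    have "pd i F' x' = 0" if "i \<in> I - {l}" for i
     using pd[OF V(2) x'(1), of i] that I x(1) l unfolding F'_def x'(2) by (auto simp: A_def)
    moreover have "sliced n (I - {l}) (c(l := p l)) x'" using x(1) by (auto simp: A_def sliced_def x'_def)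
    moreover have "v = F' x'" using x'(2) x(4) by (simp add: F'_def)
    ultimately show "v \<in> F' ` {x \<in> W. sliced n (I - {l}) (c(l := p l)) x \<and> (\<forall>i\<in>I - {l}. pd i F' x = 0)}"
     using x'(1) by blast
   qed
   then show ?thesis using W(1,2) neg negligible_subset by blast
  qed
 qed (use AR in \<open>auto simp: A1_def\<close>)
 moreover have "countable (lists I)" using fI by (simp add: countable_finite countable_lists)
 moreover have "negligible (\<Union>l\<in>I. F ` A1 L l)" if "L \<in> lists I" for L
  using calculation(2)[OF that] fI by (intro negligible_Union) auto
 moreover have "negligible (\<Union>L\<in>lists I. \<Union>l\<in>I. F ` A1 L l)"
 proof (rule negligible_countable_Union)
  show "countable ((%L. \<Union>l\<in>I. F ` A1 L l) ` lists I)" using calculation(3) by (rule countable_image)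
  show "negligible S" if "S \<in> (%L. \<Union>l\<in>I. F ` A1 L l) ` lists I" for S using calculation(4) that by blast
 qed
 ultimately have "negligible (F ` A0 \<union> (\<Union>L\<in>lists I. \<Union>l\<in>I. F ` A1 L l))"
  by (intro negligible_Un)
 then show ?case unfolding A_def[symmetric]
  by (rule negligible_subset) (rule order_trans[OF image_mono[OF sub]], simp add: image_Un image_UN)
qed

theorem sard:
 assumes "opn n V" "smooth_on n V F"
 shows "negligible (F ` {x\<in>V. \<forall>i<n. pd i F x = 0})"
 using sard_slice[OF order_refl assms, of undefined] by (simp add: sliced_def lessThan_iff Ball_def)

lemma opn_vimage:
 assumes "opn n V" "opn m W" "\<And>k. k < m ==> continuous_on V (h k)"
 shows "opn n {x\<in>V. tuple m (%k. h k x) \<in> W}"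
proof -
 obtain U where U: "open U" "W = Rn m \<inter> U" using assms(2) opn_open by blast
 obtain U' where U': "open U'" "V = Rn n \<inter> U'" using assms(1) opn_open by blast
 have "continuous_on V (%x. if i < m then h i x else 0)" for i
  using assms(3)[of i] by (cases "i < m") auto
 then have "continuous_on V (%x. tuple m (%k. h k x))"
  unfolding tuple_def by (rule continuous_on_coordinatewise_then_product)
 from continuous_openin_preimage_gen[OF this U(1)]
 obtain T where "open T" "V \<inter> (%x. tuple m (%k. h k x)) -` U = V \<inter> T" unfolding openin_open by blast
 then have "{x\<in>V. tuple m (%k. h k x) \<in> W} = Rn n \<inter> (U' \<inter> T)" "open (U' \<inter> T)" using U U' by auto
 then show ?thesis using opn_open by blast
qed

text \<open>Critical points of \<open>F\<close> on a level set are, with the Lagrange multipliers as further variables,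
 critical points of \<open>F - \<Sum> \<lambda>\<^sub>j f\<^sub>j\<close>, so Sard's theorem needs no parametrization of the level set.\<close>

lemma sard_constrained:
 fixes m :: nat
 assumes V: "opn n V" "smooth_on n V F" "\<And>j. j < m ==> smooth_on n V (f j)" and T: "T \<subseteq> {..<m}"
 shows "negligible (F ` {x\<in>V. (\<forall>j\<in>T. f j x = 0) \<and> (\<exists>\<mu>. \<forall>i<n. pd i F x = (\<Sum>j\<in>T. \<mu> j * pd i (f j) x))})"
proof -
 define V' where "V' = {z\<in>Rn (n + m). tuple n z \<in> V}"
 have V': "opn (n + m) V'"
  unfolding V'_def by (rule opn_vimage[OF opn_Rn V(1), of "n + m" "%k z. z k", OF continuous_on_coord])
 have sm: "smooth_on (n + m) V' (%z. g (tuple n z))" if "smooth_on n V g" for g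
 proof (rule smooth_comp[OF V' V(1) that, of "%k z. z k"])
  show "smooth_on (n + m) V' (%z. z k)" for k by (rule smooth_coord[OF V'])
  show "tuple n (%k. z k) \<in> V" if "z \<in> V'" for z using that unfolding V'_def by blast
 qed
 define G where "G z = F (tuple n z) - (\<Sum>j\<in>T. z (n + j) * f j (tuple n z))" for z
 have G: "smooth_on (n + m) V' G"
  unfolding G_def using T V by (intro smooth_diff V' sm smooth_sum smooth_mult smooth_coord) auto
 have "F ` {x\<in>V. (\<forall>j\<in>T. f j x = 0) \<and> (\<exists>\<mu>. \<forall>i<n. pd i F x = (\<Sum>j\<in>T. \<mu> j * pd i (f j) x))}
   \<subseteq> G ` {z\<in>V'. \<forall>i<n + m. pd i G z = 0}"
 proof
  fix v assume "v \<in> F ` {x\<in>V. (\<forall>j\<in>T. f j x = 0) \<and> (\<exists>\<mu>. \<forall>i<n. pd i F x = (\<Sum>j\<in>T. \<mu> j * pd i (f j) x))}"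
  then obtain x \<mu> where x: "x \<in> V" "\<And>j. j \<in> T ==> f j x = 0" "v = F x"
   "\<And>i. i < n ==> pd i F x = (\<Sum>j\<in>T. \<mu> j * pd i (f j) x)" by blast
  have xR: "x \<in> Rn n" using x(1) V(1) opn_subset by blast
  \<comment> \<open>The multiplier of \<open>f j\<close> is stored at index
    \<open>n + j\<close>.\<close>
  define z where "z i = (if i < n then x i else if i < n + m then \<mu> (i - n) else 0)" for i
  have z: "z \<in> Rn (n + m)" "tuple n z = x" using xR by (auto simp: z_def in_Rn tuple_def fun_eq_iff)
  have zV: "z \<in> V'" using z x(1) by (simp add: V'_def)
  have "pd i G z = 0" if i: "i < n + m" for i
  proof (rule pd_eqI, cases "i < n")
   case True
   have "tuple n (z(i := t)) = (tuple n z)(i := t)" for t using True by (auto simp: tuple_def fun_eq_iff)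
   then have tu: "tuple n (z(i := t)) = x(i := t)" for t using z(2) by simp
   have zi: "z i = x i" using True by (simp add: z_def)
   have "((%t. F (x(i := t)) - (\<Sum>j\<in>T. \<mu> j * f j (x(i := t)))) has_real_derivative
     pd i F x - (\<Sum>j\<in>T. \<mu> j * pd i (f j) x)) (at (x i))"
    using T by (intro DERIV_diff DERIV_sum DERIV_cmult smooth_onD(2)[OF V(2) V(1) True x(1)] smooth_onD(2)[OF V(3) V(1) True x(1)]) auto
   moreover have "G (z(i := t)) = F (x(i := t)) - (\<Sum>j\<in>T. \<mu> j * f j (x(i := t)))" for t
    unfolding G_def tu using True T by (intro arg_cong2[of _ _ _ _ "(-)"] refl sum.cong) (auto simp: z_def)
   ultimately show "((%t. G (z(i := t))) has_real_derivative 0) (at (z i))"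
    using x(4)[OF True] zi by simp
  next
   \<comment> \<open>The variable is now a multiplier. Multipliers enter \<open>G\<close> only
     through products with constraints, and these vanish at \<open>x\<close>.\<close>
   case False
   have "tuple n (z(i := t)) = tuple n z" for t using False by (auto simp: tuple_def fun_eq_iff)
   then have tu: "tuple n (z(i := t)) = x" for t using z(2) by simp
   have "G (z(i := t)) = F x" for t unfolding G_def tu using x(2) by simp
   then show "((%t. G (z(i := t))) has_real_derivative 0) (at (z i))" by simp
  qed
  moreover have "G z = v" unfolding G_def z(2) using x(2,3) by simp
  ultimately show "v \<in> G ` {z\<in>V'. \<forall>i<n + m. pd i G z = 0}" using zV by blast
 qed
 then show ?thesis using sard[OF V' G] negligible_subset by blast
qed

text \<open>A family of functions of one variable closed under differentiation; \<open>S\<close> is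
  the effect of differentiation on the index.\<close>

lemma smooth_family:
 fixes F :: "'k => real => real"
 assumes F: "\<And>k t. (F k has_real_derivative F (S k) t) (at t)" and V: "opn n V" "smooth_on n V h"
 shows "smooth_on n V (%x. F k (h x))"
proof -
 have "smooth_on 1 (Rn 1) (%v. F k (v 0))"
 proof (rule smooth_on_coinductI[OF opn_Rn, of "%f. \<exists>k. f = (%v. F k (v 0))"])
  fix g assume "\<exists>k. g = (%v. F k (v (0::nat)))"
  then obtain k where g: "g = (%v. F k (v 0))" by blast
  have "continuous_on UNIV (F k)" using F DERIV_isCont continuous_at_imp_continuous_on by blast
  then have "continuous_on (Rn 1) g"
   unfolding g using continuous_on_compose2[OF _ continuous_on_coord] by blast
  moreover have "((%t. g (x(i := t))) has_real_derivative F (S k) (x 0)) (at (x i))" if "i < 1" for i x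
   using that F unfolding g by simp
  ultimately show "continuous_on (Rn 1) g \<and> (\<exists>D. \<forall>i<1. (\<forall>x\<in>Rn 1. ((%t. g (x(i := t))) has_real_derivative D i x) (at (x i))) \<and>
    ((\<exists>k. D i = (%v. F k (v 0))) \<or> smooth_on 1 (Rn 1) (D i)))"
   by (intro conjI exI[of _ "%i x. F (S k) (x 0)"] allI impI ballI disjI1 exI[of _ "S k"]) simp_all
 qed blast
 from smooth_comp[OF V(1) opn_Rn this, of "%_. h"] V(2) show ?thesis by simp
qed

section \<open>Bump functions\<close>

text \<open>The function \<open>exp (- 1 / t)\<close>, extended by zero, and all its derivatives
  have this shape.\<close>

definition flatexp :: "real poly => real => real" where
 "flatexp P t = (if t > 0 then poly P (1 / t) * exp (- 1 / t) else 0)"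

text \<open>The factor \<open>s ^ k\<close> absorbs the shift of degree when a coefficient is split
  off, which lets the induction run.\<close>

lemma poly_exp_tendsto_0: "((%s::real. s ^ k * poly P s * exp (- s)) \<longlongrightarrow> 0) at_top"
proof (induction P arbitrary: k)
 case (pCons a P)
 have "((%s. a * (s ^ k / exp s) + s ^ Suc k * poly P s * exp (- s)) \<longlongrightarrow> a * 0 + 0) at_top"
  by (intro tendsto_intros tendsto_power_div_exp_0 pCons.IH)
 then show ?case by (simp add: algebra_simps exp_minus divide_inverse)
qed simp

text \<open>With \<open>s = 1 / t\<close> the derivative of \<open>s\<close> is
  \<open>- (s * s)\<close>, so the polynomial \<open>P\<close> becomes
  \<open>s * s * (P - pderiv P)\<close>. At 0 the exponential beats every power of
  \<open>s\<close>.\<close>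

lemma flatexp_deriv: "(flatexp P has_real_derivative flatexp ([:0, 0, 1:] * (P - pderiv P)) t) (at t)"
proof -
 consider "t > 0" | "t < 0" | "t = 0" by linarith
 then show ?thesis
 proof cases
  case 1
  define s where "s = 1 / t"
  have q: "((%t. 1 / t) has_real_derivative - (s * s)) (at t)"
   using DERIV_inverse[of t UNIV] 1 by (simp add: s_def inverse_eq_divide power2_eq_square)
  have p: "((%t. poly P (1 / t)) has_real_derivative poly (pderiv P) s * - (s * s)) (at t)"
   unfolding s_def by (rule DERIV_chain2[OF poly_DERIV q[unfolded s_def]])
  have e: "((%t. exp (- 1 / t)) has_real_derivative exp (- s) * (s * s)) (at t)"
   using DERIV_chain2[OF DERIV_exp DERIV_minus[OF q]] by (simp add: s_def)
  have "((%t. poly P (1 / t) * exp (- 1 / t)) has_real_derivative flatexp ([:0, 0, 1:] * (P - pderiv P)) t) (at t)"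
  proof -
   have st: "1 / t = s" "- 1 / t = - s" by (simp_all add: s_def)
   have "poly (pderiv P) s * - (s * s) * exp (- 1 / t) + exp (- s) * (s * s) * poly P (1 / t) = flatexp ([:0, 0, 1:] * (P - pderiv P)) t"
    unfolding flatexp_def st using 1 by (simp add: algebra_simps)
   with DERIV_mult[OF p e] show ?thesis by (simp only:)
  qed
  note d = this
  have "\<forall>\<^sub>F s in nhds t. s > 0" using eventually_nhds_in_open[of "{0<..}" t] 1 by auto
  then have ev: "\<forall>\<^sub>F s in nhds t. poly P (1 / s) * exp (- 1 / s) = flatexp P s"
   by eventually_elim (simp add: flatexp_def)
  from iffD1[OF DERIV_cong_ev[OF refl ev refl] d] show ?thesis .
 next
  case 2
  have "\<forall>\<^sub>F s in nhds t. s < 0" using eventually_nhds_in_open[of "{..<0}" t] 2 by auto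
  then have ev: "\<forall>\<^sub>F s in nhds t. 0 = flatexp P s" by eventually_elim (simp add: flatexp_def)
  have d: "((%s. 0) has_real_derivative flatexp ([:0, 0, 1:] * (P - pderiv P)) t) (at t)"
   using 2 by (simp add: flatexp_def)
  from iffD1[OF DERIV_cong_ev[OF refl ev refl] d] show ?thesis .
 next
  case 3
  have "((%h. flatexp P h / h) \<longlongrightarrow> 0) (at_right 0)"
  proof (rule Lim_transform_eventually)
   show "((%h. inverse h ^ 1 * poly P (inverse h) * exp (- inverse h)) \<longlongrightarrow> 0) (at_right 0)"
    by (rule filterlim_compose[OF poly_exp_tendsto_0 filterlim_inverse_at_top_right])
   show "\<forall>\<^sub>F h in at_right 0. inverse h ^ 1 * poly P (inverse h) * exp (- inverse h) = flatexp P h / h"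
    unfolding eventually_at_right_field by (intro exI[of _ 1]) (auto simp: flatexp_def field_simps)
  qed
  moreover have "((%h. flatexp P h / h) \<longlongrightarrow> 0) (at_left 0)"
   by (rule Lim_transform_eventually[of "%_. 0"])
    (auto simp: eventually_at_left_field flatexp_def intro!: exI[of _ "-1"])
  ultimately have "((%h. flatexp P h / h) \<longlongrightarrow> 0) (at 0)" by (simp add: filterlim_split_at)
  then show ?thesis using 3 by (simp add: has_field_derivative_iff flatexp_def)
 qed
qed

definition e0 :: "real => real" where "e0 = flatexp 1"

lemma e0_simps: "e0 t > 0 \<longleftrightarrow> t > 0" "e0 t \<ge> 0" "e0 t = 0 \<longleftrightarrow> t \<le> 0"
 by (auto simp: e0_def flatexp_def)

lemma smooth_e0: "opn n V ==> smooth_on n V h ==> smooth_on n V (%x. e0 (h x))"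
 unfolding e0_def by (rule smooth_family[of flatexp, OF flatexp_deriv])

definition step :: "real => real" where "step t = e0 t / (e0 t + e0 (1 - t))"

lemma step_simps: "t \<le> 0 ==> step t = 0" "t \<ge> 1 ==> step t = 1"
 using e0_simps[of t] e0_simps[of "1 - t"] by (auto simp: step_def)

lemma smooth_step:
 assumes "opn n V" "smooth_on n V h" shows "smooth_on n V (%x. step (h x))"
proof -
 have "e0 (h x) + e0 (1 - h x) \<noteq> 0" for x
  using e0_simps[of "h x"] e0_simps[of "1 - h x"] by (cases "h x > 0") linarith+
 moreover have "smooth_on n V (%x. e0 (1 - h x))"
  by (rule smooth_e0[OF assms(1) smooth_diff[OF assms(1) smooth_const[OF assms(1)] assms(2)]])
 ultimately show ?thesis
  unfolding step_def using smooth_e0[OF assms] assms(1) by (intro smooth_divide smooth_add)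
qed

text \<open>Used with integer shifts: the functions \<open>tent (s - real m)\<close> are locally
  finite, and for each \<open>s \<ge> 0\<close> at least one of them is positive.\<close>

definition tent :: "real => real" where "tent t = e0 (1 - t) * e0 (1 + t)"

lemma tent_simps: "tent t \<ge> 0" "tent t > 0 \<longleftrightarrow> \<bar>t\<bar> < 1" "\<bar>t\<bar> \<ge> 1 ==> tent t = 0"
proof -
 show "tent t \<ge> 0" by (simp add: tent_def e0_simps)
 show "\<bar>t\<bar> \<ge> 1 ==> tent t = 0" by (auto simp: tent_def e0_simps)
 then show "tent t > 0 \<longleftrightarrow> \<bar>t\<bar> < 1"
  using e0_simps(1)[of "1 - t"] e0_simps(1)[of "1 + t"] by (cases "\<bar>t\<bar> < 1") (auto simp: tent_def)
qed

lemma smooth_tent: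
 assumes "opn n V" "smooth_on n V h" shows "smooth_on n V (%x. tent (h x))"
 unfolding tent_def using smooth_e0[OF assms(1) smooth_diff[OF assms(1) smooth_const[OF assms(1)] assms(2)], of 1]
  smooth_e0[OF assms(1) smooth_add[OF assms(1) smooth_const[OF assms(1)] assms(2)], of 1]
 by (rule smooth_mult[OF assms(1)])

definition sqn :: "nat => (nat => real) => real" where "sqn n x = (\<Sum>i<n. (x i)\<^sup>2)"

lemma smooth_sqn: "opn n V ==> smooth_on n V (sqn m)"
 unfolding sqn_def by (intro smooth_sum smooth_power smooth_coord)

lemma sqn_coord: "i < n ==> (x i)\<^sup>2 \<le> sqn n x"
 unfolding sqn_def by (rule member_le_sum) auto

lemma sqn_nonneg: "sqn n x \<ge> 0" by (simp add: sqn_def sum_nonneg)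

text \<open>The squared distance keeps the function smooth. It is 1 up to distance \<open>e\<close>
  and 0 from distance \<open>sqrt 2 * e\<close> on, hence also when one coordinate is off by
  \<open>2 * e\<close>.\<close>

definition bump :: "nat => (nat => real) => real => (nat => real) => real" where
 "bump n p e x = step (2 - sqn n (%i. x i - p i) / e\<^sup>2)"

lemma smooth_bump: "opn m V ==> smooth_on m V (bump n p e)"
proof -
 assume V: "opn m V"
 have "smooth_on m V (%x. 2 - sqn n (%i. x i - p i) * (1 / e\<^sup>2))"
  unfolding sqn_def by (intro smooth_diff smooth_const smooth_mult smooth_sum smooth_power smooth_coord V)
 then show ?thesis using smooth_step[OF V] by (simp add: bump_def[abs_def])
qed

lemma bump_eq_1: "e > 0 ==> sqn n (%i. x i - p i) \<le> e\<^sup>2 ==> bump n p e x = 1"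
 unfolding bump_def by (rule step_simps(2)) (simp add: field_simps)

lemma bump_eq_0: "e > 0 ==> i < n ==> \<bar>x i - p i\<bar> \<ge> 2 * e ==> bump n p e x = 0"
proof -
 assume a: "e > 0" "i < n" "\<bar>x i - p i\<bar> \<ge> 2 * e"
 then have "(2 * e)\<^sup>2 \<le> (x i - p i)\<^sup>2" using power_mono[of "2 * e" "\<bar>x i - p i\<bar>" 2] by simp
 also have "\<dots> \<le> sqn n (%i. x i - p i)" using sqn_coord[OF a(2), of "%i. x i - p i"] by simp
 finally have "4 * e\<^sup>2 \<le> sqn n (%i. x i - p i)" by (simp add: power_mult_distrib)
 then have "2 * e\<^sup>2 \<le> sqn n (%i. x i - p i)" using zero_le_power2[of e] by linarith
 moreover have "e\<^sup>2 > 0" using a(1) by simp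
 ultimately show ?thesis unfolding bump_def by (intro step_simps(1)) (simp add: field_simps)
qed

lemma opn_sqn_less: "opn n {x\<in>Rn n. sqn n (%i. x i - p i) < r}"
proof -
 have "open {x. sqn n (%i. x i - p i) < r}"
  unfolding sqn_def by (intro open_Collect_less continuous_on_sum continuous_on_power continuous_on_diff continuous_on_const continuous_on_coord)
 then show ?thesis using opn_open by blast
qed

section \<open>Hadamard's lemma\<close>

lemma joint_continuous:
 assumes "continuous_on (Rn (Suc m)) K"
 shows "continuous_on (Rn m \<times> S) (%(x, t). K (x(m := t)))"
proof -
 have "continuous_on (Rn m \<times> S) (%z. ((fst z)(m := snd z)) i)" for i
 proof (cases "i = m")
  case False
  have "continuous_on (Rn m \<times> S) (\<lambda>z::(nat => real) \<times> real. fst z i)"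
   by (rule continuous_on_compose2[OF continuous_on_coord[of UNIV] continuous_on_fst[OF continuous_on_id]]) simp
  then show ?thesis using False by simp
 qed (simp add: continuous_on_snd continuous_on_id)
 then have "continuous_on (Rn m \<times> S) (%z. (fst z)(m := snd z))"
  by (rule continuous_on_coordinatewise_then_product)
 then have "continuous_on (Rn m \<times> S) (%z. K ((fst z)(m := snd z)))"
  by (rule continuous_on_compose2[OF assms]) (auto simp: in_Rn)
 then show ?thesis by (simp add: case_prod_beta')
qed

lemma Rn_Suc_upd: "x \<in> Rn m ==> x(m := u) \<in> Rn (Suc m)"
 by (auto simp: in_Rn)

text \<open>Differentiation under the integral sign produces an integral of the same kind, so these
  integrals form a class stable under derivatives. The integration variable is the coordinate at
  index \<open>m\<close>.\<close>

lemma smooth_integral: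
 assumes "Sm (Suc m) K"
 shows "Sm m (%x. integral {0..1} (%u. K (x(m := u))))"
proof (rule smooth_on_coinductI[OF opn_Rn, of "%f. \<exists>K. Sm (Suc m) K \<and> f = (%x. integral {0..1} (%u. K (x(m := u))))"])
 show "\<exists>K'. Sm (Suc m) K' \<and> (%x. integral {0..1} (%u. K (x(m := u)))) = (%x. integral {0..1} (%u. K' (x(m := u))))"
  using assms by (intro exI[of _ K]) simp
next
 fix f assume "\<exists>K. Sm (Suc m) K \<and> f = (%x. integral {0..1} (%u. K (x(m := u))))"
 then obtain K where K: "Sm (Suc m) K" and f: "f = (%x. integral {0..1} (%u. K (x(m := u))))" by blast
 have "continuous_on (Rn m) f"
  unfolding f using integral_continuous_on_param[of "Rn m" 0 1 "%x u. K (x(m := u))"]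
   joint_continuous[OF smooth_onD(1)[OF K opn_Rn], of "{0..1}"] by simp
 moreover have "((%t. f (x(i := t))) has_real_derivative integral {0..1} (%u. pd i K (x(m := u)))) (at (x i))"
  if i: "i < m" and x: "x \<in> Rn m" for i x
 proof -
  have xu: "(x(i := s))(m := u) \<in> Rn (Suc m)" for s u using x i by (intro Rn_Suc_upd upd_in_Rn)
  have jc: "continuous_on (UNIV \<times> {0..1}) (%(s, u). G ((x(i := s))(m := u)))"
   if G: "Sm (Suc m) G" for G
  proof -
   have "continuous_on (UNIV \<times> {0..1}) (%z. (x(i := fst z)) j)" for j
    by (cases "j = i") (simp_all add: continuous_on_fst continuous_on_id)
   then have "continuous_on (UNIV \<times> {0..1}) (%z. x(i := fst z))"
    by (rule continuous_on_coordinatewise_then_product)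
   then have "continuous_on (UNIV \<times> {0..1::real}) (%z. (x(i := fst z), snd z))"
    by (intro continuous_on_Pair continuous_on_snd continuous_on_id)
   from continuous_on_compose2[OF joint_continuous[OF smooth_onD(1)[OF G opn_Rn], of UNIV] this]
   show ?thesis using x i by (simp add: case_prod_beta' image_subset_iff)
  qed
  have "((%s. integral (cbox 0 1) (%u. K ((x(i := s))(m := u)))) has_field_derivative
    integral (cbox 0 1) (%u. pd i K ((x(i := x i))(m := u)))) (at (x i) within UNIV)"
  proof (rule leibniz_rule_field_derivative[where fx = "%s u. pd i K ((x(i := s))(m := u))"])
   show "((%s. K ((x(i := s))(m := u))) has_real_derivative pd i K ((x(i := s))(m := u))) (at s)" for s u
   proof -
    have "((%t. K (((x(i := s))(m := u))(i := t))) has_real_derivative pd i K ((x(i := s))(m := u))) (at (((x(i := s))(m := u)) i))"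
     using i by (intro smooth_onD(2)[OF K opn_Rn _ xu]) simp
    moreover have "((x(i := s))(m := u))(i := t) = (x(i := t))(m := u)" "((x(i := s))(m := u)) i = s" for t
     using i by auto
    ultimately show ?thesis by (simp del: fun_upd_apply)
   qed
   show "(%u. K ((x(i := s))(m := u))) integrable_on cbox 0 1" for s
   proof (rule integrable_continuous)
    show "continuous_on (cbox 0 1) (%u. K ((x(i := s))(m := u)))"
     using continuous_on_compose2[OF jc[OF K], of "{0..1}" "%u. (s, u)"]
     by (simp add: continuous_on_Pair continuous_on_const continuous_on_id image_subset_iff del: fun_upd_apply)
   qed
   show "continuous_on (UNIV \<times> cbox 0 1) (%(s, u). pd i K ((x(i := s))(m := u)))"
    using jc[OF smooth_onD(3)[OF K opn_Rn, of i]] i by simp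
  qed auto
  then show ?thesis unfolding f by (simp del: fun_upd_apply)
 qed
 moreover have ex: "\<exists>K'. Sm (Suc m) K' \<and>
   (%x. integral {0..1} (%u. pd i K (x(m := u)))) = (%x. integral {0..1} (%u. K' (x(m := u))))" if "i < m" for i
  using smooth_onD(3)[OF K opn_Rn, of i] that by (intro exI[of _ "pd i K"] conjI refl) simp
 ultimately show "continuous_on (Rn m) f \<and> (\<exists>D. \<forall>i<m. (\<forall>x\<in>Rn m. ((%t. f (x(i := t))) has_real_derivative D i x) (at (x i))) \<and>
   ((\<exists>K. Sm (Suc m) K \<and> D i = (%x. integral {0..1} (%u. K (x(m := u))))) \<or> Sm m (D i)))"
  by (intro conjI exI[of _ "%i x. integral {0..1} (%u. pd i K (x(m := u)))"] allI impI ballI disjI1 ex)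
qed

text \<open>A form of composition for maps that are not written as a \<open>tuple\<close>, such as
  updates of a point.\<close>

lemma smooth_reindex:
 assumes "Sm m G" "opn n V" "\<And>k. k < m ==> smooth_on n V (h k)"
  "\<And>x. x \<in> V ==> c x \<in> Rn m" "\<And>x k. x \<in> V ==> k < m ==> c x k = h k x"
 shows "smooth_on n V (%x. G (c x))"
proof (rule smooth_on_cong[OF assms(2) smooth_comp[OF assms(2) opn_Rn assms(1,3)]])
 fix x assume x: "x \<in> V"
 have "tuple m (%k. h k x) = c x"
  using assms(4,5)[OF x] by (auto simp: tuple_def in_Rn fun_eq_iff)
 then show "G (tuple m (%k. h k x)) = G (c x)" by simp
qed simp_all

text \<open>\<open>H\<close> is the mean of the derivative in direction \<open>l\<close> over the
  segment from \<open>x l\<close> to \<open>s\<close>. The end point \<open>s\<close> is an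
  additional coordinate at index \<open>m\<close>, which makes the quotient smooth jointly in
  \<open>x\<close> and \<open>s\<close>.\<close>

lemma hadamard:
 assumes l: "l < m" and G: "Sm m G"
 obtains H where "Sm (Suc m) H"
  "\<And>x s. x \<in> Rn m ==> G (x(l := s)) - G x = (s - x l) * H (x(m := s))"
  "\<And>x. x \<in> Rn m ==> H (x(m := x l)) = pd l G x"
proof -
 \<comment> \<open>Index \<open>m\<close> holds the end point of the segment and index
   \<open>Suc m\<close> the integration variable.\<close>
 define K where "K w = pd l G ((tuple m w)(l := w l + w (Suc m) * (w m - w l)))" for w
 have K: "smooth_on (Suc (Suc m)) (Rn (Suc (Suc m))) K"
  unfolding K_def
 proof (rule smooth_reindex[OF smooth_onD(3)[OF G opn_Rn l] opn_Rn, of _ "%k w. if k = l then w l + w (Suc m) * (w m - w l) else w k"])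
  show "smooth_on (Suc (Suc m)) (Rn (Suc (Suc m))) (%w. if k = l then w l + w (Suc m) * (w m - w l) else w k)" for k
   by (cases "k = l") (simp_all add: smooth_add smooth_mult smooth_diff smooth_coord)
 qed (use l in auto)
 define H where "H z = integral {0..1} (%u. K (z(Suc m := u)))" for z
 have H: "Sm (Suc m) H"
  unfolding H_def by (rule smooth_integral[OF K])
 have Hx: "H (x(m := s)) = integral {0..1} (%u. pd l G (x(l := x l + u * (s - x l))))" if x: "x \<in> Rn m" for x s
 proof -
  have "tuple m ((x(m := s))(Suc m := u)) = x" for u using x by (auto simp: tuple_def in_Rn fun_eq_iff)
  then have "K ((x(m := s))(Suc m := u)) = pd l G (x(l := x l + u * (s - x l)))" for u
   using l by (simp add: K_def)
  then show ?thesis unfolding H_def by simp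
 qed
 have "G (x(l := s)) - G x = (s - x l) * H (x(m := s))" if x: "x \<in> Rn m" for x s
 proof -
  have "((%u. pd l G (x(l := x l + u * (s - x l))) * (s - x l)) has_integral
    G (x(l := x l + 1 * (s - x l))) - G (x(l := x l + 0 * (s - x l)))) {0..1}"
  proof (rule fundamental_theorem_of_calculus)
   fix u :: real
   have "((%t. G (x(l := t))) has_real_derivative pd l G (x(l := x l + u * (s - x l)))) (at (x l + u * (s - x l)))"
    using smooth_onD(2)[OF G opn_Rn l upd_in_Rn[OF x l, of "x l + u * (s - x l)"]]
    unfolding fun_upd_upd fun_upd_same .
   then have "((%u. G (x(l := x l + u * (s - x l)))) has_real_derivative pd l G (x(l := x l + u * (s - x l))) * (s - x l)) (at u)"
    by (rule DERIV_chain2[where g = "%u. x l + u * (s - x l)"]) (auto intro!: derivative_eq_intros)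
   then show "((%u. G (x(l := x l + u * (s - x l)))) has_vector_derivative pd l G (x(l := x l + u * (s - x l))) * (s - x l)) (at u within {0..1})"
    by (simp add: has_real_derivative_iff_has_vector_derivative has_vector_derivative_at_within)
  qed simp
  from integral_unique[OF this] show ?thesis by (simp add: Hx[OF x] mult.commute)
 qed
 moreover have "H (x(m := x l)) = pd l G x" if "x \<in> Rn m" for x using Hx[OF that, of "x l"] by simp
 ultimately show thesis using that[OF H] by blast
qed

text \<open>One application of \<open>hadamard\<close> for each edge of the staircase from
  \<open>p\<close> to \<open>x\<close>.\<close>

lemma hadamard_point:
 assumes G: "Sm n G" and p: "p \<in> Rn n"
 obtains g where "\<And>k. k < n ==> Sm n (g k)"
  "\<And>x. x \<in> Rn n ==> G x = G p + (\<Sum>k<n. (x k - p k) * g k x)" "\<And>k. k < n ==> g k p = pd k G p"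
proof -
 have "\<exists>H. Sm (Suc n) H \<and>
  (\<forall>x\<in>Rn n. \<forall>s. G (x(k := s)) - G x = (s - x k) * H (x(n := s))) \<and>
  (\<forall>x\<in>Rn n. H (x(n := x k)) = pd k G x)" if "k < n" for k
  by (rule hadamard[OF that G]) blast
 then obtain H where H: "\<And>k. k < n ==> Sm (Suc n) (H k)"
  "\<And>k x s. k < n ==> x \<in> Rn n ==> G (x(k := s)) - G x = (s - x k) * H k (x(n := s))"
  "\<And>k x. k < n ==> x \<in> Rn n ==> H k (x(n := x k)) = pd k G x"
  by metis
 define g where "g k x = H k ((mix p x k)(n := x k))" for k x
 have mR: "mix p x k \<in> Rn n" if "x \<in> Rn n" for x k using p that by (auto simp: mix_def in_Rn)
 have "Sm n (g k)" if k: "k < n" for k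
  unfolding g_def
 proof (rule smooth_reindex[OF H(1)[OF k] opn_Rn, of _ "%i x. if i = n then x k else if i < k then x i else p i"])
  show "Sm n (%x. if i = n then x k else if i < k then x i else p i)" for i
   by (cases "i = n"; cases "i < k") (simp_all add: smooth_coord smooth_const)
 qed (use k mR in \<open>auto simp: mix_def intro: Rn_Suc_upd\<close>)
 moreover have "G x = G p + (\<Sum>k<n. (x k - p k) * g k x)" if x: "x \<in> Rn n" for x
 proof -
  have "G ((mix p x k)(k := x k)) - G ((mix p x k)(k := p k)) = (x k - p k) * g k x" if "k < n" for k
   using H(2)[OF that mR[OF x], of k "x k"] unfolding mix_simps(4) by (simp add: g_def mix_def)
  then show ?thesis using telescope[OF p x, of G] by simp
 qed
 moreover have "g k p = pd k G p" if "k < n" for k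
  using H(3)[OF that p] by (simp add: g_def mix_def cong: if_cong)
 ultimately show thesis using that by blast
qed

text \<open>The function \<open>z N * A (tuple N z) - 1\<close> generates the ideal of the graph of
  \<open>1 / A\<close>. Near the graph \<open>A\<close> does not vanish and Hadamard's lemma in
  coordinate \<open>N\<close> divides by it; away from the graph it is invertible.\<close>

lemma factor_inverse:
 assumes A: "Sm N A" and P: "Sm (Suc N) P"
  and z: "\<And>x. x \<in> Rn N ==> A x \<noteq> 0 ==> P (x(N := 1 / A x)) = 0"
 obtains Q where "Sm (Suc N) Q"
  "\<And>z. z \<in> Rn (Suc N) ==> P z = (z N * A (tuple N z) - 1) * Q z"
proof -
 obtain H where H: "smooth_on (Suc (Suc N)) (Rn (Suc (Suc N))) H"
  "\<And>x s. x \<in> Rn (Suc N) ==> P (x(N := s)) - P x = (s - x N) * H (x(Suc N := s))"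
  using hadamard[OF _ P, of N] by (metis lessI)
 define B where "B z = A (tuple N z)" for z
 have B: "Sm (Suc N) B"
  unfolding B_def by (rule smooth_reindex[OF A opn_Rn, of _ "%k z. z k"]) (auto intro: smooth_coord)
 define E where "E z = z N * B z - 1" for z
 have E: "Sm (Suc N) E"
  unfolding E_def by (intro smooth_diff smooth_mult smooth_coord smooth_const B opn_Rn)
 \<comment> \<open>Two formulas for the same quotient. The first is smooth wherever \<open>B\<close>
   is nonzero, which includes a neighbourhood of the graph, and agrees there with the second off the
   graph.\<close>
 define Q where "Q z = (if E z = 0 then H (z(Suc N := 1 / B z)) / B z else P z / E z)" for z
 have PH: "P z = E z * (H (z(Suc N := 1 / B z)) / B z)" if "z \<in> Rn (Suc N)" "B z \<noteq> 0" for z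
 proof -
  have "(tuple N z)(N := 1 / A (tuple N z)) = z(N := 1 / B z)" using that(1) by (auto simp: B_def tuple_def in_Rn fun_eq_iff)
  then have "P (z(N := 1 / B z)) = 0" using z[of "tuple N z"] that(2) by (simp add: B_def)
  then show ?thesis using H(2)[OF that(1), of "1 / B z"] that(2) by (simp add: E_def field_simps)
 qed
 have open1: "opn (Suc N) {z\<in>Rn (Suc N). f z \<noteq> 0}" if f: "Sm (Suc N) f" for f
 proof -
  have "openin (top_of_set (Rn (Suc N))) (Rn (Suc N) \<inter> f -` (- {0}))"
   by (rule continuous_openin_preimage_gen[OF smooth_onD(1)[OF f opn_Rn]]) auto
  then have "\<exists>T. open T \<and> Rn (Suc N) \<inter> f -` (- {0}) = Rn (Suc N) \<inter> T" by (simp only: openin_open)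
  moreover have "Rn (Suc N) \<inter> f -` (- {0}) = {z\<in>Rn (Suc N). f z \<noteq> 0}" by auto
  ultimately show ?thesis unfolding opn_open by metis
 qed
 have "Sm (Suc N) Q"
 proof (rule smooth_on_local[OF opn_Rn])
  fix z assume zR: "z \<in> Rn (Suc N)"
  show "\<exists>W. opn (Suc N) W \<and> z \<in> W \<and> smooth_on (Suc N) W Q"
  proof (cases "E z = 0")
   case True
   then have Bz: "B z \<noteq> 0" by (auto simp: E_def)
   let ?W = "{z\<in>Rn (Suc N). B z \<noteq> 0}"
   have W: "opn (Suc N) ?W" by (rule open1[OF B])
   have BW: "smooth_on (Suc N) ?W B" by (rule smooth_on_subset[OF B opn_Rn W]) auto
   have "smooth_on (Suc N) ?W (%z. H (z(Suc N := 1 / B z)))"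
   proof (rule smooth_reindex[OF H(1) W, of "%k z. if k = Suc N then 1 / B z else z k"])
    show "smooth_on (Suc N) ?W (%z. if k = Suc N then 1 / B z else z k)" for k
     using smooth_divide[OF W smooth_const[OF W] BW] smooth_coord[OF W] by (cases "k = Suc N") auto
   qed (auto intro: Rn_Suc_upd)
   then have "smooth_on (Suc N) ?W (%z. H (z(Suc N := 1 / B z)) / B z)"
    using smooth_divide[OF W _ BW] by blast
   then have "smooth_on (Suc N) ?W Q"
    by (rule smooth_on_cong[OF W]) (use PH in \<open>auto simp: Q_def\<close>)
   then show ?thesis using W zR Bz by blast
  next
   case False
   let ?W = "{z\<in>Rn (Suc N). E z \<noteq> 0}"
   have W: "opn (Suc N) ?W" by (rule open1[OF E])
   have "smooth_on (Suc N) ?W (%z. P z / E z)"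
    by (intro smooth_divide[OF W] smooth_on_subset[OF P opn_Rn W] smooth_on_subset[OF E opn_Rn W]) auto
   then have "smooth_on (Suc N) ?W Q"
    by (rule smooth_on_cong[OF W]) (auto simp: Q_def)
   then show ?thesis using W zR False by blast
  qed
 qed
 moreover have "P z = (z N * A (tuple N z) - 1) * Q z" if "z \<in> Rn (Suc N)" for z
  using PH[OF that] by (cases "A (tuple N z) = 0") (auto simp: Q_def E_def B_def)
 ultimately show thesis using that by blast
qed

section \<open>Rapidly decaying multiples\<close>

lemma smooth_suminf:
 assumes V: "opn n V" and g: "\<And>m::nat. smooth_on n V (g m)"
  and loc: "\<And>x. x \<in> V ==> \<exists>U M. opn n U \<and> x \<in> U \<and> (\<forall>z\<in>U. \<forall>m\<ge>M. g m z = 0)"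
 shows "smooth_on n V (%x. \<Sum>m. g m x)"
proof (rule smooth_on_local[OF V])
 fix x assume x: "x \<in> V"
 obtain U M where U: "opn n U" "x \<in> U" "\<And>z m. z \<in> U ==> m \<ge> M ==> g m z = 0" using loc[OF x] by blast
 have W: "opn n (U \<inter> V)" using U(1) V by blast
 have "smooth_on n (U \<inter> V) (%x. \<Sum>m<M. g m x)"
  by (intro smooth_sum[OF W] smooth_on_subset[OF g V W]) blast
 moreover have "(\<Sum>m<M. g m z) = (\<Sum>m. g m z)" if "z \<in> U \<inter> V" for z
  by (rule suminf_finite[symmetric]) (use U(3) that in \<open>auto simp: not_less\<close>)
 ultimately have "smooth_on n (U \<inter> V) (%x. \<Sum>m. g m x)" by (rule smooth_on_cong[OF W])
 then show "\<exists>W. opn n W \<and> x \<in> W \<and> smooth_on n W (%x. \<Sum>m. g m x)" using W U(2) x by blast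
qed

lemma itpd_snoc: "itpd (is @ [i]) F = pd i (itpd is F)"
 by (induction "is" arbitrary: F) auto

lemma itpd_cong:
 assumes "opn n V" "set is \<subseteq> {..<n}" "smooth_on n V F" "\<And>y. y \<in> V ==> F y = G y" "x \<in> V"
 shows "itpd is F x = itpd is G x"
 using assms(2-5)
proof (induction "is" arbitrary: F G)
 case (Cons i "is")
 have "i < n" using Cons.prems(1) by simp
 then have "pd i F y = pd i G y" if "y \<in> V" for y
  using pd_cong[OF assms(1) that _ Cons.prems(3) Cons.prems(2)] by blast
 then show ?case
  using Cons.IH[of "pd i F" "pd i G"] Cons.prems smooth_onD(3)[OF Cons.prems(2) assms(1) \<open>i < n\<close>] by simp
qed simp

lemma itpd_lincomb:
 assumes V: "opn n V" "finite K" and f: "set is \<subseteq> {..<n}" "\<And>k. k \<in> K ==> smooth_on n V (f k)" "x \<in> V"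
 shows "itpd is (%x. \<Sum>k\<in>K. c k * f k x) x = (\<Sum>k\<in>K. c k * itpd is (f k) x)"
 using f
proof (induction "is" arbitrary: f)
 case (Cons i "is")
 have i: "i < n" using Cons.prems(1) by simp
 have s: "smooth_on n V (%x. \<Sum>k\<in>K. c k * f k x)"
  using Cons.prems(2) by (intro smooth_sum smooth_mult smooth_const V)
 have "pd i (%x. \<Sum>k\<in>K. c k * f k x) y = (\<Sum>k\<in>K. c k * pd i (f k) y)" if "y \<in> V" for y
  by (rule pd_eqI, rule DERIV_sum, rule DERIV_cmult, rule smooth_onD(2)[OF _ V(1) i that]) (rule Cons.prems(2))
 then have "itpd is (pd i (%x. \<Sum>k\<in>K. c k * f k x)) x = itpd is (%x. \<Sum>k\<in>K. c k * pd i (f k) x) x"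
  using Cons.prems(1,3) by (intro itpd_cong[OF V(1) _ smooth_onD(3)[OF s V(1) i]]) auto
 also have "\<dots> = (\<Sum>k\<in>K. c k * itpd is (pd i (f k)) x)"
  using Cons.prems smooth_onD(3)[OF _ V(1) i] by (intro Cons.IH) auto
 finally show ?case by simp
qed simp

lemma opn_sqn_between: "opn n {z\<in>Rn n. a < sqn n z \<and> sqn n z < b}"
proof -
 have "open {z. a < sqn n z \<and> sqn n z < b}"
  unfolding sqn_def
  by (intro open_Collect_conj open_Collect_less continuous_on_sum continuous_on_power continuous_on_const continuous_on_coord)
 then show ?thesis using opn_open by blast
qed

lemma tent_sqn_shell:
 assumes "z \<in> Rn n"
 shows "(\<Sum>m. c m * tent (sqn n z - real m)) = (\<Sum>m | \<bar>sqn n z - real m\<bar> < 1. c m * tent (sqn n z - real m))"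
  "finite {m. \<bar>sqn n z - real m\<bar> < 1}"
proof -
 have "{m. \<bar>sqn n z - real m\<bar> < 1} \<subseteq> {..nat \<lceil>sqn n z + 1\<rceil>}" by auto linarith
 then show fin: "finite {m. \<bar>sqn n z - real m\<bar> < 1}" using finite_subset by blast
 show "(\<Sum>m. c m * tent (sqn n z - real m)) = (\<Sum>m | \<bar>sqn n z - real m\<bar> < 1. c m * tent (sqn n z - real m))"
  by (rule suminf_finite[OF fin]) (auto simp: tent_simps(3))
qed

lemma smooth_shells: "Sm n (%z. \<Sum>m. c m * tent (sqn n z - real m))"
proof (rule smooth_suminf[OF opn_Rn])
 show "Sm n (%z. c m * tent (sqn n z - real m))" for m
  by (intro smooth_mult smooth_const smooth_tent smooth_diff smooth_sqn opn_Rn)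
 fix x assume x: "x \<in> Rn n"
 let ?U = "{z\<in>Rn n. -1 < sqn n z \<and> sqn n z < sqn n x + 1}"
 have "x \<in> ?U" using x sqn_nonneg[of n x] by auto
 moreover have "c m * tent (sqn n z - real m) = 0" if "z \<in> ?U" "m \<ge> nat \<lceil>sqn n x + 2\<rceil>" for z m
 proof -
  have "real m \<ge> sqn n x + 2" using that(2) by linarith
  then have "\<bar>sqn n z - real m\<bar> \<ge> 1" using that(1) by auto
  then show ?thesis by (simp add: tent_simps(3))
 qed
 ultimately show "\<exists>U M. opn n U \<and> x \<in> U \<and> (\<forall>z\<in>U. \<forall>m\<ge>M. c m * tent (sqn n z - real m) = 0)"
  by (intro exI[of _ ?U] exI[of _ "nat \<lceil>sqn n x + 2\<rceil>"] conjI opn_sqn_between) blast+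
qed

text \<open>On the shell where \<open>sqn n z\<close> is close to \<open>m\<close>, compactness
  bounds all derivatives of order at most \<open>m\<close> of the cut-off \<open>G\<close> by one
  constant \<open>B m\<close>. The weight of the shell makes its contribution tiny. A fixed
  derivative and a fixed power are out of control for finitely many shells only, hence the threshold
  \<open>R\<close>.\<close>

lemma rapid_weight:
 assumes G: "Sm n G"
 obtains W where "Sm n W" "\<And>z. z \<in> Rn n ==> W z > 0"
  "\<And>is p. set is \<subseteq> {..<n} ==> \<exists>R. \<forall>z\<in>Rn n. sqn n z \<ge> R --> \<bar>itpd is (%z. W z * G z) z\<bar> * sqn n z ^ p \<le> 5"
proof -
 define Hm where "Hm m z = tent (sqn n z - real m) * G z" for m z
 have Hm: "Sm n (Hm m)" for m
  unfolding Hm_def by (intro smooth_mult smooth_tent smooth_diff smooth_const smooth_sqn G opn_Rn)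
 have Hm0: "itpd is (Hm m) z = 0" if "set is \<subseteq> {..<n}" "z \<in> Rn n" "sqn n z > real m + 1" for "is" m z
 proof -
  let ?U = "{y\<in>Rn n. real m + 1 < sqn n y \<and> sqn n y < sqn n z + 1}"
  have U: "opn n ?U" "z \<in> ?U" using opn_sqn_between that by auto
  have "Hm m y = 0" if "y \<in> ?U" for y using that by (simp add: Hm_def tent_simps(3))
  then have "itpd is (Hm m) z = itpd is (%_. 0) z"
   by (intro itpd_cong[OF U(1) that(1) smooth_on_subset[OF Hm opn_Rn U(1)] _ U(2)]) auto
  also have "\<dots> = 0" using itpd_lincomb[OF opn_Rn finite.emptyI that(1), of "%_. undefined" z "%_. 0"] that(2) by simp
  finally show ?thesis .
 qed
 have "\<exists>B>0. \<forall>is. set is \<subseteq> {..<n} \<and> length is \<le> m --> (\<forall>z\<in>Rn n. \<bar>itpd is (Hm m) z\<bar> \<le> B)" for m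
 proof -
  let ?L = "{is. set is \<subseteq> {..<n} \<and> length is \<le> m}"
  have "\<exists>C\<ge>0. \<forall>z\<in>Rn n. \<bar>itpd is (Hm m) z\<bar> \<le> C" if L: "is \<in> ?L" for "is"
  proof -
   have "cub n (%_. 0) (real m + 3) \<subseteq> Rn n" by (auto simp: cub_def)
   then obtain C where C: "C \<ge> 0" "\<And>y. y \<in> cub n (%_. 0) (real m + 2) ==> \<bar>itpd is (Hm m) y\<bar> \<le> C"
    using bounded_on_cube[OF opn_Rn smooth_onD(1)[OF smooth_itpd[OF opn_Rn Hm] opn_Rn], of "is" "%_. 0" "real m + 3" "real m + 2" m] L by auto
   have "\<bar>itpd is (Hm m) z\<bar> \<le> C" if z: "z \<in> Rn n" for z
   proof (cases "z \<in> cub n (%_. 0) (real m + 2)")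
    case False
    then obtain i where i: "i < n" "\<bar>z i\<bar> \<ge> real m + 2" using z by (auto simp: cub_def not_less)
    have "real m + 1 < (real m + 2)\<^sup>2" by (simp add: power2_eq_square algebra_simps) (smt (verit) mult_nonneg_nonneg of_nat_0_le_iff)
    also have "\<dots> \<le> (z i)\<^sup>2" using i(2) by (simp add: abs_le_square_iff[symmetric])
    also have "\<dots> \<le> sqn n z" by (rule sqn_coord[OF i(1)])
    finally show ?thesis using Hm0[OF _ z, of "is" m] L C(1) by simp
   qed (rule C(2))
   then show ?thesis using C(1) by blast
  qed
  then have "\<forall>is\<in>?L. \<exists>C. C \<ge> 0 \<and> (\<forall>z\<in>Rn n. \<bar>itpd is (Hm m) z\<bar> \<le> C)" by blast
  from bchoice[OF this] obtain C where "\<forall>is\<in>?L. C is \<ge> 0 \<and> (\<forall>z\<in>Rn n. \<bar>itpd is (Hm m) z\<bar> \<le> C is)" by (rule exE)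
  then have C: "\<And>is. is \<in> ?L ==> C is \<ge> 0" "\<And>is z. is \<in> ?L ==> z \<in> Rn n ==> \<bar>itpd is (Hm m) z\<bar> \<le> C is"
   by blast+
  have fin: "finite ?L" by (rule finite_lists_length_le) simp
  have "C is \<le> 1 + sum C ?L" if "is \<in> ?L" for "is"
   using member_le_sum[OF that _ fin, of C] C(1) by auto
  moreover have "1 + sum C ?L > 0" using sum_nonneg[of ?L C] C(1) by (smt (verit))
  moreover have "\<bar>itpd is (Hm m) z\<bar> \<le> 1 + sum C ?L" if "set is \<subseteq> {..<n} \<and> length is \<le> m" "z \<in> Rn n" for "is" z
   using C(2)[of "is" z] calculation(1)[of "is"] that by simp
  ultimately show ?thesis by (intro exI[of _ "1 + sum C ?L"]) blast
 qed
 then obtain B where B: "\<And>m. B m > 0" "\<And>m is z. set is \<subseteq> {..<n} ==> length is \<le> m ==> z \<in> Rn n ==> \<bar>itpd is (Hm m) z\<bar> \<le> B m"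
  by metis
 \<comment> \<open>Makes \<open>c m * B m\<close> equal to \<open>1 / (real m + 2) ^ m\<close>. This
   beats each fixed power, because \<open>real m + 2\<close> exceeds \<open>sqn n z\<close> on the
   shells near \<open>z\<close>.\<close>
 define c where "c m = 1 / (B m * (real m + 2) ^ m)" for m
 have c: "c m > 0" "c m * B m = 1 / (real m + 2) ^ m" for m using B(1)[of m] by (auto simp: c_def)
 define W where "W z = (\<Sum>m. c m * tent (sqn n z - real m))" for z
 have W: "Sm n W" unfolding W_def by (rule smooth_shells)
 have W1: "W z > 0" if z: "z \<in> Rn n" for z
  unfolding W_def tent_sqn_shell(1)[OF z]
 proof (rule sum_pos2[OF tent_sqn_shell(2)[OF z], of "nat \<lfloor>sqn n z\<rfloor>"])
  show m: "nat \<lfloor>sqn n z\<rfloor> \<in> {m. \<bar>sqn n z - real m\<bar> < 1}" using sqn_nonneg[of n z] by auto linarith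
  then show "0 < c (nat \<lfloor>sqn n z\<rfloor>) * tent (sqn n z - real (nat \<lfloor>sqn n z\<rfloor>))" using c(1) by (simp add: tent_simps(2))
  show "0 \<le> c m * tent (sqn n z - real m)" for m using c(1)[of m] by (simp add: tent_simps(1))
 qed
 have "\<exists>R. \<forall>z\<in>Rn n. sqn n z \<ge> R --> \<bar>itpd is (%z. W z * G z) z\<bar> * sqn n z ^ p \<le> 5" if L: "set is \<subseteq> {..<n}" for "is" p
 \<comment> \<open>The threshold ensures that every shell near \<open>z\<close> has index at least
   \<open>length is\<close>, so that \<open>B\<close> applies, and at least \<open>p\<close>, so
   that the decay suffices.\<close>
 proof (intro exI[of _ "real (length is) + real p + 3"] ballI impI)
  fix z assume z: "z \<in> Rn n" and R: "real (length is) + real p + 3 \<le> sqn n z"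
  define s where "s = sqn n z"
  have s: "s \<ge> real (length is) + real p + 3" using R by (simp add: s_def)
  \<comment> \<open>The shells that can meet the neighbourhood \<open>?U\<close> of
    \<open>z\<close>; 5 is a crude bound for their number and the constant in the claim.\<close>
  define M where "M = {m. s - 2 < real m \<and> real m < s + 2}"
  have Msub: "M \<subseteq> {nat \<lfloor>s\<rfloor> - 1..nat \<lfloor>s\<rfloor> + 2}" unfolding M_def using s by auto linarith+
  have fM: "finite M" using Msub finite_subset by blast
  have "card M \<le> card {nat \<lfloor>s\<rfloor> - 1..nat \<lfloor>s\<rfloor> + 2}" using Msub by (intro card_mono) auto
  then have cM: "card M \<le> 5" by simp
  let ?U = "{y\<in>Rn n. s - 1 < sqn n y \<and> sqn n y < s + 1}"
  have U: "opn n ?U" "z \<in> ?U" using opn_sqn_between z by (auto simp: s_def)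
  have "W y * G y = (\<Sum>m\<in>M. c m * Hm m y)" if y: "y \<in> ?U" for y
  proof -
   have "(\<Sum>m. c m * tent (sqn n y - real m)) = (\<Sum>m\<in>M. c m * tent (sqn n y - real m))"
   proof (rule suminf_finite[OF fM])
    fix m assume "m \<notin> M"
    then have "\<bar>sqn n y - real m\<bar> \<ge> 1" using y by (auto simp: M_def)
    then show "c m * tent (sqn n y - real m) = 0" by (simp add: tent_simps(3))
   qed
   then show ?thesis by (simp add: W_def Hm_def sum_distrib_right mult.assoc)
  qed
  then have "itpd is (%z. W z * G z) z = itpd is (%y. \<Sum>m\<in>M. c m * Hm m y) z"
   by (intro itpd_cong[OF U(1) L smooth_on_subset[OF smooth_mult[OF opn_Rn W G] opn_Rn U(1)] _ U(2)]) auto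
  also have "\<dots> = (\<Sum>m\<in>M. c m * itpd is (Hm m) z)"
   by (rule itpd_lincomb[OF opn_Rn fM L Hm z])
  finally have eq: "itpd is (%z. W z * G z) z = (\<Sum>m\<in>M. c m * itpd is (Hm m) z)" .
  have "\<bar>c m * itpd is (Hm m) z\<bar> \<le> 1 / s ^ p" if m: "m \<in> M" for m
  proof -
   have m1: "real m + 2 > s" "m \<ge> length is" "m \<ge> p" using m s by (auto simp: M_def)
   have "\<bar>c m * itpd is (Hm m) z\<bar> \<le> c m * B m"
    unfolding abs_mult using c(1)[of m] B(2)[OF L m1(2) z] by (intro mult_mono) auto
   also have "\<dots> = 1 / (real m + 2) ^ m" by (rule c(2))
   also have "s ^ p \<le> (real m + 2) ^ m"
   proof -
    have "s ^ p \<le> s ^ m" using m1(3) s by (intro power_increasing) auto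
    also have "\<dots> \<le> (real m + 2) ^ m" using m1(1) s by (intro power_mono) auto
    finally show ?thesis .
   qed
   then have "1 / (real m + 2) ^ m \<le> 1 / s ^ p" using s by (intro divide_left_mono mult_pos_pos zero_less_power) auto
   finally show ?thesis .
  qed
  then have "\<bar>itpd is (%z. W z * G z) z\<bar> \<le> (\<Sum>m\<in>M. 1 / s ^ p)"
   unfolding eq by (intro order_trans[OF sum_abs] sum_mono) auto
  also have "\<dots> \<le> 5 * (1 / s ^ p)" using cM s by (simp add: divide_right_mono)
  finally show "\<bar>itpd is (%z. W z * G z) z\<bar> * sqn n z ^ p \<le> 5"
   using s by (simp add: s_def[symmetric] field_simps)
 qed
 then show thesis using that[OF W W1] by blast
qed

section \<open>Functions of \<open>1 / A\<close>, extended by zero\<close>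

definition rterm :: "nat => ((nat => real) => real) => ((nat => real) => real) => nat => ((nat => real) => real) => nat list
  => (nat => real) => real" where
 "rterm N A F p D is x = (if A x = 0 then 0 else (1 / A x) ^ p * D x * itpd is F (x(N := 1 / A x)))"

text \<open>The class for coinduction: sums of terms formed from a power of \<open>1 / A\<close>, a
  smooth coefficient and an iterated derivative of \<open>F\<close> at the point with last
  coordinate \<open>1 / A x\<close>. Differentiation keeps this shape.\<close>

inductive_set rterms for N A F where
 one: "Sm N D ==> set is \<subseteq> {..<Suc N} ==> rterm N A F p D is \<in> rterms N A F"
| add: "f \<in> rterms N A F ==> g \<in> rterms N A F ==> (%x. f x + g x) \<in> rterms N A F"

text \<open>Near a zero of \<open>A\<close> the reciprocal is large, and the decay of
  \<open>F\<close> bounds the term by a multiple of the square of \<open>A\<close>; this gives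
  continuity and a vanishing derivative at the zero. Elsewhere the four summands come from the power
  of \<open>1 / A\<close>, from \<open>D\<close>, from \<open>F\<close> in direction
  \<open>i\<close>, and from \<open>F\<close> in direction \<open>N\<close> through
  \<open>1 / A\<close>.\<close>

lemma rterm_step:
 assumes A: "Sm N A" and F: "Sm (Suc N) F"
  and decay: "\<And>is p. set is \<subseteq> {..<Suc N} ==> \<exists>R. \<forall>z\<in>Rn (Suc N). sqn (Suc N) z \<ge> R --> \<bar>itpd is F z\<bar> * sqn (Suc N) z ^ p \<le> 5"
  and D: "Sm N D" and L: "set is \<subseteq> {..<Suc N}"
 shows "continuous_on (Rn N) (rterm N A F p D is)"
  "\<And>i x. i < N ==> x \<in> Rn N ==> ((%t. rterm N A F p D is (x(i := t))) has_real_derivative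
   (rterm N A F (Suc p) (%x. - real p * (pd i A x * D x)) is x + rterm N A F p (pd i D) is x) +
   (rterm N A F p D (is @ [i]) x + rterm N A F (p + 2) (%x. - (D x * pd i A x)) (is @ [N]) x)) (at (x i))"
proof -
 let ?f = "rterm N A F p D is"
 define Kf where "Kf = itpd is F"
 have Kf: "Sm (Suc N) Kf" unfolding Kf_def by (rule smooth_itpd[OF opn_Rn F L])
 define U where "U = {x\<in>Rn N. A x \<noteq> 0}"
 have U: "opn N U"
 proof -
  have "openin (top_of_set (Rn N)) (Rn N \<inter> A -` (- {0}))"
   by (rule continuous_openin_preimage_gen[OF smooth_onD(1)[OF A opn_Rn]]) auto
  then have "\<exists>T. open T \<and> Rn N \<inter> A -` (- {0}) = Rn N \<inter> T" by (simp only: openin_open)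
  moreover have "Rn N \<inter> A -` (- {0}) = U" by (auto simp: U_def)
  ultimately show ?thesis unfolding opn_open by metis
 qed
 have AU: "smooth_on N U A" by (rule smooth_on_subset[OF A opn_Rn U]) (auto simp: U_def)
 have small: "\<exists>C\<ge>0. \<exists>d>0. \<forall>x\<in>cub N x0 d. \<bar>?f x\<bar> \<le> C * (A x)\<^sup>2" if x0: "x0 \<in> Rn N" "A x0 = 0" for x0
 proof -
  obtain d1 where d1: "d1 > 0" "\<And>y. y \<in> cub N x0 d1 ==> \<bar>D y - D x0\<bar> < 1"
   using continuous_on_cubD[OF opn_Rn smooth_onD(1)[OF D opn_Rn] x0(1), of 1] by (metis zero_less_one)
  \<comment> \<open>The exponent \<open>p + 2\<close> pays for the factor
    \<open>(1 / A x) ^ p\<close> and for the two powers of \<open>A x\<close> in the bound.\<close>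
  obtain R where R: "\<And>z. z \<in> Rn (Suc N) ==> sqn (Suc N) z \<ge> R ==> \<bar>Kf z\<bar> * sqn (Suc N) z ^ (p + 2) \<le> 5"
   using decay[OF L, of "p + 2"] unfolding Kf_def by blast
  define R' where "R' = max R 1"
  have R': "R' \<ge> 1" "R' \<ge> R" by (auto simp: R'_def)
  obtain d2 where d2: "d2 > 0" "\<And>y. y \<in> cub N x0 d2 ==> \<bar>A y - A x0\<bar> < 1 / R'"
   using continuous_on_cubD[OF opn_Rn smooth_onD(1)[OF A opn_Rn] x0(1), of "1 / R'"] R'(1)
   by (metis less_le_trans zero_less_divide_1_iff zero_less_one)
  have "\<bar>?f x\<bar> \<le> ((\<bar>D x0\<bar> + 1) * 5) * (A x)\<^sup>2" if x: "x \<in> cub N x0 (min d1 d2)" for x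
  proof (cases "A x = 0")
   case False
   have x12: "x \<in> cub N x0 d1" "x \<in> cub N x0 d2"
    using x cub_mono[of "min d1 d2" d1 N x0] cub_mono[of "min d1 d2" d2 N x0] by auto
   define y where "y = 1 / A x"
   define z where "z = x(N := y)"
   have zR: "z \<in> Rn (Suc N)" using x by (auto simp: z_def cub_def intro: Rn_Suc_upd)
   have Dx: "\<bar>D x\<bar> \<le> \<bar>D x0\<bar> + 1" using d1(2)[OF x12(1)] by linarith
   have "\<bar>A x\<bar> < 1 / R'" using d2(2)[OF x12(2)] x0(2) by simp
   then have y1: "\<bar>y\<bar> > R'" using False R'(1) by (simp add: y_def field_simps)
   then have y2: "\<bar>y\<bar> \<ge> 1" using R'(1) by linarith
   have "R' * 1 \<le> \<bar>y\<bar> * \<bar>y\<bar>" using y1 y2 R'(1) by (intro mult_mono) auto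
   then have yR: "R' \<le> y\<^sup>2" by (simp add: power2_eq_square)
   have ys: "y\<^sup>2 \<le> sqn (Suc N) z" using sqn_coord[of N "Suc N" z] by (simp add: z_def)
   have "\<bar>y\<bar> ^ p * y\<^sup>2 = \<bar>y\<bar> ^ (p + 2)" by (simp add: power_add power2_eq_square)
   also have "\<dots> \<le> (y\<^sup>2) ^ (p + 2)"
   proof (rule power_mono)
    show "\<bar>y\<bar> \<le> y\<^sup>2" using mult_left_mono[of 1 "\<bar>y\<bar>" "\<bar>y\<bar>"] y2 by (simp add: power2_eq_square)
   qed simp
   also have "\<dots> \<le> sqn (Suc N) z ^ (p + 2)" using ys by (intro power_mono) auto
   finally have "\<bar>Kf z\<bar> * (\<bar>y\<bar> ^ p * y\<^sup>2) \<le> \<bar>Kf z\<bar> * sqn (Suc N) z ^ (p + 2)" by (intro mult_left_mono) auto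
   also have "\<dots> \<le> 5" using R[OF zR] yR ys R'(2) by linarith
   finally have "\<bar>D x\<bar> * (\<bar>Kf z\<bar> * (\<bar>y\<bar> ^ p * y\<^sup>2)) \<le> (\<bar>D x0\<bar> + 1) * 5" using Dx by (intro mult_mono) auto
   moreover have "\<bar>?f x\<bar> = \<bar>y\<bar> ^ p * \<bar>D x\<bar> * \<bar>Kf z\<bar>"
    using False by (simp add: rterm_def y_def z_def Kf_def abs_mult power_abs)
   ultimately have "\<bar>?f x\<bar> * y\<^sup>2 \<le> (\<bar>D x0\<bar> + 1) * 5" by (simp add: mult_ac)
   then show ?thesis using False by (simp add: y_def field_simps)
  qed (simp add: rterm_def)
  then show ?thesis using d1(1) d2(1) by (intro exI[of _ "(\<bar>D x0\<bar> + 1) * 5"] conjI exI[of _ "min d1 d2"]) auto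
 qed
 have fU: "smooth_on N U ?f"
 proof (rule smooth_on_cong[OF U])
  have "smooth_on N U (%x. Kf (x(N := 1 / A x)))"
  proof (rule smooth_reindex[OF Kf U, of "%k x. if k = N then 1 / A x else x k"])
   show "smooth_on N U (%x. if k = N then 1 / A x else x k)" for k
    using smooth_divide[OF U smooth_const[OF U] AU] smooth_coord[OF U] by (cases "k = N") (auto simp: U_def)
  qed (auto simp: U_def intro: Rn_Suc_upd)
  moreover have "smooth_on N U D" by (rule smooth_on_subset[OF D opn_Rn U]) (auto simp: U_def)
  moreover have "smooth_on N U (%x. 1 / A x)" using smooth_divide[OF U smooth_const[OF U] AU] by (auto simp: U_def)
  ultimately show "smooth_on N U (%x. (1 / A x) ^ p * D x * Kf (x(N := 1 / A x)))"
   by (intro smooth_mult smooth_power U)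
 qed (simp add: rterm_def U_def Kf_def)
 show "continuous_on (Rn N) ?f"
 proof (rule continuous_on_cubI)
  fix x and e :: real assume x: "x \<in> Rn N" and e: "e > 0"
  show "\<exists>d>0. \<forall>y\<in>Rn N \<inter> cub N x d. \<bar>?f y - ?f x\<bar> < e"
  proof (cases "A x = 0")
   case False
   then have "x \<in> U" using x by (simp add: U_def)
   from continuous_on_cubD[OF U smooth_onD(1)[OF fU U] this e] show ?thesis by (metis IntD2)
  next
   case True
   from small[OF x this] obtain C d where C: "C \<ge> 0" "d > 0" "\<And>y. y \<in> cub N x d ==> \<bar>?f y\<bar> \<le> C * (A y)\<^sup>2" by blast
   define r where "r = min 1 (e / (C + 1))"
   have r: "r > 0" "r \<le> 1" "C * r < e" using e C(1)
    by (auto simp: r_def min_def field_simps)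
   obtain d2 where d2: "d2 > 0" "\<And>y. y \<in> cub N x d2 ==> \<bar>A y - A x\<bar> < r"
    using continuous_on_cubD[OF opn_Rn smooth_onD(1)[OF A opn_Rn] x r(1)] by metis
   have "\<bar>?f y - ?f x\<bar> < e" if y: "y \<in> cub N x (min d d2)" for y
   proof -
    have y12: "y \<in> cub N x d" "y \<in> cub N x d2"
     using y cub_mono[of "min d d2" d N x] cub_mono[of "min d d2" d2 N x] by auto
    have a: "\<bar>A y\<bar> < r" using d2(2)[OF y12(2)] True by simp
    have "(A y)\<^sup>2 = \<bar>A y\<bar> * \<bar>A y\<bar>" by (simp add: power2_eq_square)
    also have "\<dots> \<le> r * 1" using a r by (intro mult_mono) auto
    finally have "C * (A y)\<^sup>2 \<le> C * r" using C(1) by (intro mult_left_mono) auto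
    then show ?thesis using C(3)[OF y12(1)] r(3) True by (simp add: rterm_def)
   qed
   then show ?thesis using C(2) d2(1) by (intro exI[of _ "min d d2"]) auto
  qed
 qed simp
 fix i x assume i: "i < N" and x: "x \<in> Rn N"
 show "((%t. ?f (x(i := t))) has_real_derivative
   (rterm N A F (Suc p) (%x. - real p * (pd i A x * D x)) is x + rterm N A F p (pd i D) is x) +
   (rterm N A F p D (is @ [i]) x + rterm N A F (p + 2) (%x. - (D x * pd i A x)) (is @ [N]) x)) (at (x i))"
 proof (cases "A x = 0")
  case True
  from small[OF x this] obtain C d where C: "C \<ge> 0" "d > 0" "\<And>y. y \<in> cub N x d ==> \<bar>?f y\<bar> \<le> C * (A y)\<^sup>2" by blast
  have Ad: "((%t. A (x(i := t))) has_real_derivative pd i A x) (at (x i))" by (rule smooth_onD(2)[OF A opn_Rn i x])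
  have "((%t. A (x(i := t)) / (t - x i)) \<longlongrightarrow> pd i A x) (at (x i))"
   using Ad True by (simp add: has_field_derivative_iff)
  moreover have "((%t. A (x(i := t))) \<longlongrightarrow> 0) (at (x i))"
   using DERIV_isCont[OF Ad] True by (simp add: isCont_def)
  ultimately have "((%t. C * (\<bar>A (x(i := t))\<bar> * \<bar>A (x(i := t)) / (t - x i)\<bar>)) \<longlongrightarrow> C * (\<bar>0\<bar> * \<bar>pd i A x\<bar>)) (at (x i))"
   by (intro tendsto_intros)
  then have lim: "((%t. C * (\<bar>A (x(i := t))\<bar> * \<bar>A (x(i := t)) / (t - x i)\<bar>)) \<longlongrightarrow> 0) (at (x i))" by simp
  have ev: "\<forall>\<^sub>F t in at (x i). x(i := t) \<in> cub N x d"
   using eventually_upd[OF opn_cub cub_center[OF x C(2)] i] by (simp add: eventually_at_filter eventually_mono)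
  have "((%t. ?f (x(i := t)) / (t - x i)) \<longlongrightarrow> 0) (at (x i))"
  proof (rule Lim_null_comparison[OF _ lim])
   show "\<forall>\<^sub>F t in at (x i). norm (?f (x(i := t)) / (t - x i)) \<le> C * (\<bar>A (x(i := t))\<bar> * \<bar>A (x(i := t)) / (t - x i)\<bar>)"
    using ev
   proof eventually_elim
    case (elim t)
    have "\<bar>?f (x(i := t))\<bar> / \<bar>t - x i\<bar> \<le> C * (A (x(i := t)))\<^sup>2 / \<bar>t - x i\<bar>"
     using C(3)[OF elim] by (intro divide_right_mono) auto
    also have "\<dots> = C * (\<bar>A (x(i := t))\<bar> * \<bar>A (x(i := t)) / (t - x i)\<bar>)"
     by (simp add: power2_eq_square abs_mult)
    finally show ?case by simp
   qed
  qed
  then show ?thesis using True by (simp add: has_field_derivative_iff rterm_def)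
 next
  case False
  define a where "a = pd i A x"
  define y where "y = 1 / A x"
  define q where "q t = 1 / A (x(i := t))" for t
  have qx: "q (x i) = y" by (simp add: q_def y_def)
  have Ad: "((%t. A (x(i := t))) has_real_derivative a) (at (x i))"
   unfolding a_def by (rule smooth_onD(2)[OF A opn_Rn i x])
  have qd: "(q has_real_derivative - (a * y\<^sup>2)) (at (x i))"
   unfolding q_def[abs_def]
   using DERIV_inverse_fun[OF Ad] False by (simp add: y_def inverse_eq_divide power2_eq_square divide_simps)
  have qp: "((%t. q t ^ p) has_real_derivative - (real p * a * y ^ Suc p)) (at (x i))"
  proof (cases p)
   case (Suc k)
   then show ?thesis using DERIV_power[OF qd, of p] by (simp add: qx power2_eq_square algebra_simps)
  qed simp
  have Dd: "((%t. D (x(i := t))) has_real_derivative pd i D x) (at (x i))" by (rule smooth_onD(2)[OF D opn_Rn i x])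
  define c where "c t = (x(i := t))(N := q t)" for t
  define z where "z = x(N := y)"
  have cz: "c (x i) = z" by (simp add: c_def z_def qx)
  have zR: "z \<in> Rn (Suc N)" unfolding z_def by (rule Rn_Suc_upd[OF x])
  have "((%t. Kf (c t)) has_real_derivative (\<Sum>k<Suc N. pd k Kf (c (x i)) * (if k = N then - (a * y\<^sup>2) else if k = i then 1 else 0))) (at (x i))"
  proof (rule chain_rule[OF opn_Rn Kf])
   show "c (x i) \<in> Rn (Suc N)" using cz zR by simp
   show "c t \<in> Rn (Suc N)" for t unfolding c_def by (intro Rn_Suc_upd upd_in_Rn x i)
   show "((%t. c t k) has_real_derivative (if k = N then - (a * y\<^sup>2) else if k = i then 1 else 0)) (at (x i))" for k
    using qd i by (auto simp: c_def)
  qed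
  also have "(\<Sum>k<Suc N. pd k Kf (c (x i)) * (if k = N then - (a * y\<^sup>2) else if k = i then 1 else 0))
   = (\<Sum>k\<in>{i,N}. pd k Kf (c (x i)) * (if k = N then - (a * y\<^sup>2) else if k = i then 1 else 0))"
   using i by (intro sum.mono_neutral_right) auto
  also have "\<dots> = pd i Kf z - pd N Kf z * (a * y\<^sup>2)" using i by (simp add: cz)
  finally have Kd: "((%t. Kf (c t)) has_real_derivative pd i Kf z - pd N Kf z * (a * y\<^sup>2)) (at (x i))" .
  have "((%t. q t ^ p * D (x(i := t)) * Kf (c t)) has_real_derivative
    (- (real p * a * y ^ Suc p) * D (x(i := x i)) + pd i D x * q (x i) ^ p) * Kf (c (x i)) +
    (pd i Kf z - pd N Kf z * (a * y\<^sup>2)) * (q (x i) ^ p * D (x(i := x i)))) (at (x i))"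
   by (intro DERIV_mult qp Dd Kd)
  moreover have "(- (real p * a * y ^ Suc p) * D (x(i := x i)) + pd i D x * q (x i) ^ p) * Kf (c (x i)) +
    (pd i Kf z - pd N Kf z * (a * y\<^sup>2)) * (q (x i) ^ p * D (x(i := x i)))
   = (rterm N A F (Suc p) (%x. - real p * (pd i A x * D x)) is x + rterm N A F p (pd i D) is x) +
   (rterm N A F p D (is @ [i]) x + rterm N A F (p + 2) (%x. - (D x * pd i A x)) (is @ [N]) x)"
  proof -
   have "rterm N A F (Suc p) (%x. - real p * (pd i A x * D x)) is x = y ^ Suc p * (- real p * (a * D x)) * Kf z"
    "rterm N A F p (pd i D) is x = y ^ p * pd i D x * Kf z"
    "rterm N A F p D (is @ [i]) x = y ^ p * D x * pd i Kf z"
    "rterm N A F (p + 2) (%x. - (D x * pd i A x)) (is @ [N]) x = y ^ (p + 2) * - (D x * a) * pd N Kf z"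
    using False unfolding rterm_def itpd_snoc Kf_def z_def y_def a_def by simp_all
   then show ?thesis unfolding qx cz fun_upd_triv by (simp only:) (simp add: algebra_simps power_add power2_eq_square)
  qed
  ultimately have d: "((%t. q t ^ p * D (x(i := t)) * Kf (c t)) has_real_derivative
   (rterm N A F (Suc p) (%x. - real p * (pd i A x * D x)) is x + rterm N A F p (pd i D) is x) +
   (rterm N A F p D (is @ [i]) x + rterm N A F (p + 2) (%x. - (D x * pd i A x)) (is @ [N]) x)) (at (x i))" by simp
  have "\<forall>\<^sub>F t in nhds (x i). x(i := t) \<in> U"
   using False x by (intro eventually_upd[OF U _ i]) (simp add: U_def)
  then have ev: "\<forall>\<^sub>F t in nhds (x i). q t ^ p * D (x(i := t)) * Kf (c t) = ?f (x(i := t))"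
   by eventually_elim (simp add: U_def rterm_def q_def c_def Kf_def)
  from iffD1[OF DERIV_cong_ev[OF refl ev refl] d] show ?thesis .
 qed
qed

text \<open>This produces the numerator of a fraction for a given element of the localization at \<open>A\<close>.\<close>

lemma rapid_extension:
 assumes A: "Sm N A" and G: "Sm (Suc N) G"
 obtains W e where "Sm (Suc N) W" "\<And>z. z \<in> Rn (Suc N) ==> W z > 0"
  "Sm N e" "\<And>x. x \<in> Rn N ==> A x \<noteq> 0 ==> e x = W (x(N := 1 / A x)) * G (x(N := 1 / A x))"
  "\<And>x. x \<in> Rn N ==> A x = 0 ==> e x = 0"
proof (rule rapid_weight[OF G])
 fix W assume W: "Sm (Suc N) W" "\<And>z. z \<in> Rn (Suc N) ==> W z > 0"
  "\<And>is p. set is \<subseteq> {..<Suc N} ==> \<exists>R. \<forall>z\<in>Rn (Suc N). sqn (Suc N) z \<ge> R --> \<bar>itpd is (%z. W z * G z) z\<bar> * sqn (Suc N) z ^ p \<le> 5"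
 define F where "F z = W z * G z" for z
 have F: "Sm (Suc N) F" unfolding F_def by (rule smooth_mult[OF opn_Rn W(1) G])
 note step = rterm_step[OF A F W(3)[folded F_def]]
 have "continuous_on (Rn N) f \<and> (\<exists>D. \<forall>i<N. (\<forall>x\<in>Rn N. ((%t. f (x(i := t))) has_real_derivative D i x) (at (x i))) \<and> D i \<in> rterms N A F)"
  if "f \<in> rterms N A F" for f
  using that
 proof induction
  case (one D "is" p)
  define D' where "D' i = (%x. (rterm N A F (Suc p) (%x. - real p * (pd i A x * D x)) is x + rterm N A F p (pd i D) is x) +
   (rterm N A F p D (is @ [i]) x + rterm N A F (p + 2) (%x. - (D x * pd i A x)) (is @ [N]) x))" for i
  have "D' i \<in> rterms N A F" if "i < N" for i
   unfolding D'_def using one that smooth_onD(3)[OF one(1) opn_Rn that] smooth_onD(3)[OF A opn_Rn that]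
   by (intro rterms.add rterms.one smooth_mult smooth_minus smooth_const opn_Rn) auto
  moreover have "((%t. rterm N A F p D is (x(i := t))) has_real_derivative D' i x) (at (x i))" if "i < N" "x \<in> Rn N" for i x
   unfolding D'_def by (rule step(2)[OF _ one that]) assumption
  moreover have "continuous_on (Rn N) (rterm N A F p D is)" by (rule step(1)[OF _ one]) assumption
  ultimately show ?case by (intro conjI exI[of _ D'] allI impI ballI)
 next
  case (add f g)
  then obtain D E where D: "\<forall>i<N. (\<forall>x\<in>Rn N. ((%t. f (x(i := t))) has_real_derivative D i x) (at (x i))) \<and> D i \<in> rterms N A F"
   and E: "\<forall>i<N. (\<forall>x\<in>Rn N. ((%t. g (x(i := t))) has_real_derivative E i x) (at (x i))) \<and> E i \<in> rterms N A F" by blast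
  have "((%t. f (x(i := t)) + g (x(i := t))) has_real_derivative D i x + E i x) (at (x i))" if "i < N" "x \<in> Rn N" for i x
   using D E that by (intro DERIV_add) blast+
  moreover have "continuous_on (Rn N) (%x. f x + g x)" using add by (intro continuous_on_add) blast+
  moreover have "(%x. D i x + E i x) \<in> rterms N A F" if "i < N" for i using D E that by (intro rterms.add) blast+
  ultimately show ?case by (intro conjI exI[of _ "%i x. D i x + E i x"] allI impI ballI)
 qed
 note st = this
 \<comment> \<open>The term without derivatives; its value where \<open>A\<close> vanishes is zero
   by the definition of \<open>rterm\<close>.\<close>
 define e where "e = rterm N A F 0 (%_. 1) []"
 have "Sm N e"
 proof (rule smooth_on_coinductI[OF opn_Rn, of "%f. f \<in> rterms N A F"])
  show "e \<in> rterms N A F" unfolding e_def by (intro rterms.one smooth_const opn_Rn) simp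
  fix g assume "g \<in> rterms N A F"
  from st[OF this] obtain D where c: "continuous_on (Rn N) g"
   and D: "\<forall>i<N. (\<forall>x\<in>Rn N. ((%t. g (x(i := t))) has_real_derivative D i x) (at (x i))) \<and> D i \<in> rterms N A F"
   by (elim conjE exE)
  then show "continuous_on (Rn N) g \<and> (\<exists>D. \<forall>i<N. (\<forall>x\<in>Rn N. ((%t. g (x(i := t))) has_real_derivative D i x) (at (x i))) \<and>
    (D i \<in> rterms N A F \<or> Sm N (D i)))"
   by (intro conjI exI[of _ D]) (simp_all del: fun_upd_apply)
 qed
 note e = this
 show thesis
  by (rule that[OF W(1,2) e]) (simp_all add: e_def rterm_def F_def)
qed

section \<open>Algebra of \<open>C\<^sup>\<infinity>\<close>-rings\<close>

text \<open>\<open>cop\<close> is meant for functions that are extensional on \<open>Rn n\<close>.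
  The restriction built in here allows plain lambda terms.\<close>

definition app :: "'a cinf => nat => ((nat => real) => real) => (nat => 'a) => 'a" where
 "app A n g a = cop A n (restrict g (Rn n)) a"

lemma carrier_CinfR: "g \<in> carrier (CinfR n) \<longleftrightarrow> g \<in> extensional (Rn n) \<and> Sm n g"
 by (simp add: CinfR_def function_cinf_def)

lemma restrict_CinfR [simp]: "Sm n g ==> restrict g (Rn n) \<in> carrier (CinfR n)"
 unfolding carrier_CinfR using smooth_on_cong[OF opn_Rn, of n g "restrict g (Rn n)"] by simp

lemma CinfR_smooth: "g \<in> carrier (CinfR n) ==> Sm n g"
 by (simp add: carrier_CinfR)

lemma cop_app: "g \<in> carrier (CinfR n) ==> cop A n g a = app A n g a"
 by (simp add: app_def carrier_CinfR extensional_restrict)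

lemma app_eqI: "(\<And>x. x \<in> Rn n ==> g x = h x) ==> app A n g a = app A n h a"
 unfolding app_def by (metis restrict_ext)

lemma op_app:
 "op1 A \<alpha> x = app A 1 (%v. \<alpha> (v 0)) (%_. x)"
 "op2 A \<beta> x y = app A 2 (%v. \<beta> (v 0) (v 1)) (%i. if i = 0 then x else y)"
 "const A c = app A 0 (%v. c) (%_. undefined)"
 by (simp_all add: op1_def op2_def const_def app_def)

lemma as_ring_simps [simp]:
 "carrier (as_ring A) = carrier A" "add (as_ring A) = op2 A (+)" "mult (as_ring A) = op2 A (*)"
 "one (as_ring A) = const A 1" "zero (as_ring A) = const A 0"
 by (simp_all add: as_ring_def)

lemma Sm_intros [simp]:
 "Sm n (%x. c)" "Sm n (%x. x i)" "Sm n g ==> Sm n h ==> Sm n (%x. g x + h x)"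
 "Sm n g ==> Sm n h ==> Sm n (%x. g x * h x)" "Sm n g ==> Sm n h ==> Sm n (%x. g x - h x)"
 "Sm n g ==> Sm n (%x. - g x)" "Sm n g ==> Sm n (%x. (g x)\<^sup>2)"
 by (simp_all add: smooth_const smooth_coord smooth_add smooth_mult smooth_diff smooth_minus smooth_power)

lemma Sm_comp: "Sm m f ==> (\<And>j. j < m ==> Sm n (g j)) ==> Sm n (%x. f (tuple m (%j. g j x)))"
 by (rule smooth_comp[OF opn_Rn opn_Rn]) simp_all

locale cinf = fixes A :: "'a cinf" assumes cinf_ring: "cinf_ring A"
begin

lemma app_closed:
 assumes "Sm n g" "\<And>i. i < n ==> a i \<in> carrier A"
 shows "app A n g a \<in> carrier A"
proof -
 have "\<forall>n g a. g \<in> carrier (CinfR n) \<and> (\<forall>i<n. a i \<in> carrier A) --> cop A n g a \<in> carrier A"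
  using cinf_ring unfolding cinf_ring_def by (elim conjE)
 from this[rule_format, where g = "restrict g (Rn n)"] show ?thesis
  unfolding app_def using restrict_CinfR[OF assms(1)] assms(2) by simp
qed

lemma app_cong:
 assumes "Sm n g" "\<And>i. i < n ==> a i \<in> carrier A" "\<And>i. i < n ==> a i = b i" "\<And>x. x \<in> Rn n ==> g x = h x"
 shows "app A n g a = app A n h b"
proof -
 have "\<forall>n g a b. g \<in> carrier (CinfR n) \<and> (\<forall>i<n. a i \<in> carrier A \<and> a i = b i) --> cop A n g a = cop A n g b"
  using cinf_ring unfolding cinf_ring_def by (elim conjE)
 from this[rule_format, where g = "restrict g (Rn n)" and n = n and a = a and b = b]
 have "app A n g a = app A n g b" unfolding app_def using assms(2,3) restrict_CinfR[OF assms(1)] by simp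
 also have "\<dots> = app A n h b" using assms(4) by (rule app_eqI)
 finally show ?thesis .
qed

lemma app_coord:
 assumes "i < n" "\<And>j. j < n ==> a j \<in> carrier A"
 shows "app A n (%x. x i) a = a i"
proof -
 have "\<forall>n a i. i < n \<and> (\<forall>j<n. a j \<in> carrier A) --> cop A n (\<lambda>x\<in>Rn n. x i) a = a i"
  using cinf_ring unfolding cinf_ring_def by (elim conjE)
 from this[rule_format, of i n a] show ?thesis unfolding app_def using assms by simp
qed

lemma app_comp:
 assumes "Sm m f" "\<And>j. j < m ==> Sm n (g j)" "\<And>i. i < n ==> a i \<in> carrier A"
  and h: "\<And>x. x \<in> Rn n ==> h x = f (tuple m (%j. g j x))"
 shows "app A n h a = app A m f (%j. app A n (g j) a)"
proof -
 let ?g = "%j. restrict (g j) (Rn n)"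
 have "\<forall>m n f g a. f \<in> carrier (CinfR m) \<and> (\<forall>j<m. g j \<in> carrier (CinfR n)) \<and> (\<forall>i<n. a i \<in> carrier A)
    --> cop A n (\<lambda>x\<in>Rn n. f (tuple m (%j. g j x))) a = cop A m f (%j. cop A n (g j) a)"
  using cinf_ring unfolding cinf_ring_def by (elim conjE)
 from this[rule_format, where f = "restrict f (Rn m)" and m = m and n = n and g = ?g and a = a]
 have "cop A n (\<lambda>x\<in>Rn n. restrict f (Rn m) (tuple m (%j. ?g j x))) a = cop A m (restrict f (Rn m)) (%j. cop A n (?g j) a)"
  using restrict_CinfR[OF assms(1)] restrict_CinfR[OF assms(2)] assms(3) by simp
 moreover have "(\<lambda>x\<in>Rn n. restrict f (Rn m) (tuple m (%j. ?g j x))) = restrict h (Rn n)"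
  using h by (intro restrict_ext) simp
 ultimately show ?thesis by (simp add: app_def)
qed

lemma op2_app:
 assumes "Sm 2 (%v. \<beta> (v 0) (v 1))" "Sm n g" "Sm n h" "\<And>i. i < n ==> a i \<in> carrier A"
 shows "op2 A \<beta> (app A n g a) (app A n h a) = app A n (%x. \<beta> (g x) (h x)) a"
proof -
 have "app A n (%x. \<beta> (g x) (h x)) a = app A 2 (%v. \<beta> (v 0) (v 1)) (%j. app A n (if j = 0 then g else h) a)"
  using assms by (intro app_comp) auto
 also have "\<dots> = op2 A \<beta> (app A n g a) (app A n h a)"
  unfolding op_app using assms by (intro app_cong) (auto intro: app_closed)
 finally show ?thesis by simp
qed

lemma op1_app:
 assumes "Sm 1 (%v. \<alpha> (v 0))" "Sm n g" "\<And>i. i < n ==> a i \<in> carrier A"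
 shows "op1 A \<alpha> (app A n g a) = app A n (%x. \<alpha> (g x)) a"
 unfolding op_app by (rule app_comp[symmetric]) (use assms in auto)

lemma const_app: "(\<And>i. i < n ==> a i \<in> carrier A) ==> const A c = app A n (%x. c) a"
proof -
 assume a: "\<And>i. i < n ==> a i \<in> carrier A"
 have "app A n (%x. c) a = app A 0 (%v. c) (%j. app A n (%x. 0) a)"
  using a by (intro app_comp) auto
 also have "\<dots> = const A c" unfolding op_app by (intro app_cong) auto
 finally show ?thesis by simp
qed

lemma const_closed [simp]: "const A c \<in> carrier A"
 unfolding op_app by (rule app_closed) auto

lemma op2_closed:
 "Sm 2 (%v. \<beta> (v 0) (v 1)) ==> x \<in> carrier A ==> y \<in> carrier A ==> op2 A \<beta> x y \<in> carrier A"
 unfolding op_app by (rule app_closed) auto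

lemma op1_closed: "Sm 1 (%v. \<alpha> (v 0)) ==> x \<in> carrier A ==> op1 A \<alpha> x \<in> carrier A"
 unfolding op_app by (rule app_closed) auto

lemma arith_closed [simp]:
 "x \<in> carrier A ==> y \<in> carrier A ==> op2 A (+) x y \<in> carrier A"
 "x \<in> carrier A ==> y \<in> carrier A ==> op2 A (*) x y \<in> carrier A"
 "x \<in> carrier A ==> y \<in> carrier A ==> op2 A (-) x y \<in> carrier A"
 by (auto intro: op2_closed)

text \<open>Identities are transferred from smooth functions of three variables.\<close>

definition vars :: "'a => 'a => 'a => nat => 'a" where
 "vars x y z = (%i. if i = 0 then x else if i = 1 then y else z)"

lemma vars:
 assumes "x \<in> carrier A" "y \<in> carrier A" "z \<in> carrier A"
 shows "i < 3 ==> vars x y z i \<in> carrier A"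
  "x = app A 3 (%v. v 0) (vars x y z)" "y = app A 3 (%v. v 1) (vars x y z)" "z = app A 3 (%v. v 2) (vars x y z)"
  "const A c = app A 3 (%v. c) (vars x y z)"
proof -
 have v: "vars x y z i \<in> carrier A" for i using assms by (simp add: vars_def)
 then show "i < 3 ==> vars x y z i \<in> carrier A" by blast
 show "x = app A 3 (%v. v 0) (vars x y z)" "y = app A 3 (%v. v 1) (vars x y z)" "z = app A 3 (%v. v 2) (vars x y z)"
  using v by (simp_all add: app_coord vars_def)
 show "const A c = app A 3 (%v. c) (vars x y z)" using v by (intro const_app)
qed

lemma arith_app:
 assumes "Sm n g" "Sm n h" "\<And>i. i < n ==> a i \<in> carrier A"
 shows "op2 A (+) (app A n g a) (app A n h a) = app A n (%x. g x + h x) a"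
  "op2 A (*) (app A n g a) (app A n h a) = app A n (%x. g x * h x) a"
  "op2 A (-) (app A n g a) (app A n h a) = app A n (%x. g x - h x) a"
 using assms by (auto intro: op2_app)

text \<open>Premises in the object logic, so that \<open>OF\<close> does not generalize the argument \<open>a i\<close> to a function of \<open>i\<close>.\<close>

lemma app_closed': "Sm n g ==> \<forall>i<n. a i \<in> carrier A ==> app A n g a \<in> carrier A"
 by (rule app_closed) auto

lemma arith_app':
 assumes "Sm n g" "Sm n h" "\<forall>i<n. a i \<in> carrier A"
 shows "op2 A (+) (app A n g a) (app A n h a) = app A n (%x. g x + h x) a"
  "op2 A (*) (app A n g a) (app A n h a) = app A n (%x. g x * h x) a"
  "op2 A (-) (app A n g a) (app A n h a) = app A n (%x. g x - h x) a"
 using arith_app[of n g h a] assms by auto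

lemma const_app': "\<forall>i<n. a i \<in> carrier A ==> const A c = app A n (%x. c) a"
 by (rule const_app) auto

lemma ring_laws:
 assumes "x \<in> carrier A" "y \<in> carrier A" "z \<in> carrier A"
 shows "op2 A (+) (op2 A (+) x y) z = op2 A (+) x (op2 A (+) y z)"
  "op2 A (+) x y = op2 A (+) y x" "op2 A (+) (const A 0) x = x" "op2 A (+) x (op2 A (-) y x) = y"
  "op2 A (+) (op2 A (-) (const A 0) x) x = const A 0"
  "op2 A (*) (op2 A (*) x y) z = op2 A (*) x (op2 A (*) y z)"
  "op2 A (*) x y = op2 A (*) y x" "op2 A (*) (const A 1) x = x"
  "op2 A (*) (op2 A (+) x y) z = op2 A (+) (op2 A (*) x z) (op2 A (*) y z)"
  "op2 A (-) x x = const A 0"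
  "op2 A (*) (const A 0) x = const A 0" "op2 A (-) x (const A 0) = x"
  "op2 A (+) (op2 A (-) x y) (op2 A (-) y z) = op2 A (-) x z"
  "op2 A (*) (op2 A (-) x y) z = op2 A (-) (op2 A (*) x z) (op2 A (*) y z)"
  "op2 A (-) x y = op2 A (+) x (op2 A (*) (const A (- 1)) y)"
  "op2 A (+) x (op2 A (*) (const A (- 1)) x) = const A 0"
  "op2 A (-) (op2 A (+) x y) y = x"
proof -
 obtain a where a: "\<And>i. i < 3 ==> a i \<in> carrier A" and e: "x = app A 3 (%v. v 0) a" "y = app A 3 (%v. v 1) a"
  "z = app A 3 (%v. v 2) a" "\<And>c. const A c = app A 3 (%v. c) a"
  using vars[OF assms] by blast
 note s = e arith_app[OF _ _ a]
 show "op2 A (+) (op2 A (+) x y) z = op2 A (+) x (op2 A (+) y z)"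
  "op2 A (+) x y = op2 A (+) y x" "op2 A (+) (const A 0) x = x" "op2 A (+) x (op2 A (-) y x) = y"
  "op2 A (+) (op2 A (-) (const A 0) x) x = const A 0"
  "op2 A (*) (op2 A (*) x y) z = op2 A (*) x (op2 A (*) y z)"
  "op2 A (*) x y = op2 A (*) y x" "op2 A (*) (const A 1) x = x"
  "op2 A (*) (op2 A (+) x y) z = op2 A (+) (op2 A (*) x z) (op2 A (*) y z)"
  "op2 A (-) x x = const A 0"
  "op2 A (*) (const A 0) x = const A 0" "op2 A (-) x (const A 0) = x"
  "op2 A (+) (op2 A (-) x y) (op2 A (-) y z) = op2 A (-) x z"
  "op2 A (*) (op2 A (-) x y) z = op2 A (-) (op2 A (*) x z) (op2 A (*) y z)"
  "op2 A (-) x y = op2 A (+) x (op2 A (*) (const A (- 1)) y)"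
  "op2 A (+) x (op2 A (*) (const A (- 1)) x) = const A 0"
  "op2 A (-) (op2 A (+) x y) y = x"
  by (simp_all add: s algebra_simps)
qed

lemma laws [simp]:
 assumes "x \<in> carrier A"
 shows "op2 A (+) (const A 0) x = x" "op2 A (+) x (const A 0) = x" "op2 A (-) x x = const A 0"
  "op2 A (-) x (const A 0) = x" "op2 A (*) (const A 0) x = const A 0" "op2 A (*) x (const A 0) = const A 0"
  "op2 A (*) (const A 1) x = x" "op2 A (*) x (const A 1) = x"
 using ring_laws[of x "const A 0" x] ring_laws[of x "const A 1" x] assms by auto

lemma cring: "cring (as_ring A)"
proof (rule cringI)
 show "abelian_group (as_ring A)"
 proof (rule abelian_groupI)
  fix x assume "x \<in> carrier (as_ring A)"
  then show "\<exists>y\<in>carrier (as_ring A). y \<oplus>\<^bsub>as_ring A\<^esub> x = \<zero>\<^bsub>as_ring A\<^esub>"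
   using ring_laws(5)[of x x x] by (intro bexI[of _ "op2 A (-) (const A 0) x"]) auto
 qed (auto simp: ring_laws(1,3), metis ring_laws(2))
 show "comm_monoid (as_ring A)"
  by (rule comm_monoidI) (auto simp: ring_laws(6,8), metis ring_laws(7))
qed (auto simp: ring_laws(9))

lemma ring: "ring (as_ring A)"
 using cring by (simp add: cring_def)

lemma minus_eq:
 assumes "x \<in> carrier A" "y \<in> carrier A"
 shows "x \<ominus>\<^bsub>as_ring A\<^esub> y = op2 A (-) x y"
proof -
 interpret R: cring "as_ring A" by (rule cring)
 have "op2 A (+) y (op2 A (*) (const A (- 1)) y) = const A 0" using ring_laws(16) assms by blast
 then have "\<ominus>\<^bsub>as_ring A\<^esub> y = op2 A (*) (const A (- 1)) y"
  using R.minus_equality[of "op2 A (*) (const A (- 1)) y" y] R.a_comm[of y "op2 A (*) (const A (- 1)) y"] assms by simp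
 then show ?thesis unfolding a_minus_def using ring_laws(15) assms by simp
qed

lemma idealI':
 assumes "I \<subseteq> carrier A" "const A 0 \<in> I" "\<And>x y. x \<in> I ==> y \<in> I ==> op2 A (+) x y \<in> I"
  "\<And>x y. x \<in> carrier A ==> y \<in> I ==> op2 A (*) x y \<in> I"
 shows "ideal I (as_ring A)"
proof (rule idealI[OF ring])
 interpret R: cring "as_ring A" by (rule cring)
 show "subgroup I (add_monoid (as_ring A))"
 proof (rule R.add.subgroupI)
  fix x assume x: "x \<in> I"
  have "\<ominus>\<^bsub>as_ring A\<^esub> x = op2 A (*) (const A (- 1)) x"
   using R.minus_equality[of "op2 A (*) (const A (- 1)) x" x] R.a_comm[of x "op2 A (*) (const A (- 1)) x"] ring_laws(16)[of x x x] x assms(1)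
   by (simp add: subset_iff)
  then show "\<ominus>\<^bsub>as_ring A\<^esub> x \<in> I" using assms(4)[of "const A (- 1)" x] x by simp
 qed (use assms in auto)
 show "x \<otimes>\<^bsub>as_ring A\<^esub> a \<in> I" if "a \<in> I" "x \<in> carrier (as_ring A)" for a x using assms(4) that by simp
 show "a \<otimes>\<^bsub>as_ring A\<^esub> x \<in> I" if "a \<in> I" "x \<in> carrier (as_ring A)" for a x
  using assms(1,4) that ring_laws(7)[of a x x] by (simp add: subset_iff)
qed

lemma idealD:
 assumes "ideal I (as_ring A)"
 shows "I \<subseteq> carrier A" "const A 0 \<in> I" "x \<in> I ==> y \<in> I ==> op2 A (+) x y \<in> I"
  "x \<in> carrier A ==> y \<in> I ==> op2 A (*) x y \<in> I" "x \<in> I ==> y \<in> I ==> op2 A (-) x y \<in> I"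
proof -
 interpret I: ideal I "as_ring A" by (rule assms)
 show sub: "I \<subseteq> carrier A" using I.a_subset by simp
 have s: "additive_subgroup I (as_ring A)" by (rule ideal.axioms(1)[OF assms])
 show "const A 0 \<in> I" using additive_subgroup.zero_closed[OF s] by simp
 show add: "op2 A (+) x y \<in> I" if "x \<in> I" "y \<in> I" for x y using additive_subgroup.a_closed[OF s that] by simp
 show mul: "op2 A (*) x y \<in> I" if "x \<in> carrier A" "y \<in> I" for x y using I.I_l_closed[of y x] that by simp
 show "op2 A (-) x y \<in> I" if "x \<in> I" "y \<in> I"
  using add[OF that(1) mul[OF const_closed that(2)], of "- 1"] ring_laws(15)[of x y x] that sub by (simp add: subset_iff)
qed

lemma Idl:
 assumes "S \<subseteq> carrier A"
 shows "ideal (Idl\<^bsub>as_ring A\<^esub> S) (as_ring A)" "S \<subseteq> Idl\<^bsub>as_ring A\<^esub> S"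
  "ideal I (as_ring A) ==> S \<subseteq> I ==> Idl\<^bsub>as_ring A\<^esub> S \<subseteq> I"
proof -
 interpret R: cring "as_ring A" by (rule cring)
 show "ideal (Idl\<^bsub>as_ring A\<^esub> S) (as_ring A)" "S \<subseteq> Idl\<^bsub>as_ring A\<^esub> S"
  using assms R.genideal_ideal R.genideal_self by auto
 show "ideal I (as_ring A) ==> S \<subseteq> I ==> Idl\<^bsub>as_ring A\<^esub> S \<subseteq> I" by (rule R.genideal_minimal)
qed

lemma PIdl:
 assumes "c \<in> carrier A"
 shows "ideal (PIdl\<^bsub>as_ring A\<^esub> c) (as_ring A)" "c \<in> PIdl\<^bsub>as_ring A\<^esub> c"
  "ideal I (as_ring A) ==> c \<in> I ==> PIdl\<^bsub>as_ring A\<^esub> c \<subseteq> I"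
proof -
 interpret R: cring "as_ring A" by (rule cring)
 show "ideal (PIdl\<^bsub>as_ring A\<^esub> c) (as_ring A)" "c \<in> PIdl\<^bsub>as_ring A\<^esub> c"
  using assms R.cgenideal_ideal R.cgenideal_self by auto
 show "ideal I (as_ring A) ==> c \<in> I ==> PIdl\<^bsub>as_ring A\<^esub> c \<subseteq> I" by (rule R.cgenideal_minimal)
qed

lemma zero_ring_iff: "zero_ring A \<longleftrightarrow> const A 1 = const A 0"
proof
 assume "zero_ring A"
 then show "const A 1 = const A 0" using const_closed[of 1] unfolding zero_ring_def by auto
next
 assume e: "const A 1 = const A 0"
 have "x = const A 0" if x: "x \<in> carrier A" for x
  using ring_laws(8)[of x x x] ring_laws(11)[of x x x] x e by simp
 then show "zero_ring A" unfolding zero_ring_def using const_closed by blast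
qed

lemma Units_iff: "x \<in> Units (as_ring A) \<longleftrightarrow> x \<in> carrier A \<and> (\<exists>y\<in>carrier A. op2 A (*) x y = const A 1)"
 unfolding Units_def using ring_laws(7) by auto

lemma Units_nonvanishing:
 assumes "Sm n P" "\<And>v. v \<in> Rn n ==> P v \<noteq> 0" "\<And>i. i < n ==> a i \<in> carrier A"
 shows "app A n P a \<in> Units (as_ring A)"
proof -
 have i: "Sm n (%v. inverse (P v))" using assms by (intro smooth_inverse) auto
 have "op2 A (*) (app A n P a) (app A n (%v. inverse (P v)) a) = app A n (%v. P v * inverse (P v)) a"
  using assms i by (intro arith_app(2))
 also have "\<dots> = app A n (%v. 1) a" using assms(2) by (intro app_eqI) simp
 also have "\<dots> = const A 1" using const_app[of n a 1] assms(3) by simp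
 finally show ?thesis unfolding Units_iff using assms i by (auto intro: app_closed)
qed

lemma zero_ring_nonvanishing:
 assumes "Sm n P" "\<And>v. v \<in> Rn n ==> P v \<noteq> 0" "\<And>i. i < n ==> a i \<in> carrier A" "app A n P a = const A 0"
 shows "zero_ring A"
proof -
 have "const A 0 \<in> Units (as_ring A)" using Units_nonvanishing[of n P a] assms by simp
 then obtain y where "y \<in> carrier A" "op2 A (*) (const A 0) y = const A 1" unfolding Units_iff by blast
 then show ?thesis unfolding zero_ring_iff using ring_laws(11)[of y y y] by simp
qed

text \<open>Hadamard's lemma in one variable at a time shows that an ideal is a congruence for all operations.\<close>

lemma congruence_step:
 assumes I: "ideal I (as_ring A)" and g: "Sm n g" and l: "l < n" and a: "\<And>i. i < n ==> a i \<in> carrier A"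
  and s: "s \<in> carrier A" "op2 A (-) s (a l) \<in> I"
 shows "op2 A (-) (app A n g (a(l := s))) (app A n g a) \<in> I"
proof (rule hadamard[OF l g])
 fix H assume H: "Sm (Suc n) H" "\<And>x s. x \<in> Rn n ==> g (x(l := s)) - g x = (s - x l) * H (x(n := s))"
 \<comment> \<open>With \<open>s\<close> as an extra argument both values are taken at the same
   tuple. Hadamard's lemma then writes their difference as a multiple of the value of
   \<open>x n - x l\<close>, which lies in \<open>I\<close>.\<close>
 define b where "b = a(n := s)"
 have b: "\<And>i. i < Suc n ==> b i \<in> carrier A" using a s(1) by (auto simp: b_def less_Suc_eq)
 have bi: "app A (Suc n) (%x. x i) b = b i" if "i < Suc n" for i using app_coord[of i "Suc n" b] b that by blast
 have 1: "app A n g (a(l := s)) = app A (Suc n) (%x. g ((tuple n x)(l := x n))) b"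
 proof -
  have "app A (Suc n) (%x. g ((tuple n x)(l := x n))) b = app A n g (%j. app A (Suc n) (if j = l then (%x. x n) else (%x. x j)) b)"
  proof (rule app_comp[OF g _ b])
   fix x assume "x \<in> Rn (Suc n)"
   have "(tuple n x)(l := x n) = tuple n (%j. (if j = l then (%x. x n) else (%x. x j)) x)"
    using l by (auto simp: tuple_def fun_eq_iff)
   then show "g ((tuple n x)(l := x n)) = g (tuple n (%j. (if j = l then (%x. x n) else (%x. x j)) x))" by simp
  qed auto
  also have "\<dots> = app A n g (a(l := s))"
   using bi l a s(1) by (intro app_cong[OF g]) (auto simp: b_def)
  finally show ?thesis by simp
 qed
 have 2: "app A n g a = app A (Suc n) (%x. g (tuple n x)) b"
 proof -
  have "app A (Suc n) (%x. g (tuple n x)) b = app A n g (%j. app A (Suc n) (%x. x j) b)"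
   by (rule app_comp[OF g _ b]) auto
  also have "\<dots> = app A n g a"
   using bi a by (intro app_cong[OF g]) (auto simp: b_def)
  finally show ?thesis by simp
 qed
 have S1: "Sm (Suc n) (%x. g (tuple n x))" using Sm_comp[OF g, of "Suc n" "%j x. x j"] by simp
 have S2: "Sm (Suc n) (%x. g ((tuple n x)(l := x n)))"
 proof (rule smooth_reindex[OF g opn_Rn, of _ "%j x. if j = l then x n else x j"])
  show "Sm (Suc n) (%x. if j = l then x n else x j)" for j by (cases "j = l") simp_all
 qed (use l in auto)
 have "op2 A (-) (app A n g (a(l := s))) (app A n g a) = app A (Suc n) (%x. g ((tuple n x)(l := x n)) - g (tuple n x)) b"
  unfolding 1 2 by (rule arith_app(3)[OF S2 S1 b])
 also have "\<dots> = app A (Suc n) (%x. H x * (x n - x l)) b"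
 proof (rule app_eqI)
  fix x assume x: "x \<in> Rn (Suc n)"
  have "(tuple n x)(n := x n) = x" using x by (auto simp: tuple_def in_Rn fun_eq_iff)
  then show "g ((tuple n x)(l := x n)) - g (tuple n x) = H x * (x n - x l)"
   using H(2)[of "tuple n x" "x n"] l by simp
 qed
 also have "\<dots> = op2 A (*) (app A (Suc n) H b) (op2 A (-) (b n) (b l))"
  using arith_app(2)[where a = b, OF H(1) _ b, where h = "%x. x n - x l"]
   arith_app(3)[where a = b and n = "Suc n", OF _ _ b, where g = "%x. x n" and h = "%x. x l"] bi l by simp
 also have "\<dots> \<in> I" using idealD(4)[OF I app_closed[where a = b, OF H(1) b]] s(2) l by (simp add: b_def)
 finally show ?thesis .
qed

lemma congruence:
 assumes I: "ideal I (as_ring A)" and g: "Sm n g"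
  and a: "\<And>i. i < n ==> a i \<in> carrier A" "\<And>i. i < n ==> b i \<in> carrier A" "\<And>i. i < n ==> op2 A (-) (b i) (a i) \<in> I"
 shows "op2 A (-) (app A n g b) (app A n g a) \<in> I"
proof -
 define m where "m k = (%i. if i < k then b i else a i)" for k
 have mc: "m k i \<in> carrier A" if "i < n" for k i using a that by (simp add: m_def)
 have "op2 A (-) (app A n g (m k)) (app A n g a) \<in> I" if "k \<le> n" for k
  using that
 proof (induction k)
  case 0
  have "m 0 = a" by (simp add: m_def)
  then show ?case using idealD(2)[OF I] laws(3)[OF app_closed[OF g a(1)]] by simp
 next
  case (Suc k)
  have "m (Suc k) = (m k)(k := b k)" by (auto simp: m_def fun_eq_iff)
  then have "op2 A (-) (app A n g (m (Suc k))) (app A n g (m k)) \<in> I"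
   using congruence_step[OF I g, of k "m k" "b k"] Suc.prems mc a by (simp add: m_def)
  from idealD(3)[OF I this Suc.IH] Suc.prems show ?case
   using ring_laws(13)[of "app A n g (m (Suc k))" "app A n g (m k)" "app A n g a"] app_closed[OF g mc] app_closed[OF g a(1)] by simp
 qed
 from this[of n] have "op2 A (-) (app A n g (m n)) (app A n g a) \<in> I" by simp
 moreover have "app A n g (m n) = app A n g b" by (rule app_cong[OF g mc]) (auto simp: m_def)
 ultimately show ?thesis by simp
qed

end

section \<open>Homomorphisms and quotients\<close>

lemma chomD: "h \<in> chom A B ==> x \<in> carrier A ==> h x \<in> carrier B"
 "h \<in> chom A B ==> h \<in> extensional (carrier A)"
 by (auto simp: chom_def PiE_def)

lemma chom_app:
 "h \<in> chom A B ==> Sm n g ==> (\<And>i. i < n ==> a i \<in> carrier A) ==> h (app A n g a) = app B n g (%i. h (a i))"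
 unfolding chom_def app_def using restrict_CinfR[of n g] by blast

lemma chom_app':
 "h \<in> chom A B ==> Sm n g ==> \<forall>i<n. a i \<in> carrier A ==> h (app A n g a) = app B n g (%i. h (a i))"
 by (rule chom_app) auto

lemma chomI:
 assumes "h \<in> extensional (carrier A)" "\<And>x. x \<in> carrier A ==> h x \<in> carrier B"
  "\<And>n g a. Sm n g ==> (\<And>i. i < n ==> a i \<in> carrier A) ==> h (app A n g a) = app B n g (%i. h (a i))"
 shows "h \<in> chom A B"
 using assms unfolding chom_def by (auto simp: PiE_def cop_app CinfR_smooth)

lemma chom_op2:
 assumes "h \<in> chom A B" "Sm 2 (%v. \<beta> (v 0) (v 1))" "x \<in> carrier A" "y \<in> carrier A"
 shows "h (op2 A \<beta> x y) = op2 B \<beta> (h x) (h y)"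
 using chom_app[OF assms(1,2), of "%i. if i = 0 then x else y"] assms(3,4) by (simp add: op_app if_distrib cong: if_cong)

lemma chom_op1:
 "h \<in> chom A B ==> Sm 1 (%v. \<alpha> (v 0)) ==> x \<in> carrier A ==> h (op1 A \<alpha> x) = op1 B \<alpha> (h x)"
 unfolding op_app by (rule chom_app) auto

lemma chom_arith:
 assumes "h \<in> chom A B" "x \<in> carrier A" "y \<in> carrier A"
 shows "h (op2 A (+) x y) = op2 B (+) (h x) (h y)" "h (op2 A (*) x y) = op2 B (*) (h x) (h y)"
  "h (op2 A (-) x y) = op2 B (-) (h x) (h y)"
 using assms by (auto intro!: chom_op2)

lemma chom_const:
 assumes "h \<in> chom A B" "cinf_ring B" shows "h (const A c) = const B c"
proof -
 interpret B: cinf B by unfold_locales (rule assms)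
 have "h (const A c) = app B 0 (%v. c) (%i. h undefined)"
  unfolding op_app by (rule chom_app[OF assms(1)]) simp_all
 also have "\<dots> = const B c" unfolding op_app by (rule B.app_cong) simp_all
 finally show ?thesis .
qed

lemma chom_Units:
 assumes "h \<in> chom A B" "cinf_ring A" "cinf_ring B" "x \<in> Units (as_ring A)" shows "h x \<in> Units (as_ring B)"
proof -
 interpret A: cinf A by unfold_locales (rule assms)
 interpret B: cinf B by unfold_locales (rule assms)
 obtain y where y: "x \<in> carrier A" "y \<in> carrier A" "op2 A (*) x y = const A 1" using assms(4) A.Units_iff by blast
 then have "op2 B (*) (h x) (h y) = const B 1" using chom_arith(2)[OF assms(1) y(1,2)] chom_const[OF assms(1,3)] by simp
 then show ?thesis using B.Units_iff chomD(1)[OF assms(1)] y by blast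
qed

lemma chom_compose:
 assumes h: "h \<in> chom A B" and u: "u \<in> chom B C" and AC: "cinf_ring A" "cinf_ring C"
 shows "(\<lambda>x\<in>carrier A. u (h x)) \<in> chom A C"
proof -
 interpret A: cinf A by unfold_locales (rule AC)
 interpret C: cinf C by unfold_locales (rule AC)
 show ?thesis
 proof (rule chomI)
  fix n g a assume g: "Sm n g" and a: "\<And>i. i < n ==> a i \<in> carrier A"
  have "u (h (app A n g a)) = app C n g (%i. u (h (a i)))"
   using chom_app[OF h g a] chom_app[OF u g, of "%i. h (a i)"] chomD(1)[OF h a] by simp
  also have "\<dots> = app C n g (%i. (\<lambda>x\<in>carrier A. u (h x)) (a i))"
   using a chomD(1)[OF u chomD(1)[OF h]] by (intro C.app_cong[OF g]) auto
  finally show "(\<lambda>x\<in>carrier A. u (h x)) (app A n g a) = app C n g (%i. (\<lambda>x\<in>carrier A. u (h x)) (a i))"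
   using A.app_closed[OF g a] by simp
 qed (use chomD(1)[OF h] chomD(1)[OF u] in auto)
qed

definition ker :: "'a cinf => 'b cinf => ('a => 'b) => 'a set" where
 "ker A B h = {x \<in> carrier A. h x = const B 0}"

lemma ker_ideal:
 assumes "h \<in> chom A B" "cinf_ring A" "cinf_ring B" shows "ideal (ker A B h) (as_ring A)"
proof -
 interpret A: cinf A by unfold_locales (rule assms)
 interpret B: cinf B by unfold_locales (rule assms)
 note h = assms(1)
 show ?thesis
 proof (rule A.idealI')
  show "const A 0 \<in> ker A B h" using chom_const[OF h assms(3)] by (simp add: ker_def)
  show "op2 A (+) x y \<in> ker A B h" if "x \<in> ker A B h" "y \<in> ker A B h" for x y
   using that chom_arith(1)[OF h, of x y] by (auto simp: ker_def)
  show "op2 A (*) x y \<in> ker A B h" if "x \<in> carrier A" "y \<in> ker A B h" for x y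
   using that chom_arith(2)[OF h, of x y] chomD(1)[OF h]
   by (auto simp: ker_def)
 qed (auto simp: ker_def)
qed

lemma hom_eq_iff_ker:
 assumes "h \<in> chom A B" "cinf_ring A" "cinf_ring B" "x \<in> carrier A" "y \<in> carrier A"
 shows "h x = h y \<longleftrightarrow> op2 A (-) x y \<in> ker A B h"
proof -
 interpret A: cinf A by unfold_locales (rule assms)
 interpret B: cinf B by unfold_locales (rule assms)
 have c: "h x \<in> carrier B" "h y \<in> carrier B" using chomD(1)[OF assms(1)] assms by auto
 have "h (op2 A (-) x y) = op2 B (-) (h x) (h y)" by (rule chom_arith(3)[OF assms(1,4,5)])
 moreover have "op2 B (-) (h x) (h y) = const B 0 \<longleftrightarrow> h x = h y"
  using B.ring_laws(4)[of "h y" "h x" "h y"] c by auto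
 ultimately show ?thesis using assms(4,5) by (simp add: ker_def)
qed

text \<open>Arguments in \<open>Q\<close> lift to \<open>A\<close>, where the laws hold;
  \<open>cong\<close> makes the operations of \<open>Q\<close> depend on the first \<open>n\<close>
  arguments only.\<close>

lemma cinf_ring_image:
 assumes A: "cinf_ring A" and p: "p ` carrier A = carrier Q"
  and hom: "\<And>n g a. g \<in> carrier (CinfR n) ==> (\<And>i. i < n ==> a i \<in> carrier A) ==> p (cop A n g a) = cop Q n g (%i. p (a i))"
  and cong: "\<And>n g a b. g \<in> carrier (CinfR n) ==> (\<And>i. i < n ==> a i \<in> carrier Q) ==> (\<And>i. i < n ==> a i = b i) ==> cop Q n g a = cop Q n g b"
 shows "cinf_ring Q"
proof -
 interpret A: cinf A by unfold_locales (rule A)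
 have lift: "\<exists>b. (\<forall>i<n. b i \<in> carrier A \<and> p (b i) = a i)" if "\<forall>i<n. a i \<in> carrier Q" for n :: nat and a
 proof -
  have "\<forall>i. \<exists>b. i < n --> b \<in> carrier A \<and> p b = a i" using that p by (metis imageE)
  then show ?thesis by metis
 qed
 have cop: "\<exists>b. (\<forall>i<n. b i \<in> carrier A \<and> p (b i) = a i) \<and> (\<forall>g. g \<in> carrier (CinfR n) --> cop Q n g a = p (cop A n g b) \<and> cop A n g b \<in> carrier A)"
  if a: "\<forall>i<n. a i \<in> carrier Q" for n a
 proof -
  obtain b where b: "\<And>i. i < n ==> b i \<in> carrier A \<and> p (b i) = a i" using lift[OF a] by blast
  have "cop Q n g a = p (cop A n g b) \<and> cop A n g b \<in> carrier A" if g: "g \<in> carrier (CinfR n)" for g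
  proof -
   have "app A n g b \<in> carrier A" using b by (intro A.app_closed CinfR_smooth[OF g]) blast
   moreover have "cop Q n g a = cop Q n g (%i. p (b i))" using a b by (intro cong[OF g]) auto
   moreover have "p (cop A n g b) = cop Q n g (%i. p (b i))" using b by (intro hom[OF g]) blast
   ultimately show ?thesis by (simp add: cop_app[OF g])
  qed
  then show ?thesis using b by blast
 qed
 show ?thesis unfolding cinf_ring_def
 proof (intro conjI allI impI; (elim conjE)?)
  fix n g a assume g: "g \<in> carrier (CinfR n)" and a: "\<forall>i<n. a i \<in> carrier Q"
  show "cop Q n g a \<in> carrier Q" using cop[OF a] g p by (metis imageI)
 next
  fix n g a b assume g: "g \<in> carrier (CinfR n)" and a: "\<forall>i<n. a i \<in> carrier Q \<and> a i = b i"
  then show "cop Q n g a = cop Q n g b" by (intro cong) auto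
 next
  fix n :: nat and a i assume i: "i < n" and a: "\<forall>j<n. a j \<in> carrier Q"
  obtain b where b: "\<And>i. i < n ==> b i \<in> carrier A \<and> p (b i) = a i"
   "\<And>g. g \<in> carrier (CinfR n) ==> cop Q n g a = p (cop A n g b)" using cop[OF a] by blast
  have "cop Q n (\<lambda>x\<in>Rn n. x i) a = p (app A n (%x. x i) b)"
   using b(2)[of "\<lambda>x\<in>Rn n. x i"] restrict_CinfR[of n "%x. x i"] by (simp add: app_def)
  then show "cop Q n (\<lambda>x\<in>Rn n. x i) a = a i" using A.app_coord[OF i, of b] b(1) i by simp
 next
  fix m n f g a assume f: "f \<in> carrier (CinfR m)" and g: "\<forall>j<m. g j \<in> carrier (CinfR n)" and a: "\<forall>i<n. a i \<in> carrier Q"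
  obtain b where b: "\<And>i. i < n ==> b i \<in> carrier A \<and> p (b i) = a i"
   "\<And>g. g \<in> carrier (CinfR n) ==> cop Q n g a = p (cop A n g b) \<and> cop A n g b \<in> carrier A" using cop[OF a] by blast
  have S: "Sm m f" "\<And>j. j < m ==> Sm n (g j)" using f g CinfR_smooth by blast+
  have gf: "(\<lambda>x\<in>Rn n. f (tuple m (%j. g j x))) \<in> carrier (CinfR n)" using Sm_comp[OF S] by simp
  have "cop A n (\<lambda>x\<in>Rn n. f (tuple m (%j. g j x))) b = app A n (%x. f (tuple m (%j. g j x))) b" by (simp add: app_def)
  also have "\<dots> = app A m f (%j. app A n (g j) b)" using b by (intro A.app_comp S) auto
  also have "\<dots> = cop A m f (%j. cop A n (g j) b)"
   unfolding cop_app[OF f] using S b g by (intro A.app_cong) (auto simp: cop_app intro: A.app_closed)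
  finally have "cop Q n (\<lambda>x\<in>Rn n. f (tuple m (%j. g j x))) a = p (cop A m f (%j. cop A n (g j) b))"
   using b(2)[OF gf] by simp
  also have "\<dots> = cop Q m f (%j. p (cop A n (g j) b))" using f b(2) g by (intro hom) auto
  also have "\<dots> = cop Q m f (%j. cop Q n (g j) a)" using f b(2) g p by (intro cong) auto
  finally show "cop Q n (\<lambda>x\<in>Rn n. f (tuple m (%j. g j x))) a = cop Q m f (%j. cop Q n (g j) a)" .
 qed
qed

text \<open>\<open>quot\<close> chooses representatives by \<open>SOME\<close>. They differ from the
  given ones by elements of \<open>I\<close>, and \<open>congruence\<close> makes the choice
  irrelevant.\<close>

lemma quot_basics:
 assumes A: "cinf_ring A" and I: "ideal I (as_ring A)"
 shows "cinf_ring (quot A I)" "quot_map A I \<in> chom A (quot A I)" "quot_map A I ` carrier A = carrier (quot A I)"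
  "ker A (quot A I) (quot_map A I) = I"
proof -
 interpret A: cinf A by unfold_locales (rule A)
 interpret R: cring "as_ring A" by (rule A.cring)
 interpret I: ideal I "as_ring A" by (rule I)
 let ?p = "quot_map A I"
 have eq: "?p x = ?p y \<longleftrightarrow> op2 A (-) x y \<in> I" if "x \<in> carrier A" "y \<in> carrier A" for x y
  using R.quotient_eq_iff_same_a_r_cos[OF I, of x y] A.minus_eq that by (simp add: quot_map_def)
 show im: "?p ` carrier A = carrier (quot A I)"
  by (auto simp: quot_map_def quot_def A_RCOSETS_def')
 have some: "(SOME y. y \<in> ?p x) \<in> carrier A \<and> op2 A (-) (SOME y. y \<in> ?p x) x \<in> I" if x: "x \<in> carrier A" for x
 proof -
  have "x \<in> ?p x" using I.a_rcos_self[of x] x by (simp add: quot_map_def)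
  then have s: "(SOME y. y \<in> ?p x) \<in> ?p x" by (rule someI)
  then have s': "(SOME y. y \<in> ?p x) \<in> I +>\<^bsub>as_ring A\<^esub> x" using x by (simp add: quot_map_def)
  then obtain i where i: "i \<in> I" "(SOME y. y \<in> ?p x) = op2 A (+) i x"
   by (auto simp: a_r_coset_def' )
  then have "i \<in> carrier A" using A.idealD(1)[OF I] by blast
  then show ?thesis unfolding i(2) using i(1) x A.ring_laws(17)[of i x x] by simp
 qed
 have hom: "?p (cop A n g a) = cop (quot A I) n g (%i. ?p (a i))"
  if g: "g \<in> carrier (CinfR n)" and a: "\<And>i. i < n ==> a i \<in> carrier A" for n g a
 proof -
  let ?b = "%i. SOME y. y \<in> ?p (a i)"
  have b: "\<And>i. i < n ==> ?b i \<in> carrier A" "\<And>i. i < n ==> op2 A (-) (?b i) (a i) \<in> I" using some a by blast+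
  have S: "Sm n g" by (rule CinfR_smooth[OF g])
  have "op2 A (-) (app A n g ?b) (app A n g a) \<in> I" by (rule A.congruence[OF I S a b])
  then have "?p (app A n g ?b) = ?p (app A n g a)" using eq A.app_closed[where a = ?b, OF S b(1)] A.app_closed[where a = a, OF S a] by blast
  moreover have "cop (quot A I) n g (%i. ?p (a i)) = ?p (app A n g ?b)"
   using A.app_closed[where a = ?b, OF S b(1)] by (simp add: quot_def quot_map_def cop_app[OF g])
  ultimately show ?thesis by (simp add: cop_app[OF g])
 qed
 show Q: "cinf_ring (quot A I)"
 proof (rule cinf_ring_image[OF A im hom])
  fix n g and a b :: "nat => 'a set"
  assume g: "g \<in> carrier (CinfR n)" and a: "\<And>i. i < n ==> a i \<in> carrier (quot A I)" and ab: "\<And>i. i < n ==> a i = b i"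
  have "(SOME x. x \<in> a i) \<in> carrier A" if i: "i < n" for i
  proof -
   obtain x where "x \<in> carrier A" "a i = ?p x" using a[OF i] im by blast
   then show ?thesis using some[of x] by simp
  qed
  then have "app A n g (%i. SOME x. x \<in> a i) = app A n g (%i. SOME x. x \<in> b i)"
   using ab by (intro A.app_cong CinfR_smooth[OF g]) auto
  then show "cop (quot A I) n g a = cop (quot A I) n g b" by (simp add: quot_def cop_app[OF g])
 qed
 show p: "?p \<in> chom A (quot A I)"
  unfolding chom_def using im hom by (auto simp: quot_map_def)
 have "const (quot A I) 0 = ?p (const A 0)" using chom_const[OF p Q] by simp
 then show "ker A (quot A I) ?p = I"
  using eq[OF _ A.const_closed, of _ 0] A.ring_laws(12) I.a_subset by (auto simp: ker_def)
qed

lemma chom_factor: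
 assumes A: "cinf_ring A" "cinf_ring Q" "cinf_ring T" and p: "p \<in> chom A Q" "p ` carrier A = carrier Q"
  and t: "t \<in> chom A T" and k: "ker A Q p \<subseteq> ker A T t"
 shows "\<exists>u\<in>chom Q T. \<forall>x\<in>carrier A. u (p x) = t x"
proof -
 interpret A: cinf A by unfold_locales (rule A)
 interpret T: cinf T by unfold_locales (rule A)
 interpret Q: cinf Q by unfold_locales (rule A)
 define s where "s y = (SOME x. x \<in> carrier A \<and> p x = y)" for y
 have s: "s y \<in> carrier A \<and> p (s y) = y" if "y \<in> carrier Q" for y
 proof -
  have "y \<in> p ` carrier A" using that p(2) by simp
  then obtain x where "x \<in> carrier A \<and> p x = y" by (elim imageE) simp
  then show ?thesis unfolding s_def by (rule someI)
 qed
 define u where "u = (\<lambda>y\<in>carrier Q. t (s y))"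
 have up: "u (p x) = t x" if x: "x \<in> carrier A" for x
 proof -
  have px: "p x \<in> carrier Q" using chomD(1)[OF p(1) x] .
  have "op2 A (-) (s (p x)) x \<in> ker A Q p" using hom_eq_iff_ker[OF p(1) A(1,2), of "s (p x)" x] s[OF px] x by simp
  then have "t (s (p x)) = t x" using hom_eq_iff_ker[OF t A(1,3), of "s (p x)" x] s[OF px] x k by blast
  then show ?thesis using px by (simp add: u_def)
 qed
 have "u \<in> chom Q T"
 proof (rule chomI)
  fix n g a assume g: "Sm n g" and a: "\<And>i. i < n ==> a i \<in> carrier Q"
  have sa: "\<And>i. i < n ==> s (a i) \<in> carrier A" using s a by blast
  have "app Q n g a = app Q n g (%i. p (s (a i)))" using s a by (intro Q.app_cong g) auto
  also have "\<dots> = p (app A n g (%i. s (a i)))" using chom_app[OF p(1) g sa] by simp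
  finally have "u (app Q n g a) = t (app A n g (%i. s (a i)))" using up A.app_closed[OF g sa] by simp
  also have "\<dots> = app T n g (%i. t (s (a i)))" by (rule chom_app[OF t g sa])
  also have "\<dots> = app T n g (%i. u (a i))"
   using a chomD(1)[OF t sa] by (intro T.app_cong g) (auto simp: u_def)
  finally show "u (app Q n g a) = app T n g (%i. u (a i))" .
 qed (use s chomD(1)[OF t] in \<open>auto simp: u_def\<close>)
 then show ?thesis using up by blast
qed

lemma chom_eqI:
 assumes "u \<in> chom Q T" "v \<in> chom Q T" "\<And>y. y \<in> carrier Q ==> u y = v y" shows "u = v"
 using assms chomD(2) extensionalityI by metis

lemma chom_id: "(\<lambda>x\<in>carrier A. x) \<in> chom A A" if "cinf_ring A"
proof -
 interpret A: cinf A by unfold_locales (rule that)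
 show ?thesis by (rule chomI) (auto intro: A.app_closed A.app_cong)
qed

lemma ciso_of_equal_ker:
 assumes A: "cinf_ring A" "cinf_ring Q" "cinf_ring T" and p: "p \<in> chom A Q" "p ` carrier A = carrier Q"
  and t: "t \<in> chom A T" "t ` carrier A = carrier T" and k: "ker A Q p = ker A T t"
 shows "\<exists>u\<in>ciso Q T. \<forall>x\<in>carrier A. u (p x) = t x"
proof -
 obtain u where u: "u \<in> chom Q T" "\<forall>x\<in>carrier A. u (p x) = t x" using chom_factor[OF A p t(1)] k by blast
 have "inj_on u (carrier Q)"
 proof (rule inj_onI)
  fix y z assume "y \<in> carrier Q" "z \<in> carrier Q" and e: "u y = u z"
  then obtain a b where ab: "a \<in> carrier A" "b \<in> carrier A" "y = p a" "z = p b" using p(2) by blast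
  then have "t a = t b" using e u(2) by simp
  then show "y = z" using hom_eq_iff_ker[OF t(1) A(1,3) ab(1,2)] hom_eq_iff_ker[OF p(1) A(1,2) ab(1,2)] k ab by simp
 qed
 moreover have "u ` carrier Q = carrier T" unfolding p(2)[symmetric] t(2)[symmetric] image_image using u(2) by simp
 ultimately show ?thesis using u unfolding ciso_def bij_betw_def by blast
qed

lemma ciso_inverse:
 assumes A: "cinf_ring A" "cinf_ring B" and h: "h \<in> ciso A B"
 shows "\<exists>v\<in>ciso B A. (\<forall>x\<in>carrier A. v (h x) = x) \<and> (\<forall>y\<in>carrier B. h (v y) = y)"
proof -
 have hc: "h \<in> chom A B" and hs: "h ` carrier A = carrier B" and hi: "inj_on h (carrier A)" using h by (auto simp: ciso_def bij_betw_def)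
 interpret A: cinf A by unfold_locales (rule A)
 have "h x = const B 0 \<longleftrightarrow> x = const A 0" if "x \<in> carrier A" for x
  using inj_on_eq_iff[OF hi that A.const_closed[of 0]] chom_const[OF hc A(2), of 0] by simp
 then have "ker A B h = ker A A (\<lambda>x\<in>carrier A. x)" unfolding ker_def by (intro Collect_cong) auto
 moreover have "(\<lambda>x\<in>carrier A. x) ` carrier A = carrier A" by simp
 ultimately have "\<exists>v\<in>ciso B A. \<forall>x\<in>carrier A. v (h x) = (\<lambda>x\<in>carrier A. x) x"
  using ciso_of_equal_ker[OF A(1,2,1) hc hs chom_id[OF A(1)]] by simp
 then obtain v where v: "v \<in> ciso B A" "\<And>x. x \<in> carrier A ==> v (h x) = x" by auto
 have "h (v y) = y" if "y \<in> carrier B" for y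
 proof -
  have "y \<in> h ` carrier A" using that hs by simp
  then show ?thesis using v(2) by (elim imageE) simp
 qed
 then show ?thesis using v by (intro bexI[of _ v] conjI ballI) simp_all
qed

section \<open>Finite generation, quotients and localizations\<close>

lemma function_cinf_simps [simp]: "carrier (function_cinf P F) = F"
 by (simp add: function_cinf_def)

lemma app_function_cinf: "app (function_cinf P F) n g a = (\<lambda>p\<in>P. g (tuple n (%i. a i p)))"
 by (rule ext) (simp add: app_def function_cinf_def)

lemma function_cinf_ring:
 assumes F: "F \<subseteq> extensional P"
  and closed: "\<And>n g a. Sm n g ==> (\<And>i. i < n ==> a i \<in> F) ==> (\<lambda>p\<in>P. g (tuple n (%i. a i p))) \<in> F"
 shows "cinf_ring (function_cinf P F)"
 unfolding cinf_ring_def function_cinf_simps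
proof (intro conjI allI impI; (elim conjE)?)
 fix n g and a :: "nat => 'a => real" assume "g \<in> carrier (CinfR n)" "\<forall>i<n. a i \<in> F"
 then show "cop (function_cinf P F) n g a \<in> F"
  using closed[of n g a] CinfR_smooth by (simp add: function_cinf_def)
next
 fix n g and a b :: "nat => 'a => real" assume "\<forall>i<n. a i \<in> F \<and> a i = b i"
 then have "tuple n (%i. a i p) = tuple n (%i. b i p)" for p by (auto simp: tuple_def)
 then show "cop (function_cinf P F) n g a = cop (function_cinf P F) n g b" by (simp add: function_cinf_def)
next
 fix n i :: nat and a :: "nat => 'a => real" assume i: "i < n" and "\<forall>j<n. a j \<in> F"
 then have "a i \<in> extensional P" using F by blast
 then show "cop (function_cinf P F) n (\<lambda>x\<in>Rn n. x i) a = a i"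
  using i by (auto simp: function_cinf_def fun_eq_iff extensional_def)
next
 fix m n f g and a :: "nat => 'a => real"
 have "tuple m (%j. (\<lambda>p\<in>P. g j (tuple n (%i. a i p))) p) = tuple m (%j. g j (tuple n (%i. a i p)))" if "p \<in> P" for p
  using that by simp
 then show "cop (function_cinf P F) n (\<lambda>x\<in>Rn n. f (tuple m (%j. g j x))) a =
   cop (function_cinf P F) m f (%j. cop (function_cinf P F) n (g j) a)"
  by (auto simp: function_cinf_def fun_eq_iff)
qed

lemma CinfR_ring: "cinf_ring (CinfR n)"
 unfolding CinfR_def
proof (rule function_cinf_ring)
 fix m g and a :: "nat => (nat => real) => real"
 assume g: "Sm m g" and a: "\<And>i. i < m ==> a i \<in> {f \<in> extensional (Rn n). Sm n f}"
 then have "Sm n (%p. g (tuple m (%i. a i p)))" by (intro Sm_comp) auto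
 then show "(\<lambda>p\<in>Rn n. g (tuple m (%i. a i p))) \<in> {f \<in> extensional (Rn n). Sm n f}"
  using restrict_CinfR[of n "%p. g (tuple m (%i. a i p))"] carrier_CinfR by auto
qed auto

lemma app_CinfR: "app (CinfR n) m g a = (\<lambda>x\<in>Rn n. g (tuple m (%i. a i x)))"
 unfolding CinfR_def by (rule app_function_cinf)

lemma ops_CinfR:
 "op2 (CinfR n) \<beta> f g = (\<lambda>x\<in>Rn n. \<beta> (f x) (g x))" "const (CinfR n) c = (\<lambda>x\<in>Rn n. c)"
 by (simp_all add: op_app app_CinfR)

definition coord :: "nat => nat => (nat => real) => real" where
 "coord n i = (\<lambda>x\<in>Rn n. x i)"

lemma coord_CinfR [simp]: "coord n i \<in> carrier (CinfR n)"
 by (simp add: coord_def)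

lemma app_coords:
 assumes "g \<in> carrier (CinfR n)" shows "app (CinfR n) n g (coord n) = g"
proof -
 have "app (CinfR n) n g (coord n) x = g x" for x
 proof (cases "x \<in> Rn n")
  case True
  then have "tuple n (%i. coord n i x) = x" by (auto simp: coord_def tuple_def in_Rn fun_eq_iff)
  then show ?thesis using True by (simp add: app_CinfR)
 next
  case False
  then show ?thesis using assms by (simp add: app_CinfR carrier_CinfR extensional_def)
 qed
 then show ?thesis by blast
qed

definition ev :: "'a cinf => nat => (nat => 'a) => ((nat => real) => real) => 'a" where
 "ev A n a = (\<lambda>g\<in>carrier (CinfR n). app A n g a)"

lemma ev_restrict [simp]: "Sm n g ==> ev A n a (restrict g (Rn n)) = app A n g a"
 unfolding ev_def by (simp, rule app_eqI) simp

definition generates :: "'a cinf => nat => (nat => 'a) => bool" where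
 "generates A n a \<longleftrightarrow> (\<forall>i<n. a i \<in> carrier A) \<and> (\<forall>b\<in>carrier A. \<exists>g. Sm n g \<and> b = app A n g a)"

lemma generatesD:
 "generates A n a ==> \<forall>i<n. a i \<in> carrier A" "generates A n a ==> b \<in> carrier A ==> \<exists>g. Sm n g \<and> b = app A n g a"
 unfolding generates_def by blast+

context cinf
begin

lemma app_coord': "i < n ==> \<forall>j<n. a j \<in> carrier A ==> app A n (%x. x i) a = a i"
 by (rule app_coord) auto

lemma ev_chom:
 assumes a: "\<And>i. i < n ==> a i \<in> carrier A" shows "ev A n a \<in> chom (CinfR n) A"
proof (rule chomI)
 show "ev A n a \<in> extensional (carrier (CinfR n))" by (simp add: ev_def)
 show "ev A n a g \<in> carrier A" if "g \<in> carrier (CinfR n)" for g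
  using that app_closed[OF CinfR_smooth[OF that] a] by (simp add: ev_def)
 fix m g b assume g: "Sm m g" and b: "\<And>j. j < m ==> b j \<in> carrier (CinfR n)"
 have bs: "\<And>j. j < m ==> Sm n (b j)" using b CinfR_smooth by blast
 have "ev A n a (app (CinfR n) m g b) = app A n (%x. g (tuple m (%j. b j x))) a"
  unfolding app_CinfR by (rule ev_restrict) (rule Sm_comp[OF g bs])
 also have "\<dots> = app A m g (%j. app A n (b j) a)" by (rule app_comp[OF g bs a]) auto
 also have "\<dots> = app A m g (%j. ev A n a (b j))"
  using b app_closed[OF bs a] by (intro app_cong g) (auto simp: ev_def)
 finally show "ev A n a (app (CinfR n) m g b) = app A m g (%j. ev A n a (b j))" .
qed

lemma generates_surj:
 assumes "generates A n a" shows "ev A n a ` carrier (CinfR n) = carrier A"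
proof
 show "ev A n a ` carrier (CinfR n) \<subseteq> carrier A"
  using chomD(1)[OF ev_chom] assms by (auto simp: generates_def)
 show "carrier A \<subseteq> ev A n a ` carrier (CinfR n)"
 proof
  fix b assume "b \<in> carrier A"
  then obtain g where "Sm n g" "b = app A n g a" using assms by (auto simp: generates_def)
  then show "b \<in> ev A n a ` carrier (CinfR n)" by (intro image_eqI[of _ _ "restrict g (Rn n)"]) simp_all
 qed
qed

lemma app_extend:
 assumes g: "Sm n g" and b: "\<And>i. i < n ==> b i \<in> carrier A" "y \<in> carrier A"
 shows "app A (Suc n) (%z. g (tuple n z)) (b(n := y)) = app A n g b"
proof -
 have c: "\<And>i. i < Suc n ==> (b(n := y)) i \<in> carrier A" using b by (auto simp: less_Suc_eq)
 have "app A (Suc n) (%z. g (tuple n z)) (b(n := y)) = app A n g (%j. app A (Suc n) (%z. z j) (b(n := y)))"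
  by (rule app_comp[OF g _ c]) auto
 also have "\<dots> = app A n g b"
 proof (rule app_cong[OF g])
  fix j assume j: "j < n"
  have "\<forall>i<Suc n. (b(n := y)) i \<in> carrier A" using c by blast
  then show *: "app A (Suc n) (%z. z j) (b(n := y)) = b j" using app_coord'[of j "Suc n" "b(n := y)"] j by simp
  show "app A (Suc n) (%z. z j) (b(n := y)) \<in> carrier A" unfolding * using b j by blast
 qed simp
 finally show ?thesis .
qed

lemma app_extend':
 "Sm n g ==> \<forall>i<n. b i \<in> carrier A ==> y \<in> carrier A ==> app A (Suc n) (%z. g (tuple n z)) (b(n := y)) = app A n g b"
 by (rule app_extend) auto

end

lemma Sm_extend: "Sm n g ==> Sm (Suc n) (%z. g (tuple n z))"
 using Sm_comp[of n g "Suc n" "%j z. z j"] by simp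

lemma quot_CinfR_generates:
 assumes "ideal I (as_ring (CinfR n))"
 shows "generates (quot (CinfR n) I) n (%i. quot_map (CinfR n) I (coord n i))"
  "g \<in> carrier (CinfR n) ==> quot_map (CinfR n) I g = app (quot (CinfR n) I) n g (%i. quot_map (CinfR n) I (coord n i))"
proof -
 note q = quot_basics[OF CinfR_ring assms]
 show *: "quot_map (CinfR n) I g = app (quot (CinfR n) I) n g (%i. quot_map (CinfR n) I (coord n i))"
  if "g \<in> carrier (CinfR n)" for g
  using chom_app[OF q(2) CinfR_smooth[OF that], of "coord n"] app_coords[OF that] by simp
 show "generates (quot (CinfR n) I) n (%i. quot_map (CinfR n) I (coord n i))"
  unfolding generates_def
 proof (intro conjI allI impI ballI)
  show "quot_map (CinfR n) I (coord n i) \<in> carrier (quot (CinfR n) I)" for i by (rule chomD(1)[OF q(2)]) simp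
  fix b assume "b \<in> carrier (quot (CinfR n) I)"
  then obtain g where "g \<in> carrier (CinfR n)" "b = quot_map (CinfR n) I g" using q(3) by blast
  then show "\<exists>g. Sm n g \<and> b = app (quot (CinfR n) I) n g (%i. quot_map (CinfR n) I (coord n i))"
   using * CinfR_smooth by blast
 qed
qed

text \<open>Generators, unlike a chosen presentation as a quotient, are easily carried along
  surjections and localizations.\<close>

lemma scheme_iff: "cinf_scheme A \<longleftrightarrow> cinf_ring A \<and> (\<exists>n a. generates A n a)"
proof
 assume "cinf_scheme A"
 then obtain n I h where A: "cinf_ring A" and I: "ideal I (as_ring (CinfR n))" and h: "h \<in> ciso A (quot (CinfR n) I)"
  unfolding cinf_scheme_def by blast
 note q = quot_basics[OF CinfR_ring I]
 obtain v where v: "v \<in> ciso (quot (CinfR n) I) A" "\<forall>x\<in>carrier A. v (h x) = x"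
  using ciso_inverse[OF A q(1) h] by blast
 have vc: "v \<in> chom (quot (CinfR n) I) A" and hc: "h \<in> chom A (quot (CinfR n) I)" using v(1) h by (auto simp: ciso_def)
 define a where "a i = quot_map (CinfR n) I (coord n i)" for i
 have g: "generates (quot (CinfR n) I) n a" unfolding a_def by (rule quot_CinfR_generates(1)[OF I])
 have "generates A n (%i. v (a i))"
  unfolding generates_def
 proof (intro conjI allI impI ballI)
  show "v (a i) \<in> carrier A" if "i < n" for i using g that chomD(1)[OF vc] by (auto simp: generates_def)
  fix b assume b: "b \<in> carrier A"
  obtain f where "Sm n f" "h b = app (quot (CinfR n) I) n f a" using generatesD(2)[OF g chomD(1)[OF hc b]] by blast
  then have "b = app A n f (%i. v (a i))"
   using chom_app'[OF vc _ generatesD(1)[OF g], of f] v(2) b by metis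
  then show "\<exists>g. Sm n g \<and> b = app A n g (%i. v (a i))" using \<open>Sm n f\<close> by blast
 qed
 then show "cinf_ring A \<and> (\<exists>n a. generates A n a)" using A by blast
next
 assume "cinf_ring A \<and> (\<exists>n a. generates A n a)"
 then obtain n a where A: "cinf_ring A" and g: "generates A n a" by blast
 interpret A: cinf A by unfold_locales (rule A)
 have e: "ev A n a \<in> chom (CinfR n) A" using g by (intro A.ev_chom) (auto simp: generates_def)
 let ?I = "ker (CinfR n) A (ev A n a)"
 have I: "ideal ?I (as_ring (CinfR n))" by (rule ker_ideal[OF e CinfR_ring A])
 note q = quot_basics[OF CinfR_ring I]
 obtain u where "u \<in> ciso A (quot (CinfR n) ?I)"
  using ciso_of_equal_ker[OF CinfR_ring A q(1) e A.generates_surj[OF g] q(2,3)] q(4) by blast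
 then show "cinf_scheme A" unfolding cinf_scheme_def using A I by blast
qed

lemma schemeD: "cinf_scheme A ==> cinf_ring A"
 by (simp add: cinf_scheme_def)

lemma scheme_image:
 assumes A: "cinf_scheme A" and B: "cinf_ring B" and h: "h \<in> chom A B" "h ` carrier A = carrier B"
 shows "cinf_scheme B"
proof -
 obtain n a where g: "generates A n a" using A scheme_iff by blast
 have "generates B n (%i. h (a i))"
  unfolding generates_def
 proof (intro conjI allI impI ballI)
  show "h (a i) \<in> carrier B" if "i < n" for i using g that chomD(1)[OF h(1)] by (auto simp: generates_def)
  fix b assume "b \<in> carrier B"
  then obtain x where x: "x \<in> carrier A" "b = h x" using h(2) by blast
  then obtain f where "Sm n f" "x = app A n f a" using g by (auto simp: generates_def)
  then show "\<exists>g. Sm n g \<and> b = app B n g (%i. h (a i))"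
   using chom_app'[OF h(1), of n f a] x g by (intro exI[of _ f]) (auto simp: generates_def)
 qed
 then show ?thesis using B scheme_iff by blast
qed

text \<open>A copy, in the type of test objects, of the subring generated by finitely many elements.
  It makes universal properties applicable to subrings: this is how localizations and limits are
  shown to be generated by what they should be.\<close>

lemma subring_std:
 assumes B: "cinf_ring B" and a: "\<And>i. i < n ==> a i \<in> carrier B"
 obtains T :: "std cinf" and j where "cinf_scheme T" "j \<in> chom T B" "inj_on j (carrier T)"
  "j ` carrier T = {app B n g a | g. Sm n g}"
proof -
 interpret B: cinf B by unfold_locales (rule B)
 have e: "ev B n a \<in> chom (CinfR n) B" by (rule B.ev_chom[OF a])
 let ?I = "ker (CinfR n) B (ev B n a)" and ?p = "quot_map (CinfR n) (ker (CinfR n) B (ev B n a))"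
 have I: "ideal ?I (as_ring (CinfR n))" by (rule ker_ideal[OF e CinfR_ring B])
 note q = quot_basics[OF CinfR_ring I]
 obtain j where j: "j \<in> chom (quot (CinfR n) ?I) B" "\<forall>g\<in>carrier (CinfR n). j (?p g) = ev B n a g"
  using chom_factor[OF CinfR_ring q(1) B q(2,3) e] q(4) by blast
 show thesis
 proof (rule that[of "quot (CinfR n) ?I" j])
  show "cinf_scheme (quot (CinfR n) ?I)" using scheme_iff q(1) quot_CinfR_generates(1)[OF I] by blast
  show "inj_on j (carrier (quot (CinfR n) ?I))"
  proof (rule inj_onI)
   fix x y assume "x \<in> carrier (quot (CinfR n) ?I)" "y \<in> carrier (quot (CinfR n) ?I)" and e': "j x = j y"
   then have "x \<in> ?p ` carrier (CinfR n)" "y \<in> ?p ` carrier (CinfR n)" using q(3) by simp_all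
   then obtain f g where fg: "f \<in> carrier (CinfR n)" "g \<in> carrier (CinfR n)" "x = ?p f" "y = ?p g" by (elim imageE)
   then show "x = y" using e' j(2) hom_eq_iff_ker[OF e CinfR_ring B fg(1,2)] hom_eq_iff_ker[OF q(2) CinfR_ring q(1) fg(1,2)] q(4) by simp
  qed
  have "j ` carrier (quot (CinfR n) ?I) = ev B n a ` carrier (CinfR n)"
   unfolding q(3)[symmetric] image_image using j(2) by simp
  also have "\<dots> = {app B n g a | g. Sm n g}"
  proof
   show "ev B n a ` carrier (CinfR n) \<subseteq> {app B n g a | g. Sm n g}" using CinfR_smooth by (auto simp: ev_def)
   show "{app B n g a | g. Sm n g} \<subseteq> ev B n a ` carrier (CinfR n)"
   proof
    fix y assume "y \<in> {app B n g a | g. Sm n g}"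
    then obtain g where "Sm n g" "y = app B n g a" by blast
    then show "y \<in> ev B n a ` carrier (CinfR n)" by (intro image_eqI[of _ _ "restrict g (Rn n)"]) simp_all
   qed
  qed
  finally show "j ` carrier (quot (CinfR n) ?I) = {app B n g a | g. Sm n g}" .
 qed (rule j(1))
qed

lemma scheme_std:
 assumes A: "cinf_scheme A"
 obtains T :: "std cinf" and h where "cinf_scheme T" "h \<in> ciso A T"
proof -
 obtain n I h where I: "ideal I (as_ring (CinfR n))" and h: "h \<in> ciso A (quot (CinfR n) I)"
  using A unfolding cinf_scheme_def by blast
 have "cinf_scheme (quot (CinfR n) I)" using scheme_iff quot_basics(1)[OF CinfR_ring I] quot_CinfR_generates(1)[OF I] by blast
 then show thesis using h that by blast
qed

lemma chom_lift:
 assumes j: "j \<in> chom T B" "inj_on j (carrier T)" and h: "h \<in> chom C B" "h ` carrier C \<subseteq> j ` carrier T"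
  and R: "cinf_ring T" "cinf_ring B" "cinf_ring C"
 shows "\<exists>k\<in>chom C T. \<forall>x\<in>carrier C. j (k x) = h x"
proof -
 interpret T: cinf T by unfold_locales (rule R)
 interpret C: cinf C by unfold_locales (rule R)
 interpret B: cinf B by unfold_locales (rule R)
 define k where "k = (\<lambda>x\<in>carrier C. inv_into (carrier T) j (h x))"
 have k: "k x \<in> carrier T" "j (k x) = h x" if "x \<in> carrier C" for x
 proof -
  have "h x \<in> j ` carrier T" using that h(2) by blast
  then show "k x \<in> carrier T" "j (k x) = h x" using that by (simp_all add: k_def inv_into_into f_inv_into_f)
 qed
 have "k \<in> chom C T"
 proof (rule chomI)
  fix n g a assume g: "Sm n g" and a0: "\<And>i. i < n ==> a i \<in> carrier C"
  then have a: "\<forall>i<n. a i \<in> carrier C" by blast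
  have "j (k (app C n g a)) = h (app C n g a)" using k(2) C.app_closed'[OF g a] by blast
  also have "\<dots> = app B n g (%i. h (a i))" by (rule chom_app'[OF h(1) g a])
  also have "\<dots> = app B n g (%i. j (k (a i)))" using k(2) a chomD(1)[OF h(1)] by (intro B.app_cong[OF g]) auto
  also have "\<dots> = j (app T n g (%i. k (a i)))" using chom_app'[OF j(1) g, of "%i. k (a i)"] k(1) a by simp
  finally show "k (app C n g a) = app T n g (%i. k (a i))"
   using inj_onD[OF j(2)] k(1) C.app_closed'[OF g a] T.app_closed'[OF g, of "%i. k (a i)"] a by blast
 qed (use k in \<open>auto simp: k_def\<close>)
 then show ?thesis using k(2) by blast
qed

lemma quotient_std:
 assumes A: "cinf_scheme A" and I: "ideal I (as_ring A)"
 obtains N :: "std cinf" and p where "cinf_scheme N" "p \<in> chom A N" "p ` carrier A = carrier N" "ker A N p = I"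
proof -
 note A' = schemeD[OF A]
 note q = quot_basics[OF A' I]
 have Q: "cinf_scheme (quot A I)" by (rule scheme_image[OF A q(1-3)])
 obtain N :: "std cinf" and h where N: "cinf_scheme N" and h: "h \<in> ciso (quot A I) N" using scheme_std[OF Q] .
 note N' = schemeD[OF N]
 have hc: "h \<in> chom (quot A I) N" and hb: "bij_betw h (carrier (quot A I)) (carrier N)" using h by (auto simp: ciso_def)
 let ?p = "\<lambda>x\<in>carrier A. h (quot_map A I x)"
 have p: "?p \<in> chom A N" by (rule chom_compose[OF q(2) hc A' N'])
 interpret Q: cinf "quot A I" by unfold_locales (rule q)
 show thesis
 proof (rule that[OF N p])
  have "?p ` carrier A = h ` (quot_map A I ` carrier A)" by (auto simp: image_image)
  then show "?p ` carrier A = carrier N" using q(3) hb by (simp add: bij_betw_def)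
  have "h (quot_map A I x) = const N 0 \<longleftrightarrow> quot_map A I x = const (quot A I) 0" if "x \<in> carrier A" for x
   using chom_const[OF hc N', of 0] inj_on_eq_iff[OF bij_betw_imp_inj_on[OF hb] chomD(1)[OF q(2) that] Q.const_closed[of 0]] by simp
  then have "ker A N ?p = ker A (quot A I) (quot_map A I)" by (auto simp: ker_def)
  then show "ker A N ?p = I" using q(4) by simp
 qed
qed

subsection \<open>The \<open>\<infinity>\<close>-radical\<close>

text \<open>If only zero rings receive a map that kills \<open>I\<close> and inverts
  \<open>a\<close>, then the zero ring itself has the universal property of the
  localization.\<close>

lemma inf_radI:
 assumes A: "cinf_ring A" and I: "ideal I (as_ring A)" and a: "a \<in> carrier A"
  and T: "\<And>(T :: std cinf) \<tau>. cinf_scheme T ==> \<tau> \<in> chom A T ==> (\<And>x. x \<in> I ==> \<tau> x = const T 0) ==>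
   \<tau> a \<in> Units (as_ring T) ==> zero_ring T"
 shows "a \<in> inf_radical A I"
proof -
 note q = quot_basics[OF A I]
 \<comment> \<open>The zero ring, realized in the type of test objects.\<close>
 define Z :: "std cinf" where "Z = \<lparr>carrier = {{}}, cop = (%n g a. {})\<rparr>"
 have Zr: "cinf_ring Z" by (auto simp: Z_def cinf_ring_def)
 interpret Z: cinf Z by unfold_locales (rule Zr)
 have gen: "generates Z 0 undefined" unfolding generates_def by (auto simp: Z_def app_def intro: exI[of _ "%_. 0"])
 have Zs: "cinf_scheme Z" using Zr gen scheme_iff by blast
 have Z0: "const Z c = {}" "op2 Z \<beta> x y = {}" for c \<beta> x y by (simp_all add: Z_def const_def op2_def)
 have Zz: "zero_ring Z" using Z0 by (simp add: zero_ring_def Z_def const_def)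
 let ?\<phi> = "\<lambda>x\<in>carrier (quot A I). {}"
 interpret Q: cinf "quot A I" by unfold_locales (rule q)
 have "is_localization (quot A I) (quot_map A I a) Z ?\<phi>"
  unfolding is_localization_def
 proof (intro conjI allI impI ballI Zs)
  show "?\<phi> \<in> chom (quot A I) Z"
  proof (rule chomI)
   fix n g a assume "Sm n g" "\<And>i. i < n ==> a i \<in> carrier (quot A I)"
   then have "app (quot A I) n g a \<in> carrier (quot A I)" by (rule Q.app_closed)
   then show "?\<phi> (app (quot A I) n g a) = app Z n g (%i. ?\<phi> (a i))" by (simp add: Z_def app_def)
  qed (simp_all add: Z_def)
  show "?\<phi> (quot_map A I a) \<in> Units (as_ring Z)"
   unfolding Z.Units_iff using chomD(1)[OF q(2) a] Z0 by (auto simp: Z_def)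
  fix T :: "std cinf" and \<tau> assume Ts: "cinf_scheme T" and \<tau>: "\<tau> \<in> chom (quot A I) T" and u: "\<tau> (quot_map A I a) \<in> Units (as_ring T)"
  note T' = schemeD[OF Ts]
  interpret T: cinf T by unfold_locales (rule T')
  have z: "zero_ring T"
  proof (rule T[OF Ts chom_compose[OF q(2) \<tau> A T']])
   show "(\<lambda>x\<in>carrier A. \<tau> (quot_map A I x)) x = const T 0" if "x \<in> I" for x
   proof -
    have "x \<in> ker A (quot A I) (quot_map A I)" using q(4) that by simp
    then show ?thesis using chom_const[OF \<tau> T', of 0] by (simp add: ker_def)
   qed
  qed (use u a in simp)
  show "\<exists>!v. v \<in> chom Z T \<and> (\<forall>x\<in>carrier (quot A I). v (?\<phi> x) = \<tau> x)"
  proof (rule ex1I[of _ "\<lambda>x\<in>carrier Z. const T 0"])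
   have "(\<lambda>x\<in>carrier Z. const T 0) \<in> chom Z T"
   proof (rule chomI)
    fix n g a assume g: "Sm n g" and a0: "\<And>i. i < n ==> a i \<in> carrier Z"
    then have a: "\<forall>i<n. a i \<in> carrier Z" by blast
    have "app T n g (%i. (\<lambda>x\<in>carrier Z. const T 0) (a i)) \<in> carrier T" using a by (intro T.app_closed'[OF g]) auto
    then show "(\<lambda>x\<in>carrier Z. const T 0) (app Z n g a) = app T n g (%i. (\<lambda>x\<in>carrier Z. const T 0) (a i))"
     using z Z.app_closed'[OF g a] by (simp add: zero_ring_def)
   qed auto
   then show "(\<lambda>x\<in>carrier Z. const T 0) \<in> chom Z T \<and> (\<forall>x\<in>carrier (quot A I). (\<lambda>x\<in>carrier Z. const T 0) (?\<phi> x) = \<tau> x)"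
    using z chomD(1)[OF \<tau>] by (auto simp: zero_ring_def Z_def)
   fix v assume "v \<in> chom Z T \<and> (\<forall>x\<in>carrier (quot A I). v (?\<phi> x) = \<tau> x)"
   then show "v = (\<lambda>x\<in>carrier Z. const T 0)"
    using z chomD[of v Z T] by (intro extensionalityI[of _ "carrier Z"]) (auto simp: zero_ring_def)
  qed
 qed
 then show ?thesis unfolding inf_radical_def using a Zz by blast
qed

text \<open>The localization, which is zero, maps to a copy of \<open>B\<close> of standard type, so
  1 equals 0 there and hence in \<open>B\<close>.\<close>

lemma inf_radD:
 assumes A: "cinf_ring A" and I: "ideal I (as_ring A)" and a: "a \<in> inf_radical A I"
  and B: "cinf_scheme B" and t: "t \<in> chom A B" "\<And>x. x \<in> I ==> t x = const B 0" "t a \<in> Units (as_ring B)"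
 shows "zero_ring B"
proof -
 note B' = schemeD[OF B]
 note q = quot_basics[OF A I]
 obtain L :: "std cinf" and \<phi> where L: "is_localization (quot A I) (quot_map A I a) L \<phi>" "zero_ring L" and ac: "a \<in> carrier A"
  using a unfolding inf_radical_def by blast
 obtain T :: "std cinf" and h where T: "cinf_scheme T" and h: "h \<in> ciso B T" using scheme_std[OF B] .
 note T' = schemeD[OF T]
 have hc: "h \<in> chom B T" and hi: "inj_on h (carrier B)" using h by (auto simp: ciso_def bij_betw_def)
 interpret B: cinf B by unfold_locales (rule B')
 interpret T: cinf T by unfold_locales (rule T')
 have "I \<subseteq> ker A B t" using t(2) cinf.idealD(1)[OF cinf.intro[OF A] I] by (auto simp: ker_def)
 then obtain v where v: "v \<in> chom (quot A I) B" "\<forall>x\<in>carrier A. v (quot_map A I x) = t x"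
  using chom_factor[OF A q(1) B' q(2,3) t(1)] q(4) by blast
 let ?w = "\<lambda>x\<in>carrier (quot A I). h (v x)"
 have w: "?w \<in> chom (quot A I) T" by (rule chom_compose[OF v(1) hc q(1) T'])
 have "?w (quot_map A I a) \<in> Units (as_ring T)"
  using chom_Units[OF hc B' T' t(3)] v(2) ac chomD(1)[OF q(2) ac] by simp
 then have "\<exists>u. u \<in> chom L T" using L(1) T w unfolding is_localization_def by blast
 then obtain u where u: "u \<in> chom L T" by blast
 have "cinf_ring L" using L(1) schemeD unfolding is_localization_def by blast
 then have "const L 1 = const L 0" using L(2) cinf.zero_ring_iff cinf.intro by blast
 then have "const T 1 = const T 0" using chom_const[OF u T', of 1] chom_const[OF u T', of 0] by simp
 then have "h (const B 1) = h (const B 0)" using chom_const[OF hc T'] by simp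
 then show ?thesis using hi B.zero_ring_iff by (auto simp: inj_on_def)
qed

lemma inf_rad_carrier: "inf_radical A I \<subseteq> carrier A"
 by (auto simp: inf_radical_def)

text \<open>A Nullstellensatz: modulo the relations of \<open>A\<close>, the radical is governed by
  the zero set of a single element of \<open>I\<close>. In one direction a sum of squares without
  zeros becomes zero in the test ring. In the other the definition is applied to a quotient that
  remembers only where functions vanish; that quotient must be zero, so the locus
  \<open>w = 0\<close>, \<open>\<alpha> z = 1\<close> is empty for some \<open>w\<close>.\<close>

lemma inf_radical_iff:
 assumes A: "cinf_ring A" and gen: "generates A n x" and I: "ideal I (as_ring A)"
 shows "a \<in> inf_radical A I \<longleftrightarrow>
  (\<exists>\<alpha> w. Sm n \<alpha> \<and> Sm n w \<and> a = app A n \<alpha> x \<and> app A n w x \<in> I \<and> (\<forall>v\<in>Rn n. w v = 0 --> \<alpha> v = 0))"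
proof
 interpret A: cinf A by unfold_locales (rule A)
 have x: "\<forall>i<n. x i \<in> carrier A" using gen by (auto simp: generates_def)
 {
  assume "\<exists>\<alpha> w. Sm n \<alpha> \<and> Sm n w \<and> a = app A n \<alpha> x \<and> app A n w x \<in> I \<and> (\<forall>v\<in>Rn n. w v = 0 --> \<alpha> v = 0)"
  then obtain \<alpha> w where S: "Sm n \<alpha>" "Sm n w" and a: "a = app A n \<alpha> x" and w: "app A n w x \<in> I"
   and z: "\<And>v. v \<in> Rn n ==> w v = 0 ==> \<alpha> v = 0" by blast
  show "a \<in> inf_radical A I"
  proof (rule inf_radI[OF A I])
   show "a \<in> carrier A" unfolding a by (rule A.app_closed'[OF S(1) x])
   fix T :: "std cinf" and \<tau> assume Ts: "cinf_scheme T" and \<tau>: "\<tau> \<in> chom A T" and k: "\<And>x. x \<in> I ==> \<tau> x = const T 0"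
    and u: "\<tau> a \<in> Units (as_ring T)"
   note T' = schemeD[OF Ts]
   interpret T: cinf T by unfold_locales (rule T')
   obtain y where y: "y \<in> carrier T" "op2 T (*) (\<tau> a) y = const T 1" using u T.Units_iff by blast
   have tx: "\<forall>i<n. \<tau> (x i) \<in> carrier T" using chomD(1)[OF \<tau>] x by blast
   let ?b = "(%i. \<tau> (x i))(n := y)"
   have b: "\<forall>i<Suc n. ?b i \<in> carrier T" using tx y(1) by (auto simp: less_Suc_eq)
   have W: "app T (Suc n) (%z. w (tuple n z)) ?b = const T 0"
    using T.app_extend'[OF S(2) tx y(1)] chom_app'[OF \<tau> S(2) x] k[OF w] by simp
   have Al: "app T (Suc n) (%z. \<alpha> (tuple n z)) ?b = \<tau> a"
    using T.app_extend'[OF S(1) tx y(1)] chom_app'[OF \<tau> S(1) x] a by simp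
   have Y: "app T (Suc n) (%z. z n) ?b = y" using T.app_coord[of n "Suc n" ?b] b by simp
   have "app T (Suc n) (%z. \<alpha> (tuple n z) * z n - 1) ?b = op2 T (-) (op2 T (*) (\<tau> a) y) (const T 1)"
    using T.arith_app'(3)[OF _ _ b, of "%z. \<alpha> (tuple n z) * z n" "%z. 1"] T.arith_app'(2)[OF _ _ b, of "%z. \<alpha> (tuple n z)" "%z. z n"]
     Sm_extend[OF S(1)] Al Y T.const_app'[OF b, of 1, symmetric] by (simp add: fun_upd_def)
   also have "\<dots> = const T 0" unfolding y(2) using T.ring_laws(10)[of "const T 1"] by simp
   finally have E: "app T (Suc n) (%z. \<alpha> (tuple n z) * z n - 1) ?b = const T 0" .
   \<comment> \<open>Without zeros: where \<open>w\<close> vanishes so does \<open>\<alpha>\<close>,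
     and then the second square is 1. Yet its value in the test ring is zero.\<close>
   let ?P = "%z. w (tuple n z) * w (tuple n z) + (\<alpha> (tuple n z) * z n - 1) * (\<alpha> (tuple n z) * z n - 1)"
   have "app T (Suc n) ?P ?b = op2 T (+) (op2 T (*) (const T 0) (const T 0)) (op2 T (*) (const T 0) (const T 0))"
    using Sm_extend[OF S(1)] Sm_extend[OF S(2)]
    by (simp only: T.arith_app'(1,2)[OF _ _ b, symmetric] Sm_intros W E lessI)
   also have "\<dots> = const T 0" by simp
   finally have P0: "app T (Suc n) ?P ?b = const T 0" .
   show "zero_ring T"
   proof (rule T.zero_ring_nonvanishing[OF _ _ _ P0])
    show "Sm (Suc n) ?P" using Sm_extend[OF S(1)] Sm_extend[OF S(2)] by simp
    show "?P z \<noteq> 0" for z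
    proof
     assume "?P z = 0"
     then have "w (tuple n z) = 0" "\<alpha> (tuple n z) * z n - 1 = 0" using sum_squares_eq_zero_iff by blast+
     then show False using z[of "tuple n z"] by simp
    qed
   qed (use b in blast)
  qed
 }
 assume a: "a \<in> inf_radical A I"
 then have "a \<in> carrier A" using a unfolding inf_radical_def by (elim CollectE conjE)
 then obtain \<alpha> where \<alpha>: "Sm n \<alpha>" "a = app A n \<alpha> x" using gen by (auto simp: generates_def)
 let ?R = "CinfR (Suc n)"
 interpret R: cinf ?R by unfold_locales (rule CinfR_ring)
 \<comment> \<open>Functions that vanish on the locus cut out by \<open>\<alpha> z = 1\<close> and
   one \<open>w\<close> representing an element of \<open>I\<close>. Nonnegativity makes the sum of
   two such \<open>w\<close> cut out the intersection of their loci, so \<open>J\<close> is closed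
   under addition.\<close>
 define J where "J = {F \<in> carrier ?R. \<exists>w. Sm n w \<and> app A n w x \<in> I \<and> (\<forall>v\<in>Rn n. w v \<ge> 0) \<and>
   (\<forall>z\<in>Rn (Suc n). w (tuple n z) = 0 --> \<alpha> (tuple n z) * z n = 1 --> F z = 0)}"
 have JI: "F \<in> J" if "F \<in> carrier ?R" "Sm n w" "app A n w x \<in> I" "\<And>v. v \<in> Rn n ==> w v \<ge> 0"
   "\<And>z. z \<in> Rn (Suc n) ==> w (tuple n z) = 0 ==> \<alpha> (tuple n z) * z n = 1 ==> F z = 0" for F w
  using that by (auto simp: J_def intro!: exI[of _ w])
 define JW where "JW F w \<longleftrightarrow> F \<in> carrier ?R \<and> Sm n w \<and> app A n w x \<in> I \<and> (\<forall>v\<in>Rn n. w v \<ge> 0) \<and>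
   (\<forall>z\<in>Rn (Suc n). w (tuple n z) = 0 --> \<alpha> (tuple n z) * z n = 1 --> F z = 0)" for F w
 have JD: "\<exists>w. JW F w" if "F \<in> J" for F using that unfolding J_def JW_def by simp
 have JWD: "F \<in> carrier ?R" "Sm n w" "app A n w x \<in> I" "\<And>v. v \<in> Rn n ==> w v \<ge> 0"
   "\<And>z. z \<in> Rn (Suc n) ==> w (tuple n z) = 0 ==> \<alpha> (tuple n z) * z n = 1 ==> F z = 0" if "JW F w" for F w
  using that unfolding JW_def by simp_all
 have const0: "app A n (%v. 0) x \<in> I" using A.const_app'[OF x, of 0] A.idealD(2)[OF I] by simp
 have J: "ideal J (as_ring ?R)"
 proof (rule R.idealI')
  show "const ?R 0 \<in> J" using const0 by (intro JI[of _ "%v. 0"]) (auto simp: ops_CinfR)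
  fix F G assume "F \<in> J" "G \<in> J"
  from JD[OF this(1)] JD[OF this(2)] obtain w w' where wF: "JW F w" and wG: "JW G w'" by (elim exE)
  note F = JWD[OF wF] and G = JWD[OF wG]
  show "op2 ?R (+) F G \<in> J"
  proof (rule JI[of _ "%v. w v + w' v"])
   show "app A n (%v. w v + w' v) x \<in> I"
    using A.arith_app'(1)[OF F(2) G(2) x] A.idealD(3)[OF I F(3) G(3)] by simp
   fix z assume z: "z \<in> Rn (Suc n)" "w (tuple n z) + w' (tuple n z) = 0" "\<alpha> (tuple n z) * z n = 1"
   then have "w (tuple n z) = 0" "w' (tuple n z) = 0" using F(4)[of "tuple n z"] G(4)[of "tuple n z"] by auto
   then show "op2 ?R (+) F G z = 0" using F(5) G(5) z by (simp add: ops_CinfR)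
  qed (use F G in \<open>auto intro: add_nonneg_nonneg\<close>)
 next
  fix F G assume F: "F \<in> carrier ?R" and "G \<in> J"
  from JD[OF this(2)] obtain w' where wG: "JW G w'" by (elim exE)
  note G = JWD[OF wG]
  show "op2 ?R (*) F G \<in> J"
   by (rule JI[of _ w']) (use F G R.arith_closed(2)[OF F G(1)] in \<open>auto simp: ops_CinfR(1)[of _ _ _ G]\<close>)
 qed (auto simp: J_def)
 let ?T = "quot ?R J" and ?p = "quot_map ?R J"
 note q = quot_basics[OF CinfR_ring J]
 interpret T: cinf ?T by unfold_locales (rule q)
 have pz: "?p F = const ?T 0 \<longleftrightarrow> F \<in> J" if "F \<in> carrier ?R" for F
 proof -
  have "?p F = const (quot ?R J) 0 \<longleftrightarrow> F \<in> ker ?R (quot ?R J) ?p" using that by (simp add: ker_def)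
  then show ?thesis using q(4) by simp
 qed
 have Ts: "cinf_scheme ?T" using scheme_iff q(1) quot_CinfR_generates(1)[OF J] by blast
 let ?c = "%i. ?p (coord (Suc n) i)"
 have cc: "\<And>i. ?c i \<in> carrier ?T" using chomD(1)[OF q(2)] by simp
 have appc: "app ?T n g ?c = ?p (\<lambda>z\<in>Rn (Suc n). g (tuple n z))" if g: "Sm n g" for g
 proof -
  have "app ?T n g ?c = ?p (app ?R n g (coord (Suc n)))" using chom_app'[OF q(2) g, of "coord (Suc n)"] by simp
  also have "app ?R n g (coord (Suc n)) = (\<lambda>z\<in>Rn (Suc n). g (tuple n z))"
   unfolding app_CinfR by (intro restrict_ext arg_cong[of _ _ g]) (auto simp: tuple_def coord_def)
  finally show ?thesis .
 qed
 \<comment> \<open>A representative \<open>g\<close> may change sign; its square is admissible as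
   \<open>w\<close> and has the same zeros.\<close>
 have sq: "?p (\<lambda>z\<in>Rn (Suc n). g (tuple n z)) = const ?T 0" if g: "Sm n g" "app A n g x \<in> I" for g
 proof -
  have "app A n (%v. g v * g v) x \<in> I"
   using A.arith_app'(2)[OF g(1) g(1) x] A.idealD(4)[OF I A.app_closed'[OF g(1) x] g(2)] by simp
  then have "(\<lambda>z\<in>Rn (Suc n). g (tuple n z)) \<in> J"
   using g Sm_extend[OF g(1)] by (intro JI[of _ "%v. g v * g v"]) auto
  then show ?thesis using pz Sm_extend[OF g(1)] by simp
 qed
 have ex: "ev A n x \<in> chom (CinfR n) A" using x by (intro A.ev_chom) auto
 have et: "ev ?T n ?c \<in> chom (CinfR n) ?T" using cc by (intro T.ev_chom) auto
 have "ker (CinfR n) A (ev A n x) \<subseteq> ker (CinfR n) ?T (ev ?T n ?c)"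
 proof
  fix g assume "g \<in> ker (CinfR n) A (ev A n x)"
  then have g: "g \<in> carrier (CinfR n)" "app A n g x = const A 0" by (auto simp: ker_def ev_def)
  then show "g \<in> ker (CinfR n) ?T (ev ?T n ?c)"
   using appc[OF CinfR_smooth[OF g(1)]] sq[OF CinfR_smooth[OF g(1)]] A.idealD(2)[OF I] by (simp add: ker_def ev_def)
 qed
 from chom_factor[OF CinfR_ring A q(1) ex A.generates_surj[OF gen] et this]
 obtain u where u: "u \<in> chom A ?T" "\<forall>g\<in>carrier (CinfR n). u (ev A n x g) = ev ?T n ?c g" by blast
 have ua: "u (app A n g x) = ?p (\<lambda>z\<in>Rn (Suc n). g (tuple n z))" if g: "Sm n g" for g
  using u(2)[rule_format, of "restrict g (Rn n)"] g appc[OF g] by simp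
 have "zero_ring ?T"
 proof (rule inf_radD[OF A I a Ts u(1)])
  fix y assume y: "y \<in> I"
  then have "y \<in> carrier A" using A.idealD(1)[OF I] by blast
  then obtain g where "Sm n g" "y = app A n g x" using gen by (auto simp: generates_def)
  then show "u y = const ?T 0" using ua sq y by simp
 next
  let ?f = "\<lambda>z\<in>Rn (Suc n). \<alpha> (tuple n z)"
  have fR: "?f \<in> carrier ?R" using Sm_extend[OF \<alpha>(1)] by simp
  have "op2 ?R (-) (op2 ?R (*) ?f (coord (Suc n) n)) (const ?R 1) \<in> J"
   using const0 by (intro JI[OF R.arith_closed(3)[OF R.arith_closed(2)[OF fR coord_CinfR] R.const_closed], of "%v. 0"])
    (auto simp: ops_CinfR coord_def)
  then have "?p (op2 ?R (*) ?f (coord (Suc n) n)) = ?p (const ?R 1)"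
   using hom_eq_iff_ker[OF q(2) CinfR_ring q(1), of "op2 ?R (*) ?f (coord (Suc n) n)" "const ?R 1"] fR q(4) by simp
  then have "op2 ?T (*) (?p ?f) (?c n) = const ?T 1"
   using chom_arith(2)[OF q(2) fR coord_CinfR] chom_const[OF q(2,1), of 1] by simp
  then show "u a \<in> Units (as_ring ?T)"
   unfolding T.Units_iff \<alpha>(2) ua[OF \<alpha>(1)] using cc chomD(1)[OF q(2) fR] by blast
 qed
 then have "?p (const ?R 1) = const ?T 0" using T.zero_ring_iff chom_const[OF q(2,1), of 1] by simp
 then have "const ?R 1 \<in> J" using pz by simp
 then obtain w where w: "Sm n w" "app A n w x \<in> I"
  "\<And>z. z \<in> Rn (Suc n) ==> w (tuple n z) = 0 ==> \<alpha> (tuple n z) * z n = 1 ==> const ?R 1 z = 0" unfolding J_def by blast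
 have "\<alpha> v = 0" if v: "v \<in> Rn n" "w v = 0" for v
 proof (rule ccontr)
  assume "\<alpha> v \<noteq> 0"
  moreover have "tuple n (v(n := 1 / \<alpha> v)) = v" using v(1) by (auto simp: tuple_def in_Rn fun_eq_iff)
  ultimately show False
   using w(3)[of "v(n := 1 / \<alpha> v)"] Rn_Suc_upd[OF v(1)] v(2) by (simp add: ops_CinfR)
 qed
 then show "\<exists>\<alpha> w. Sm n \<alpha> \<and> Sm n w \<and> a = app A n \<alpha> x \<and> app A n w x \<in> I \<and> (\<forall>v\<in>Rn n. w v = 0 --> \<alpha> v = 0)"
  using \<alpha> w by blast
qed

text \<open>In the zero set criterion a sum is witnessed by the sum of the squares of the two
  witnesses, which vanishes exactly where both do.\<close>

lemma inf_radical_ideal: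
 assumes A: "cinf_scheme A" and I: "ideal I (as_ring A)"
 shows "ideal (inf_radical A I) (as_ring A)"
proof -
 note A' = schemeD[OF A]
 interpret A: cinf A by unfold_locales (rule A')
 obtain n x where gen: "generates A n x" using A scheme_iff by blast
 have x: "\<forall>i<n. x i \<in> carrier A" using gen by (auto simp: generates_def)
 note iff = inf_radical_iff[OF A' gen I]
 show ?thesis
 proof (rule A.idealI'[OF inf_rad_carrier])
  have "app A n (%v. 0) x \<in> I" using A.const_app'[OF x, of 0] A.idealD(2)[OF I] by simp
  then show "const A 0 \<in> inf_radical A I"
   unfolding iff using A.const_app'[OF x, of 0] by (intro exI[of _ "%v. 0"]) auto
 next
  fix a b assume "a \<in> inf_radical A I" "b \<in> inf_radical A I"
  then obtain \<alpha> w \<beta> w' where a: "Sm n \<alpha>" "Sm n w" "a = app A n \<alpha> x" "app A n w x \<in> I" "\<forall>v\<in>Rn n. w v = 0 --> \<alpha> v = 0"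
   and b: "Sm n \<beta>" "Sm n w'" "b = app A n \<beta> x" "app A n w' x \<in> I" "\<forall>v\<in>Rn n. w' v = 0 --> \<beta> v = 0"
   unfolding iff by blast
  have "app A n (%v. w v * w v + w' v * w' v) x \<in> I"
   using A.arith_app'(1,2)[OF _ _ x, symmetric] a b A.idealD(3,4)[OF I] A.app_closed'[OF a(2) x] A.app_closed'[OF b(2) x]
   by (simp add: A.arith_app'(1,2)[OF _ _ x, symmetric])
  moreover have "op2 A (+) a b = app A n (%v. \<alpha> v + \<beta> v) x" using A.arith_app'(1)[OF a(1) b(1) x] a b by simp
  moreover have "\<forall>v\<in>Rn n. w v * w v + w' v * w' v = 0 --> \<alpha> v + \<beta> v = 0"
   using a(5) b(5) sum_squares_eq_zero_iff by (metis add.right_neutral)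
  ultimately show "op2 A (+) a b \<in> inf_radical A I"
   unfolding iff using a b by (intro exI[of _ "%v. \<alpha> v + \<beta> v"] exI[of _ "%v. w v * w v + w' v * w' v"]) simp
 next
  fix a b assume a: "a \<in> carrier A" and "b \<in> inf_radical A I"
  then obtain \<beta> w' where b: "Sm n \<beta>" "Sm n w'" "b = app A n \<beta> x" "app A n w' x \<in> I" "\<forall>v\<in>Rn n. w' v = 0 --> \<beta> v = 0"
   unfolding iff by blast
  obtain \<alpha> where "Sm n \<alpha>" "a = app A n \<alpha> x" using a gen by (auto simp: generates_def)
  then show "op2 A (*) a b \<in> inf_radical A I"
   unfolding iff using b A.arith_app'(2)[OF \<open>Sm n \<alpha>\<close> b(1) x]
   by (intro exI[of _ "%v. \<alpha> v * \<beta> v"] exI[of _ w']) simp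
 qed
qed

subsection \<open>Universal properties\<close>

lemma intersectionI:
 assumes "cinf_scheme N" "\<psi> \<in> chom A N" "\<forall>j\<in>J. \<iota> j \<in> chom (B j) N \<and> (\<forall>x\<in>carrier A. \<iota> j (\<phi> j x) = \<psi> x)"
  and "\<And>(T :: std cinf) \<tau> \<kappa>. cinf_scheme T ==> \<tau> \<in> chom A T ==> \<forall>j\<in>J. \<kappa> j \<in> chom (B j) T \<and> (\<forall>x\<in>carrier A. \<kappa> j (\<phi> j x) = \<tau> x) ==>
   \<exists>!u. u \<in> chom N T \<and> (\<forall>x\<in>carrier A. u (\<psi> x) = \<tau> x) \<and> (\<forall>j\<in>J. \<forall>y\<in>carrier (B j). u (\<iota> j y) = \<kappa> j y)"
 shows "is_intersection A J B \<phi> N \<psi>"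
 unfolding is_intersection_def
 by (intro conjI assms(1,2) exI[of _ \<iota>] assms(3) allI impI ballI) (rule assms(4); assumption)

lemma intersection_univ:
 fixes T :: "std cinf"
 assumes "is_intersection A J B \<phi> N \<psi>" "cinf_scheme T" "\<tau> \<in> chom A T"
  "\<forall>j\<in>J. \<kappa> j \<in> chom (B j) T \<and> (\<forall>x\<in>carrier A. \<kappa> j (\<phi> j x) = \<tau> x)"
 shows "\<exists>u\<in>chom N T. \<forall>x\<in>carrier A. u (\<psi> x) = \<tau> x"
proof -
 from assms(1) obtain \<iota> where i: "\<forall>T :: std cinf. cinf_scheme T -->
     (\<forall>\<tau>\<in>chom A T. \<forall>\<kappa>.
       (\<forall>j\<in>J. \<kappa> j \<in> chom (B j) T \<and> (\<forall>x\<in>carrier A. \<kappa> j (\<phi> j x) = \<tau> x)) -->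
       (\<exists>!u. u \<in> chom N T \<and> (\<forall>x\<in>carrier A. u (\<psi> x) = \<tau> x) \<and>
          (\<forall>j\<in>J. \<forall>y\<in>carrier (B j). u (\<iota> j y) = \<kappa> j y)))"
  unfolding is_intersection_def by (elim conjE exE)
 show ?thesis
  using ex1_implies_ex[OF i[THEN spec, THEN mp, OF assms(2), THEN bspec, OF assms(3), THEN spec, THEN mp, OF assms(4)]] by blast
qed

lemma localizationI:
 assumes "cinf_scheme L" "\<phi> \<in> chom A L" "\<phi> a \<in> Units (as_ring L)"
  and "\<And>(T :: std cinf) \<tau>. cinf_scheme T ==> \<tau> \<in> chom A T ==> \<tau> a \<in> Units (as_ring T) ==>
   \<exists>!u. u \<in> chom L T \<and> (\<forall>x\<in>carrier A. u (\<phi> x) = \<tau> x)"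
 shows "is_localization A a L \<phi>"
 unfolding is_localization_def by (intro conjI assms(1-3) allI impI ballI) (rule assms(4); assumption)

lemma localization_univ:
 fixes T :: "std cinf"
 assumes "is_localization A a L \<phi>" "cinf_scheme T" "\<tau> \<in> chom A T" "\<tau> a \<in> Units (as_ring T)"
 shows "\<exists>!u. u \<in> chom L T \<and> (\<forall>x\<in>carrier A. u (\<phi> x) = \<tau> x)"
proof -
 have "\<forall>T :: std cinf. cinf_scheme T --> (\<forall>\<tau>\<in>chom A T. \<tau> a \<in> Units (as_ring T) -->
      (\<exists>!u. u \<in> chom L T \<and> (\<forall>x\<in>carrier A. u (\<phi> x) = \<tau> x)))"
  using assms(1) unfolding is_localization_def by (elim conjE)
 from this[THEN spec, THEN mp, OF assms(2), THEN bspec, OF assms(3), THEN mp, OF assms(4)] show ?thesis .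
qed

text \<open>A map out of \<open>A\<close> factors through every \<open>B j\<close> iff it kills all
  the kernels, that is, the ideal they generate.\<close>

lemma intersection_of_quotients:
 assumes A: "cinf_ring A" and N: "cinf_scheme N" and psi: "\<psi> \<in> chom A N" "\<psi> ` carrier A = carrier N"
  and B: "\<And>j. j \<in> J ==> cinf_ring (B j)" and phi: "\<And>j. j \<in> J ==> \<phi> j \<in> chom A (B j)"
   "\<And>j. j \<in> J ==> \<phi> j ` carrier A = carrier (B j)"
  and k: "ker A N \<psi> = Idl\<^bsub>as_ring A\<^esub> (\<Union>j\<in>J. ker A (B j) (\<phi> j))"
 shows "is_intersection A J B \<phi> N \<psi>"
proof -
 interpret A: cinf A by unfold_locales (rule A)
 note N' = schemeD[OF N]
 have sub: "(\<Union>j\<in>J. ker A (B j) (\<phi> j)) \<subseteq> carrier A" by (auto simp: ker_def)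
 have "\<forall>j\<in>J. \<exists>i. i \<in> chom (B j) N \<and> (\<forall>x\<in>carrier A. i (\<phi> j x) = \<psi> x)"
 proof
  fix j assume j: "j \<in> J"
  have "ker A (B j) (\<phi> j) \<subseteq> ker A N \<psi>" unfolding k using A.Idl(2)[OF sub] j by blast
  from chom_factor[OF A B[OF j] N' phi(1)[OF j] phi(2)[OF j] psi(1) this]
  show "\<exists>i. i \<in> chom (B j) N \<and> (\<forall>x\<in>carrier A. i (\<phi> j x) = \<psi> x)" by blast
 qed
 from bchoice[OF this] obtain \<iota> where i: "\<forall>j\<in>J. \<iota> j \<in> chom (B j) N \<and> (\<forall>x\<in>carrier A. \<iota> j (\<phi> j x) = \<psi> x)" by (rule exE)
 have "\<exists>!u. u \<in> chom N T \<and> (\<forall>x\<in>carrier A. u (\<psi> x) = \<tau> x) \<and> (\<forall>j\<in>J. \<forall>y\<in>carrier (B j). u (\<iota> j y) = \<kappa> j y)"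
  if Ts: "cinf_scheme T" and t: "\<tau> \<in> chom A T" and kap: "\<forall>j\<in>J. \<kappa> j \<in> chom (B j) T \<and> (\<forall>x\<in>carrier A. \<kappa> j (\<phi> j x) = \<tau> x)"
  for T :: "std cinf" and \<tau> \<kappa>
 proof -
  note T' = schemeD[OF Ts]
  have "ker A (B j) (\<phi> j) \<subseteq> ker A T \<tau>" if j: "j \<in> J" for j
  proof
   fix x assume x: "x \<in> ker A (B j) (\<phi> j)"
   then have x: "x \<in> carrier A" "\<phi> j x = const (B j) 0" by (simp_all add: ker_def)
   have "\<kappa> j \<in> chom (B j) T" "\<kappa> j (\<phi> j x) = \<tau> x" using kap j x(1) by simp_all
   then show "x \<in> ker A T \<tau>" using x chom_const[OF _ T', of "\<kappa> j" "B j" 0] by (simp add: ker_def)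
  qed
  then have "ker A N \<psi> \<subseteq> ker A T \<tau>"
   unfolding k by (intro A.Idl(3)[OF sub] ker_ideal[OF t A T']) blast
  from chom_factor[OF A N' T' psi t this] obtain u where u: "u \<in> chom N T" "\<forall>x\<in>carrier A. u (\<psi> x) = \<tau> x" by blast
  show ?thesis
  proof (rule ex1I[of _ u])
   show "u \<in> chom N T \<and> (\<forall>x\<in>carrier A. u (\<psi> x) = \<tau> x) \<and> (\<forall>j\<in>J. \<forall>y\<in>carrier (B j). u (\<iota> j y) = \<kappa> j y)"
   proof (intro conjI u ballI)
    fix j y assume j: "j \<in> J" and "y \<in> carrier (B j)"
    then have "y \<in> \<phi> j ` carrier A" using phi(2) by simp
    then obtain x where "x \<in> carrier A" "y = \<phi> j x" by blast
    then show "u (\<iota> j y) = \<kappa> j y" using u(2) i kap j by simp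
   qed
   fix v assume v: "v \<in> chom N T \<and> (\<forall>x\<in>carrier A. v (\<psi> x) = \<tau> x) \<and> (\<forall>j\<in>J. \<forall>y\<in>carrier (B j). v (\<iota> j y) = \<kappa> j y)"
   show "v = u"
   proof (rule chom_eqI[of _ N T])
    fix y assume "y \<in> carrier N"
    then have "y \<in> \<psi> ` carrier A" using psi(2) by simp
    then show "v y = u y" using u(2) v by auto
   qed (use u v in auto)
  qed
 qed
 then show ?thesis by (rule intersectionI[OF N psi(1) i])
qed

lemma intersectionD:
 assumes "is_intersection A J B \<phi> N \<psi>"
 shows "cinf_scheme N" "\<psi> \<in> chom A N"
  "\<exists>\<iota>. \<forall>j\<in>J. \<iota> j \<in> chom (B j) N \<and> (\<forall>x\<in>carrier A. \<iota> j (\<phi> j x) = \<psi> x)"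
proof -
 from assms obtain \<iota> where "cinf_scheme N" "\<psi> \<in> chom A N" "\<forall>j\<in>J. \<iota> j \<in> chom (B j) N \<and> (\<forall>x\<in>carrier A. \<iota> j (\<phi> j x) = \<psi> x)"
  unfolding is_intersection_def by (elim conjE exE)
 note i = this
 show "cinf_scheme N" by (rule i(1))
 show "\<psi> \<in> chom A N" by (rule i(2))
 show "\<exists>\<iota>. \<forall>j\<in>J. \<iota> j \<in> chom (B j) N \<and> (\<forall>x\<in>carrier A. \<iota> j (\<phi> j x) = \<psi> x)" by (intro exI[of _ \<iota>] i(3))
qed

text \<open>The universal property is stated for test objects of type \<open>std\<close>. An
  isomorphic copy of \<open>T\<close> in this type makes it available for every \<open>T\<close>, in
  particular for the reals.\<close>

lemma intersection_ext:
 assumes i: "is_intersection A J B \<phi> N \<psi>" and A: "cinf_ring A" and B: "\<And>j. j \<in> J ==> cinf_ring (B j)"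
  and phi: "\<And>j. j \<in> J ==> \<phi> j \<in> chom A (B j)"
  and T: "cinf_scheme T" and t: "\<tau> \<in> chom A T" and k: "\<And>j. j \<in> J ==> \<exists>k\<in>chom (B j) T. \<forall>x\<in>carrier A. k (\<phi> j x) = \<tau> x"
 shows "\<exists>u\<in>chom N T. \<forall>x\<in>carrier A. u (\<psi> x) = \<tau> x"
proof -
 note N = schemeD[OF intersectionD(1)[OF i]] and psi = intersectionD(2)[OF i]
 note T' = schemeD[OF T]
 obtain S :: "std cinf" and h where S: "cinf_scheme S" and h: "h \<in> ciso T S" using scheme_std[OF T] .
 note S' = schemeD[OF S]
 obtain v where v: "v \<in> ciso S T" "\<forall>x\<in>carrier T. v (h x) = x" using ciso_inverse[OF T' S' h] by blast
 have hc: "h \<in> chom T S" and vc: "v \<in> chom S T" using h v(1) by (auto simp: ciso_def)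
 from k have "\<forall>j\<in>J. \<exists>k. k \<in> chom (B j) T \<and> (\<forall>x\<in>carrier A. k (\<phi> j x) = \<tau> x)" by blast
 from bchoice[OF this] obtain \<kappa> where kap: "\<forall>j\<in>J. \<kappa> j \<in> chom (B j) T \<and> (\<forall>x\<in>carrier A. \<kappa> j (\<phi> j x) = \<tau> x)" by (rule exE)
 define \<kappa>' where "\<kappa>' j = (\<lambda>y\<in>carrier (B j). h (\<kappa> j y))" for j
 define \<tau>' where "\<tau>' = (\<lambda>x\<in>carrier A. h (\<tau> x))"
 have t': "\<tau>' \<in> chom A S" unfolding \<tau>'_def by (rule chom_compose[OF t hc A S'])
 have k': "\<forall>j\<in>J. \<kappa>' j \<in> chom (B j) S \<and> (\<forall>x\<in>carrier A. \<kappa>' j (\<phi> j x) = \<tau>' x)"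
 proof (intro ballI conjI)
  fix j assume j: "j \<in> J"
  show "\<kappa>' j \<in> chom (B j) S" unfolding \<kappa>'_def using kap j by (intro chom_compose[OF _ hc B[OF j] S']) blast
  show "\<kappa>' j (\<phi> j x) = \<tau>' x" if "x \<in> carrier A" for x
   using kap j chomD(1)[OF phi[OF j] that] that by (simp add: \<kappa>'_def \<tau>'_def)
 qed
 from intersection_univ[OF i S t' k'] obtain u where u: "u \<in> chom N S" "\<forall>x\<in>carrier A. u (\<psi> x) = \<tau>' x" by blast
 have "(\<lambda>y\<in>carrier N. v (u y)) \<in> chom N T" by (rule chom_compose[OF u(1) vc N T'])
 moreover have "(\<lambda>y\<in>carrier N. v (u y)) (\<psi> x) = \<tau> x" if "x \<in> carrier A" for x
  using that u(2) v(2) chomD(1)[OF psi that] chomD(1)[OF t that] by (simp add: \<tau>'_def)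
 ultimately show ?thesis by blast
qed

text \<open>The quotient of \<open>A\<close> by the generated ideal is itself a test object;
  whatever becomes zero in \<open>N\<close> becomes zero there.\<close>

lemma intersection_ker:
 assumes i: "is_intersection A J B \<phi> N \<psi>" and A: "cinf_scheme A" and B: "\<And>j. j \<in> J ==> cinf_ring (B j)"
  and phi: "\<And>j. j \<in> J ==> \<phi> j \<in> chom A (B j)" "\<And>j. j \<in> J ==> \<phi> j ` carrier A = carrier (B j)"
 shows "ker A N \<psi> \<subseteq> Idl\<^bsub>as_ring A\<^esub> (\<Union>j\<in>J. ker A (B j) (\<phi> j))"
proof -
 note A' = schemeD[OF A]
 interpret A: cinf A by unfold_locales (rule A')
 have sub: "(\<Union>j\<in>J. ker A (B j) (\<phi> j)) \<subseteq> carrier A" by (auto simp: ker_def)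
 obtain T :: "std cinf" and p where T: "cinf_scheme T" and p: "p \<in> chom A T"
  and k: "ker A T p = Idl\<^bsub>as_ring A\<^esub> (\<Union>j\<in>J. ker A (B j) (\<phi> j))"
  using quotient_std[OF A A.Idl(1)[OF sub]] .
 note T' = schemeD[OF T]
 have "\<exists>k\<in>chom (B j) T. \<forall>x\<in>carrier A. k (\<phi> j x) = p x" if j: "j \<in> J" for j
  using A.Idl(2)[OF sub] j by (intro chom_factor[OF A' B[OF j] T' phi(1)[OF j] phi(2)[OF j] p]) (auto simp: k)
 from intersection_ext[OF i A' B phi(1) T p this]
 obtain u where u: "u \<in> chom N T" "\<forall>x\<in>carrier A. u (\<psi> x) = p x" by blast
 show ?thesis unfolding k[symmetric]
 proof
  fix x assume "x \<in> ker A N \<psi>"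
  then have x: "x \<in> carrier A" "\<psi> x = const N 0" by (auto simp: ker_def)
  then have "p x = const T 0" using u(2) chom_const[OF u(1) T', of 0] by metis
  then show "x \<in> ker A T p" using x by (simp add: ker_def)
 qed
qed

lemma localizationD:
 assumes "is_localization A a L \<phi>"
 shows "cinf_scheme L" "\<phi> \<in> chom A L" "\<phi> a \<in> Units (as_ring L)"
proof -
 have "cinf_scheme L \<and> \<phi> \<in> chom A L \<and> \<phi> a \<in> Units (as_ring L)"
  using assms unfolding is_localization_def by (elim conjE) (intro conjI)
 then show "cinf_scheme L" "\<phi> \<in> chom A L" "\<phi> a \<in> Units (as_ring L)" by simp_all
qed

lemma localization_ext:
 assumes l: "is_localization A a L \<phi>" and A: "cinf_ring A" and a: "a \<in> carrier A"
  and T: "cinf_scheme T" and t: "\<tau> \<in> chom A T" "\<tau> a \<in> Units (as_ring T)"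
 shows "\<exists>u\<in>chom L T. \<forall>x\<in>carrier A. u (\<phi> x) = \<tau> x"
proof -
 note L = schemeD[OF localizationD(1)[OF l]] and phi = localizationD(2)[OF l]
 note T' = schemeD[OF T]
 obtain S :: "std cinf" and h where S: "cinf_scheme S" and h: "h \<in> ciso T S" using scheme_std[OF T] .
 note S' = schemeD[OF S]
 obtain v where v: "v \<in> ciso S T" "\<forall>x\<in>carrier T. v (h x) = x" using ciso_inverse[OF T' S' h] by blast
 have hc: "h \<in> chom T S" and vc: "v \<in> chom S T" using h v(1) by (auto simp: ciso_def)
 let ?t = "\<lambda>x\<in>carrier A. h (\<tau> x)"
 have t': "?t \<in> chom A S" by (rule chom_compose[OF t(1) hc A S'])
 have "?t a \<in> Units (as_ring S)" using chom_Units[OF hc T' S' t(2)] a by simp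
 from localization_univ[OF l S t' this] obtain u where u: "u \<in> chom L S" "\<forall>x\<in>carrier A. u (\<phi> x) = ?t x" by blast
 have "(\<lambda>y\<in>carrier L. v (u y)) \<in> chom L T" by (rule chom_compose[OF u(1) vc L T'])
 moreover have "(\<lambda>y\<in>carrier L. v (u y)) (\<phi> x) = \<tau> x" if "x \<in> carrier A" for x
  using that u(2) v(2) chomD(1)[OF phi that] chomD(1)[OF t(1) that] by simp
 ultimately show ?thesis by blast
qed

text \<open>Carried to a test object, both maps are the unique extension of the same map from
  \<open>A\<close>.\<close>

lemma localization_epi:
 assumes l: "is_localization A a L \<phi>" and A: "cinf_ring A" and a: "a \<in> carrier A" and T: "cinf_scheme T"
  and uv: "u \<in> chom L T" "v \<in> chom L T" "\<And>x. x \<in> carrier A ==> u (\<phi> x) = v (\<phi> x)"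
 shows "u = v"
proof -
 note L = schemeD[OF localizationD(1)[OF l]] and phi = localizationD(2)[OF l]
 note T' = schemeD[OF T]
 obtain S :: "std cinf" and h where S: "cinf_scheme S" and h: "h \<in> ciso T S" using scheme_std[OF T] .
 note S' = schemeD[OF S]
 have hc: "h \<in> chom T S" and hi: "inj_on h (carrier T)" using h by (auto simp: ciso_def bij_betw_def)
 let ?u = "\<lambda>y\<in>carrier L. h (u y)" and ?v = "\<lambda>y\<in>carrier L. h (v y)"
 let ?t = "\<lambda>x\<in>carrier A. ?u (\<phi> x)"
 have u': "?u \<in> chom L S" and v': "?v \<in> chom L S" using uv by (auto intro!: chom_compose[OF _ hc L S'])
 have t': "?t \<in> chom A S" by (rule chom_compose[OF phi u' A S'])
 have "?t a \<in> Units (as_ring S)" using chom_Units[OF u' L S' localizationD(3)[OF l]] a by simp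
 from localization_univ[OF l S t' this]
 have "\<exists>!w. w \<in> chom L S \<and> (\<forall>x\<in>carrier A. w (\<phi> x) = ?t x)" .
 moreover have "\<forall>x\<in>carrier A. ?u (\<phi> x) = ?t x" "\<forall>x\<in>carrier A. ?v (\<phi> x) = ?t x"
  using uv(3) chomD(1)[OF phi] by simp_all
 ultimately have "?u = ?v" using u' v' by blast
 then have "h (u y) = h (v y)" if "y \<in> carrier L" for y using that by (metis restrict_apply')
 then have "u y = v y" if "y \<in> carrier L" for y
  using inj_onD[OF hi, of "u y" "v y"] chomD(1)[OF uv(1) that] chomD(1)[OF uv(2) that] that by blast
 then show ?thesis by (rule chom_eqI[OF uv(1,2)])
qed

lemma (in cinf) inverse_unique:
 assumes "x \<in> carrier A" "y \<in> carrier A" "z \<in> carrier A" "op2 A (*) x y = const A 1" "op2 A (*) x z = const A 1"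
 shows "y = z"
proof -
 have "y = op2 A (*) (op2 A (*) x z) y" using assms by simp
 also have "\<dots> = op2 A (*) (op2 A (*) x y) z"
  using ring_laws(6)[OF assms(1,3,2)] ring_laws(6)[OF assms(1,2,3)] ring_laws(7)[OF assms(3,2,2)] by simp
 finally show ?thesis using assms by simp
qed

lemma generates_hom_eqI:
 assumes g: "generates A n x" and u: "u \<in> chom A T" "v \<in> chom A T" and e: "\<And>i. i < n ==> u (x i) = v (x i)" and T: "cinf_ring T"
 shows "u = v"
proof (rule chom_eqI[OF u])
 interpret T: cinf T by unfold_locales (rule T)
 have x: "\<forall>i<n. x i \<in> carrier A" using g by (auto simp: generates_def)
 fix y assume "y \<in> carrier A"
 then obtain f where f: "Sm n f" "y = app A n f x" using g by (auto simp: generates_def)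
 have "u y = app T n f (%i. u (x i))" using chom_app'[OF u(1) f(1) x] f(2) by simp
 also have "\<dots> = app T n f (%i. v (x i))" using e chomD(1)[OF u(1)] chomD(1)[OF u(2)] x by (intro T.app_cong f(1)) auto
 also have "\<dots> = v y" using chom_app'[OF u(2) f(1) x] f(2) by simp
 finally show "u y = v y" .
qed

text \<open>Generators and relations of \<open>A\<close>, one new variable for the inverse, and the
  relation \<open>\<alpha> z = 1\<close>.\<close>

lemma localization_exists:
 assumes A: "cinf_scheme A" and a: "a \<in> carrier A"
 obtains L :: "std cinf" and \<phi> where "is_localization A a L \<phi>"
proof -
 note A' = schemeD[OF A]
 interpret A: cinf A by unfold_locales (rule A')
 obtain n x where gen: "generates A n x" using A scheme_iff by blast
 have x: "\<forall>i<n. x i \<in> carrier A" using gen by (auto simp: generates_def)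
 obtain \<alpha> where \<alpha>: "Sm n \<alpha>" "a = app A n \<alpha> x" using a gen by (auto simp: generates_def)
 let ?R = "CinfR (Suc n)"
 interpret R: cinf ?R by unfold_locales (rule CinfR_ring)
 define E where "E = (\<lambda>z\<in>Rn (Suc n). \<alpha> (tuple n z) * z n - 1)"
 have Er: "E \<in> carrier ?R" unfolding E_def using Sm_extend[OF \<alpha>(1)] by simp
 define S where "S = insert E {\<lambda>z\<in>Rn (Suc n). g (tuple n z) | g. Sm n g \<and> app A n g x = const A 0}"
 have S: "S \<subseteq> carrier ?R" unfolding S_def using Er Sm_extend by auto
 define J where "J = Idl\<^bsub>as_ring ?R\<^esub> S"
 have J: "ideal J (as_ring ?R)" "S \<subseteq> J" unfolding J_def by (rule R.Idl[OF S])+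
 let ?L = "quot ?R J" and ?p = "quot_map ?R J"
 note q = quot_basics[OF CinfR_ring J(1)]
 interpret L: cinf ?L by unfold_locales (rule q)
 have pz: "?p F = const ?L 0 \<longleftrightarrow> F \<in> J" if "F \<in> carrier ?R" for F
 proof -
  have "?p F = const (quot ?R J) 0 \<longleftrightarrow> F \<in> ker ?R (quot ?R J) ?p" using that by (simp add: ker_def)
  then show ?thesis using q(4) by simp
 qed
 let ?c = "%i. ?p (coord (Suc n) i)"
 have genL: "generates ?L (Suc n) ?c" by (rule quot_CinfR_generates(1)[OF J(1)])
 have Ls: "cinf_scheme ?L" using scheme_iff q(1) genL by blast
 have cc: "\<And>i. ?c i \<in> carrier ?L" using chomD(1)[OF q(2)] by simp
 have appc: "app ?L n g ?c = ?p (\<lambda>z\<in>Rn (Suc n). g (tuple n z))" if g: "Sm n g" for g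
 proof -
  have "app ?L n g ?c = ?p (app ?R n g (coord (Suc n)))" using chom_app'[OF q(2) g, of "coord (Suc n)"] by simp
  also have "app ?R n g (coord (Suc n)) = (\<lambda>z\<in>Rn (Suc n). g (tuple n z))"
   unfolding app_CinfR by (intro restrict_ext arg_cong[of _ _ g]) (auto simp: tuple_def coord_def)
  finally show ?thesis .
 qed
 have ex: "ev A n x \<in> chom (CinfR n) A" using x by (intro A.ev_chom) auto
 have et: "ev ?L n ?c \<in> chom (CinfR n) ?L" using cc by (intro L.ev_chom) auto
 have "ker (CinfR n) A (ev A n x) \<subseteq> ker (CinfR n) ?L (ev ?L n ?c)"
 proof
  fix g assume "g \<in> ker (CinfR n) A (ev A n x)"
  then have g: "g \<in> carrier (CinfR n)" "app A n g x = const A 0" by (auto simp: ker_def ev_def)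
  note gs = CinfR_smooth[OF g(1)]
  have "(\<lambda>z\<in>Rn (Suc n). g (tuple n z)) \<in> J" using J(2) g(2) gs unfolding S_def by blast
  then show "g \<in> ker (CinfR n) ?L (ev ?L n ?c)"
   using appc[OF gs] pz Sm_extend[OF gs] g(1) by (simp add: ker_def ev_def)
 qed
 from chom_factor[OF CinfR_ring A' q(1) ex A.generates_surj[OF gen] et this]
 obtain \<phi> where phi: "\<phi> \<in> chom A ?L" "\<forall>g\<in>carrier (CinfR n). \<phi> (ev A n x g) = ev ?L n ?c g" by blast
 have phia: "\<phi> (app A n g x) = ?p (\<lambda>z\<in>Rn (Suc n). g (tuple n z))" if g: "Sm n g" for g
  using phi(2)[rule_format, of "restrict g (Rn n)"] g appc[OF g] by simp
 let ?f = "\<lambda>z\<in>Rn (Suc n). \<alpha> (tuple n z)"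
 have fR: "?f \<in> carrier ?R" using Sm_extend[OF \<alpha>(1)] by simp
 have "op2 ?R (-) (op2 ?R (*) ?f (coord (Suc n) n)) (const ?R 1) = E"
  by (auto simp: ops_CinfR coord_def E_def fun_eq_iff)
 then have "op2 ?R (-) (op2 ?R (*) ?f (coord (Suc n) n)) (const ?R 1) \<in> J"
  using J(2) unfolding S_def by auto
 then have "?p (op2 ?R (*) ?f (coord (Suc n) n)) = ?p (const ?R 1)"
  using hom_eq_iff_ker[OF q(2) CinfR_ring q(1), of "op2 ?R (*) ?f (coord (Suc n) n)" "const ?R 1"] fR q(4) by simp
 then have inv: "op2 ?L (*) (\<phi> a) (?c n) = const ?L 1"
  using chom_arith(2)[OF q(2) fR coord_CinfR] chom_const[OF q(2,1), of 1] unfolding \<alpha>(2) phia[OF \<alpha>(1)] by simp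
 have "is_localization A a ?L \<phi>"
  unfolding is_localization_def
 proof (intro conjI allI impI ballI Ls phi(1))
  show "\<phi> a \<in> Units (as_ring ?L)" unfolding L.Units_iff using inv cc chomD(1)[OF phi(1) a] by blast
  fix T :: "std cinf" and \<tau> assume Ts: "cinf_scheme T" and t: "\<tau> \<in> chom A T" and u: "\<tau> a \<in> Units (as_ring T)"
  note T' = schemeD[OF Ts]
  interpret T: cinf T by unfold_locales (rule T')
  obtain y where y: "y \<in> carrier T" "op2 T (*) (\<tau> a) y = const T 1" using u T.Units_iff by blast
  have tx: "\<forall>i<n. \<tau> (x i) \<in> carrier T" using chomD(1)[OF t] x by blast
  let ?b = "(%i. \<tau> (x i))(n := y)"
  have b: "\<forall>i<Suc n. ?b i \<in> carrier T" using tx y(1) by (auto simp: less_Suc_eq)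
  have eb: "ev T (Suc n) ?b \<in> chom ?R T" using b by (intro T.ev_chom) blast
  have Al: "app T (Suc n) (%z. g (tuple n z)) ?b = \<tau> (app A n g x)" if g: "Sm n g" for g
   using T.app_extend'[OF g tx y(1)] chom_app'[OF t g x] by simp
  have Y: "app T (Suc n) (%z. z n) ?b = y" using T.app_coord[of n "Suc n" ?b] b by simp
  have "app T (Suc n) (%z. \<alpha> (tuple n z) * z n - 1) ?b = op2 T (-) (op2 T (*) (\<tau> a) y) (const T 1)"
   using T.arith_app'(3)[OF _ _ b, of "%z. \<alpha> (tuple n z) * z n" "%z. 1"] T.arith_app'(2)[OF _ _ b, of "%z. \<alpha> (tuple n z)" "%z. z n"]
    Sm_extend[OF \<alpha>(1)] Al[OF \<alpha>(1)] \<alpha>(2) Y T.const_app'[OF b, of 1, symmetric] by (simp add: fun_upd_def)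
  then have E0: "app T (Suc n) (%z. \<alpha> (tuple n z) * z n - 1) ?b = const T 0" unfolding y(2) by simp
  have "S \<subseteq> ker ?R T (ev T (Suc n) ?b)"
   using S E0 Al Sm_extend[OF \<alpha>(1)] chom_const[OF t T', of 0] Sm_extend
   by (auto simp: S_def ker_def E_def)
  then have "J \<subseteq> ker ?R T (ev T (Suc n) ?b)"
   unfolding J_def by (intro R.Idl(3)[OF S] ker_ideal[OF eb CinfR_ring T'])
  then have "ker ?R ?L ?p \<subseteq> ker ?R T (ev T (Suc n) ?b)" unfolding q(4) .
  from chom_factor[OF CinfR_ring q(1) T' q(2,3) eb this]
  obtain w where w: "w \<in> chom ?L T" "\<forall>g\<in>carrier ?R. w (?p g) = ev T (Suc n) ?b g" by blast
  have wphi: "w (\<phi> z) = \<tau> z" if z: "z \<in> carrier A" for z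
  proof -
   obtain g where g: "Sm n g" "z = app A n g x" using generatesD(2)[OF gen z] by blast
   show ?thesis unfolding g(2) phia[OF g(1)] using w(2) Sm_extend[OF g(1)] Al[OF g(1)] by simp
  qed
  show "\<exists>!w. w \<in> chom ?L T \<and> (\<forall>x\<in>carrier A. w (\<phi> x) = \<tau> x)"
  proof (rule ex1I[of _ w])
   show "w \<in> chom ?L T \<and> (\<forall>x\<in>carrier A. w (\<phi> x) = \<tau> x)" using w(1) wphi by blast
   fix v assume v: "v \<in> chom ?L T \<and> (\<forall>x\<in>carrier A. v (\<phi> x) = \<tau> x)"
   show "v = w"
   proof (rule generates_hom_eqI[OF genL _ w(1) _ T'])
    fix i assume "i < Suc n"
    then consider "i < n" | "i = n" by linarith
    then show "v (?c i) = w (?c i)"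
    proof cases
     case 1
     have "\<phi> (app A n (%z. z i) x) = ?p (\<lambda>z\<in>Rn (Suc n). tuple n z i)" by (rule phia) simp
     also have "(\<lambda>z\<in>Rn (Suc n). tuple n z i) = coord (Suc n) i" using 1 by (auto simp: coord_def fun_eq_iff)
     finally have "\<phi> (x i) = ?c i" using A.app_coord[of i n x] 1 x by simp
     then show ?thesis using v wphi x 1 by metis
    next
     case 2
     have "op2 T (*) (\<tau> a) (v (?c n)) = const T 1"
      using chom_arith(2)[of v ?L T "\<phi> a" "?c n"] v inv chomD(1)[OF phi(1) a] cc chom_const[of v ?L T 1] T' a by simp
     moreover have "op2 T (*) (\<tau> a) (w (?c n)) = const T 1"
      using chom_arith(2)[of w ?L T "\<phi> a" "?c n"] w(1) wphi inv chomD(1)[OF phi(1) a] cc chom_const[of w ?L T 1] T' a by simp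
     ultimately show ?thesis
      using T.inverse_unique chomD(1)[OF t a] chomD(1)[of v ?L T] chomD(1)[OF w(1)] v cc 2 by blast
    qed
   qed (use v in blast)
  qed
 qed
 then show thesis using that by blast
qed

text \<open>The subring generated by these elements already contains an inverse of the image of
  \<open>a\<close>. So the localization maps to it, and the composite with the inclusion is the
  identity by uniqueness.\<close>

lemma localization_generated:
 assumes l: "is_localization A a L \<phi>" and A: "cinf_ring A" and a: "a \<in> carrier A" and gen: "generates A n x"
  and y: "y \<in> carrier L" "op2 L (*) (\<phi> a) y = const L 1"
 shows "generates L (Suc n) ((%i. \<phi> (x i))(n := y))"
proof -
 note Ls = localizationD(1)[OF l] and phi = localizationD(2)[OF l]
 note L' = schemeD[OF Ls]
 interpret L: cinf L by unfold_locales (rule L')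
 have x: "\<forall>i<n. x i \<in> carrier A" using gen by (auto simp: generates_def)
 have px: "\<forall>i<n. \<phi> (x i) \<in> carrier L" using chomD(1)[OF phi] x by blast
 let ?b = "(%i. \<phi> (x i))(n := y)"
 have b: "\<And>i. i < Suc n ==> ?b i \<in> carrier L" using px y(1) by (auto simp: less_Suc_eq)
 obtain T :: "std cinf" and j where T: "cinf_scheme T" and j: "j \<in> chom T L" "inj_on j (carrier T)"
  "j ` carrier T = {app L (Suc n) g ?b | g. Sm (Suc n) g}" using subring_std[OF L' b] .
 note T' = schemeD[OF T]
 interpret T: cinf T by unfold_locales (rule T')
 have "\<phi> ` carrier A \<subseteq> j ` carrier T"
 proof
  fix z assume "z \<in> \<phi> ` carrier A"
  then obtain g where g: "Sm n g" "z = \<phi> (app A n g x)" using gen by (auto simp: generates_def)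
  have "z = app L (Suc n) (%z. g (tuple n z)) ?b"
   unfolding g(2) chom_app'[OF phi g(1) x] using L.app_extend'[OF g(1) px y(1)] by simp
  then show "z \<in> j ` carrier T" unfolding j(3) using Sm_extend[OF g(1)] by blast
 qed
 from chom_lift[OF j(1,2) phi this T' L' A] obtain k where k: "k \<in> chom A T" "\<forall>x\<in>carrier A. j (k x) = \<phi> x" by blast
 have "y = app L (Suc n) (%z. z n) ?b" using L.app_coord[of n "Suc n" ?b] b by simp
 then have "y \<in> j ` carrier T" unfolding j(3) using Sm_intros(2) by blast
 then obtain y0 where y0: "y0 \<in> carrier T" "j y0 = y" by blast
 have ka: "k a \<in> carrier T" using chomD(1)[OF k(1) a] .
 have "j (op2 T (*) (k a) y0) = j (const T 1)"
  using chom_arith(2)[OF j(1) ka y0(1)] k(2) a y0(2) y(2) chom_const[OF j(1) L', of 1] by simp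
 then have "op2 T (*) (k a) y0 = const T 1" using inj_onD[OF j(2)] ka y0(1) by simp
 then have "k a \<in> Units (as_ring T)" unfolding T.Units_iff using ka y0(1) by blast
 from localization_ext[OF l A a T k(1) this] obtain u where u: "u \<in> chom L T" "\<forall>x\<in>carrier A. u (\<phi> x) = k x" by blast
 have ju: "(\<lambda>z\<in>carrier L. j (u z)) \<in> chom L L" by (rule chom_compose[OF u(1) j(1) L' L'])
 have "(\<lambda>z\<in>carrier L. j (u z)) = (\<lambda>z\<in>carrier L. z)"
 proof (rule localization_epi[OF l A a Ls ju chom_id[OF L']])
  show "(\<lambda>z\<in>carrier L. j (u z)) (\<phi> x) = (\<lambda>z\<in>carrier L. z) (\<phi> x)" if "x \<in> carrier A" for x
   using that u(2) k(2) chomD(1)[OF phi that] by simp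
 qed
 then have "z \<in> j ` carrier T" if "z \<in> carrier L" for z
  using that chomD(1)[OF u(1) that] by (metis image_eqI restrict_apply')
 then show ?thesis unfolding generates_def j(3) using b by blast
qed

section \<open>Finite intersections of open loci\<close>

primrec cprod :: "'a cinf => (nat => 'a) => nat => 'a" where
 "cprod A c 0 = const A 1"
| "cprod A c (Suc k) = op2 A (*) (cprod A c k) (c k)"

lemma (in cinf) cprod_closed: "(\<And>j. j < k ==> c j \<in> carrier A) ==> cprod A c k \<in> carrier A"
 by (induction k) auto

lemma chom_cprod:
 assumes "h \<in> chom A B" "cinf_ring A" "cinf_ring B" "\<And>j. j < k ==> c j \<in> carrier A"
 shows "h (cprod A c k) = cprod B (%j. h (c j)) k"
proof -
 interpret A: cinf A by unfold_locales (rule assms)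
 show ?thesis using assms(4)
  by (induction k) (simp_all add: chom_const[OF assms(1,3)] chom_arith(2)[OF assms(1)] A.cprod_closed)
qed

lemma (in cinf) Units_mult:
 assumes "x \<in> carrier A" "y \<in> carrier A"
 shows "op2 A (*) x y \<in> Units (as_ring A) \<longleftrightarrow> x \<in> Units (as_ring A) \<and> y \<in> Units (as_ring A)"
proof
 assume "op2 A (*) x y \<in> Units (as_ring A)"
 then obtain z where z: "z \<in> carrier A" "op2 A (*) (op2 A (*) x y) z = const A 1" unfolding Units_iff by blast
 have "op2 A (*) x (op2 A (*) y z) = const A 1" using ring_laws(6)[OF assms z(1)] z(2) by simp
 moreover have "op2 A (*) y (op2 A (*) x z) = const A 1"
  using ring_laws(6)[OF assms(2,1) z(1)] ring_laws(7)[OF assms assms(1)] z(2) by simp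
 ultimately show "x \<in> Units (as_ring A) \<and> y \<in> Units (as_ring A)"
  unfolding Units_iff using assms z(1) by (meson arith_closed(2))
next
 interpret R: cring "as_ring A" by (rule cring)
 assume "x \<in> Units (as_ring A) \<and> y \<in> Units (as_ring A)"
 then show "op2 A (*) x y \<in> Units (as_ring A)" using R.Units_m_closed[of x y] by simp
qed

lemma (in cinf) Units_cprod:
 "(\<And>j. j < k ==> c j \<in> carrier A) ==> cprod A c k \<in> Units (as_ring A) \<longleftrightarrow> (\<forall>j<k. c j \<in> Units (as_ring A))"
proof (induction k)
 case 0
 then show ?case unfolding Units_iff by (auto intro!: bexI[of _ "const A 1"])
next
 case (Suc k)
 then show ?case using Units_mult[of "cprod A c k" "c k"] cprod_closed[of k c] by (auto simp: less_Suc_eq)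
qed

text \<open>A product is a unit iff each factor is, so inverting the product is universal for
  inverting all \<open>c j\<close>.\<close>

lemma intersection_of_localizations:
 assumes A: "cinf_scheme A" and c: "\<And>j. j < m ==> c j \<in> carrier A"
  and G: "\<And>j. j < m ==> is_localization A (c j) (G j) (\<gamma> j)"
  and U: "is_localization A (cprod A c m) U \<omega>"
 shows "is_intersection A {..<m} G \<gamma> U \<omega>"
proof -
 note A' = schemeD[OF A]
 interpret A: cinf A by unfold_locales (rule A')
 have cc: "cprod A c m \<in> carrier A" by (rule A.cprod_closed[OF c])
 note Us = localizationD(1)[OF U] and om = localizationD(2)[OF U]
 note U' = schemeD[OF Us]
 interpret U: cinf U by unfold_locales (rule U')
 have unit: "\<omega> (c j) \<in> Units (as_ring U)" if "j < m" for j
 proof -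
  have "cprod U (%j. \<omega> (c j)) m \<in> Units (as_ring U)"
   using localizationD(3)[OF U] chom_cprod[OF om A' U' c] by simp
  then show ?thesis using U.Units_cprod[of m "%j. \<omega> (c j)"] chomD(1)[OF om c] that by blast
 qed
 have "\<forall>j\<in>{..<m}. \<exists>i. i \<in> chom (G j) U \<and> (\<forall>x\<in>carrier A. i (\<gamma> j x) = \<omega> x)"
  using localization_ext[OF G A' c Us om unit] by blast
 from bchoice[OF this] obtain \<iota> where i: "\<forall>j\<in>{..<m}. \<iota> j \<in> chom (G j) U \<and> (\<forall>x\<in>carrier A. \<iota> j (\<gamma> j x) = \<omega> x)" by (rule exE)
 have "\<exists>!u. u \<in> chom U T \<and> (\<forall>x\<in>carrier A. u (\<omega> x) = \<tau> x) \<and> (\<forall>j\<in>{..<m}. \<forall>y\<in>carrier (G j). u (\<iota> j y) = \<kappa> j y)"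
  if Ts: "cinf_scheme T" and t: "\<tau> \<in> chom A T" and kap: "\<forall>j\<in>{..<m}. \<kappa> j \<in> chom (G j) T \<and> (\<forall>x\<in>carrier A. \<kappa> j (\<gamma> j x) = \<tau> x)"
  for T :: "std cinf" and \<tau> \<kappa>
 proof -
  note T' = schemeD[OF Ts]
  interpret T: cinf T by unfold_locales (rule T')
  have "\<tau> (c j) \<in> Units (as_ring T)" if j: "j < m" for j
  proof -
   have kj: "\<kappa> j \<in> chom (G j) T" "\<kappa> j (\<gamma> j (c j)) = \<tau> (c j)" using kap j c[OF j] by auto
   show ?thesis using chom_Units[OF kj(1) schemeD[OF localizationD(1)[OF G[OF j]]] T' localizationD(3)[OF G[OF j]]] kj(2) by simp
  qed
  then have "\<tau> (cprod A c m) \<in> Units (as_ring T)"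
   using chom_cprod[OF t A' T' c] T.Units_cprod[of m "%j. \<tau> (c j)"] chomD(1)[OF t c] by simp
  from localization_ext[OF U A' cc Ts t this] obtain u where u: "u \<in> chom U T" "\<forall>x\<in>carrier A. u (\<omega> x) = \<tau> x" by blast
  show ?thesis
  proof (rule ex1I[of _ u])
   have "u (\<iota> j y) = \<kappa> j y" if j: "j \<in> {..<m}" and y: "y \<in> carrier (G j)" for j y
   proof -
    have jm: "j < m" using j by simp
    note Gj = schemeD[OF localizationD(1)[OF G[OF jm]]]
    have ij: "\<iota> j \<in> chom (G j) U" "\<forall>x\<in>carrier A. \<iota> j (\<gamma> j x) = \<omega> x" using i j by auto
    have kj: "\<kappa> j \<in> chom (G j) T" "\<forall>x\<in>carrier A. \<kappa> j (\<gamma> j x) = \<tau> x" using kap j by auto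
    have "(\<lambda>y\<in>carrier (G j). u (\<iota> j y)) = \<kappa> j"
    proof (rule localization_epi[OF G[OF jm] A' c[OF jm] Ts chom_compose[OF ij(1) u(1) Gj T'] kj(1)])
     show "(\<lambda>y\<in>carrier (G j). u (\<iota> j y)) (\<gamma> j x) = \<kappa> j (\<gamma> j x)" if "x \<in> carrier A" for x
      using that ij(2) kj(2) u(2) chomD(1)[OF localizationD(2)[OF G[OF jm]] that] by simp
    qed
    then show ?thesis using y by (metis restrict_apply')
   qed
   then show "u \<in> chom U T \<and> (\<forall>x\<in>carrier A. u (\<omega> x) = \<tau> x) \<and> (\<forall>j\<in>{..<m}. \<forall>y\<in>carrier (G j). u (\<iota> j y) = \<kappa> j y)"
    using u by blast
   fix v assume v: "v \<in> chom U T \<and> (\<forall>x\<in>carrier A. v (\<omega> x) = \<tau> x) \<and> (\<forall>j\<in>{..<m}. \<forall>y\<in>carrier (G j). v (\<iota> j y) = \<kappa> j y)"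
   show "v = u" using v u by (intro localization_epi[OF U A' cc Ts]) auto
  qed
 qed
 then show ?thesis by (rule intersectionI[OF Us om i])
qed

section \<open>Points and loci\<close>

lemma real_cinf_simps [simp]:
 "carrier real_cinf = UNIV" "app real_cinf n g a = g (tuple n a)"
 by (simp_all add: real_cinf_def app_def)

lemma real_cinf_ops [simp]:
 "op2 real_cinf \<beta> x y = \<beta> x y" "op1 real_cinf \<alpha> x = \<alpha> x" "const real_cinf c = c"
 by (simp_all add: op_app)

lemma real_cinf_ring: "cinf_ring real_cinf"
 unfolding cinf_ring_def
proof (intro conjI allI impI)
 fix n :: nat and g and a b :: "nat => real"
 assume "g \<in> carrier (CinfR n) \<and> (\<forall>i<n. a i \<in> carrier real_cinf \<and> a i = b i)"
 then have "tuple n a = tuple n b" by (auto simp: tuple_def)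
 then show "cop real_cinf n g a = cop real_cinf n g b" by (simp add: real_cinf_def)
qed (auto simp: real_cinf_def)

lemma real_cinf_scheme: "cinf_scheme real_cinf"
proof -
 have "generates real_cinf 0 undefined" unfolding generates_def
  by (auto intro!: exI[of _ "%_. b" for b])
 then show ?thesis using scheme_iff real_cinf_ring by blast
qed

lemma real_cinf_Units: "x \<in> Units (as_ring real_cinf) \<longleftrightarrow> x \<noteq> 0"
proof -
 interpret R: cinf real_cinf by unfold_locales (rule real_cinf_ring)
 show ?thesis unfolding R.Units_iff by (auto intro!: exI[of _ "1 / x"])
qed

lemma real_cinf_nonzero: "\<not> zero_ring real_cinf"
 by (auto simp: zero_ring_def)

lemma inf_rad_point:
 assumes A: "cinf_ring A" and I: "ideal I (as_ring A)" and p: "p \<in> chom A real_cinf" "\<And>x. x \<in> I ==> p x = 0"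
  and a: "a \<in> inf_radical A I"
 shows "p a = 0"
 using inf_radD[OF A I a real_cinf_scheme p(1)] p(2) real_cinf_nonzero real_cinf_Units by (metis real_cinf_ops(3))

lemma cutoff:
 "Sm 1 (%v. cutoff r (v 0))" "cutoff r t = 0 \<longleftrightarrow> t \<le> r" "Sm 1 (%v. cutoff r (- v 0))"
proof -
 have "Sm 1 (%v. e0 (v 0 - r))" by (rule smooth_e0[OF opn_Rn]) simp
 then have "(\<lambda>v\<in>Rn 1. e0 (v 0 - r)) \<in> carrier (CinfR 1) \<and> {t. e0 (t - r) = 0} = {..r}"
  by (auto simp: e0_simps)
 from someI[of "\<lambda>\<alpha>. (\<lambda>v\<in>Rn 1. \<alpha> (v 0)) \<in> carrier (CinfR 1) \<and> {t. \<alpha> t = 0} = {..r}", OF this]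
 have c: "(\<lambda>v\<in>Rn 1. cutoff r (v 0)) \<in> carrier (CinfR 1)" "{t. cutoff r t = 0} = {..r}"
  unfolding cutoff_def by blast+
 show 1: "Sm 1 (%v. cutoff r (v 0))"
  by (rule smooth_on_cong[OF opn_Rn CinfR_smooth[OF c(1)]]) simp
 show "cutoff r t = 0 \<longleftrightarrow> t \<le> r" using c(2) by auto
 have "Sm 1 (%x. (%v. cutoff r (v 0)) (tuple 1 (%_. - x 0)))" by (rule Sm_comp[OF 1]) simp
 then show "Sm 1 (%v. cutoff r (- v 0))" by simp
qed

lemma loci_ideals:
 assumes A: "cinf_scheme A" and f: "f \<in> carrier A"
 shows "ideal (le_ideal A f r) (as_ring A)" "ideal (ge_ideal A f r) (as_ring A)"
proof -
 interpret A: cinf A by unfold_locales (rule schemeD[OF A])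
 have "op1 A (cutoff r) f \<in> carrier A" "op1 A (%t. cutoff (- r) (- t)) f \<in> carrier A"
  by (auto intro!: A.op1_closed f cutoff)
 then show "ideal (le_ideal A f r) (as_ring A)" "ideal (ge_ideal A f r) (as_ring A)"
  unfolding le_ideal_def ge_ideal_def by (auto intro!: inf_radical_ideal[OF A] A.PIdl(1))
qed

lemma loci_points:
 assumes A: "cinf_scheme A" and f: "f \<in> carrier A" and p: "p \<in> chom A real_cinf"
 shows "p f \<le> r ==> x \<in> le_ideal A f r ==> p x = 0" "p f \<ge> r ==> x \<in> ge_ideal A f r ==> p x = 0"
proof -
 note A' = schemeD[OF A]
 interpret A: cinf A by unfold_locales (rule A')
 have *: "p x = 0" if S: "Sm 1 (%v. \<alpha> (v 0))" and "\<alpha> (p f) = 0" and x: "x \<in> inf_radical A (PIdl\<^bsub>as_ring A\<^esub> (op1 A \<alpha> f))" for \<alpha>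
 proof -
  have c: "op1 A \<alpha> f \<in> carrier A" by (rule A.op1_closed[OF S f])
  have "op1 A \<alpha> f \<in> ker A real_cinf p" using c chom_op1[OF p S f] that(2) by (simp add: ker_def)
  then have "PIdl\<^bsub>as_ring A\<^esub> (op1 A \<alpha> f) \<subseteq> ker A real_cinf p" by (intro A.PIdl(3)[OF c] ker_ideal[OF p A' real_cinf_ring])
  then show ?thesis by (intro inf_rad_point[OF A' A.PIdl(1)[OF c] p _ x]) (auto simp: ker_def)
 qed
 show "p f \<le> r ==> x \<in> le_ideal A f r ==> p x = 0"
  unfolding le_ideal_def by (rule *[OF cutoff(1)]) (simp_all add: cutoff)
 show "p f \<ge> r ==> x \<in> ge_ideal A f r ==> p x = 0"
  unfolding ge_ideal_def by (rule *[OF cutoff(3)]) (simp_all add: cutoff)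
qed

lemma eq_locus_exists:
 assumes A: "cinf_scheme A" and f: "f \<in> carrier A"
 obtains E :: "std cinf" and \<epsilon> where "is_eq_locus A f r E \<epsilon>" "cinf_scheme E" "\<epsilon> \<in> chom A E" "\<epsilon> ` carrier A = carrier E"
  "ker A E \<epsilon> = Idl\<^bsub>as_ring A\<^esub> (le_ideal A f r \<union> ge_ideal A f r)"
proof -
 note A' = schemeD[OF A]
 interpret A: cinf A by unfold_locales (rule A')
 note I = loci_ideals[OF A f, of r]
 have S: "le_ideal A f r \<union> ge_ideal A f r \<subseteq> carrier A" using A.idealD(1)[OF I(1)] A.idealD(1)[OF I(2)] by blast
 obtain E :: "std cinf" and \<epsilon> where E: "cinf_scheme E" "\<epsilon> \<in> chom A E" "\<epsilon> ` carrier A = carrier E"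
  "ker A E \<epsilon> = Idl\<^bsub>as_ring A\<^esub> (le_ideal A f r \<union> ge_ideal A f r)" using quotient_std[OF A A.Idl(1)[OF S]] .
 have j: "ideal j (as_ring A)" if "j \<in> {le_ideal A f r, ge_ideal A f r}" for j using that I by blast
 have "is_eq_locus A f r E \<epsilon>"
  unfolding is_eq_locus_def
 proof (rule intersection_of_quotients[OF A' E(1-3)])
  show "cinf_ring (quot A j)" "quot_map A j \<in> chom A (quot A j)" "quot_map A j ` carrier A = carrier (quot A j)"
   if "j \<in> {le_ideal A f r, ge_ideal A f r}" for j
   using quot_basics[OF A' j[OF that]] by blast+
  have "(\<Union>j\<in>{le_ideal A f r, ge_ideal A f r}. ker A (quot A j) (quot_map A j)) = le_ideal A f r \<union> ge_ideal A f r"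
   using quot_basics(4)[OF A' I(1)] quot_basics(4)[OF A' I(2)] by simp
  then show "ker A E \<epsilon> = Idl\<^bsub>as_ring A\<^esub> (\<Union>j\<in>{le_ideal A f r, ge_ideal A f r}. ker A (quot A j) (quot_map A j))"
   using E(4) by simp
 qed
 then show thesis using that E by blast
qed

lemma zero_ideal: "cinf_ring A ==> ideal {const A 0} (as_ring A)"
proof -
 assume "cinf_ring A"
 then interpret A: cinf A by unfold_locales
 show ?thesis by (rule A.idealI') auto
qed

lemma red_basics:
 assumes N: "cinf_scheme N"
 shows "ideal (nil_radical N) (as_ring N)" "cinf_ring (red N)" "red_map N \<in> chom N (red N)"
  "red_map N ` carrier N = carrier (red N)" "ker N (red N) (red_map N) = nil_radical N"
proof -
 show I: "ideal (nil_radical N) (as_ring N)"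
  unfolding nil_radical_def by (rule inf_radical_ideal[OF N zero_ideal[OF schemeD[OF N]]])
 show "cinf_ring (red N)" "red_map N \<in> chom N (red N)"
  "red_map N ` carrier N = carrier (red N)" "ker N (red N) (red_map N) = nil_radical N"
  unfolding red_def red_map_def using quot_basics[OF schemeD[OF N] I] by blast+
qed

lemma nil_point:
 assumes N: "cinf_scheme N" and p: "p \<in> chom N real_cinf" and x: "x \<in> nil_radical N"
 shows "p x = 0"
proof (rule inf_rad_point[OF schemeD[OF N] zero_ideal[OF schemeD[OF N]] p _ x[unfolded nil_radical_def]])
 show "p y = 0" if "y \<in> {const N 0}" for y using that chom_const[OF p real_cinf_ring, of 0] by simp
qed

text \<open>For \<open>x = f\<close> on \<open>M\<^bsub>f = 0\<^esub>\<close>, where \<open>f\<close> need not vanish.\<close>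

lemma nil_of_cutoffs:
 assumes N: "cinf_scheme N" and x: "x \<in> carrier N"
  and z: "op1 N (cutoff 0) x = const N 0" "op1 N (%t. cutoff 0 (- t)) x = const N 0"
 shows "x \<in> nil_radical N"
 unfolding nil_radical_def
proof (rule inf_radI[OF schemeD[OF N] zero_ideal[OF schemeD[OF N]] x])
 fix T :: "std cinf" and \<tau> assume Ts: "cinf_scheme T" and t: "\<tau> \<in> chom N T" and u: "\<tau> x \<in> Units (as_ring T)"
 note T' = schemeD[OF Ts]
 interpret T: cinf T by unfold_locales (rule T')
 obtain y where y: "y \<in> carrier T" "op2 T (*) (\<tau> x) y = const T 1" using u T.Units_iff by blast
 have tx: "\<tau> x \<in> carrier T" by (rule chomD(1)[OF t x])
 let ?b = "%i::nat. if i = 0 then \<tau> x else y"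
 have b: "\<forall>i<2. ?b i \<in> carrier T" using tx y(1) by simp
 have X: "app T 2 (%v. v 0) ?b = \<tau> x" "app T 2 (%v. v 1) ?b = y" using T.app_coord[of _ 2 ?b] b by auto
 have c1: "Sm 2 (%v. cutoff 0 (v 0))" "Sm 2 (%v. cutoff 0 (- v 0))"
  using Sm_comp[OF cutoff(1)[of 0], of 2 "%_ v. v 0"] Sm_comp[OF cutoff(3)[of 0], of 2 "%_ v. v 0"] by simp_all
 have z1: "app T 2 (%v. cutoff 0 (v 0)) ?b = const T 0" "app T 2 (%v. cutoff 0 (- v 0)) ?b = const T 0"
  using T.op1_app[OF cutoff(1), of 2 "%v. v 0" ?b 0] T.op1_app[OF cutoff(3), of 2 "%v. v 0" ?b 0] b X(1)
   chom_op1[OF t cutoff(1) x, of 0] chom_op1[OF t cutoff(3) x, of 0] z chom_const[OF t T', of 0] by simp_all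
 have "app T 2 (%v. v 0 * v 1 - 1) ?b = op2 T (-) (op2 T (*) (\<tau> x) y) (const T 1)"
  using T.arith_app'(3)[OF _ _ b, of "%v. v 0 * v 1" "%v. 1"] T.arith_app'(2)[OF _ _ b, of "%v. v 0" "%v. v 1"]
   X T.const_app'[OF b, of 1, symmetric] by simp
 then have E: "app T 2 (%v. v 0 * v 1 - 1) ?b = const T 0" unfolding y(2) by simp
 \<comment> \<open>Without zeros: if both cutoffs vanish then \<open>v 0 \<le> 0\<close> and
   \<open>- v 0 \<le> 0\<close>, and then the last square is 1.\<close>
 let ?P = "%v. (cutoff 0 (v 0) * cutoff 0 (v 0) + cutoff 0 (- v 0) * cutoff 0 (- v 0)) + (v 0 * v 1 - 1) * (v 0 * v 1 - 1)"
 have "app T 2 ?P ?b = op2 T (+) (op2 T (+) (op2 T (*) (const T 0) (const T 0)) (op2 T (*) (const T 0) (const T 0))) (op2 T (*) (const T 0) (const T 0))"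
  using c1 by (simp only: T.arith_app'(1,2)[OF _ _ b, symmetric] Sm_intros z1 E)
 then have P0: "app T 2 ?P ?b = const T 0" by simp
 show "zero_ring T"
 proof (rule T.zero_ring_nonvanishing[OF _ _ _ P0])
  show "Sm 2 ?P" using c1 by simp
  show "?P v \<noteq> 0" for v
  proof
   assume "?P v = 0"
   then have "v 0 * v 1 - 1 = 0 \<and> cutoff 0 (v 0) = 0 \<and> cutoff 0 (- v 0) = 0"
    by (smt (verit) mult_eq_0_iff zero_le_square)
   then show False using cutoff(2)[of 0 "v 0"] cutoff(2)[of 0 "- v 0"] by auto
  qed
 qed (use b in blast)
qed

section \<open>Functions on manifolds\<close>

lemma dd_add:
 assumes "opn n V" "smooth_on n V f" "smooth_on n V g" "x \<in> V"
 shows "dd n (%x. f x + g x) x w = dd n f x w + dd n g x w"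
proof -
 have "pd i (%x. f x + g x) x = pd i f x + pd i g x" if "i < n" for i
  using assms that by (intro pd_eqI DERIV_add smooth_onD(2)) auto
 then show ?thesis by (simp add: dd_def sum.distrib[symmetric] distrib_right)
qed

lemma dd_mult:
 assumes "opn n V" "smooth_on n V f" "smooth_on n V g" "x \<in> V"
 shows "dd n (%x. f x * g x) x w = f x * dd n g x w + g x * dd n f x w"
proof -
 have "pd i (%x. f x * g x) x = pd i f x * g x + pd i g x * f x" if i: "i < n" for i
  using DERIV_mult[OF smooth_onD(2)[OF assms(2,1) i assms(4)] smooth_onD(2)[OF assms(3,1) i assms(4)]]
  by (intro pd_eqI) simp
 then show ?thesis by (simp add: dd_def sum.distrib[symmetric] sum_distrib_left algebra_simps)
qed

lemma dd_const [simp]: "dd n (%x. c) x w = 0"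
proof -
 have "pd i (%x. c) x = 0" for i by (intro pd_eqI) simp
 then show ?thesis by (simp add: dd_def)
qed

lemma dd_cong:
 assumes "opn n V" "x \<in> V" "\<And>y. y \<in> V ==> f y = g y" "smooth_on n V f"
 shows "dd n f x w = dd n g x w"
 unfolding dd_def by (intro sum.cong refl) (simp add: pd_cong[OF assms(1,2) _ assms(3,4)])

lemma dd_linear:
 "dd n f x (%i. a i - c * b i) = dd n f x a - c * dd n f x b"
 "dd n f x (%i. a i - (\<Sum>k\<in>K. c' k * u k i)) = dd n f x a - (\<Sum>k\<in>K. c' k * dd n f x (u k))"
proof -
 show "dd n f x (%i. a i - c * b i) = dd n f x a - c * dd n f x b"
  by (simp add: dd_def sum_distrib_left sum_subtractf algebra_simps)
 have "(\<Sum>i<n. pd i f x * (\<Sum>k\<in>K. c' k * u k i)) = (\<Sum>k\<in>K. c' k * (\<Sum>i<n. pd i f x * u k i))"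
  unfolding sum_distrib_left by (subst sum.swap) (simp add: mult.left_commute)
 then show "dd n f x (%i. a i - (\<Sum>k\<in>K. c' k * u k i)) = dd n f x a - (\<Sum>k\<in>K. c' k * dd n f x (u k))"
  by (simp add: dd_def sum_subtractf right_diff_distrib)
qed

locale mfd =
 fixes n and S :: "'p topology" and \<A> :: "('p set \<times> ('p => nat => real)) set"
 assumes mfd: "is_manifold n S \<A>"
begin

abbreviation A where "A \<equiv> CinfM n S \<A>"

text \<open>Smoothness in all charts, without the extensionality that membership in the ring
  requires.\<close>

definition fn :: "('p => real) => bool" where
 "fn f \<longleftrightarrow> (\<forall>(U, \<phi>)\<in>\<A>. smooth_on n (\<phi> ` U) (%x. f (inv_into U \<phi> x)))"

lemma fnD: "fn f ==> (U, \<phi>) \<in> \<A> ==> smooth_on n (\<phi> ` U) (%x. f (inv_into U \<phi> x))"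
 unfolding fn_def by blast

lemma carrier: "f \<in> carrier A \<longleftrightarrow> f \<in> extensional (topspace S) \<and> fn f"
 by (simp add: CinfM_def fn_def)

lemma covers: "s \<in> topspace S ==> \<exists>U \<phi>. (U, \<phi>) \<in> \<A> \<and> s \<in> U"
 using mfd unfolding is_manifold_def by blast

lemma chart:
 assumes "(U, \<phi>) \<in> \<A>"
 shows "openin S U" "opn n (\<phi> ` U)" "inj_on \<phi> U" "U \<subseteq> topspace S"
  "homeomorphic_map (subtopology S U) (subtopology (Euclidean_space n) (\<phi> ` U)) \<phi>"
  "\<And>Q. openin S Q ==> opn n (\<phi> ` (U \<inter> Q))" "\<And>V. opn n V ==> openin S {t\<in>U. \<phi> t \<in> V}"
  "\<And>t. t \<in> U ==> inv_into U \<phi> (\<phi> t) = t" "\<And>t. t \<in> U ==> \<phi> t \<in> Rn n"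
proof -
 have c: "openin S U \<and> opn n (\<phi> ` U) \<and>
    homeomorphic_map (subtopology S U) (subtopology (Euclidean_space n) (\<phi> ` U)) \<phi>"
  using mfd assms unfolding is_manifold_def by blast
 then show o: "openin S U" and on: "opn n (\<phi> ` U)" and
  h: "homeomorphic_map (subtopology S U) (subtopology (Euclidean_space n) (\<phi> ` U)) \<phi>" by blast+
 show U: "U \<subseteq> topspace S" using openin_subset[OF o] .
 then have top: "topspace (subtopology S U) = U" by auto
 show inj: "inj_on \<phi> U" using homeomorphic_imp_injective_map[OF h] top by simp
 show "inv_into U \<phi> (\<phi> t) = t" if "t \<in> U" for t using inv_into_f_f[OF inj that] .
 show "\<phi> t \<in> Rn n" if "t \<in> U" for t using that opn_subset[OF on] by blast
 show "opn n (\<phi> ` (U \<inter> Q))" if "openin S Q" for Q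
 proof -
  have "openin (subtopology S U) (U \<inter> Q)" using that o by (simp add: openin_open_subtopology openin_Int)
  then have "openin (subtopology (Euclidean_space n) (\<phi> ` U)) (\<phi> ` (U \<inter> Q))"
   using homeomorphic_imp_open_map[OF h] unfolding open_map_def by blast
  then show ?thesis using on by (simp add: openin_open_subtopology)
 qed
 show "openin S {t\<in>U. \<phi> t \<in> V}" if "opn n V" for V
 proof -
  have "continuous_map (subtopology S U) (Euclidean_space n) \<phi>"
   using homeomorphic_imp_continuous_map[OF h] unfolding continuous_map_in_subtopology by blast
  from openin_continuous_map_preimage[OF this that] show ?thesis
   unfolding top using o by (simp add: openin_open_subtopology)
 qed
qed

lemma transition:
 "(U, \<phi>) \<in> \<A> ==> (W, \<psi>) \<in> \<A> ==> k < n ==> smooth_on n (\<phi> ` (U \<inter> W)) (%x. \<psi> (inv_into U \<phi> x) k)"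
 using mfd unfolding is_manifold_def by blast

text \<open>Since transition maps are smooth, one chart around each point suffices, and it may be
  shrunk.\<close>

lemma fn_local:
 assumes loc: "\<And>s. s \<in> topspace S ==> \<exists>U \<phi> V. (U, \<phi>) \<in> \<A> \<and> s \<in> U \<and> openin S V \<and> s \<in> V \<and>
   smooth_on n (\<phi> ` (U \<inter> V)) (%x. f (inv_into U \<phi> x))"
 shows "fn f"
proof -
 have "smooth_on n (\<psi> ` W) (%x. f (inv_into W \<psi> x))" if W: "(W, \<psi>) \<in> \<A>" for W \<psi>
 proof (rule smooth_on_local[OF chart(2)[OF W]])
  fix x assume "x \<in> \<psi> ` W"
  then obtain s where s: "s \<in> W" "x = \<psi> s" by blast
  obtain U \<phi> V where U: "(U, \<phi>) \<in> \<A>" "s \<in> U" "openin S V" "s \<in> V"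
   and sm: "smooth_on n (\<phi> ` (U \<inter> V)) (%x. f (inv_into U \<phi> x))"
   using loc[OF subsetD[OF chart(4)[OF W] s(1)]] by (elim exE conjE)
  have UV: "openin S (U \<inter> V)" using chart(1)[OF U(1)] U(3) by (rule openin_Int)
  let ?Q = "\<psi> ` (W \<inter> (U \<inter> V))"
  have Q: "opn n ?Q" using chart(6)[OF W UV] .
  have t: "smooth_on n ?Q (%y. \<phi> (inv_into W \<psi> y) k)" if "k < n" for k
   by (rule smooth_on_subset[OF transition[OF W U(1) that] chart(6)[OF W chart(1)[OF U(1)]] Q]) blast
  have *: "tuple n (%k. \<phi> (inv_into W \<psi> y) k) = \<phi> (inv_into W \<psi> y)" "inv_into W \<psi> y \<in> U \<inter> V" if y: "y \<in> ?Q" for y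
  proof -
   obtain t where t: "t \<in> W" "t \<in> U" "t \<in> V" "y = \<psi> t" using y by blast
   then have i: "inv_into W \<psi> y = t" using chart(8)[OF W] by simp
   show "tuple n (%k. \<phi> (inv_into W \<psi> y) k) = \<phi> (inv_into W \<psi> y)" unfolding i using tuple_id[OF chart(9)[OF U(1) t(2)]] by simp
   show "inv_into W \<psi> y \<in> U \<inter> V" unfolding i using t by blast
  qed
  have "smooth_on n ?Q (%y. (%x. f (inv_into U \<phi> x)) (tuple n (%k. \<phi> (inv_into W \<psi> y) k)))"
  proof (rule smooth_comp[OF Q chart(6)[OF U(1,3)] sm t])
   show "tuple n (%k. \<phi> (inv_into W \<psi> y) k) \<in> \<phi> ` (U \<inter> V)" if "y \<in> ?Q" for y
    unfolding *(1)[OF that] using *(2)[OF that] by (rule imageI)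
  qed
  then have "smooth_on n ?Q (%x. f (inv_into W \<psi> x))"
   by (rule smooth_on_cong[OF Q]) (use *(1) *(2) chart(8)[OF U(1)] in simp)
  then show "\<exists>Q. opn n Q \<and> x \<in> Q \<and> smooth_on n Q (%x. f (inv_into W \<psi> x))"
   using Q s U(2,4) by (intro exI[of _ ?Q]) blast
 qed
 then show ?thesis unfolding fn_def by blast
qed

lemma fn_cong: "fn f ==> (\<And>s. s \<in> topspace S ==> f s = g s) ==> fn g"
 unfolding fn_def
proof (clarsimp)
 fix U \<phi> assume f: "\<forall>(U, \<phi>)\<in>\<A>. smooth_on n (\<phi> ` U) (%x. f (inv_into U \<phi> x))"
  and e: "\<And>s. s \<in> topspace S ==> f s = g s" and U: "(U, \<phi>) \<in> \<A>"
 have "smooth_on n (\<phi> ` U) (%x. f (inv_into U \<phi> x))" using f U by blast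
 then show "smooth_on n (\<phi> ` U) (%x. g (inv_into U \<phi> x))"
  by (rule smooth_on_cong[OF chart(2)[OF U]]) (rule e, rule subsetD[OF chart(4)[OF U]], erule inv_into_into)
qed

lemma restrict_fn [simp]: "fn f ==> restrict f (topspace S) \<in> carrier A"
 unfolding carrier by (auto elim: fn_cong)

lemma fn_comp: "Sm m g ==> (\<And>i. i < m ==> fn (a i)) ==> fn (%p. g (tuple m (%i. a i p)))"
 unfolding fn_def by (auto intro!: smooth_comp[OF _ opn_Rn] chart(2))

lemma fn_inverse: "fn f ==> (\<And>s. s \<in> topspace S ==> f s \<noteq> 0) ==> fn (%s. 1 / f s)"
 unfolding fn_def
proof clarify
 fix U \<phi> assume f: "\<forall>(U, \<phi>)\<in>\<A>. smooth_on n (\<phi> ` U) (%x. f (inv_into U \<phi> x))"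
  and e: "\<And>s. s \<in> topspace S ==> f s \<noteq> 0" and U: "(U, \<phi>) \<in> \<A>"
 have "smooth_on n (\<phi> ` U) (%x. f (inv_into U \<phi> x))" using f U by blast
 moreover have "f (inv_into U \<phi> x) \<noteq> 0" if "x \<in> \<phi> ` U" for x
  by (rule e, rule subsetD[OF chart(4)[OF U]], rule inv_into_into[OF that])
 ultimately show "smooth_on n (\<phi> ` U) (%x. 1 / f (inv_into U \<phi> x))"
  by (intro smooth_divide smooth_const chart(2)[OF U])
qed

lemma ring: "cinf_ring A"
 unfolding CinfM_def
proof (rule function_cinf_ring)
 fix m g and a :: "nat => 'p => real"
 assume g: "Sm m g" and a: "\<And>i. i < m ==> a i \<in> {f \<in> extensional (topspace S). \<forall>(U, \<phi>)\<in>\<A>. smooth_on n (\<phi> ` U) (%x. f (inv_into U \<phi> x))}"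
 have "fn (a i)" if "i < m" for i using a[OF that] by (simp add: fn_def)
 from restrict_fn[OF fn_comp[OF g this]]
 show "(\<lambda>p\<in>topspace S. g (tuple m (%i. a i p))) \<in> {f \<in> extensional (topspace S). \<forall>(U, \<phi>)\<in>\<A>. smooth_on n (\<phi> ` U) (%x. f (inv_into U \<phi> x))}"
  by (simp add: CinfM_def)
qed auto

sublocale A: cinf A by unfold_locales (rule ring)

lemma app_A: "app A m g a = (\<lambda>p\<in>topspace S. g (tuple m (%i. a i p)))"
 by (simp add: CinfM_def app_function_cinf)

lemma ops_A:
 "op2 A \<beta> f g = (\<lambda>p\<in>topspace S. \<beta> (f p) (g p))" "op1 A \<alpha> f = (\<lambda>p\<in>topspace S. \<alpha> (f p))" "const A c = (\<lambda>p\<in>topspace S. c)"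
 unfolding op_app app_A by simp_all

lemma A_eqI: "f \<in> carrier A ==> g \<in> carrier A ==> (\<And>s. s \<in> topspace S ==> f s = g s) ==> f = g"
 unfolding carrier by (auto intro: extensionalityI)

lemma eval_point: "s \<in> topspace S ==> (\<lambda>f\<in>carrier A. f s) \<in> chom A real_cinf"
proof (rule chomI)
 fix m g a assume s: "s \<in> topspace S" and g: "Sm m g" and a: "\<And>i. i < m ==> a i \<in> carrier A"
 have "tuple m (%i. a i s) = tuple m (%i. (\<lambda>f\<in>carrier A. f s) (a i))" using a by (auto simp: tuple_def)
 moreover have "app A m g a \<in> carrier A" by (rule A.app_closed[OF g a])
 ultimately show "(\<lambda>f\<in>carrier A. f s) (app A m g a) = app real_cinf m g (%i. (\<lambda>f\<in>carrier A. f s) (a i))"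
  using s by (simp add: app_A)
qed simp_all

text \<open>If \<open>p\<close> were not an evaluation, the function \<open>\<Sum>\<^sub>i (x\<^sub>i - p x\<^sub>i)\<^sup>2\<close> would be invertible.\<close>

lemma points_eval:
 assumes sch: "cinf_scheme A" and p: "p \<in> chom A real_cinf"
 shows "\<exists>s\<in>topspace S. \<forall>f\<in>carrier A. p f = f s"
proof -
 obtain N x where gen: "generates A N x" using sch scheme_iff by blast
 note x = generatesD(1)[OF gen]
 let ?g = "%v. \<Sum>i<N. (v i - p (x i)) * (v i - p (x i))"
 have g: "Sm N ?g" by (intro smooth_intros opn_Rn)
 have "\<exists>s\<in>topspace S. \<forall>i<N. x i s = p (x i)"
 proof (rule ccontr)
  assume none: "\<not> ?thesis"
  define G where "G = app A N ?g x"
  have Gc: "G \<in> carrier A" unfolding G_def by (rule A.app_closed'[OF g x])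
  have pG: "p G = 0" unfolding G_def using chom_app'[OF p g x] by simp
  have "G s \<noteq> 0" if s: "s \<in> topspace S" for s
  proof
   assume "G s = 0"
   then have "(\<Sum>i<N. (x i s - p (x i)) * (x i s - p (x i))) = 0" using s by (simp add: G_def app_A)
   then have "\<forall>i\<in>{..<N}. (x i s - p (x i)) * (x i s - p (x i)) = 0"
    by (subst (asm) sum_nonneg_eq_0_iff) auto
   then show False using none s by auto
  qed
  then have i: "(\<lambda>s\<in>topspace S. 1 / G s) \<in> carrier A" and e: "op2 A (*) G (\<lambda>s\<in>topspace S. 1 / G s) = const A 1"
   using Gc restrict_fn[OF fn_inverse, of G] by (simp add: carrier, auto simp: ops_A intro!: restrict_ext)
  have "p (const A 1) = 0" unfolding e[symmetric] using chom_arith(2)[OF p Gc i] pG by simp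
  then show False using chom_const[OF p real_cinf_ring, of 1] by simp
 qed
 then obtain s where s: "s \<in> topspace S" "\<forall>i<N. x i s = p (x i)" by blast
 have "p f = f s" if f: "f \<in> carrier A" for f
 proof -
  obtain h where h: "Sm N h" "f = app A N h x" using generatesD(2)[OF gen f] by blast
  have "tuple N (%i. p (x i)) = tuple N (%i. x i s)" using s(2) by (auto simp: tuple_def)
  then show ?thesis unfolding h(2) using chom_app'[OF p h(1) x] s(1) by (simp add: app_A)
 qed
 then show ?thesis using s(1) by blast
qed

section \<open>Extension by zero, and derivations as directional derivatives\<close>

definition ext :: "'p set => ('p => nat => real) => 'p => real => ((nat => real) => real) => 'p => real" where
 "ext U \<phi> s e g = (\<lambda>t\<in>topspace S. if t \<in> U then bump n (\<phi> s) e (\<phi> t) * g (\<phi> t) else 0)"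

text \<open>The support lies in a compact subset of the chart. In a Hausdorff space this subset is
  closed, so around every point off the chart the function is locally zero.\<close>

lemma ext:
 assumes U: "(U, \<phi>) \<in> \<A>" and s: "s \<in> U" and e: "e > 0"
  and C: "{y \<in> Rn n. \<forall>i<n. \<bar>y i - \<phi> s i\<bar> \<le> 2 * e} \<subseteq> \<phi> ` U" (is "?C \<subseteq> _") and g: "smooth_on n (\<phi> ` U) g"
 shows "ext U \<phi> s e g \<in> carrier A"
 unfolding ext_def
proof (rule restrict_fn, rule fn_local)
 let ?f = "%t. if t \<in> U then bump n (\<phi> s) e (\<phi> t) * g (\<phi> t) else 0"
 let ?K = "{t\<in>U. \<phi> t \<in> ?C}"
 have im: "\<phi> ` ?K = ?C" using C by auto
 have "compactin (Euclidean_space n) ?C"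
  using compact_closed_cube[of n "\<phi> s" "2 * e"] unfolding Euclidean_space_eq compactin_subtopology
  by (auto simp: in_Rn)
 then have "compactin (subtopology (Euclidean_space n) (\<phi> ` U)) (\<phi> ` ?K)"
  unfolding im compactin_subtopology using C by blast
 then have "compactin (subtopology S U) ?K"
  using homeomorphic_map_compactness[OF chart(5)[OF U], of ?K] chart(4)[OF U] by auto
 then have "compactin S ?K" unfolding compactin_subtopology by blast
 moreover have "Hausdorff_space S" using mfd unfolding is_manifold_def by blast
 ultimately have K: "openin S (topspace S - ?K)" using compactin_imp_closedin closedin_def by blast
 have z: "?f t = 0" if tK: "t \<in> topspace S - ?K" for t
 proof (cases "t \<in> U")
  case True
  then obtain i where "i < n" "\<bar>\<phi> t i - \<phi> s i\<bar> \<ge> 2 * e" using tK chart(9)[OF U True] by force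
  then show ?thesis using bump_eq_0[OF e] by simp
 qed simp
 fix t assume t: "t \<in> topspace S"
 show "\<exists>U \<phi> V. (U, \<phi>) \<in> \<A> \<and> t \<in> U \<and> openin S V \<and> t \<in> V \<and> smooth_on n (\<phi> ` (U \<inter> V)) (%x. ?f (inv_into U \<phi> x))"
 proof (cases "t \<in> U")
  case True
  have "smooth_on n (\<phi> ` U) (%x. bump n (\<phi> s) e x * g x)"
   by (intro smooth_mult smooth_bump chart(2)[OF U] g)
  then have "smooth_on n (\<phi> ` U) (%x. ?f (inv_into U \<phi> x))"
   by (rule smooth_on_cong[OF chart(2)[OF U]]) (use chart(8)[OF U] in auto)
  then show ?thesis using U True chart(1)[OF U] by (intro exI[of _ U] exI[of _ \<phi>] conjI) simp_all
 next
  case False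
  obtain W \<psi> where W: "(W, \<psi>) \<in> \<A>" "t \<in> W" using covers[OF t] by blast
  let ?V = "topspace S - ?K"
  have "smooth_on n (\<psi> ` (W \<inter> ?V)) (%x. ?f (inv_into W \<psi> x))"
  proof (rule smooth_on_cong[OF chart(6)[OF W(1) K] smooth_const[OF chart(6)[OF W(1) K], of 0]])
   fix x assume "x \<in> \<psi> ` (W \<inter> ?V)"
   then obtain r where r: "r \<in> W" "r \<in> ?V" "x = \<psi> r" by (elim imageE IntE)
   then have "inv_into W \<psi> x = r" using chart(8)[OF W(1)] by simp
   show "0 = ?f (inv_into W \<psi> x)" unfolding \<open>inv_into W \<psi> x = r\<close> by (rule z[OF r(2), symmetric])
  qed
  moreover have "t \<in> ?V" using t False by blast
  ultimately show ?thesis using W K by (intro exI[of _ W] exI[of _ \<psi>] exI[of _ ?V] conjI)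
 qed
qed

lemma cube_in_chart:
 assumes U: "(U, \<phi>) \<in> \<A>" and s: "s \<in> U" and Q: "openin S Q" "s \<in> Q"
 obtains e where "e > 0" "{y \<in> Rn n. \<forall>i<n. \<bar>y i - \<phi> s i\<bar> \<le> 2 * e} \<subseteq> \<phi> ` (U \<inter> Q)"
proof -
 have "\<phi> s \<in> \<phi> ` (U \<inter> Q)" using s Q by blast
 from opn_contains_cub[OF chart(6)[OF U Q(1)] this] obtain e where e: "e > 0" "cub n (\<phi> s) e \<subseteq> \<phi> ` (U \<inter> Q)" .
 have "{y \<in> Rn n. \<forall>i<n. \<bar>y i - \<phi> s i\<bar> \<le> 2 * (e / 3)} \<subseteq> cub n (\<phi> s) e" using e(1) by (auto simp: cub_def)
 then show thesis using e by (intro that[of "e / 3"]) auto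
qed

lemma tangentD:
 assumes "v \<in> tangent_vectors A p" "p \<in> chom A real_cinf"
 shows "\<And>f g. f \<in> carrier A ==> g \<in> carrier A ==> v (op2 A (+) f g) = v f + v g"
  "\<And>f g. f \<in> carrier A ==> g \<in> carrier A ==> v (op2 A (*) f g) = p f * v g + p g * v f" "v (const A c) = 0"
proof -
 have *: "\<And>f g. f \<in> carrier A ==> g \<in> carrier A ==> v (op2 A (+) f g) = v f + v g"
  "\<And>f g. f \<in> carrier A ==> g \<in> carrier A ==> v (op2 A (*) f g) = p f * v g + p g * v f"
  and h: "\<And>c f. f \<in> carrier A ==> v (op1 A ((*) c) f) = c * v f"
  using assms(1) unfolding tangent_vectors_def by auto
 show "v (op2 A (+) f g) = v f + v g" "v (op2 A (*) f g) = p f * v g + p g * v f"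
  if "f \<in> carrier A" "g \<in> carrier A" for f g using *[OF that] .
 have "op2 A (*) (const A 1) (const A 1) = const A 1" "op1 A ((*) c) (const A 1) = const A c" by (auto simp: ops_A)
 moreover have "p (const A 1) = 1" using chom_const[OF assms(2) real_cinf_ring, of 1] by simp
 ultimately show "v (const A c) = 0" using *(2)[of "const A 1" "const A 1"] h[of "const A 1" c] by simp
qed

text \<open>With a bump function \<open>b\<close> that is 1 at \<open>s\<close> and supported in
  \<open>Q\<close>, the product \<open>b f\<close> is zero; the Leibniz rule turns this into
  \<open>v f = 0\<close>.\<close>

lemma tangent_local:
 assumes v: "v \<in> tangent_vectors A p" "p \<in> chom A real_cinf" and s: "s \<in> topspace S" "\<And>f. f \<in> carrier A ==> p f = f s"
  and Q: "openin S Q" "s \<in> Q" and f: "f \<in> carrier A" "\<And>t. t \<in> Q ==> f t = 0"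
 shows "v f = 0"
proof -
 obtain U \<phi> where U: "(U, \<phi>) \<in> \<A>" "s \<in> U" using covers[OF s(1)] by blast
 obtain e where e: "e > 0" "{y \<in> Rn n. \<forall>i<n. \<bar>y i - \<phi> s i\<bar> \<le> 2 * e} \<subseteq> \<phi> ` (U \<inter> Q)" using cube_in_chart[OF U Q] .
 let ?b = "ext U \<phi> s e (%_. 1)"
 have b: "?b \<in> carrier A" using e by (intro ext[OF U e(1)] smooth_const chart(2)[OF U(1)]) blast
 have bs: "?b s = 1" using s(1) U(2) bump_eq_1[OF e(1), of n "\<phi> s" "\<phi> s"] by (simp add: ext_def sqn_def)
 have "?b t * f t = 0" if t: "t \<in> topspace S" for t
 proof (cases "t \<in> Q")
  case False
  have "?b t = 0" if tU: "t \<in> U"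
  proof -
   have "\<phi> t \<notin> \<phi> ` (U \<inter> Q)" using False tU chart(3)[OF U(1)] by (auto dest: inj_onD)
   then obtain i where "i < n" "\<bar>\<phi> t i - \<phi> s i\<bar> \<ge> 2 * e" using e(2) chart(9)[OF U(1) tU] by force
   then show ?thesis using bump_eq_0[OF e(1)] t by (simp add: ext_def)
  qed
  then show ?thesis using t by (cases "t \<in> U") (simp_all add: ext_def)
 qed (simp add: f)
 then have "op2 A (*) ?b f = const A 0" by (auto simp: ops_A)
 then show ?thesis using tangentD(2)[OF v b f(1)] tangentD(3)[OF v, of 0] s(2)[OF b] s(2)[OF f(1)] f(2)[OF Q(2)] bs by simp
qed

text \<open>In the chart Hadamard's lemma expands \<open>f\<close> into products of coordinate
  differences and smooth factors, and the Leibniz rule evaluates \<open>v\<close> on these. Locality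
  allows \<open>f\<close> to be replaced by the expansion, whose members are extended by zero to the
  manifold.\<close>

lemma tangent_chart:
 assumes v: "v \<in> tangent_vectors A p" "p \<in> chom A real_cinf" and s: "\<And>f. f \<in> carrier A ==> p f = f s"
  and U: "(U, \<phi>) \<in> \<A>" "s \<in> U"
 shows "\<exists>w. \<forall>f\<in>carrier A. v f = dd n (%x. f (inv_into U \<phi> x)) (\<phi> s) w"
proof -
 have sS: "s \<in> topspace S" using U chart(4) by blast
 obtain e where e: "e > 0" "{y \<in> Rn n. \<forall>i<n. \<bar>y i - \<phi> s i\<bar> \<le> 2 * e} \<subseteq> \<phi> ` (U \<inter> topspace S)"
  using cube_in_chart[OF U openin_topspace sS] .
 then have C: "{y \<in> Rn n. \<forall>i<n. \<bar>y i - \<phi> s i\<bar> \<le> 2 * e} \<subseteq> \<phi> ` U" (is "?C \<subseteq> _") by blast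
 let ?V = "{x\<in>Rn n. sqn n (%i. x i - \<phi> s i) < e\<^sup>2}" and ?E = "ext U \<phi> s e"
 let ?Q = "{t\<in>U. \<phi> t \<in> ?V}"
 have V: "opn n ?V" by (rule opn_sqn_less)
 have Q: "openin S ?Q" using chart(7)[OF U(1) V] .
 have sQ: "s \<in> ?Q" using U e(1) chart(9)[OF U] by (simp add: sqn_def)
 have Ec: "?E g \<in> carrier A" if "Sm n g" for g
  by (rule ext[OF U e(1) C smooth_on_subset[OF that opn_Rn chart(2)[OF U(1)] opn_subset[OF chart(2)[OF U(1)]]]])
 have EQ: "?E g t = g (\<phi> t)" if "t \<in> ?Q" for g t
  using that bump_eq_1[OF e(1), of n "\<phi> t" "\<phi> s"] chart(4)[OF U(1)] by (auto simp: ext_def)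
 have xk: "Sm n (%x. x k - \<phi> s k)" for k by (intro smooth_intros opn_Rn)
 define w where "w k = v (?E (%x. x k - \<phi> s k))" for k
 have "v f = dd n (%x. f (inv_into U \<phi> x)) (\<phi> s) w" if f: "f \<in> carrier A" for f
 proof -
  let ?f = "%x. f (inv_into U \<phi> x)"
  \<comment> \<open>Hadamard's lemma needs a function on all of \<open>Rn n\<close>, so
    \<open>f\<close> is cut off inside the chart. Near \<open>\<phi> s\<close> nothing
    changes.\<close>
  define h where "h x = (if x \<in> \<phi> ` U then bump n (\<phi> s) e x * ?f x else 0)" for x
  have ff: "smooth_on n (\<phi> ` U) ?f" using f U(1) by (simp add: carrier fnD)
  have h: "Sm n h"
  proof (rule smooth_on_local[OF opn_Rn])
   fix x assume x: "x \<in> Rn n"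
   show "\<exists>W. opn n W \<and> x \<in> W \<and> smooth_on n W h"
   proof (cases "x \<in> \<phi> ` U")
    case True
    have "smooth_on n (\<phi> ` U) (%x. bump n (\<phi> s) e x * ?f x)" by (intro smooth_mult smooth_bump chart(2)[OF U(1)] ff)
    then have "smooth_on n (\<phi> ` U) h" by (rule smooth_on_cong[OF chart(2)[OF U(1)]]) (simp add: h_def)
    then show ?thesis using True chart(2)[OF U(1)] by blast
   next
    case False
    have "open (- ?C)" using compact_imp_closed[OF compact_closed_cube[of n "\<phi> s" "2 * e"]] by (simp add: open_Compl)
    then have W: "opn n (Rn n \<inter> - ?C)" unfolding opn_open by blast
    have "h y = 0" if yC: "y \<in> Rn n \<inter> - ?C" for y
    proof -
     obtain i where "i < n" "\<bar>y i - \<phi> s i\<bar> \<ge> 2 * e" using yC by force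
     then show ?thesis using bump_eq_0[OF e(1)] by (simp add: h_def)
    qed
    then have "smooth_on n (Rn n \<inter> - ?C) h"
     by (intro smooth_on_cong[OF W smooth_const[OF W, of 0]]) simp
    then show ?thesis using False x C W by (intro exI[of _ "Rn n \<inter> - ?C"]) blast
   qed
  qed
  have "\<exists>g. (\<forall>k<n. Sm n (g k)) \<and> (\<forall>x\<in>Rn n. h x = h (\<phi> s) + (\<Sum>k<n. (x k - \<phi> s k) * g k x)) \<and> (\<forall>k<n. g k (\<phi> s) = pd k h (\<phi> s))"
  proof (rule hadamard_point[OF h chart(9)[OF U]])
   fix g assume g: "\<And>k. k < n ==> Sm n (g k)" "\<And>x. x \<in> Rn n ==> h x = h (\<phi> s) + (\<Sum>k<n. (x k - \<phi> s k) * g k x)"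
    "\<And>k. k < n ==> g k (\<phi> s) = pd k h (\<phi> s)"
   show ?thesis by (intro exI[of _ g] conjI allI impI ballI) (rule g; assumption)+
  qed
  then obtain g where g0: "\<forall>k<n. Sm n (g k)" "\<forall>x\<in>Rn n. h x = h (\<phi> s) + (\<Sum>k<n. (x k - \<phi> s k) * g k x)"
   "\<forall>k<n. g k (\<phi> s) = pd k h (\<phi> s)" by (elim exE conjE)
  note g = g0(1)[rule_format] bspec[OF g0(2)] g0(3)[rule_format]
  have hf: "h x = ?f x" if "x \<in> \<phi> ` U \<inter> ?V" for x
   using that bump_eq_1[OF e(1), of n x "\<phi> s"] by (simp add: h_def)
  \<comment> \<open>Partial sums of the expansion; \<open>v\<close> is evaluated on them by
    induction, since additivity is known for two summands.\<close>
  let ?r = "%m. \<lambda>t\<in>topspace S. h (\<phi> s) + (\<Sum>k<m. ?E (%x. x k - \<phi> s k) t * ?E (g k) t)"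
  have r: "?r m \<in> carrier A \<and> v (?r m) = (\<Sum>k<m. pd k h (\<phi> s) * w k)" if "m \<le> n" for m
   using that
  proof (induction m)
   case 0
   have "?r 0 = const A (h (\<phi> s))" by (simp add: ops_A)
   then show ?case using tangentD(3)[OF v] by simp
  next
   case (Suc m)
   let ?a = "?E (%x. x m - \<phi> s m)" and ?b = "?E (g m)"
   have ab: "?a \<in> carrier A" "?b \<in> carrier A" using Suc.prems by (auto intro!: Ec xk g)
   have e1: "?r (Suc m) = op2 A (+) (?r m) (op2 A (*) ?a ?b)" by (auto simp: ops_A)
   have vab: "v (op2 A (*) ?a ?b) = pd m h (\<phi> s) * w m"
    using tangentD(2)[OF v ab] EQ[OF sQ] s[OF ab(1)] s[OF ab(2)] g(3)[of m] Suc.prems by (simp add: w_def)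
   note IH = Suc.IH[OF Suc_leD[OF Suc.prems], THEN conjunct1] Suc.IH[OF Suc_leD[OF Suc.prems], THEN conjunct2]
   note c = A.arith_closed(2)[OF ab]
   show ?case unfolding e1 unfolding tangentD(1)[OF v IH(1) c] IH(2) vab sum.lessThan_Suc
    using A.arith_closed(1)[OF IH(1) c] by blast
  qed
  have r: "?r n \<in> carrier A" "v (?r n) = (\<Sum>k<n. pd k h (\<phi> s) * w k)" using r[of n] by blast+
  have d: "op2 A (-) f (?r n) \<in> carrier A" using f r(1) by simp
  have "v (op2 A (-) f (?r n)) = 0"
  proof (rule tangent_local[OF v sS s Q sQ d])
   fix t assume t: "t \<in> ?Q"
   then have tS: "t \<in> topspace S" and ti: "inv_into U \<phi> (\<phi> t) = t" using chart(4,8)[OF U(1)] by blast+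
   have "f t = h (\<phi> t)" using hf[of "\<phi> t"] t ti by auto
   then show "op2 A (-) f (?r n) t = 0" using g(2)[of "\<phi> t"] t EQ[OF t] tS by (simp add: ops_A)
  qed
  moreover have "f = op2 A (+) (?r n) (op2 A (-) f (?r n))"
   using f by (intro A_eqI A.arith_closed d r) (simp_all add: ops_A)
  ultimately have "v f = v (?r n)" using tangentD(1)[OF v r(1) d] by simp
  also have "\<dots> = dd n h (\<phi> s) w" using r(2) by (simp add: dd_def)
  also have "\<dots> = dd n ?f (\<phi> s) w"
  proof (rule dd_cong[of n "\<phi> ` U \<inter> ?V"])
   show VV: "opn n (\<phi> ` U \<inter> ?V)" using chart(2)[OF U(1)] V by (rule openin_Int)
   show "\<phi> s \<in> \<phi> ` U \<inter> ?V" using sQ by blast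
   show "smooth_on n (\<phi> ` U \<inter> ?V) h" by (rule smooth_on_subset[OF h opn_Rn VV]) (use opn_subset[OF V] in blast)
  qed (rule hf)
  finally show ?thesis .
 qed
 then show ?thesis by blast
qed

end

section \<open>Regular values\<close>

lemma inf_rad_superset:
 assumes A: "cinf_ring A" and I: "ideal I (as_ring A)" shows "I \<subseteq> inf_radical A I"
proof
 interpret A: cinf A by unfold_locales (rule A)
 fix a assume a: "a \<in> I"
 show "a \<in> inf_radical A I"
 proof (rule inf_radI[OF A I])
  show "a \<in> carrier A" using a A.idealD(1)[OF I] by blast
  fix T :: "std cinf" and \<tau>
  assume Ts: "cinf_scheme T" and z: "\<And>x. x \<in> I ==> \<tau> x = const T 0" and u: "\<tau> a \<in> Units (as_ring T)"
  interpret T: cinf T by unfold_locales (rule schemeD[OF Ts])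
  obtain y where "y \<in> carrier T" "op2 T (*) (const T 0) y = const T 1" using u z[OF a] T.Units_iff by auto
  then show "zero_ring T" using T.zero_ring_iff T.laws(5)[of y] by simp
 qed
qed

lemma closure_ideal_ker: "closure_ideal A B \<phi> = ker A B \<phi>"
 by (simp add: closure_ideal_def a_kernel_def' ker_def)

lemma tangent_pullback:
 assumes h: "h \<in> chom A B" and v: "v \<in> tangent_vectors B u" and u: "\<And>x. x \<in> carrier A ==> u (h x) = p x"
 shows "(%x. v (h x)) \<in> tangent_vectors A p"
proof -
 have "v (h (op1 A ((*) c) x)) = c * v (h x)" if x: "x \<in> carrier A" for c x
 proof -
  have "Sm 1 (%w. c * w 0)" by (intro smooth_intros opn_Rn)
  from chom_op1[OF h this x] show ?thesis
   using v chomD(1)[OF h x] unfolding tangent_vectors_def by simp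
 qed
 then show ?thesis
  using v chom_arith[OF h] chomD(1)[OF h] u unfolding tangent_vectors_def by simp
qed

lemma le_ideal_cutoff:
 assumes A: "cinf_scheme A" and f: "f \<in> carrier A"
 shows "op1 A (cutoff r) f \<in> le_ideal A f r" "op1 A (%t. cutoff (- r) (- t)) f \<in> ge_ideal A f r"
proof -
 note A' = schemeD[OF A]
 interpret A: cinf A by unfold_locales (rule A')
 have c: "op1 A (cutoff r) f \<in> carrier A" "op1 A (%t. cutoff (- r) (- t)) f \<in> carrier A"
  by (auto intro!: A.op1_closed f cutoff)
 show "op1 A (cutoff r) f \<in> le_ideal A f r"
  unfolding le_ideal_def using inf_rad_superset[OF A' A.PIdl(1)[OF c(1)]] A.PIdl(2)[OF c(1)] by blast
 show "op1 A (%t. cutoff (- r) (- t)) f \<in> ge_ideal A f r"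
  unfolding ge_ideal_def using inf_rad_superset[OF A' A.PIdl(1)[OF c(2)]] A.PIdl(2)[OF c(2)] by blast
qed

text \<open>The data occurring in \<open>zero_regular\<close>, where \<open>N\<close> is known only
  by its universal property. What is extracted from it: common zeros of the \<open>f i\<close> lift
  to points of the reduction of \<open>N\<close>, and all \<open>f i\<close> become zero in that
  reduction.\<close>

locale eq_loci =
 fixes A :: "'a cinf" and K :: "nat set" and f :: "nat => 'a" and E :: "nat => std cinf" and \<epsilon>
  and N :: "std cinf" and \<psi>
 assumes A: "cinf_scheme A" and f: "\<And>i. i \<in> K ==> f i \<in> carrier A"
  and E: "\<And>i. i \<in> K ==> is_eq_locus A (f i) 0 (E i) (\<epsilon> i)" and N: "is_intersection A K E \<epsilon> N \<psi>"
begin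

lemma quot_loci:
 assumes "i \<in> K" "j \<in> {le_ideal A (f i) 0, ge_ideal A (f i) 0}"
 shows "cinf_ring (quot A j)" "quot_map A j \<in> chom A (quot A j)" "quot_map A j ` carrier A = carrier (quot A j)"
  "ker A (quot A j) (quot_map A j) = j"
proof -
 have "ideal j (as_ring A)" using assms loci_ideals[OF A f[OF assms(1)], of 0] by blast
 from quot_basics[OF schemeD[OF A] this]
 show "cinf_ring (quot A j)" "quot_map A j \<in> chom A (quot A j)" "quot_map A j ` carrier A = carrier (quot A j)"
  "ker A (quot A j) (quot_map A j) = j" by blast+
qed

lemma E_scheme: "i \<in> K ==> cinf_scheme (E i)" "i \<in> K ==> \<epsilon> i \<in> chom A (E i)"
 using E intersectionD(1,2) unfolding is_eq_locus_def by blast+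

lemma N_scheme: "cinf_scheme N" "\<psi> \<in> chom A N" using intersectionD(1,2)[OF N] by blast+

definition \<kappa> where "\<kappa> = (\<lambda>x\<in>carrier A. red_map N (\<psi> x))"

lemma kappa: "\<kappa> \<in> chom A (red N)"
 unfolding \<kappa>_def by (rule chom_compose[OF N_scheme(2) red_basics(3)[OF N_scheme(1)] schemeD[OF A] red_basics(2)[OF N_scheme(1)]])

text \<open>Such a homomorphism kills the ideals of both half loci of each \<open>f i\<close>, so it
  factors through every \<open>E i\<close> and then through \<open>N\<close>. Being real-valued it
  also kills the nilradical.\<close>

lemma point:
 assumes p: "p \<in> chom A real_cinf" "\<And>i. i \<in> K ==> p (f i) = 0"
 shows "\<exists>u\<in>chom (red N) real_cinf. \<forall>x\<in>carrier A. u (\<kappa> x) = p x"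
proof -
 note A' = schemeD[OF A]
 have "\<exists>u\<in>chom (E i) real_cinf. \<forall>x\<in>carrier A. u (\<epsilon> i x) = p x" if i: "i \<in> K" for i
 proof (rule intersection_ext[OF E[OF i, unfolded is_eq_locus_def] A' quot_loci(1)[OF i] quot_loci(2)[OF i] real_cinf_scheme p(1)])
  fix j assume j: "j \<in> {le_ideal A (f i) 0, ge_ideal A (f i) 0}"
  have "j \<subseteq> ker A real_cinf p"
   using j loci_points[OF A f[OF i] p(1), of 0] p(2)[OF i] loci_ideals[OF A f[OF i], of 0]
    cinf.idealD(1)[unfolded cinf_def, OF A'] by (auto simp: ker_def)
  then have "ker A (quot A j) (quot_map A j) \<subseteq> ker A real_cinf p" unfolding quot_loci(4)[OF i j] .
  from chom_factor[OF A' quot_loci(1)[OF i j] real_cinf_ring quot_loci(2,3)[OF i j] p(1) this]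
  show "\<exists>k\<in>chom (quot A j) real_cinf. \<forall>x\<in>carrier A. k (quot_map A j x) = p x" .
 qed
 from intersection_ext[OF N A' schemeD[OF E_scheme(1)] E_scheme(2) real_cinf_scheme p(1) this]
 obtain u where u: "u \<in> chom N real_cinf" "\<forall>x\<in>carrier A. u (\<psi> x) = p x" by blast
 note N' = N_scheme(1)
 have "ker N (red N) (red_map N) \<subseteq> ker N real_cinf u"
  unfolding red_basics(5)[OF N'] using nil_point[OF N' u(1)] cinf.idealD(1)[unfolded cinf_def, OF schemeD[OF N'] red_basics(1)[OF N']]
  by (auto simp: ker_def)
 from chom_factor[OF schemeD[OF N'] red_basics(2)[OF N'] real_cinf_ring red_basics(3,4)[OF N'] u(1) this]
 obtain u' where u': "u' \<in> chom (red N) real_cinf" "\<forall>y\<in>carrier N. u' (red_map N y) = u y" by blast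
 have "\<forall>x\<in>carrier A. u' (\<kappa> x) = p x" using u(2) u'(2) chomD(1)[OF N_scheme(2)] by (simp add: \<kappa>_def)
 then show ?thesis using u'(1) by blast
qed

text \<open>The two ideals that define \<open>E i\<close> contain the cutoffs of \<open>f i\<close>,
  so these vanish in \<open>N\<close>; \<open>nil_of_cutoffs\<close> then puts the image of
  \<open>f i\<close> into the nilradical.\<close>

lemma killed:
 assumes i: "i \<in> K" shows "\<kappa> (f i) = const (red N) 0"
proof -
 note A' = schemeD[OF A] and Ei = schemeD[OF E_scheme(1)[OF i]] and N' = schemeD[OF N_scheme(1)]
 interpret A: cinf A by unfold_locales (rule A')
 obtain \<iota> where io: "\<forall>j\<in>K. \<iota> j \<in> chom (E j) N \<and> (\<forall>x\<in>carrier A. \<iota> j (\<epsilon> j x) = \<psi> x)" using intersectionD(3)[OF N] by blast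
 obtain \<iota>' where io': "\<forall>j\<in>{le_ideal A (f i) 0, ge_ideal A (f i) 0}.
   \<iota>' j \<in> chom (quot A j) (E i) \<and> (\<forall>x\<in>carrier A. \<iota>' j (quot_map A j x) = \<epsilon> i x)"
  using intersectionD(3)[OF E[OF i, unfolded is_eq_locus_def]] by blast
 have z: "\<psi> c = const N 0" if j: "j \<in> {le_ideal A (f i) 0, ge_ideal A (f i) 0}" and c: "c \<in> j" for j c
 proof -
  have cA: "c \<in> carrier A" and q: "quot_map A j c = const (quot A j) 0" using quot_loci(4)[OF i j] c by (auto simp: ker_def)
  have ij: "\<iota>' j \<in> chom (quot A j) (E i)" "\<iota>' j (quot_map A j c) = \<epsilon> i c" using io' j cA by auto
  have ii: "\<iota> i \<in> chom (E i) N" "\<iota> i (\<epsilon> i c) = \<psi> c" using io i cA by auto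
  show ?thesis using ij(2) ii(2) q chom_const[OF ij(1) Ei, of 0] chom_const[OF ii(1) N', of 0] by simp
 qed
 have "op1 N (cutoff 0) (\<psi> (f i)) = const N 0"
  using z[OF _ le_ideal_cutoff(1)[OF A f[OF i]]] chom_op1[OF N_scheme(2) cutoff(1) f[OF i], of 0] by simp
 moreover have "op1 N (%t. cutoff 0 (- t)) (\<psi> (f i)) = const N 0"
  using z[OF _ le_ideal_cutoff(2)[OF A f[OF i], of 0]] chom_op1[OF N_scheme(2) cutoff(3) f[OF i], of 0] by simp
 ultimately have "\<psi> (f i) \<in> nil_radical N"
  by (rule nil_of_cutoffs[OF N_scheme(1) chomD(1)[OF N_scheme(2) f[OF i]]])
 then show ?thesis using red_basics(5)[OF N_scheme(1)] f[OF i] by (auto simp: ker_def \<kappa>_def)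
qed

end

section \<open>Regularity as linear independence of differentials\<close>

context mfd
begin

definition cd :: "'p set => ('p => nat => real) => 'p => ('p => real) => (nat => real) => real" where
 "cd U \<phi> s f w = dd n (%x. f (inv_into U \<phi> x)) (\<phi> s) w"

text \<open>Linear independence of the differentials of those functions that vanish at
  \<open>s\<close>, expressed through dual vectors, which is the form in which
  \<open>tangent_kill\<close> uses it.\<close>

definition indep :: "'p set => ('p => nat => real) => ('p => real) list => 'p => bool" where
 "indep U \<phi> fs s \<longleftrightarrow> (\<forall>j<length fs. (fs ! j) s = 0 --> (\<exists>w. cd U \<phi> s (fs ! j) w \<noteq> 0 \<and>
   (\<forall>i<length fs. i \<noteq> j --> (fs ! i) s = 0 --> cd U \<phi> s (fs ! i) w = 0)))"

lemma cd_ops: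
 assumes U: "(U, \<phi>) \<in> \<A>" "s \<in> U" and fg: "f \<in> carrier A" "g \<in> carrier A"
 shows "cd U \<phi> s (op2 A (+) f g) w = cd U \<phi> s f w + cd U \<phi> s g w"
  "cd U \<phi> s (op2 A (*) f g) w = f s * cd U \<phi> s g w + g s * cd U \<phi> s f w"
  "cd U \<phi> s (const A c) w = 0"
proof -
 let ?f = "%x. f (inv_into U \<phi> x)" and ?g = "%x. g (inv_into U \<phi> x)"
 note V = chart(2)[OF U(1)]
 have f: "smooth_on n (\<phi> ` U) ?f" and g: "smooth_on n (\<phi> ` U) ?g" using fg U(1) by (simp_all add: carrier fnD)
 have p: "\<phi> s \<in> \<phi> ` U" "inv_into U \<phi> (\<phi> s) = s" using U chart(8) by auto
 have t: "inv_into U \<phi> y \<in> topspace S" if "y \<in> \<phi> ` U" for y using chart(4)[OF U(1)] inv_into_into[OF that] by blast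
 have "cd U \<phi> s (op2 A (+) f g) w = dd n (%x. ?f x + ?g x) (\<phi> s) w"
  unfolding cd_def by (rule dd_cong[OF V p(1), symmetric]) (auto simp: ops_A t intro!: smooth_add V f g)
 then show "cd U \<phi> s (op2 A (+) f g) w = cd U \<phi> s f w + cd U \<phi> s g w" using dd_add[OF V f g p(1)] by (simp add: cd_def)
 have "cd U \<phi> s (op2 A (*) f g) w = dd n (%x. ?f x * ?g x) (\<phi> s) w"
  unfolding cd_def by (rule dd_cong[OF V p(1), symmetric]) (auto simp: ops_A t intro!: smooth_mult V f g)
 then show "cd U \<phi> s (op2 A (*) f g) w = f s * cd U \<phi> s g w + g s * cd U \<phi> s f w"
  using dd_mult[OF V f g p(1)] p(2) by (simp add: cd_def)
 have "cd U \<phi> s (const A c) w = dd n (%x. c) (\<phi> s) w"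
  unfolding cd_def by (rule dd_cong[OF V p(1), symmetric]) (auto simp: ops_A t intro!: smooth_const V)
 then show "cd U \<phi> s (const A c) w = 0" by simp
qed

lemma chart_tangent:
 assumes U: "(U, \<phi>) \<in> \<A>" "s \<in> U" and p: "\<And>f. f \<in> carrier A ==> p f = f s"
 shows "(%f. cd U \<phi> s f w) \<in> tangent_vectors A p"
proof -
 have "cd U \<phi> s (op1 A ((*) c) f) w = c * cd U \<phi> s f w" if f: "f \<in> carrier A" for c f
 proof -
  have "op1 A ((*) c) f = op2 A (*) (const A c) f" by (auto simp: ops_A)
  then show ?thesis using cd_ops(2)[OF U A.const_closed[of c] f, of w] cd_ops(3)[OF U f f, of c w] subsetD[OF chart(4)[OF U(1)] U(2)]
   by (simp add: ops_A(3))
 qed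
 then show ?thesis using cd_ops[OF U] p by (simp add: tangent_vectors_def)
qed

lemma tangent_image:
 assumes h: "h \<in> chom A B" "h ` carrier A = carrier B" and B: "cinf_ring B" and u: "\<And>x. x \<in> carrier A ==> u (h x) = p x"
  and v: "v \<in> tangent_vectors A p" "\<And>x. x \<in> ker A B h ==> v x = 0"
 shows "\<exists>v'\<in>tangent_vectors B u. \<forall>x\<in>carrier A. v' (h x) = v x"
proof -
 define v' where "v' y = v (SOME x. x \<in> carrier A \<and> h x = y)" for y
 have tv: "\<forall>x\<in>carrier A. \<forall>y\<in>carrier A. v (op2 A (+) x y) = v x + v y \<and> v (op2 A (*) x y) = p x * v y + p y * v x"
  "\<forall>c. \<forall>x\<in>carrier A. v (op1 A ((*) c) x) = c * v x"
  using v(1) unfolding tangent_vectors_def by auto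
 have eq: "v' (h x) = v x" if x: "x \<in> carrier A" for x
 proof -
  let ?y = "SOME y. y \<in> carrier A \<and> h y = h x"
  have y: "?y \<in> carrier A \<and> h ?y = h x" by (rule someI[of _ x]) (simp add: x)
  have "op2 A (-) ?y x \<in> ker A B h" using hom_eq_iff_ker[OF h(1) ring B] x y by blast
  then have "v (op2 A (-) ?y x) = 0" by (rule v(2))
  moreover have e: "?y = op2 A (+) (op2 A (-) ?y x) x" using x y by (intro A_eqI A.arith_closed) (simp_all add: ops_A)
  moreover have c: "op2 A (-) ?y x \<in> carrier A" using x y by simp
  ultimately have "v ?y = v x" using arg_cong[OF e, of v] bspec[OF bspec[OF tv(1) c] x] by simp
  then show ?thesis by (simp add: v'_def)
 qed
 have "v' \<in> tangent_vectors B u"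
  unfolding tangent_vectors_def mem_Collect_eq
 proof (intro conjI ballI allI)
  fix y z assume "y \<in> carrier B" "z \<in> carrier B"
  then obtain a b where ab: "a \<in> carrier A" "b \<in> carrier A" "y = h a" "z = h b" using h(2) by blast
  show "v' (y \<oplus>\<^bsub>as_ring B\<^esub> z) = v' y + v' z" "v' (y \<otimes>\<^bsub>as_ring B\<^esub> z) = u y * v' z + u z * v' y"
   unfolding ab(3,4) using chom_arith(1,2)[OF h(1) ab(1,2), symmetric] eq tv(1) ab(1,2) u by simp_all
 next
  fix c y assume "y \<in> carrier B"
  then obtain a where a: "a \<in> carrier A" "y = h a" using h(2) by blast
  have S: "Sm 1 (%w. c * w 0)" by (intro smooth_intros opn_Rn)
  show "v' (op1 B ((*) c) y) = c * v' y"
   unfolding a(2) using chom_op1[OF h(1) S a(1), symmetric] eq[OF a(1)] eq[OF A.op1_closed[OF S a(1)]] tv(2) a(1) by simp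
 qed
 then show ?thesis using eq by blast
qed

text \<open>Regularity yields a derivation on the reduction of \<open>N\<close> that does not kill
  \<open>fs ! j\<close>. Pulled back to the manifold it is a directional derivative, and it kills
  the functions indexed by \<open>K\<close> because these are zero in the reduction. So it is a dual
  vector.\<close>

lemma regular_indep:
 assumes sch: "cinf_scheme A" and reg: "zero_regular A fs" and fs: "set fs \<subseteq> carrier A" and U: "(U, \<phi>) \<in> \<A>" "s \<in> U"
 shows "indep U \<phi> fs s"
 unfolding indep_def
proof (intro allI impI)
 fix j assume j: "j < length fs" "(fs ! j) s = 0"
 have sS: "s \<in> topspace S" using U chart(4) by blast
 \<comment> \<open>All other functions that vanish at \<open>s\<close>: the choice of
   \<open>K\<close> that makes \<open>s\<close> a point of \<open>N\<close> and gives the strongest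
   conclusion.\<close>
 define K where "K = {i. i < length fs \<and> i \<noteq> j \<and> (fs ! i) s = 0}"
 have "K \<subseteq> {..<length fs} - {j}" unfolding K_def by blast
 then obtain E :: "nat => std cinf" and \<epsilon> and N :: "std cinf" and \<psi> where E: "\<forall>i\<in>K. is_eq_locus A (fs ! i) 0 (E i) (\<epsilon> i)"
  and N: "is_intersection A K E \<epsilon> N \<psi>" and rv: "regular_value (red N) (red_map N (\<psi> (fs ! j))) 0"
  using reg j(1) unfolding zero_regular_def by blast
 have fc: "fs ! i \<in> carrier A" if "i < length fs" for i using fs that nth_mem by blast
 interpret L: eq_loci A K "%i. fs ! i" E \<epsilon> N \<psi>
  by unfold_locales (use sch E N fc in \<open>auto simp: K_def\<close>)
 let ?p = "\<lambda>f\<in>carrier A. f s"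
 have p: "?p \<in> chom A real_cinf" by (rule eval_point[OF sS])
 have "?p (fs ! i) = 0" if "i \<in> K" for i using that fc by (simp add: K_def)
 from L.point[OF p this] obtain u where u: "u \<in> chom (red N) real_cinf" "\<forall>x\<in>carrier A. u (L.\<kappa> x) = ?p x" by blast
 have "u (red_map N (\<psi> (fs ! j))) = 0" using u(2) fc[OF j(1)] j(2) by (simp add: L.\<kappa>_def)
 then obtain v where v: "v \<in> tangent_vectors (red N) u" "v (L.\<kappa> (fs ! j)) \<noteq> 0"
  using rv u(1) fc[OF j(1)] unfolding regular_value_def points_def by (auto simp: L.\<kappa>_def)
 have v': "(%x. v (L.\<kappa> x)) \<in> tangent_vectors A ?p" using u(2) by (intro tangent_pullback[OF L.kappa v(1)]) blast
 obtain w where w: "\<forall>f\<in>carrier A. v (L.\<kappa> f) = dd n (%x. f (inv_into U \<phi> x)) (\<phi> s) w"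
  using tangent_chart[OF v' p _ U] by auto
 have "v (const (red N) 0) = 0"
  using tangentD(3)[OF v' p, of 0] chom_const[OF L.kappa red_basics(2)[OF L.N_scheme(1)], of 0] by simp
 then have "cd U \<phi> s (fs ! i) w = 0" if "i < length fs" "i \<noteq> j" "(fs ! i) s = 0" for i
  using bspec[OF w fc[OF that(1)]] L.killed[of i] that by (simp add: cd_def K_def)
 moreover have "cd U \<phi> s (fs ! j) w \<noteq> 0" using w fc[OF j(1)] v(2) by (simp add: cd_def)
 ultimately show "\<exists>w. cd U \<phi> s (fs ! j) w \<noteq> 0 \<and> (\<forall>i<length fs. i \<noteq> j --> (fs ! i) s = 0 --> cd U \<phi> s (fs ! i) w = 0)"
  by (intro exI[of _ w] conjI allI impI)
qed

text \<open>A dual vector to \<open>fs ! j\<close> gives a derivation on the manifold. To descend to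
  the reduction of \<open>N\<close> it must kill every function that becomes zero there; such a
  function vanishes at all common zeros of the functions indexed by \<open>K\<close>, and
  \<open>tangent_kill\<close> applies.\<close>

lemma indep_regular:
 assumes sch: "cinf_scheme A" and fs: "set fs \<subseteq> carrier A"
  and ind: "\<And>s. s \<in> topspace S ==> \<exists>U \<phi>. (U, \<phi>) \<in> \<A> \<and> s \<in> U \<and> indep U \<phi> fs s"
 shows "zero_regular A fs"
 unfolding zero_regular_def
proof (intro allI impI conjI)
 fix j assume j: "j < length fs"
 have fc: "fs ! i \<in> carrier A" if "i < length fs" for i using fs that nth_mem by blast
 show "regular_value A (fs ! j) 0"
  unfolding regular_value_def points_def
 proof (intro ballI impI)
  fix p assume p: "p \<in> chom A real_cinf" "p (fs ! j) = 0"
  obtain s where s: "s \<in> topspace S" "\<forall>f\<in>carrier A. p f = f s" using points_eval[OF sch p(1)] by blast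
  obtain U \<phi> where U: "(U, \<phi>) \<in> \<A>" "s \<in> U" "indep U \<phi> fs s" using ind[OF s(1)] by blast
  obtain w where "cd U \<phi> s (fs ! j) w \<noteq> 0" using U(3) j p(2) s(2) fc[OF j] unfolding indep_def by auto
  moreover have "(%f. cd U \<phi> s f w) \<in> tangent_vectors A p" using s(2) by (intro chart_tangent[OF U(1,2)]) blast
  ultimately show "\<exists>v\<in>tangent_vectors A p. v (fs ! j) \<noteq> 0" by (intro bexI[of _ "%f. cd U \<phi> s f w"])
 qed
 fix K assume K: "K \<subseteq> {..<length fs} - {j}"
 have "\<forall>i\<in>K. \<exists>E. is_eq_locus A (fs ! i) 0 (fst E) (snd E) \<and> cinf_scheme (fst E) \<and> snd E \<in> chom A (fst E) \<and>
   snd E ` carrier A = carrier (fst E :: std cinf)"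
 proof
  fix i assume "i \<in> K"
  then have "fs ! i \<in> carrier A" using K fc by blast
  from eq_locus_exists[OF sch this, of 0] obtain E :: "std cinf" and e where "is_eq_locus A (fs ! i) 0 E e"
   "cinf_scheme E" "e \<in> chom A E" "e ` carrier A = carrier E" .
  then show "\<exists>E. is_eq_locus A (fs ! i) 0 (fst E) (snd E) \<and> cinf_scheme (fst E) \<and> snd E \<in> chom A (fst E) \<and>
   snd E ` carrier A = carrier (fst E :: std cinf)" by (intro exI[of _ "(E, e)"]) simp
 qed
 from bchoice[OF this] obtain P where P: "\<forall>i\<in>K. is_eq_locus A (fs ! i) 0 (fst (P i)) (snd (P i)) \<and>
   cinf_scheme (fst (P i)) \<and> snd (P i) \<in> chom A (fst (P i)) \<and> snd (P i) ` carrier A = carrier (fst (P i) :: std cinf)" by (rule exE)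
 let ?E = "%i. fst (P i)" and ?e = "%i. snd (P i)"
 have sub: "(\<Union>i\<in>K. ker A (?E i) (?e i)) \<subseteq> carrier A" by (auto simp: ker_def)
 obtain N :: "std cinf" and \<psi> where N: "cinf_scheme N" "\<psi> \<in> chom A N" "\<psi> ` carrier A = carrier N"
  "ker A N \<psi> = Idl\<^bsub>as_ring A\<^esub> (\<Union>i\<in>K. ker A (?E i) (?e i))" using quotient_std[OF sch A.Idl(1)[OF sub]] .
 have I: "is_intersection A K ?E ?e N \<psi>"
 proof (rule intersection_of_quotients[OF ring N(1-3) _ _ _ N(4)])
  show "cinf_ring (?E i)" "?e i \<in> chom A (?E i)" "?e i ` carrier A = carrier (?E i)" if "i \<in> K" for i
   using P that schemeD by blast+
 qed
 interpret L: eq_loci A K "%i. fs ! i" ?E ?e N \<psi>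
  by unfold_locales (use sch P I fc K in auto)
 note R = red_basics[OF N(1)]
 have surj: "L.\<kappa> ` carrier A = carrier (red N)"
 proof -
  have "L.\<kappa> ` carrier A = red_map N ` \<psi> ` carrier A" unfolding L.\<kappa>_def image_image by (rule image_cong) simp_all
  then show ?thesis unfolding N(3) R(4) .
 qed
 have "regular_value (red N) (red_map N (\<psi> (fs ! j))) 0"
  unfolding regular_value_def points_def
 proof (intro ballI impI)
  fix u assume u: "u \<in> chom (red N) real_cinf" "u (red_map N (\<psi> (fs ! j))) = 0"
  let ?p = "\<lambda>x\<in>carrier A. u (L.\<kappa> x)"
  have p: "?p \<in> chom A real_cinf" by (rule chom_compose[OF L.kappa u(1) ring real_cinf_ring])
  obtain s where s: "s \<in> topspace S" "\<forall>f\<in>carrier A. ?p f = f s" using points_eval[OF sch p] by blast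
  obtain U \<phi> where U: "(U, \<phi>) \<in> \<A>" "s \<in> U" "indep U \<phi> fs s" using ind[OF s(1)] by blast
  have z: "(fs ! i) s = 0" if i: "i \<in> K" for i
  proof -
   have "fs ! i \<in> carrier A" using i K fc by blast
   then have "(fs ! i) s = u (const (red N) 0)" using s(2)[rule_format, of "fs ! i"] L.killed[OF i] by simp
   then show ?thesis using chom_const[OF u(1) real_cinf_ring, of 0] by simp
  qed
  have zj: "(fs ! j) s = 0" using s(2)[rule_format, OF fc[OF j]] u(2) fc[OF j] by (simp add: L.\<kappa>_def)
  \<comment> \<open>Only the functions indexed by \<open>insert j K\<close> matter here; all of them
    vanish at \<open>s\<close>, so independence at \<open>s\<close> supplies the dual
    vectors.\<close>
  have dual: "\<exists>w. cd U \<phi> s (fs ! i) w \<noteq> 0 \<and> (\<forall>k\<in>insert j K. k \<noteq> i --> cd U \<phi> s (fs ! k) w = 0)" if "i \<in> insert j K" for i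
  proof -
   have "i < length fs" "(fs ! i) s = 0" using that K j z zj by auto
   then obtain w where "cd U \<phi> s (fs ! i) w \<noteq> 0" "\<forall>k<length fs. k \<noteq> i --> (fs ! k) s = 0 --> cd U \<phi> s (fs ! k) w = 0"
    using U(3) unfolding indep_def by blast
   then show ?thesis using K j z zj by (intro exI[of _ w]) auto
  qed
  obtain w where w: "cd U \<phi> s (fs ! j) w \<noteq> 0" "\<forall>k\<in>insert j K. k \<noteq> j --> cd U \<phi> s (fs ! k) w = 0" using dual[of j] by blast
  have "\<forall>i\<in>K. \<exists>x. cd U \<phi> s (fs ! i) x \<noteq> 0 \<and> (\<forall>k\<in>insert j K. k \<noteq> i --> cd U \<phi> s (fs ! k) x = 0)" using dual by blast
  from bchoice[OF this] obtain d where
   d: "\<forall>i\<in>K. cd U \<phi> s (fs ! i) (d i) \<noteq> 0 \<and> (\<forall>k\<in>insert j K. k \<noteq> i --> cd U \<phi> s (fs ! k) (d i) = 0)" by (rule exE)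
  have tv: "(%f. cd U \<phi> s f w) \<in> tangent_vectors A ?p" using s(2) by (intro chart_tangent[OF U(1,2)]) blast
  \<comment> \<open>The kernel is not computed: it is enough that each of its members vanishes at
    the common zeros in the chart, because these lift to points of the reduction of
    \<open>N\<close>.\<close>
  have "cd U \<phi> s a w = 0" if a: "a \<in> ker A (red N) L.\<kappa>" for a
  proof -
   have ac: "a \<in> carrier A" "L.\<kappa> a = const (red N) 0" using a by (auto simp: ker_def)
   have i: "inv_into U \<phi> (\<phi> s) = s" using chart(8)[OF U(1,2)] .
   show ?thesis unfolding cd_def
   proof (rule tangent_kill[where K = K and V = "\<phi> ` U" and g = "%i x. (fs ! i) (inv_into U \<phi> x)" and u = d])
    show "finite K" using finite_subset[OF K] by blast
    show "opn n (\<phi> ` U)" using chart(2)[OF U(1)] .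
    show "\<phi> s \<in> \<phi> ` U" using U(2) by blast
    show "smooth_on n (\<phi> ` U) (%x. (fs ! i) (inv_into U \<phi> x))" if "i \<in> K" for i
     using that K fc[of i] fnD[OF _ U(1)] unfolding carrier by blast
    show "smooth_on n (\<phi> ` U) (%x. a (inv_into U \<phi> x))" using ac(1) fnD[OF _ U(1)] unfolding carrier by blast
    show "(fs ! i) (inv_into U \<phi> (\<phi> s)) = 0" if "i \<in> K" for i unfolding i using z[OF that] .
    show "a (inv_into U \<phi> x) = 0" if x: "x \<in> \<phi> ` U" "\<forall>i\<in>K. (fs ! i) (inv_into U \<phi> x) = 0" for x
    proof -
     let ?t = "inv_into U \<phi> x"
     have t: "?t \<in> topspace S" using chart(4)[OF U(1)] inv_into_into[OF x(1)] by blast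
     have "(\<lambda>f\<in>carrier A. f ?t) (fs ! i) = 0" if "i \<in> K" for i using x(2) that K fc[of i] by auto
     from L.point[OF eval_point[OF t] this] obtain u' where "u' \<in> chom (red N) real_cinf"
      "\<forall>x\<in>carrier A. u' (L.\<kappa> x) = (\<lambda>f\<in>carrier A. f ?t) x" by blast
     then show ?thesis using ac chom_const[OF _ real_cinf_ring, of u' "red N" 0] by auto
    qed
    show "dd n (%x. (fs ! i) (inv_into U \<phi> x)) (\<phi> s) w = 0" if "i \<in> K" for i
    proof -
     have "cd U \<phi> s (fs ! i) w = 0" using bspec[OF w(2), of i] that K by auto
     then show ?thesis unfolding cd_def .
    qed
    show "dd n (%x. (fs ! k) (inv_into U \<phi> x)) (\<phi> s) (d i) = 0" if "i \<in> K" "k \<in> K" "i \<noteq> k" for i k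
    proof -
     have "cd U \<phi> s (fs ! k) (d i) = 0" 
      by (rule bspec[OF conjunct2[OF bspec[OF d that(1)]] insertI2[OF that(2)], THEN mp, OF not_sym[OF that(3)]])
     then show ?thesis unfolding cd_def .
    qed
    show "dd n (%x. (fs ! i) (inv_into U \<phi> x)) (\<phi> s) (d i) \<noteq> 0" if "i \<in> K" for i
     using bspec[OF d that] unfolding cd_def by (rule conjunct1)
   qed
  qed
  from tangent_image[OF L.kappa surj R(2) _ tv this, of u]
  obtain v' where "v' \<in> tangent_vectors (red N) u" "\<forall>x\<in>carrier A. v' (L.\<kappa> x) = cd U \<phi> s x w" by auto
  then show "\<exists>v\<in>tangent_vectors (red N) u. v (red_map N (\<psi> (fs ! j))) \<noteq> 0"
   using w(1) fc[OF j] by (intro bexI[of _ v']) (auto simp: L.\<kappa>_def)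
 qed
 then show "\<exists>(E :: nat => std cinf) \<epsilon> (N :: std cinf) \<psi>.
      (\<forall>i\<in>K. is_eq_locus A (fs ! i) 0 (E i) (\<epsilon> i)) \<and> is_intersection A K E \<epsilon> N \<psi> \<and>
      regular_value (red N) (red_map N (\<psi> (fs ! j))) 0"
  using P I by (intro exI[of _ ?E] exI[of _ ?e] exI[of _ N] exI[of _ \<psi>]) blast
qed

section \<open>Sard's theorem on a manifold\<close>

lemma countable_subatlas:
 obtains \<C> where "countable \<C>" "\<C> \<subseteq> \<A>" "\<forall>s\<in>topspace S. \<exists>(U, \<phi>)\<in>\<C>. s \<in> U"
proof -
 have "Lindelof_space S" using mfd second_countable_imp_Lindelof_space unfolding is_manifold_def by blast
 moreover have "\<forall>U\<in>fst ` \<A>. openin S U" using chart(1) by force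
 moreover have "\<Union> (fst ` \<A>) = topspace S" using covers chart(4) by force
 ultimately obtain \<V> where V: "countable \<V>" "\<V> \<subseteq> fst ` \<A>" "\<Union> \<V> = topspace S"
  unfolding Lindelof_space_def by metis
 from V(2) have "\<forall>U\<in>\<V>. \<exists>\<phi>. (U, \<phi>) \<in> \<A>" by force
 from bchoice[OF this] obtain \<phi> where p: "\<forall>U\<in>\<V>. (U, \<phi> U) \<in> \<A>" by (rule exE)
 show thesis
 proof (rule that[of "(%U. (U, \<phi> U)) ` \<V>"])
  show "\<forall>s\<in>topspace S. \<exists>(U, \<psi>)\<in>(%U. (U, \<phi> U)) ` \<V>. s \<in> U" using V(3) by blast
 qed (use V p in auto)
qed

lemma bad_values:
 assumes sch: "cinf_scheme A" and reg: "zero_regular A fs" and fs: "set fs \<subseteq> carrier A" and F: "F \<in> carrier A"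
 shows "negligible {r. \<not> zero_regular A ((\<lambda>p\<in>topspace S. F p - r) # fs)}"
proof -
 have fc: "fs ! i \<in> carrier A" if "i < length fs" for i using fs that nth_mem by blast
 obtain \<C> where C: "countable \<C>" "\<C> \<subseteq> \<A>" "\<forall>s\<in>topspace S. \<exists>(U, \<phi>)\<in>\<C>. s \<in> U" using countable_subatlas .
 \<comment> \<open>\<open>T\<close> is meant to be the set of constraints vanishing at the point. It
   is fixed beforehand, so that the constrained form of Sard's theorem applies to each chart and
   each of the finitely many \<open>T\<close>.\<close>
 define bad where "bad = (\<lambda>((U, \<phi>), T). (%x. F (inv_into U \<phi> x)) ` {x\<in>\<phi> ` U. (\<forall>j\<in>T. (fs ! j) (inv_into U \<phi> x) = 0) \<and>
   (\<exists>\<mu>. \<forall>i<n. pd i (%x. F (inv_into U \<phi> x)) x = (\<Sum>j\<in>T. \<mu> j * pd i (%x. (fs ! j) (inv_into U \<phi> x)) x))})"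
 let ?I = "\<C> \<times> Pow {..<length fs}"
 have "negligible (\<Union> (bad ` ?I))"
 proof (rule negligible_countable_Union)
  show "countable (bad ` ?I)" using C(1) by (intro countable_image countable_SIGMA) (auto intro: countable_finite)
  fix B assume "B \<in> bad ` ?I"
  then obtain U \<phi> T where U: "(U, \<phi>) \<in> \<A>" "T \<subseteq> {..<length fs}" "B = bad ((U, \<phi>), T)" using C(2) by auto
  show "negligible B"
   unfolding U(3) bad_def prod.case
   using F fc fnD[OF _ U(1)] unfolding carrier by (intro sard_constrained[OF chart(2)[OF U(1)] _ _ U(2)]) auto
 qed
 moreover have "zero_regular A ((\<lambda>p\<in>topspace S. F p - r) # fs)" if r: "r \<notin> \<Union> (bad ` ?I)" for r
 proof (rule indep_regular[OF sch])
  let ?F = "\<lambda>p\<in>topspace S. F p - r"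
  have Fr: "?F = op2 A (+) F (const A (- r))" by (auto simp: ops_A)
  then show "set (?F # fs) \<subseteq> carrier A" using fs F by simp
  fix s assume s: "s \<in> topspace S"
  obtain U \<phi> where U: "(U, \<phi>) \<in> \<C>" "s \<in> U" using bspec[OF C(3) s] by blast
  then have UA: "(U, \<phi>) \<in> \<A>" using C(2) by blast
  note I = regular_indep[OF sch reg fs UA U(2)]
  have cdF: "cd U \<phi> s ?F w = cd U \<phi> s F w" for w
   unfolding Fr using cd_ops(1)[OF UA U(2) F A.const_closed[of "- r"], of w] cd_ops(3)[OF UA U(2) F F, of "- r" w] by simp
  define T where "T = {j. j < length fs \<and> (fs ! j) s = 0}"
  have fT: "finite T" unfolding T_def by simp
  have dual: "\<exists>w. cd U \<phi> s (fs ! j) w \<noteq> 0 \<and> (\<forall>i\<in>T. i \<noteq> j --> cd U \<phi> s (fs ! i) w = 0)" if "j \<in> T" for j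
   using I that unfolding indep_def T_def by blast
  \<comment> \<open>Otherwise the differential of \<open>F\<close> would be zero on the common
    kernel of the active constraints, hence a combination of their differentials, and
    \<open>r\<close> would be a bad value.\<close>
  have w0: "\<exists>w. cd U \<phi> s F w \<noteq> 0 \<and> (\<forall>i\<in>T. cd U \<phi> s (fs ! i) w = 0)" if Fs: "F s = r"
  proof (rule ccontr)
   assume none: "\<not> ?thesis"
   from dual have "\<forall>j\<in>T. \<exists>w. cd U \<phi> s (fs ! j) w \<noteq> 0 \<and> (\<forall>i\<in>T. i \<noteq> j --> cd U \<phi> s (fs ! i) w = 0)" by blast
   from bchoice[OF this] obtain d where
    d: "\<forall>j\<in>T. cd U \<phi> s (fs ! j) (d j) \<noteq> 0 \<and> (\<forall>i\<in>T. i \<noteq> j --> cd U \<phi> s (fs ! i) (d j) = 0)" by (rule exE)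
   \<comment> \<open>Subtracting from \<open>a\<close> its components along the dual vectors
     \<open>d j\<close> leaves a vector in the common kernel.\<close>
   have span: "cd U \<phi> s F a = (\<Sum>j\<in>T. cd U \<phi> s F (d j) / cd U \<phi> s (fs ! j) (d j) * cd U \<phi> s (fs ! j) a)" for a
   proof -
    let ?c = "%j. cd U \<phi> s (fs ! j) a / cd U \<phi> s (fs ! j) (d j)"
    let ?w = "%k. a k - (\<Sum>j\<in>T. ?c j * d j k)"
    have "cd U \<phi> s (fs ! i) ?w = 0" if i: "i \<in> T" for i
    proof -
     have "(\<Sum>j\<in>T. ?c j * cd U \<phi> s (fs ! i) (d j)) = (\<Sum>j\<in>T. if j = i then ?c i * cd U \<phi> s (fs ! i) (d i) else 0)"
      using d i by (intro sum.cong) auto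
     also have "\<dots> = cd U \<phi> s (fs ! i) a" using d i fT by simp
     finally show ?thesis using dd_linear(2)[of n "%x. (fs ! i) (inv_into U \<phi> x)" "\<phi> s" a ?c d T] unfolding cd_def by simp
    qed
    then have "cd U \<phi> s F ?w = 0" using none by blast
    then show ?thesis using dd_linear(2)[of n "%x. F (inv_into U \<phi> x)" "\<phi> s" a ?c d T] unfolding cd_def
     by (simp add: mult.commute)
   qed
   define \<mu> where "\<mu> j = cd U \<phi> s F (d j) / cd U \<phi> s (fs ! j) (d j)" for j
   have unit: "cd U \<phi> s g (%k. if k = i then 1 else 0) = pd i (%x. g (inv_into U \<phi> x)) (\<phi> s)" if "i < n" for g i
    using that by (simp add: cd_def dd_def if_distrib cong: if_cong)
   have "pd i (%x. F (inv_into U \<phi> x)) (\<phi> s) = (\<Sum>j\<in>T. \<mu> j * pd i (%x. (fs ! j) (inv_into U \<phi> x)) (\<phi> s))" if "i < n" for i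
    using span[of "%k. if k = i then 1 else 0"] unit[OF that] by (simp add: \<mu>_def)
   moreover have "inv_into U \<phi> (\<phi> s) = s" using chart(8)[OF UA U(2)] .
   ultimately have "F s \<in> bad ((U, \<phi>), T)"
    unfolding bad_def prod.case using U(2) by (intro image_eqI[of _ _ "\<phi> s"]) (auto simp: T_def)
   moreover have "((U, \<phi>), T) \<in> ?I" using U(1) by (auto simp: T_def)
   ultimately show False using r Fs by blast
  qed
  have "indep U \<phi> (?F # fs) s"
   unfolding indep_def
  proof (intro allI impI)
   fix j assume j: "j < length (?F # fs)" "((?F # fs) ! j) s = 0"
   have goal: "\<exists>w. cd U \<phi> s ((?F # fs) ! j) w \<noteq> 0 \<and> (\<forall>i<length (?F # fs). i \<noteq> j --> ((?F # fs) ! i) s = 0 --> cd U \<phi> s ((?F # fs) ! i) w = 0)"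
    if "cd U \<phi> s ((?F # fs) ! j) w \<noteq> 0" "j \<noteq> 0 ==> F s = r ==> cd U \<phi> s F w = 0"
     "\<And>i. i \<in> T ==> Suc i \<noteq> j ==> cd U \<phi> s (fs ! i) w = 0" for w
   proof (intro exI[of _ w] conjI allI impI that(1))
    fix i assume i: "i < length (?F # fs)" "i \<noteq> j" "((?F # fs) ! i) s = 0"
    show "cd U \<phi> s ((?F # fs) ! i) w = 0"
    proof (cases i)
     case 0
     then show ?thesis using i that(2) s cdF by simp
    next
     case (Suc i')
     then show ?thesis using i that(3)[of i'] by (simp add: T_def)
    qed
   qed
   show "\<exists>w. cd U \<phi> s ((?F # fs) ! j) w \<noteq> 0 \<and> (\<forall>i<length (?F # fs). i \<noteq> j --> ((?F # fs) ! i) s = 0 --> cd U \<phi> s ((?F # fs) ! i) w = 0)"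
   proof (cases j)
    case 0
    then obtain w where "cd U \<phi> s F w \<noteq> 0" "\<forall>i\<in>T. cd U \<phi> s (fs ! i) w = 0" using w0 j s by auto
    then show ?thesis using 0 cdF by (intro goal[of w]) auto
   next
    case (Suc j')
    then have jT: "j' \<in> T" using j by (simp add: T_def)
    obtain w where w: "cd U \<phi> s (fs ! j') w \<noteq> 0" "\<forall>i\<in>T. i \<noteq> j' --> cd U \<phi> s (fs ! i) w = 0" using dual[OF jT] by blast
    show ?thesis
    proof (cases "F s = r")
     case False
     then show ?thesis using Suc w by (intro goal[of w]) auto
    next
     case True
     then obtain x where x: "cd U \<phi> s F x \<noteq> 0" "\<forall>i\<in>T. cd U \<phi> s (fs ! i) x = 0" using w0 by blast
     \<comment> \<open>A multiple of \<open>x\<close> makes the vector invisible to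
       \<open>F\<close>; the constraints in \<open>T\<close> do not see \<open>x\<close>, so the
       vector stays dual.\<close>
     let ?w = "%k. w k - (cd U \<phi> s F w / cd U \<phi> s F x) * x k"
     have lin: "cd U \<phi> s g ?w = cd U \<phi> s g w - (cd U \<phi> s F w / cd U \<phi> s F x) * cd U \<phi> s g x" for g
      unfolding cd_def by (rule dd_linear(1))
     have "cd U \<phi> s F ?w = 0" "\<And>i. i \<in> T ==> cd U \<phi> s (fs ! i) ?w = cd U \<phi> s (fs ! i) w"
      unfolding lin using x by simp_all
     then show ?thesis using Suc w jT by (intro goal[of ?w]) auto
    qed
   qed
  qed
  then show "\<exists>U \<phi>. (U, \<phi>) \<in> \<A> \<and> s \<in> U \<and> indep U \<phi> (?F # fs) s" using UA U(2) by blast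
 qed
 ultimately show ?thesis by (elim negligible_subset) blast
qed

end

section \<open>From manifolds to manifolds with corners\<close>

text \<open>The description of \<open>X\<close> as a closure exhibits its ring as a quotient of the
  ring of the manifold.\<close>

lemma realization_surj:
 assumes "realization n X S \<A> fs q" shows "q ` carrier (CinfM n S \<A>) = carrier X"
proof -
 let ?A = "CinfM n S \<A>"
 have R: "is_manifold n S \<A>" using assms unfolding realization_def by blast
 interpret mfd n S \<A> by unfold_locales (rule R)
 obtain U :: "std cinf" and \<omega> G \<gamma> where U: "is_intersection ?A {..<length fs} (G :: nat => std cinf) \<gamma> U \<omega>"
  and e: "subscheme_eq ?A X q (quot ?A (closure_ideal ?A U \<omega>)) (quot_map ?A (closure_ideal ?A U \<omega>))"
  using assms unfolding realization_def by blast
 have "ideal (closure_ideal ?A U \<omega>) (as_ring ?A)"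
  unfolding closure_ideal_ker using intersectionD(1,2)[OF U] schemeD ring by (intro ker_ideal) auto
 note q = quot_basics(3)[OF ring this]
 obtain u where u: "u \<in> ciso (quot ?A (closure_ideal ?A U \<omega>)) X"
  "\<forall>x\<in>carrier ?A. u (quot_map ?A (closure_ideal ?A U \<omega>) x) = q x" using e unfolding subscheme_eq_def by blast
 have "q ` carrier ?A = u ` quot_map ?A (closure_ideal ?A U \<omega>) ` carrier ?A"
  unfolding image_image using u(2) by (intro image_cong) auto
 also have "\<dots> = carrier X" unfolding q using u(1) by (simp add: ciso_def bij_betw_def)
 finally show ?thesis .
qed

lemma corners_critical_negligible:
 assumes X: "manifold_with_corners n X" and f: "f \<in> carrier X"
 shows "negligible {r. \<not> corners_regular_value X f r}"
proof -
 obtain S \<A> fs q where R: "realization n X S \<A> fs q" using X unfolding manifold_with_corners_def by blast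
 then have m: "is_manifold n S \<A>" and sch: "cinf_scheme (CinfM n S \<A>)" and fs: "set fs \<subseteq> carrier (CinfM n S \<A>)"
  and reg: "zero_regular (CinfM n S \<A>) fs" unfolding realization_def by blast+
 interpret mfd n S \<A> by unfold_locales (rule m)
 have "f \<in> q ` carrier (CinfM n S \<A>)" using f realization_surj[OF R] by simp
 then obtain F where F: "F \<in> carrier (CinfM n S \<A>)" "q F = f" by blast
 have "{r. \<not> corners_regular_value X f r} \<subseteq> {r. \<not> zero_regular (CinfM n S \<A>) ((\<lambda>p\<in>topspace S. F p - r) # fs)}"
  using R F unfolding corners_regular_value_def by blast
 then show ?thesis using negligible_subset[OF bad_values[OF sch reg fs F(1)]] by blast
qed

section \<open>Open subsets of manifolds with corners\<close>

text \<open>A test ring over \<open>C\<close> that kills the cutoff of \<open>h f\<close> and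
  inverts \<open>h x\<close> does the same, along \<open>h\<close>, for \<open>f\<close> and
  \<open>x\<close>.\<close>

lemma le_ideal_functorial:
 assumes A: "cinf_scheme A" and C: "cinf_scheme C" and h: "h \<in> chom A C" and f: "f \<in> carrier A" and x: "x \<in> le_ideal A f r"
 shows "h x \<in> le_ideal C (h f) r"
proof -
 note A' = schemeD[OF A] and C' = schemeD[OF C]
 interpret A: cinf A by unfold_locales (rule A')
 interpret C: cinf C by unfold_locales (rule C')
 let ?c = "op1 A (cutoff r) f"
 have c: "?c \<in> carrier A" by (rule A.op1_closed[OF cutoff(1) f])
 have hc: "h ?c = op1 C (cutoff r) (h f)" by (rule chom_op1[OF h cutoff(1) f])
 have d: "op1 C (cutoff r) (h f) \<in> carrier C" using chomD(1)[OF h c] hc by simp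
 have xA: "x \<in> carrier A" using x unfolding le_ideal_def inf_radical_def by (elim CollectE conjE)
 show ?thesis
  unfolding le_ideal_def
 proof (rule inf_radI[OF C' C.PIdl(1)[OF d] chomD(1)[OF h xA]])
  fix T :: "std cinf" and \<tau>
  assume Ts: "cinf_scheme T" and t: "\<tau> \<in> chom C T"
   and z: "\<And>y. y \<in> PIdl\<^bsub>as_ring C\<^esub> (op1 C (cutoff r) (h f)) ==> \<tau> y = const T 0" and u: "\<tau> (h x) \<in> Units (as_ring T)"
  let ?t = "\<lambda>x\<in>carrier A. \<tau> (h x)"
  have t': "?t \<in> chom A T" by (rule chom_compose[OF h t A' schemeD[OF Ts]])
  have "?c \<in> ker A T ?t" using c hc z[OF C.PIdl(2)[OF d]] by (simp add: ker_def)
  then have k: "PIdl\<^bsub>as_ring A\<^esub> ?c \<subseteq> ker A T ?t" by (intro A.PIdl(3)[OF c] ker_ideal[OF t' A' schemeD[OF Ts]])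
  show "zero_ring T"
  proof (rule inf_radD[OF A' A.PIdl(1)[OF c] x[unfolded le_ideal_def] Ts t'])
   show "?t y = const T 0" if "y \<in> PIdl\<^bsub>as_ring A\<^esub> ?c" for y using subsetD[OF k that] unfolding ker_def by blast
   show "?t x \<in> Units (as_ring T)" using u xA by simp
  qed
 qed
qed

lemma (in cinf) unit_cancel:
 assumes "x \<in> carrier A" "u \<in> Units (as_ring A)" "op2 A (*) x u = const A 0" shows "x = const A 0"
proof -
 obtain y where u: "u \<in> carrier A" and y: "y \<in> carrier A" "op2 A (*) u y = const A 1" using assms(2) Units_iff by blast
 have "op2 A (*) (op2 A (*) x u) y = op2 A (*) x (op2 A (*) u y)" by (rule ring_laws(6)[OF assms(1) u y(1)])
 then show ?thesis using assms(1,3) y by simp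
qed

lemma opn_preimage:
 fixes f :: "(nat => real) => real"
 assumes "opn n V" "continuous_on V f" "open Q" shows "opn n {x\<in>V. f x \<in> Q}"
proof -
 have "openin (top_of_set V) (V \<inter> f -` Q)" by (rule continuous_openin_preimage_gen[OF assms(2,3)])
 from openin_trans[OF this assms(1)[unfolded Euclidean_space_eq]] show ?thesis
  unfolding Euclidean_space_eq by (simp add: vimage_def Int_def)
qed

context mfd
begin

lemma preimage_open:
 assumes f: "f \<in> carrier A" and Q: "open Q" shows "openin S {t\<in>topspace S. f t \<in> Q}"
proof (subst openin_subopen, intro ballI)
 fix s assume s: "s \<in> {t\<in>topspace S. f t \<in> Q}"
 then obtain U \<phi> where U: "(U, \<phi>) \<in> \<A>" "s \<in> U" using covers[of s] by blast
 let ?V = "{x\<in>\<phi> ` U. f (inv_into U \<phi> x) \<in> Q}"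
 have "smooth_on n (\<phi> ` U) (%x. f (inv_into U \<phi> x))" using f fnD[OF _ U(1)] unfolding carrier by blast
 from opn_preimage[OF chart(2)[OF U(1)] smooth_onD(1)[OF this chart(2)[OF U(1)]] Q]
 have "openin S {t\<in>U. \<phi> t \<in> ?V}" by (rule chart(7)[OF U(1)])
 moreover have "s \<in> {t\<in>U. \<phi> t \<in> ?V}" using s U chart(8)[OF U] by simp
 moreover have "{t\<in>U. \<phi> t \<in> ?V} \<subseteq> {t\<in>topspace S. f t \<in> Q}"
 proof
  fix t assume "t \<in> {t\<in>U. \<phi> t \<in> ?V}"
  then have "t \<in> U" "f (inv_into U \<phi> (\<phi> t)) \<in> Q" by simp_all
  then show "t \<in> {t\<in>topspace S. f t \<in> Q}" using chart(4)[OF U(1)] chart(8)[OF U(1)] by auto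
 qed
 ultimately show "\<exists>T. openin S T \<and> s \<in> T \<and> T \<subseteq> {t\<in>topspace S. f t \<in> Q}" by blast
qed

lemma cprod_A: "s \<in> topspace S ==> cprod A c k s = (\<Prod>j<k. c j s)"
 by (induction k) (simp_all add: ops_A)

definition negs :: "('p => real) list => 'p set" where
 "negs fs = {s\<in>topspace S. \<forall>j<length fs. (fs ! j) s < 0}"

text \<open>If \<open>g\<close> vanishes wherever all constraints are negative, its product with all
  the cutoffs is zero, and the cutoffs are units in the ring of the open locus. Conversely each
  point of \<open>negs fs\<close> is a point of that locus.\<close>

lemma ker_lt_locus:
 assumes fs: "set fs \<subseteq> carrier A" and lt: "\<And>j. j < length fs ==> is_lt_locus A (fs ! j) 0 (G j) (\<gamma> j)"
  and I: "is_intersection A {..<length fs} G \<gamma> U \<omega>"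
 shows "ker A U \<omega> = {g\<in>carrier A. \<forall>s\<in>negs fs. g s = 0}"
proof -
 have fc: "fs ! i \<in> carrier A" if "i < length fs" for i using fs that nth_mem by blast
 define c where "c j = op1 A (%t. cutoff (- 0) (- t)) (fs ! j)" for j
 have loc: "is_localization A (c j) (G j) (\<gamma> j)" if "j < length fs" for j
  using lt[OF that] unfolding is_lt_locus_def c_def .
 have cc: "c j \<in> carrier A" if "j < length fs" for j
  unfolding c_def by (rule A.op1_closed[OF cutoff(3) fc[OF that]])
 have cs: "c j s = 0 \<longleftrightarrow> (fs ! j) s \<ge> 0" if "s \<in> topspace S" for j s
  using that by (simp add: c_def ops_A cutoff)
 note Us = intersectionD(1)[OF I] and om = intersectionD(2)[OF I]
 note U' = schemeD[OF Us]
 interpret U: cinf U by unfold_locales (rule U')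
 show ?thesis
 proof (intro equalityI subsetI)
  fix g assume g: "g \<in> ker A U \<omega>"
  have "g s = 0" if s: "s \<in> negs fs" for s
  proof -
   have sS: "s \<in> topspace S" using s by (simp add: negs_def)
   let ?p = "\<lambda>f\<in>carrier A. f s"
   have p: "?p \<in> chom A real_cinf" by (rule eval_point[OF sS])
   have "\<exists>u\<in>chom (G j) real_cinf. \<forall>x\<in>carrier A. u (\<gamma> j x) = ?p x" if j: "j \<in> {..<length fs}" for j
   proof (rule localization_ext[OF loc ring cc real_cinf_scheme p])
    show "?p (c j) \<in> Units (as_ring real_cinf)" using s j cs[OF sS] cc[of j] by (simp add: real_cinf_Units negs_def not_le)
   qed (use j in auto)
   from intersection_ext[OF I ring schemeD[OF localizationD(1)[OF loc]] localizationD(2)[OF loc] real_cinf_scheme p this]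
   obtain u where u: "u \<in> chom U real_cinf" "\<forall>x\<in>carrier A. u (\<omega> x) = ?p x" by auto
   have gc: "g \<in> carrier A" "\<omega> g = const U 0" using g by (simp_all add: ker_def)
   show ?thesis using bspec[OF u(2) gc(1)] gc chom_const[OF u(1) real_cinf_ring, of 0] by simp
  qed
  then show "g \<in> {g\<in>carrier A. \<forall>s\<in>negs fs. g s = 0}" using g by (simp add: ker_def)
 next
  fix g assume "g \<in> {g\<in>carrier A. \<forall>s\<in>negs fs. g s = 0}"
  then have g: "g \<in> carrier A" "\<And>s. s \<in> negs fs ==> g s = 0" by auto
  let ?c = "cprod A c (length fs)"
  have c: "?c \<in> carrier A" by (rule A.cprod_closed[OF cc])
  have "g s * ?c s = 0" if s: "s \<in> topspace S" for s
  proof (cases "s \<in> negs fs")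
   case False
   then show ?thesis using cs[OF s] s by (auto simp: cprod_A[OF s] negs_def not_less)
  qed (simp add: g)
  then have "op2 A (*) g ?c = const A 0" by (auto simp: ops_A)
  then have z: "op2 U (*) (\<omega> g) (\<omega> ?c) = const U 0"
   using chom_arith(2)[OF om g(1) c] chom_const[OF om U', of 0] by simp
  obtain \<iota> where io: "\<forall>j\<in>{..<length fs}. \<iota> j \<in> chom (G j) U \<and> (\<forall>x\<in>carrier A. \<iota> j (\<gamma> j x) = \<omega> x)"
   using intersectionD(3)[OF I] by (elim exE)
  have "\<omega> (c j) \<in> Units (as_ring U)" if j: "j < length fs" for j
  proof -
   have "\<iota> j \<in> chom (G j) U" "\<iota> j (\<gamma> j (c j)) = \<omega> (c j)" using io j cc[OF j] by auto
   then show ?thesis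
    using chom_Units[OF _ schemeD[OF localizationD(1)[OF loc[OF j]]] U' localizationD(3)[OF loc[OF j]], of "\<iota> j"] by simp
  qed
  then have "\<omega> ?c \<in> Units (as_ring U)"
   using chom_cprod[OF om ring U' cc] U.Units_cprod[of "length fs" "%j. \<omega> (c j)"] chomD(1)[OF om cc] by simp
  then have "\<omega> g = const U 0" by (rule U.unit_cancel[OF chomD(1)[OF om g(1)] _ z])
  then show "g \<in> ker A U \<omega>" using g(1) by (simp add: ker_def)
 qed
qed

end

text \<open>By the closure description, a function is zero on \<open>X\<close> iff it is zero on the
  open part where all constraints are negative.\<close>

lemma realization_ker:
 assumes R: "realization n X S \<A> fs q" and X: "cinf_ring X"
 shows "ker (CinfM n S \<A>) X q = {g\<in>carrier (CinfM n S \<A>). \<forall>s\<in>mfd.negs S fs. g s = 0}"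
proof -
 let ?A = "CinfM n S \<A>"
 have m: "is_manifold n S \<A>" and fs: "set fs \<subseteq> carrier ?A" using R unfolding realization_def by blast+
 interpret mfd n S \<A> by unfold_locales (rule m)
 from R obtain G :: "nat => std cinf" and \<gamma> and U :: "std cinf" and \<omega> where lt: "\<forall>j<length fs. is_lt_locus ?A (fs ! j) 0 (G j) (\<gamma> j)"
  and I: "is_intersection ?A {..<length fs} G \<gamma> U \<omega>"
  and e: "subscheme_eq ?A X q (quot ?A (closure_ideal ?A U \<omega>)) (quot_map ?A (closure_ideal ?A U \<omega>))"
  unfolding realization_def by (elim conjE exE)
 have "ideal (closure_ideal ?A U \<omega>) (as_ring ?A)"
  unfolding closure_ideal_ker by (rule ker_ideal[OF intersectionD(2)[OF I] ring schemeD[OF intersectionD(1)[OF I]]])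
 note q = quot_basics[OF ring this]
 let ?Q = "quot ?A (closure_ideal ?A U \<omega>)" and ?p = "quot_map ?A (closure_ideal ?A U \<omega>)"
 interpret Q: cinf ?Q by unfold_locales (rule q)
 obtain u where u: "u \<in> chom ?Q X" "inj_on u (carrier ?Q)" "\<forall>x\<in>carrier ?A. u (?p x) = q x"
  using e unfolding subscheme_eq_def ciso_def bij_betw_def by blast
 have "q x = const X 0 \<longleftrightarrow> ?p x = const ?Q 0" if x: "x \<in> carrier ?A" for x
 proof -
  have "q x = u (?p x)" "const X 0 = u (const ?Q 0)" using u(3) x chom_const[OF u(1) X, of 0] by simp_all
  then show ?thesis using inj_on_eq_iff[OF u(2) chomD(1)[OF q(2) x] Q.const_closed[of 0]] by simp
 qed
 then have "ker ?A X q = ker ?A ?Q ?p" unfolding ker_def by blast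
 also have "\<dots> = ker ?A U \<omega>" using q(4) unfolding closure_ideal_ker .
 also have "\<dots> = {g\<in>carrier ?A. \<forall>s\<in>negs fs. g s = 0}" by (rule ker_lt_locus[OF fs lt[rule_format] I])
 finally show ?thesis .
qed

section \<open>The open submanifold where a function does not vanish\<close>

locale mfd_open = mfd +
 fixes a assumes a: "a \<in> carrier A" and nonvanishing: "\<exists>s\<in>topspace S. a s \<noteq> 0"
begin

definition Q where "Q = {s\<in>topspace S. a s \<noteq> 0}"
definition S' where "S' = subtopology S Q"
definition \<A>' where "\<A>' = (\<lambda>(U, \<phi>). (U \<inter> Q, \<phi>)) ` \<A>"

lemma Q: "openin S Q" "Q \<subseteq> topspace S" "topspace S' = Q"
proof -
 have "open (- {0 :: real})" by (intro open_Compl closed_singleton)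
 from preimage_open[OF a this] show "openin S Q" by (simp add: Q_def)
qed (auto simp: Q_def S'_def)

lemma inv_Q: "(U, \<phi>) \<in> \<A> ==> x \<in> \<phi> ` (U \<inter> Q) ==> inv_into (U \<inter> Q) \<phi> x = inv_into U \<phi> x \<and> inv_into U \<phi> x \<in> U \<inter> Q"
 using chart(8)[of U \<phi>] inv_into_f_f[OF inj_on_subset[OF chart(3)[of U \<phi>], of "U \<inter> Q"]] by auto

lemma mfd': "is_manifold n S' \<A>'"
 unfolding is_manifold_def
proof (intro conjI)
 have h: "Hausdorff_space S" and c: "second_countable S" using mfd unfolding is_manifold_def by blast+
 show "topspace S' \<noteq> {}" using nonvanishing Q(3) by (auto simp: Q_def)
 show "Hausdorff_space S'" unfolding S'_def by (rule Hausdorff_space_subtopology[OF h])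
 show "second_countable S'" unfolding S'_def by (rule second_countable_subtopology[OF c])
 show "topspace S' = (\<Union>(U, \<phi>)\<in>\<A>'. U)" unfolding Q(3) using covers Q(2) by (fastforce simp: \<A>'_def)
 show "\<forall>(W, \<phi>)\<in>\<A>'. openin S' W \<and> openin (Euclidean_space n) (\<phi> ` W) \<and>
    homeomorphic_map (subtopology S' W) (subtopology (Euclidean_space n) (\<phi> ` W)) \<phi>"
  unfolding \<A>'_def
 proof (clarify, intro conjI)
  fix U \<phi> assume U: "(U, \<phi>) \<in> \<A>"
  show "openin S' (U \<inter> Q)" unfolding S'_def openin_subtopology using chart(1)[OF U] by blast
  show "openin (Euclidean_space n) (\<phi> ` (U \<inter> Q))" by (rule chart(6)[OF U Q(1)])
  have "homeomorphic_map (subtopology (subtopology S U) Q) (subtopology (subtopology (Euclidean_space n) (\<phi> ` U)) (\<phi> ` (U \<inter> Q))) \<phi>"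
   by (rule homeomorphic_map_subtopologies[OF chart(5)[OF U]])
    (use chart(4)[OF U] opn_subset[OF chart(2)[OF U]] in auto)
  moreover have "subtopology (subtopology S U) Q = subtopology S' (U \<inter> Q)"
   unfolding S'_def subtopology_subtopology by (rule arg_cong[of _ _ "subtopology S"]) blast
  moreover have "subtopology (subtopology (Euclidean_space n) (\<phi> ` U)) (\<phi> ` (U \<inter> Q)) = subtopology (Euclidean_space n) (\<phi> ` (U \<inter> Q))"
   unfolding subtopology_subtopology by (rule arg_cong[of _ _ "subtopology _"]) blast
  ultimately show "homeomorphic_map (subtopology S' (U \<inter> Q)) (subtopology (Euclidean_space n) (\<phi> ` (U \<inter> Q))) \<phi>" by simp
 qed
 show "\<forall>(U, \<phi>)\<in>\<A>'. \<forall>(W, \<psi>)\<in>\<A>'. \<forall>i<n. smooth_on n (\<phi> ` (U \<inter> W)) (%x. \<psi> (inv_into U \<phi> x) i)"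
  unfolding \<A>'_def
 proof clarify
  fix U \<phi> W \<psi> i assume U: "(U, \<phi>) \<in> \<A>" and W: "(W, \<psi>) \<in> \<A>" and i: "i < n"
  have e: "(U \<inter> Q) \<inter> (W \<inter> Q) = U \<inter> (W \<inter> Q)" by blast
  have o: "opn n (\<phi> ` (U \<inter> (W \<inter> Q)))" by (rule chart(6)[OF U openin_Int[OF chart(1)[OF W] Q(1)]])
  have "smooth_on n (\<phi> ` (U \<inter> (W \<inter> Q))) (%x. \<psi> (inv_into U \<phi> x) i)"
   by (rule smooth_on_subset[OF transition[OF U W i] chart(6)[OF U chart(1)[OF W]] o]) blast
  then show "smooth_on n (\<phi> ` ((U \<inter> Q) \<inter> (W \<inter> Q))) (%x. \<psi> (inv_into (U \<inter> Q) \<phi> x) i)"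
   unfolding e
  proof (rule smooth_on_cong[OF o])
   fix x assume "x \<in> \<phi> ` (U \<inter> (W \<inter> Q))"
   then have "x \<in> \<phi> ` (U \<inter> Q)" by blast
   then show "\<psi> (inv_into U \<phi> x) i = \<psi> (inv_into (U \<inter> Q) \<phi> x) i" using inv_Q[OF U] by simp
  qed
 qed
qed

sublocale M': mfd n S' \<A>' by unfold_locales (rule mfd')

lemma fn'I: "(\<And>U \<phi>. (U, \<phi>) \<in> \<A> ==> smooth_on n (\<phi> ` (U \<inter> Q)) (%x. f (inv_into U \<phi> x))) ==> M'.fn f"
 unfolding M'.fn_def unfolding \<A>'_def
proof clarify
 fix U \<phi> assume f: "\<And>U \<phi>. (U, \<phi>) \<in> \<A> ==> smooth_on n (\<phi> ` (U \<inter> Q)) (%x. f (inv_into U \<phi> x))" and U: "(U, \<phi>) \<in> \<A>"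
 show "smooth_on n (\<phi> ` (U \<inter> Q)) (%x. f (inv_into (U \<inter> Q) \<phi> x))"
  by (rule smooth_on_cong[OF chart(6)[OF U Q(1)] f[OF U]]) (use inv_Q[OF U] in simp)
qed

lemma fn'D:
 assumes "M'.fn f" and U: "(U, \<phi>) \<in> \<A>" shows "smooth_on n (\<phi> ` (U \<inter> Q)) (%x. f (inv_into U \<phi> x))"
proof -
 have "(U \<inter> Q, \<phi>) \<in> \<A>'" using U by (force simp: \<A>'_def)
 from M'.fnD[OF assms(1) this] show ?thesis
  by (rule smooth_on_cong[OF chart(6)[OF U Q(1)]]) (use inv_Q[OF U] in simp)
qed

lemma fn_fn': "fn f ==> M'.fn f"
 by (rule fn'I, rule smooth_on_subset[OF fnD chart(2) chart(6)[OF _ Q(1)]]) (assumption | blast)+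

lemma res: "f \<in> carrier A ==> restrict f Q \<in> carrier M'.A"
 using M'.restrict_fn[OF fn_fn', of f] unfolding Q(3) by (simp add: carrier)

lemma res_chom: "(\<lambda>f\<in>carrier A. restrict f Q) \<in> chom A M'.A"
proof (rule chomI)
 fix m g b assume g: "Sm m g" and b: "\<And>i. i < m ==> b i \<in> carrier A"
 let ?r = "\<lambda>f\<in>carrier A. restrict f Q"
 have e: "tuple m (%i. ?r (b i) s) = tuple m (%i. b i s)" if "s \<in> Q" for s
  using b that by (auto simp: tuple_def)
 have "?r (app A m g b) = restrict (app A m g b) Q" using A.app_closed[OF g b] by simp
 also have "\<dots> = (\<lambda>s\<in>Q. g (tuple m (%i. b i s)))" unfolding app_A by (rule restrict_ext) (use Q(2) in auto)
 also have "\<dots> = (\<lambda>s\<in>Q. g (tuple m (%i. ?r (b i) s)))" by (rule restrict_ext) (simp only: e)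
 finally show "?r (app A m g b) = app M'.A m g (%i. ?r (b i))" unfolding M'.app_A Q(3) .
qed (auto simp: res)

lemma inverse_a: "(\<lambda>s\<in>Q. 1 / a s) \<in> carrier M'.A" "op2 M'.A (*) (restrict a Q) (\<lambda>s\<in>Q. 1 / a s) = const M'.A 1"
proof -
 have "M'.fn a" using a by (simp add: carrier fn_fn')
 then have "M'.fn (%s. 1 / a s)" by (rule M'.fn_inverse) (simp add: Q(3), simp add: Q_def)
 then show "(\<lambda>s\<in>Q. 1 / a s) \<in> carrier M'.A" using M'.restrict_fn by (simp add: Q(3))
 show "op2 M'.A (*) (restrict a Q) (\<lambda>s\<in>Q. 1 / a s) = const M'.A 1" unfolding M'.ops_A Q(3) by (auto simp: Q_def)
qed

text \<open>The factor \<open>tent\<close> confines the support to \<open>1 / a\<close> with square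
  less than \<open>m + 1\<close>, so near a zero of \<open>a\<close> the function is zero.\<close>

lemma cutoff_extension:
 assumes b: "b \<in> carrier M'.A"
 shows "(\<lambda>s\<in>topspace S. if s \<in> Q then tent ((1 / a s)\<^sup>2 - real m) * b s else 0) \<in> carrier A"
proof (rule restrict_fn, rule fn_local)
 let ?f = "%s. if s \<in> Q then tent ((1 / a s)\<^sup>2 - real m) * b s else 0"
 fix s assume s: "s \<in> topspace S"
 obtain U \<phi> where U: "(U, \<phi>) \<in> \<A>" "s \<in> U" using covers[OF s] by blast
 show "\<exists>U \<phi> V. (U, \<phi>) \<in> \<A> \<and> s \<in> U \<and> openin S V \<and> s \<in> V \<and> smooth_on n (\<phi> ` (U \<inter> V)) (%x. ?f (inv_into U \<phi> x))"
 proof (cases "s \<in> Q")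
  case True
  note o = chart(6)[OF U(1) Q(1)]
  have i: "M'.fn (\<lambda>s\<in>Q. 1 / a s)" "M'.fn b" using inverse_a(1) b unfolding M'.carrier by blast+
  have "smooth_on n (\<phi> ` (U \<inter> Q)) (%x. tent (((\<lambda>s\<in>Q. 1 / a s) (inv_into U \<phi> x))\<^sup>2 - real m) * b (inv_into U \<phi> x))"
   by (intro smooth_mult smooth_tent smooth_diff smooth_power smooth_const o fn'D[OF i(1) U(1)] fn'D[OF i(2) U(1)])
  then have "smooth_on n (\<phi> ` (U \<inter> Q)) (%x. ?f (inv_into U \<phi> x))"
   by (rule smooth_on_cong[OF o]) (use inv_Q[OF U(1)] in simp)
  then show ?thesis using U Q(1) True by blast
 next
  case False
  let ?V = "{t\<in>topspace S. a t \<in> {x. x\<^sup>2 * (real m + 1) < 1}}"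
  have "open {x::real. x\<^sup>2 * (real m + 1) < 1}" by (intro open_Collect_less continuous_intros)
  from preimage_open[OF a this] have V: "openin S ?V" .
  have f0: "?f t = 0" if "t \<in> ?V" for t
  proof (cases "t \<in> Q")
   case True
   then have "(a t)\<^sup>2 > 0" "(a t)\<^sup>2 * (real m + 1) < 1" using that by (auto simp: Q_def)
   then have "real m + 1 < 1 / (a t)\<^sup>2" by (simp add: field_simps)
   then have "\<bar>(1 / a t)\<^sup>2 - real m\<bar> \<ge> 1" by (simp add: power_one_over)
   then show ?thesis using tent_simps(3) by simp
  qed simp
  have z: "?f (inv_into U \<phi> x) = 0" if x: "x \<in> \<phi> ` (U \<inter> ?V)" for x
  proof -
   obtain t where t: "x = \<phi> t" "t \<in> U" "t \<in> ?V" using x by (elim imageE IntE)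
   have i: "inv_into U \<phi> x = t" unfolding t(1) by (rule chart(8)[OF U(1) t(2)])
   show ?thesis unfolding i by (rule f0[OF t(3)])
  qed
  have o: "opn n (\<phi> ` (U \<inter> ?V))" by (rule chart(6)[OF U(1) V])
  have "smooth_on n (\<phi> ` (U \<inter> ?V)) (%x. ?f (inv_into U \<phi> x))"
   by (rule smooth_on_cong[OF o smooth_const[OF o, of 0]]) (rule z[symmetric])
  moreover have "s \<in> ?V" using s False by (simp add: Q_def)
  ultimately show ?thesis using U V by blast
 qed
qed

text \<open>On \<open>a \<noteq> 0\<close> a function is a sum of pieces that extend by zero, weighted by the bumps \<open>tent (1/a\<^sup>2 - m)\<close>.\<close>

lemma generated:
 assumes gen: "generates A N x"
 shows "generates M'.A (Suc N) ((%i. restrict (x i) Q)(N := \<lambda>s\<in>Q. 1 / a s))" (is "generates _ _ ?c")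
 unfolding generates_def
proof (intro conjI ballI allI impI)
 note x = generatesD(1)[OF gen]
 show "?c i \<in> carrier M'.A" if "i < Suc N" for i using that x res inverse_a(1) by (auto simp: less_Suc_eq)
 fix b assume b: "b \<in> carrier M'.A"
 have "\<forall>m. \<exists>g. Sm N g \<and> (\<lambda>s\<in>topspace S. if s \<in> Q then tent ((1 / a s)\<^sup>2 - real m) * b s else 0) = app A N g x"
  using generatesD(2)[OF gen cutoff_extension[OF b]] by blast
 from choice[OF this] obtain g where g: "\<forall>m. Sm N (g m) \<and>
  (\<lambda>s\<in>topspace S. if s \<in> Q then tent ((1 / a s)\<^sup>2 - real m) * b s else 0) = app A N (g m) x" by (rule exE)
 let ?t = "%m z. tent ((z N)\<^sup>2 - real m)"
 have loc: "\<exists>U M. opn (Suc N) U \<and> z \<in> U \<and> (\<forall>y\<in>U. \<forall>m\<ge>M. ?t m y = 0)" if z: "z \<in> Rn (Suc N)" for z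
 proof -
  let ?U = "{y\<in>Rn (Suc N). (y N)\<^sup>2 \<in> {..<(z N)\<^sup>2 + 1}}"
  have "opn (Suc N) ?U" by (rule opn_preimage[OF opn_Rn]) (auto intro!: continuous_intros continuous_on_coord)
  moreover obtain M :: nat where M: "(z N)\<^sup>2 + 2 < real M" using reals_Archimedean2 by blast
  have "?t m y = 0" if "y \<in> ?U" "m \<ge> M" for y m
  proof -
   have "real m \<ge> real M" using that(2) by simp
   then show ?thesis using that(1) M by (intro tent_simps(3)) auto
  qed
  ultimately show ?thesis using z by (intro exI[of _ ?U] exI[of _ M] conjI ballI allI impI) auto
 qed
 have ts: "Sm (Suc N) (?t m)" for m by (intro smooth_tent smooth_diff smooth_power smooth_const smooth_coord opn_Rn)
 have s1: "Sm (Suc N) (%z. \<Sum>m. ?t m z * ?t m z)"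
 proof (rule smooth_suminf[OF opn_Rn smooth_mult[OF opn_Rn ts ts]])
  fix z assume "z \<in> Rn (Suc N)"
  from loc[OF this] obtain U M where "opn (Suc N) U" "z \<in> U" "\<forall>y\<in>U. \<forall>m\<ge>M. ?t m y = 0" by (elim exE conjE)
  then show "\<exists>U M. opn (Suc N) U \<and> z \<in> U \<and> (\<forall>y\<in>U. \<forall>m\<ge>M. ?t m y * ?t m y = 0)" by (intro exI[of _ U] exI[of _ M]) simp
 qed
 have s2: "Sm (Suc N) (%z. \<Sum>m. ?t m z * g m (tuple N z))"
 proof (rule smooth_suminf[OF opn_Rn smooth_mult[OF opn_Rn ts Sm_extend]])
  show "Sm N (g m)" for m using g by blast
  fix z assume "z \<in> Rn (Suc N)"
  from loc[OF this] obtain U M where "opn (Suc N) U" "z \<in> U" "\<forall>y\<in>U. \<forall>m\<ge>M. ?t m y = 0" by (elim exE conjE)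
  then show "\<exists>U M. opn (Suc N) U \<and> z \<in> U \<and> (\<forall>y\<in>U. \<forall>m\<ge>M. ?t m y * g m (tuple N y) = 0)" by (intro exI[of _ U] exI[of _ M]) simp
 qed
 have sm: "summable (%m. ?t m z * ?t m z)" and pos: "(\<Sum>m. ?t m z * ?t m z) > 0" if z: "z \<in> Rn (Suc N)" for z
 proof -
  from loc[OF z] obtain U M where "z \<in> U" "\<forall>y\<in>U. \<forall>m\<ge>M. ?t m y = 0" by (elim exE conjE)
  then have "?t m z * ?t m z = 0" if "m \<notin> {..<M}" for m using that by simp
  then show sm: "summable (%m. ?t m z * ?t m z)" by (intro summable_finite[of "{..<M}"]) auto
  let ?k = "nat \<lfloor>(z N)\<^sup>2\<rfloor>"
  have "real ?k = of_int \<lfloor>(z N)\<^sup>2\<rfloor>" by simp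
  then have "\<bar>(z N)\<^sup>2 - real ?k\<bar> < 1" by linarith
  then have "?t ?k z > 0" using tent_simps(2) by blast
  then show "(\<Sum>m. ?t m z * ?t m z) > 0" by (intro suminf_pos2[OF sm, of ?k]) simp_all
 qed
 \<comment> \<open>On the generators \<open>g m\<close> takes the value \<open>?t m\<close> times
   \<open>b\<close>, so the numerator is \<open>b\<close> times the sum of the squares of the
   \<open>?t m\<close>. This sum is locally finite and positive everywhere.\<close>
 let ?G = "%z. (\<Sum>m. ?t m z * g m (tuple N z)) / (\<Sum>m. ?t m z * ?t m z)"
 have "b = app M'.A (Suc N) ?G ?c"
 proof (rule M'.A_eqI[OF b])
  have G: "Sm (Suc N) ?G" using pos by (intro smooth_divide s1 s2 opn_Rn) (simp add: less_imp_neq[symmetric])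
  show "app M'.A (Suc N) ?G ?c \<in> carrier M'.A"
   by (rule M'.A.app_closed[OF G]) (use x res inverse_a(1) in \<open>auto simp: less_Suc_eq\<close>)
  fix s assume "s \<in> topspace S'"
  then have s: "s \<in> Q" "s \<in> topspace S" using Q by auto
  let ?z = "tuple (Suc N) (%i. ?c i s)"
  have z: "?z N = 1 / a s" "tuple N ?z = tuple N (%i. x i s)" using s by (auto simp: tuple_def)
  have "g m (tuple N (%i. x i s)) = app A N (g m) x s" for m using s by (simp add: app_A)
  then have gm: "g m (tuple N ?z) = ?t m ?z * b s" for m
   unfolding z using g[THEN spec, of m, THEN conjunct2, THEN fun_cong, of s] s by simp
  have "(\<Sum>m. ?t m ?z * g m (tuple N ?z)) = (\<Sum>m. ?t m ?z * ?t m ?z) * b s"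
   unfolding gm mult.assoc[symmetric] by (rule suminf_mult2[OF sm, symmetric]) simp
  moreover have "(\<Sum>m. ?t m ?z * ?t m ?z) \<noteq> 0" using pos[of ?z] by simp
  ultimately show "b s = app M'.A (Suc N) ?G ?c s" using s(1) by (simp add: M'.app_A Q(3))
 qed
 moreover have "Sm (Suc N) ?G" using pos by (intro smooth_divide s1 s2 opn_Rn) (simp add: less_imp_neq[symmetric])
 ultimately show "\<exists>G. Sm (Suc N) G \<and> b = app M'.A (Suc N) G ?c" by blast
qed

lemma indep_restrict:
 assumes U: "(U, \<phi>) \<in> \<A>" "s \<in> U \<inter> Q" and fs: "set fs \<subseteq> carrier A" and i: "indep U \<phi> fs s"
 shows "M'.indep (U \<inter> Q) \<phi> (map (%f. restrict f Q) fs) s"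
proof -
 have "M'.cd (U \<inter> Q) \<phi> s (restrict (fs ! j) Q) w = cd U \<phi> s (fs ! j) w" if j: "j < length fs" for j w
 proof -
  have "fn (fs ! j)" using fs nth_mem[OF j] by (auto simp: carrier)
  note sm = fn'D[OF fn_fn'[OF this] U(1)]
  show ?thesis unfolding cd_def M'.cd_def
   by (rule dd_cong[OF chart(6)[OF U(1) Q(1)] _ _ sm, symmetric]) (use U inv_Q[OF U(1)] in auto)
 qed
 then show ?thesis using i U(2) by (simp add: indep_def M'.indep_def)
qed

end

text \<open>The identity holds on the graph of \<open>1 / \<alpha>\<close>. By
  \<open>factor_inverse\<close> the difference of the two sides is then a multiple of
  \<open>z N * \<alpha> (tuple N z) - 1\<close>, whose value at the given elements is zero. So an
  identity of functions becomes one in any ring where \<open>\<alpha>\<close> is inverted.\<close>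

lemma (in cinf) rapid_identity:
 assumes S: "Sm N \<alpha>" "Sm (Suc N) W" "Sm (Suc N) G" "Sm N e"
  and e: "\<And>v. v \<in> Rn N ==> \<alpha> v \<noteq> 0 ==> e v = W (v(N := 1 / \<alpha> v)) * G (v(N := 1 / \<alpha> v))"
  and t: "\<forall>i<N. t i \<in> carrier A" and y: "y \<in> carrier A" "op2 A (*) (app A N \<alpha> t) y = const A 1"
 shows "app A N e t = op2 A (*) (app A (Suc N) W (t(N := y))) (app A (Suc N) G (t(N := y)))"
proof -
 let ?b = "t(N := y)" and ?P = "%z. e (tuple N z) - W z * G z"
 have b: "\<forall>i<Suc N. ?b i \<in> carrier A" using t y(1) by (simp add: less_Suc_eq)
 note Se = Sm_extend[OF S(4)] and Sa = Sm_extend[OF S(1)]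
 have P: "Sm (Suc N) ?P" using Se S(2,3) by simp
 have tup: "tuple N (v(N := c)) = v" if "v \<in> Rn N" for v c
  using that by (auto simp: tuple_def fun_eq_iff in_Rn)
 have z: "?P (v(N := 1 / \<alpha> v)) = 0" if "v \<in> Rn N" "\<alpha> v \<noteq> 0" for v using e[OF that] tup[OF that(1)] by simp
 have "\<exists>H. Sm (Suc N) H \<and> (\<forall>z\<in>Rn (Suc N). ?P z = (z N * \<alpha> (tuple N z) - 1) * H z)"
 proof (rule factor_inverse[OF S(1) P z])
  fix H assume H: "Sm (Suc N) H" "\<And>z. z \<in> Rn (Suc N) ==> ?P z = (z N * \<alpha> (tuple N z) - 1) * H z"
  show ?thesis by (intro exI[of _ H] conjI ballI) (rule H; assumption)+
 qed
 then obtain H where H: "Sm (Suc N) H" "\<forall>z\<in>Rn (Suc N). ?P z = (z N * \<alpha> (tuple N z) - 1) * H z" by (elim exE conjE)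
 let ?F = "%z. z N * \<alpha> (tuple N z) - 1"
 have Fs: "Sm (Suc N) (%z. z N * \<alpha> (tuple N z))" "Sm (Suc N) ?F" using Sa by simp_all
 have "app A (Suc N) (%z. z N * \<alpha> (tuple N z)) ?b = op2 A (*) y (app A N \<alpha> t)"
  using arith_app'(2)[OF _ Sa b, of "%z. z N"] app_coord'[of N "Suc N" ?b, OF _ b] app_extend'[OF S(1) t y(1)] by (simp add: fun_upd_def)
 also have "\<dots> = const A 1" using y ring_laws(7)[OF y(1) app_closed'[OF S(1) t] y(1)] by simp
 finally have "app A (Suc N) ?F ?b = op2 A (-) (const A 1) (const A 1)"
  using arith_app'(3)[OF Fs(1) _ b, of "%z. 1"] const_app'[OF b, of 1, symmetric] by (simp add: fun_upd_def)
 then have F0: "app A (Suc N) ?F ?b = const A 0" by simp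
 have "app A (Suc N) ?P ?b = app A (Suc N) (%z. ?F z * H z) ?b" by (rule app_eqI) (use H(2) in blast)
 also have "\<dots> = const A 0" unfolding arith_app'(2)[OF Fs(2) H(1) b, symmetric] F0 by (rule laws(5)[OF app_closed'[OF H(1) b]])
 finally have d: "op2 A (-) (app A N e t) (op2 A (*) (app A (Suc N) W ?b) (app A (Suc N) G ?b)) = const A 0"
  using arith_app'(3)[OF Se _ b, of "%z. W z * G z"] arith_app'(2)[OF S(2,3) b] app_extend'[OF S(4) t y(1)] S(2,3) by (simp add: fun_upd_def)
 have c: "op2 A (*) (app A (Suc N) W ?b) (app A (Suc N) G ?b) \<in> carrier A"
  by (rule arith_closed(2)[OF app_closed'[OF S(2) b] app_closed'[OF S(3) b]])
 from ring_laws(4)[OF c app_closed'[OF S(4) t] c] show ?thesis unfolding d laws(2)[OF c] by (rule sym)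
qed

text \<open>The new realization restricts the manifold and the constraints to the part where a
  preimage \<open>a\<close> of \<open>b\<close> is nonzero. Its ring \<open>?C\<close> and the
  abstract ring \<open>B\<close> have corresponding generators: restrictions or images of the old
  ones, and an inverse. So the comparison reduces to deciding which smooth functions of these
  generators vanish on either side.\<close>

lemma manifold_with_corners_open:
 fixes X :: "'a cinf" and B :: "'b cinf"
 assumes X: "manifold_with_corners n X" and b: "b \<in> carrier X" and L: "is_localization X b B \<phi>" and nz: "\<not> zero_ring B"
 shows "manifold_with_corners n B"
proof -
 have Xs: "cinf_scheme X" using X unfolding manifold_with_corners_def by blast
 note X' = schemeD[OF Xs]
 obtain S \<A> fs q where R: "realization n X S \<A> fs q" using X unfolding manifold_with_corners_def by blast
 let ?A = "CinfM n S \<A>"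
 have m: "is_manifold n S \<A>" and sch: "cinf_scheme ?A" and fs: "set fs \<subseteq> carrier ?A" and reg: "zero_regular ?A fs"
  using R unfolding realization_def by blast+
 have int: "is_intersection ?A {..<length fs} (%j. quot ?A (le_ideal ?A (fs ! j) 0)) (%j. quot_map ?A (le_ideal ?A (fs ! j) 0)) X q"
  using R unfolding realization_def by (elim conjE)
 interpret mfd n S \<A> by unfold_locales (rule m)
 note q = intersectionD(2)[OF int] and surj = realization_surj[OF R] and kq = realization_ker[OF R X']
 note Bs = localizationD(1)[OF L] and phi = localizationD(2)[OF L]
 note B' = schemeD[OF Bs]
 interpret B: cinf B by unfold_locales (rule B')
 obtain y where y: "y \<in> carrier B" "op2 B (*) (\<phi> b) y = const B 1" using localizationD(3)[OF L] B.Units_iff by blast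
 have "b \<in> q ` carrier ?A" using b surj by simp
 then obtain a where a: "a \<in> carrier ?A" "q a = b" by blast
 have ne: "\<exists>s\<in>topspace S. a s \<noteq> 0"
 proof (rule ccontr)
  assume "\<not> ?thesis"
  then have "a = const ?A 0" by (intro A_eqI a(1) A.const_closed) (simp add: ops_A)
  then have "\<phi> b = const B 0" using a(2) chom_const[OF q X', of 0] chom_const[OF phi B', of 0] by simp
  then show False using y B.zero_ring_iff nz by simp
 qed
 interpret O: mfd_open n S \<A> a by unfold_locales (use a(1) ne in auto)
 let ?Q = "O.Q" and ?C = "CinfM n O.S' O.\<A>'"
 obtain N x where gen: "generates ?A N x" using sch scheme_iff by blast
 note x = generatesD(1)[OF gen]
 obtain \<alpha> where \<alpha>: "Sm N \<alpha>" "a = app ?A N \<alpha> x" using generatesD(2)[OF gen a(1)] by blast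
 let ?tb = "%i. \<phi> (q (x i))" and ?tc = "%i. restrict (x i) ?Q"
 let ?xb = "?tb(N := y)" and ?xc = "?tc(N := \<lambda>s\<in>?Q. 1 / a s)"
 have qx: "\<forall>i<N. q (x i) \<in> carrier X" using chomD(1)[OF q] x by blast
 have "generates X N (%i. q (x i))"
  unfolding generates_def
 proof (intro conjI qx ballI)
  fix z assume "z \<in> carrier X"
  then have "z \<in> q ` carrier ?A" using surj by simp
  then obtain f where f: "f \<in> carrier ?A" "z = q f" by blast
  obtain g where g: "Sm N g" "f = app ?A N g x" using generatesD(2)[OF gen f(1)] by blast
  show "\<exists>g. Sm N g \<and> z = app X N g (%i. q (x i))" using chom_app'[OF q g(1) x] f(2) g by (intro exI[of _ g]) simp
 qed
 from localization_generated[OF L X' b this y] have genB: "generates B (Suc N) ?xb" .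
 note genC = O.generated[OF gen]
 note xb = generatesD(1)[OF genB] and xc = generatesD(1)[OF genC]
 have tb: "\<forall>i<N. ?tb i \<in> carrier B" using chomD(1)[OF phi] qx by blast
 have tc: "\<forall>i<N. ?tc i \<in> carrier ?C" using O.res x by blast
 have hb: "app B N g ?tb = \<phi> (q (app ?A N g x))" if g: "Sm N g" for g
  using chom_app'[OF q g x] chom_app'[OF phi g qx] by simp
 have hc: "app ?C N g ?tc = restrict (app ?A N g x) ?Q" for g
  unfolding O.M'.app_A app_A O.Q(3) using O.Q(2) by (auto simp: fun_eq_iff)
 have yb: "op2 B (*) (app B N \<alpha> ?tb) y = const B 1" using hb[OF \<alpha>(1)] \<alpha>(2) a(2) y(2) by simp
 have yc: "op2 ?C (*) (app ?C N \<alpha> ?tc) (\<lambda>s\<in>?Q. 1 / a s) = const ?C 1" using hc[of \<alpha>] \<alpha>(2) O.inverse_a(2) by simp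
 let ?Z = "negs fs \<inter> ?Q"
 \<comment> \<open>Clearing denominators: after multiplication with \<open>W\<close>, whose values
   are units, the value of \<open>G\<close> comes from a function \<open>e\<close> of the old
   generators, in \<open>B\<close> and in \<open>?C\<close> alike.\<close>
 have clear: "\<exists>W e. Sm (Suc N) W \<and> (\<forall>z\<in>Rn (Suc N). W z > 0) \<and> Sm N e \<and> (\<forall>v\<in>Rn N. \<alpha> v = 0 --> e v = 0) \<and>
   app B N e ?tb = op2 B (*) (app B (Suc N) W ?xb) (app B (Suc N) G ?xb) \<and>
   app ?C N e ?tc = op2 ?C (*) (app ?C (Suc N) W ?xc) (app ?C (Suc N) G ?xc)" if G: "Sm (Suc N) G" for G
 proof (rule rapid_extension[OF \<alpha>(1) G])
  fix W e assume W: "Sm (Suc N) W" "\<And>z. z \<in> Rn (Suc N) ==> W z > 0" and e: "Sm N e"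
   "\<And>v. v \<in> Rn N ==> \<alpha> v \<noteq> 0 ==> e v = W (v(N := 1 / \<alpha> v)) * G (v(N := 1 / \<alpha> v))"
   "\<And>v. v \<in> Rn N ==> \<alpha> v = 0 ==> e v = 0"
  show ?thesis
   by (intro exI[of _ W] exI[of _ e] conjI W(1) e(1) ballI impI
     B.rapid_identity[OF \<alpha>(1) W(1) G e(1,2) tb y(1) yb] O.M'.A.rapid_identity[OF \<alpha>(1) W(1) G e(1,2) tc O.inverse_a(1) yc])
    (rule W(2) e(3); assumption)+
 qed
 \<comment> \<open>The numerator vanishes on all of \<open>negs fs\<close>: inside \<open>?Q\<close>
   by hypothesis, outside because \<open>e\<close> vanishes where \<open>\<alpha>\<close>
   does.\<close>
 have zero_on: "app ?A N e x \<in> ker ?A X q"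
  if e: "Sm N e" "\<forall>v\<in>Rn N. \<alpha> v = 0 --> e v = 0" and id: "app ?C N e ?tc = op2 ?C (*) (app ?C (Suc N) W ?xc) (app ?C (Suc N) G ?xc)"
   and z: "\<forall>s\<in>?Z. app ?C (Suc N) G ?xc s = 0" for W e G
 proof -
  have "app ?A N e x s = 0" if s: "s \<in> negs fs" for s
  proof (cases "s \<in> ?Q")
   case True
   then have "app ?A N e x s = app ?C N e ?tc s" using hc[of e] by simp
   also have "\<dots> = 0" unfolding id using z s True by (simp add: O.M'.ops_A O.Q(3))
   finally show ?thesis .
  next
   case False
   have sS: "s \<in> topspace S" using s by (simp add: negs_def)
   have "a s = \<alpha> (tuple N (%i. x i s))" by (subst \<alpha>(2)) (simp add: app_A sS)
   then have "\<alpha> (tuple N (%i. x i s)) = 0" using False sS by (simp add: O.Q_def)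
   then show ?thesis using e(2) sS by (simp add: app_A)
  qed
  then show ?thesis unfolding kq using A.app_closed'[OF e(1) x] by simp
 qed
 \<comment> \<open>Vanishing on \<open>?Z\<close> passes to the numerator, then to \<open>B\<close>,
   and the unit \<open>W\<close> is cancelled. Conversely each point of \<open>?Z\<close> extends to
   a homomorphism from \<open>B\<close> to the reals.\<close>
 have van: "app B (Suc N) G ?xb = const B 0 \<longleftrightarrow> (\<forall>s\<in>?Z. app ?C (Suc N) G ?xc s = 0)" if G: "Sm (Suc N) G" for G
 proof (intro iffI ballI)
  assume z: "\<forall>s\<in>?Z. app ?C (Suc N) G ?xc s = 0"
  from clear[OF G] obtain W e where W: "Sm (Suc N) W" "\<forall>z\<in>Rn (Suc N). W z > 0" and e: "Sm N e" "\<forall>v\<in>Rn N. \<alpha> v = 0 --> e v = 0"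
   and i: "app B N e ?tb = op2 B (*) (app B (Suc N) W ?xb) (app B (Suc N) G ?xb)"
    "app ?C N e ?tc = op2 ?C (*) (app ?C (Suc N) W ?xc) (app ?C (Suc N) G ?xc)" by (elim exE conjE)
  have "q (app ?A N e x) = const X 0" using zero_on[OF e i(2) z] by (simp add: ker_def)
  then have "op2 B (*) (app B (Suc N) W ?xb) (app B (Suc N) G ?xb) = const B 0"
   using hb[OF e(1)] i(1) chom_const[OF phi B', of 0] by simp
  then have "op2 B (*) (app B (Suc N) G ?xb) (app B (Suc N) W ?xb) = const B 0"
   by (rule trans[OF sym[OF B.ring_laws(7)[OF B.app_closed'[OF W(1) xb] B.app_closed'[OF G xb] B.app_closed'[OF G xb]]]])
  moreover have "W z \<noteq> 0" if "z \<in> Rn (Suc N)" for z using bspec[OF W(2) that] by simp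
  then have "app B (Suc N) W ?xb \<in> Units (as_ring B)" by (rule B.Units_nonvanishing[OF W(1) _ xb[rule_format]])
  ultimately show "app B (Suc N) G ?xb = const B 0" using B.unit_cancel[OF B.app_closed'[OF G xb]] by blast
 next
  fix s assume G0: "app B (Suc N) G ?xb = const B 0" and s: "s \<in> ?Z"
  then have sS: "s \<in> topspace S" and as: "a s \<noteq> 0" by (auto simp: O.Q_def)
  let ?p = "\<lambda>f\<in>carrier ?A. f s"
  have "ker ?A X q \<subseteq> ker ?A real_cinf ?p" unfolding kq using s by (auto simp: ker_def)
  from chom_factor[OF ring X' real_cinf_ring q surj eval_point[OF sS] this]
  obtain u where u: "u \<in> chom X real_cinf" "\<forall>f\<in>carrier ?A. u (q f) = ?p f" by blast
  have ub: "u b = a s" using bspec[OF u(2) a(1)] a by simp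
  then have "u b \<in> Units (as_ring real_cinf)" using as by (simp add: real_cinf_Units)
  from localization_ext[OF L X' b real_cinf_scheme u(1) this]
  obtain w where w: "w \<in> chom B real_cinf" "\<forall>z\<in>carrier X. w (\<phi> z) = u z" by blast
  have "w (\<phi> b) * w y = 1"
   using chom_arith(2)[OF w(1) chomD(1)[OF phi b] y(1)] y(2) chom_const[OF w(1) real_cinf_ring, of 1] by simp
  then have wy: "w y = 1 / a s" using bspec[OF w(2) b] ub as by (simp add: field_simps)
  have wx: "w (?tb i) = x i s" if "i < N" for i
  proof -
   have c: "x i \<in> carrier ?A" "q (x i) \<in> carrier X" using x qx that by blast+
   show ?thesis using bspec[OF w(2) c(2)] bspec[OF u(2) c(1)] c(1) by simp
  qed
  have "tuple (Suc N) (%i. w (?xb i)) = tuple (Suc N) (%i. ?xc i s)"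
   using wx wy s by (auto simp: tuple_def less_Suc_eq)
  then have "app ?C (Suc N) G ?xc s = w (app B (Suc N) G ?xb)"
   using chom_app'[OF w(1) G xb] s by (simp add: O.M'.app_A O.Q(3) fun_upd_def)
  then show "app ?C (Suc N) G ?xc s = 0" unfolding G0 using chom_const[OF w(1) real_cinf_ring, of 0] by simp
 qed
 let ?ec = "ev ?C (Suc N) ?xc" and ?eb = "ev B (Suc N) ?xb"
 have ec: "?ec \<in> chom (CinfR (Suc N)) ?C" using xc by (intro O.M'.A.ev_chom) blast
 have eb: "?eb \<in> chom (CinfR (Suc N)) B" using xb by (intro B.ev_chom) blast
 have "ker (CinfR (Suc N)) ?C ?ec \<subseteq> ker (CinfR (Suc N)) B ?eb"
 proof
  fix g assume "g \<in> ker (CinfR (Suc N)) ?C ?ec"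
  then have g: "g \<in> carrier (CinfR (Suc N))" "?ec g = const ?C 0" unfolding ker_def by blast+
  then have g: "g \<in> carrier (CinfR (Suc N))" "app ?C (Suc N) g ?xc = const ?C 0" by (simp_all add: ev_def)
  have "app B (Suc N) g ?xb = const B 0"
   unfolding van[OF CinfR_smooth[OF g(1)]] g(2) by (simp add: O.M'.ops_A O.Q(3))
  then show "g \<in> ker (CinfR (Suc N)) B ?eb" using g(1) by (simp add: ker_def ev_def)
 qed
 from chom_factor[OF CinfR_ring O.M'.ring B' ec O.M'.A.generates_surj[OF genC] eb this]
 obtain q' where q': "q' \<in> chom ?C B" "\<forall>g\<in>carrier (CinfR (Suc N)). q' (?ec g) = ?eb g" by blast
 have qapp: "q' (app ?C (Suc N) G ?xc) = app B (Suc N) G ?xb" if "Sm (Suc N) G" for G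
  using bspec[OF q'(2) restrict_CinfR[OF that]] that by simp
 have surj': "q' ` carrier ?C = carrier B"
 proof (intro equalityI subsetI)
  fix z assume "z \<in> carrier B"
  then obtain G where G: "Sm (Suc N) G" "z = app B (Suc N) G ?xb" using generatesD(2)[OF genB] by blast
  show "z \<in> q' ` carrier ?C" by (rule image_eqI[of _ _ "app ?C (Suc N) G ?xc"]) (simp_all only: G(2) qapp[OF G(1)] O.M'.A.app_closed'[OF G(1) xc])
 qed (use chomD(1)[OF q'(1)] in blast)
 have kq': "ker ?C B q' = {c\<in>carrier ?C. \<forall>s\<in>?Z. c s = 0}"
 proof -
  have "q' c = const B 0 \<longleftrightarrow> (\<forall>s\<in>?Z. c s = 0)" if c: "c \<in> carrier ?C" for c
  proof -
   obtain G where G: "Sm (Suc N) G" "c = app ?C (Suc N) G ?xc" using generatesD(2)[OF genC c] by blast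
   show ?thesis unfolding G(2) qapp[OF G(1)] by (rule van[OF G(1)])
  qed
  then show ?thesis unfolding ker_def by blast
 qed
 define fs' where "fs' = map (%f. restrict f ?Q) fs"
 have len: "length fs' = length fs" by (simp add: fs'_def)
 have fc: "fs ! j \<in> carrier ?A" if "j < length fs" for j using fs that nth_mem by blast
 have fj: "fs' ! j = restrict (fs ! j) ?Q" if "j < length fs" for j using that by (simp add: fs'_def)
 have fc': "fs' ! j \<in> carrier ?C" if "j < length fs" for j using O.res[OF fc[OF that]] fj[OF that] by simp
 have fs'c: "set fs' \<subseteq> carrier ?C" unfolding fs'_def using O.res fs by auto
 have negs': "O.M'.negs fs' = ?Z"
  unfolding O.M'.negs_def negs_def len O.Q(3) using O.Q(2) fj by auto
 have Cs: "cinf_scheme ?C" using scheme_iff O.M'.ring genC by blast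
 let ?I = "%j. le_ideal ?C (fs' ! j) 0"
 let ?LA = "\<Union>j\<in>{..<length fs}. ker ?A (quot ?A (le_ideal ?A (fs ! j) 0)) (quot_map ?A (le_ideal ?A (fs ! j) 0))" and ?LC = "\<Union>j\<in>{..<length fs'}. ker ?C (quot ?C (?I j)) (quot_map ?C (?I j))"
 have kI: "ker ?C (quot ?C (?I j)) (quot_map ?C (?I j)) = ?I j" if "j < length fs" for j
  by (rule quot_basics(4)[OF O.M'.ring loci_ideals(1)[OF Cs fc'[OF that]]])
 define K where "K = Idl\<^bsub>as_ring ?C\<^esub> ?LC"
 have sub: "?LC \<subseteq> carrier ?C" by (auto simp: ker_def)
 have IK: "?I j \<subseteq> K" if "j < length fs" for j
 proof -
  have "?I j \<subseteq> ?LC"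
   using UN_upper[of j "{..<length fs'}" "%j. ker ?C (quot ?C (?I j)) (quot_map ?C (?I j))"] that len unfolding kI[OF that] by simp
  then show ?thesis unfolding K_def by (rule subset_trans[OF _ O.M'.A.Idl(2)[OF sub]])
 qed
 \<comment> \<open>The hard inclusion turns vanishing on \<open>?Z\<close> into membership in the
   ideal generated by the half loci. For \<open>X\<close> this is known from its realization and
   applies to the numerator; the weight is then cancelled modulo \<open>K\<close>.\<close>
 have kK: "ker ?C B q' = K"
 proof (intro equalityI subsetI)
  have "ker ?C (quot ?C (?I j)) (quot_map ?C (?I j)) \<subseteq> ker ?C B q'" if "j \<in> {..<length fs'}" for j
  proof
   have j: "j < length fs" using that len by simp
   fix c assume "c \<in> ker ?C (quot ?C (?I j)) (quot_map ?C (?I j))"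
   then have c: "c \<in> ?I j" "c \<in> carrier ?C" using kI[OF j] by (auto simp: ker_def)
   have "c s = 0" if s: "s \<in> ?Z" for s
   proof -
    have sQ: "s \<in> topspace O.S'" using s O.Q(3) by simp
    have "(\<lambda>f\<in>carrier ?C. f s) (fs' ! j) \<le> 0" using fc'[OF j] fj[OF j] s j by (simp add: negs_def less_imp_le)
    from loci_points(1)[OF Cs fc'[OF j] O.M'.eval_point[OF sQ] this c(1)] show ?thesis using c(2) by simp
   qed
   then show "c \<in> ker ?C B q'" unfolding kq' using c(2) by blast
  qed
  then have "?LC \<subseteq> ker ?C B q'" by blast
  from O.M'.A.Idl(3)[OF sub ker_ideal[OF q'(1) O.M'.ring B'] this]
  show "c \<in> ker ?C B q'" if "c \<in> K" for c using that unfolding K_def by blast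
 next
  fix c assume "c \<in> ker ?C B q'"
  then have c: "c \<in> carrier ?C" "\<forall>s\<in>?Z. c s = 0" unfolding kq' by blast+
  obtain G where G: "Sm (Suc N) G" "c = app ?C (Suc N) G ?xc" using generatesD(2)[OF genC c(1)] by blast
  from clear[OF G(1)] obtain W e where W: "Sm (Suc N) W" "\<forall>z\<in>Rn (Suc N). W z > 0" and e: "Sm N e" "\<forall>v\<in>Rn N. \<alpha> v = 0 --> e v = 0"
   and i: "app ?C N e ?tc = op2 ?C (*) (app ?C (Suc N) W ?xc) (app ?C (Suc N) G ?xc)" by (elim exE conjE)
  have J: "ideal (le_ideal ?A (fs ! j) 0) (as_ring ?A)" if "j \<in> {..<length fs}" for j
   using loci_ideals(1)[OF sch fc] that by blast
  have "app ?A N e x \<in> ker ?A X q" by (rule zero_on[OF e i]) (use c(2) G(2) in blast)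
  moreover have "ker ?A X q \<subseteq> Idl\<^bsub>as_ring ?A\<^esub> ?LA"
   by (rule intersection_ker[OF int sch quot_basics(1)[OF ring J] quot_basics(2)[OF ring J] quot_basics(3)[OF ring J]])
  \<comment> \<open>In the quotient of \<open>?C\<close> by \<open>K\<close> the restricted
    numerator is zero, since restriction maps the ideals of the half loci into those on
    \<open>?Q\<close>.\<close>
  moreover obtain T :: "std cinf" and p where T: "cinf_scheme T" and p: "p \<in> chom ?C T" and kp: "ker ?C T p = K"
   using quotient_std[OF Cs O.M'.A.Idl(1)[OF sub]] unfolding K_def .
  note T' = schemeD[OF T]
  interpret T: cinf T by unfold_locales (rule T')
  let ?r = "\<lambda>f\<in>carrier ?A. restrict f ?Q"
  let ?pr = "\<lambda>f\<in>carrier ?A. p (?r f)"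
  have pr: "?pr \<in> chom ?A T" by (rule chom_compose[OF O.res_chom p ring T'])
  have "Idl\<^bsub>as_ring ?A\<^esub> ?LA \<subseteq> ker ?A T ?pr"
  proof (rule A.Idl(3)[OF _ ker_ideal[OF pr ring T']])
   show "?LA \<subseteq> carrier ?A"
    by (auto simp: ker_def)
   show "?LA \<subseteq> ker ?A T ?pr"
   proof (rule UN_least)
    fix j assume j: "j \<in> {..<length fs}"
    then have jl: "j < length fs" by simp
    show "ker ?A (quot ?A (le_ideal ?A (fs ! j) 0)) (quot_map ?A (le_ideal ?A (fs ! j) 0)) \<subseteq> ker ?A T ?pr"
     unfolding quot_basics(4)[OF ring J[OF j]]
    proof
     fix f assume f: "f \<in> le_ideal ?A (fs ! j) 0"
     then have fA: "f \<in> carrier ?A" using A.idealD(1)[OF J[OF j]] by blast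
     have "?r f \<in> le_ideal ?C (?r (fs ! j)) 0" by (rule le_ideal_functorial[OF sch Cs O.res_chom fc[OF jl] f])
     then have "?r f \<in> ker ?C T p" using IK[OF jl] fc[OF jl] fj[OF jl] unfolding kp by auto
     then show "f \<in> ker ?A T ?pr" using fA by (simp add: ker_def)
    qed
   qed
  qed
  ultimately have "app ?A N e x \<in> ker ?A T ?pr" by blast
  then have "p (app ?C N e ?tc) = const T 0" using A.app_closed'[OF e(1) x] hc[of e] by (simp add: ker_def)
  then have z: "p (op2 ?C (*) (app ?C (Suc N) W ?xc) c) = const T 0" unfolding i G(2)[symmetric] .
  have "op2 T (*) (p (app ?C (Suc N) W ?xc)) (p c) = const T 0"
   using chom_arith(2)[OF p O.M'.A.app_closed'[OF W(1) xc] c(1)] z by (rule trans[OF sym])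
  then have "op2 T (*) (p c) (p (app ?C (Suc N) W ?xc)) = const T 0"
   by (rule trans[OF sym[OF T.ring_laws(7)[OF chomD(1)[OF p O.M'.A.app_closed'[OF W(1) xc]] chomD(1)[OF p c(1)] chomD(1)[OF p c(1)]]]])
  moreover have "W z \<noteq> 0" if "z \<in> Rn (Suc N)" for z using bspec[OF W(2) that] by simp
  then have "app ?C (Suc N) W ?xc \<in> Units (as_ring ?C)" by (rule O.M'.A.Units_nonvanishing[OF W(1) _ xc[rule_format]])
  ultimately have "p c = const T 0"
   using T.unit_cancel[OF chomD(1)[OF p c(1)] chom_Units[OF p O.M'.ring T']] by blast
  then show "c \<in> K" unfolding kp[symmetric] using c(1) by (simp add: ker_def)
 qed
 have int': "is_intersection ?C {..<length fs'} (%j. quot ?C (?I j)) (%j. quot_map ?C (?I j)) B q'"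
 proof (rule intersection_of_quotients[OF O.M'.ring Bs q'(1) surj'])
  fix j assume "j \<in> {..<length fs'}"
  then have "ideal (?I j) (as_ring ?C)" using loci_ideals(1)[OF Cs fc'] len by simp
  from quot_basics[OF O.M'.ring this]
  show "cinf_ring (quot ?C (?I j))" "quot_map ?C (?I j) \<in> chom ?C (quot ?C (?I j))"
   "quot_map ?C (?I j) ` carrier ?C = carrier (quot ?C (?I j))" by blast+
 qed (rule kK[unfolded K_def])
 \<comment> \<open>For the closure clause the strict loci are taken as localizations at cutoffs; the
   kernel of their intersection and that of \<open>q'\<close> both consist of the functions
   vanishing on \<open>?Z\<close>.\<close>
 define c where "c j = op1 ?C (%t. cutoff (- 0) (- t)) (fs' ! j)" for j
 have cc: "c j \<in> carrier ?C" if "j < length fs'" for j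
  unfolding c_def by (rule O.M'.A.op1_closed[OF cutoff(3) fc']) (use that len in simp)
 have "\<forall>j\<in>{..<length fs'}. \<exists>P. is_localization ?C (c j) (fst P :: std cinf) (snd P)"
 proof
  fix j assume "j \<in> {..<length fs'}"
  then have "c j \<in> carrier ?C" using cc by simp
  from localization_exists[OF Cs this] obtain G :: "std cinf" and \<gamma> where "is_localization ?C (c j) G \<gamma>" .
  then show "\<exists>P. is_localization ?C (c j) (fst P :: std cinf) (snd P)" by (intro exI[of _ "(G, \<gamma>)"]) simp
 qed
 from bchoice[OF this] obtain P where P: "\<forall>j\<in>{..<length fs'}. is_localization ?C (c j) (fst (P j) :: std cinf) (snd (P j))" by (rule exE)
 have P': "is_localization ?C (c j) (fst (P j)) (snd (P j))" if "j < length fs'" for j using P that by simp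
 obtain U :: "std cinf" and \<omega> where U: "is_localization ?C (cprod ?C c (length fs')) U \<omega>"
  using localization_exists[OF Cs O.M'.A.cprod_closed[OF cc]] .
 have I: "is_intersection ?C {..<length fs'} (%j. fst (P j)) (%j. snd (P j)) U \<omega>"
  by (rule intersection_of_localizations[OF Cs cc P' U])
 have lt: "is_lt_locus ?C (fs' ! j) 0 (fst (P j)) (snd (P j))" if "j < length fs'" for j
  using P'[OF that] unfolding is_lt_locus_def c_def .
 have "ker ?C U \<omega> = {g\<in>carrier ?C. \<forall>s\<in>O.M'.negs fs'. g s = 0}"
  by (rule O.M'.ker_lt_locus[OF fs'c _ I]) (rule lt)
 then have kU: "closure_ideal ?C U \<omega> = ker ?C B q'" unfolding closure_ideal_ker kq' negs' .
 have "ideal (closure_ideal ?C U \<omega>) (as_ring ?C)" unfolding kU by (rule ker_ideal[OF q'(1) O.M'.ring B'])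
 note cl = quot_basics[OF O.M'.ring this]
 have eq: "subscheme_eq ?C B q' (quot ?C (closure_ideal ?C U \<omega>)) (quot_map ?C (closure_ideal ?C U \<omega>))"
  unfolding subscheme_eq_def
  by (rule ciso_of_equal_ker[OF O.M'.ring cl(1) B' cl(2,3) q'(1) surj' trans[OF cl(4) kU]])
 have reg': "zero_regular ?C fs'"
 proof (rule O.M'.indep_regular[OF Cs fs'c])
  fix s assume "s \<in> topspace O.S'"
  then have s: "s \<in> ?Q" "s \<in> topspace S" using O.Q by auto
  obtain V \<psi> where V: "(V, \<psi>) \<in> \<A>" "s \<in> V" using covers[OF s(2)] by blast
  have "O.M'.indep (V \<inter> ?Q) \<psi> fs' s"
   unfolding fs'_def by (rule O.indep_restrict[OF V(1) _ fs regular_indep[OF sch reg fs V]]) (use V(2) s(1) in blast)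
  moreover have "(V \<inter> ?Q, \<psi>) \<in> O.\<A>'" using V(1) by (force simp: O.\<A>'_def)
  ultimately show "\<exists>V \<psi>. (V, \<psi>) \<in> O.\<A>' \<and> s \<in> V \<and> O.M'.indep V \<psi> fs' s" using V(2) s(1) by blast
 qed
 have "realization n B O.S' O.\<A>' fs' q'"
  unfolding realization_def
  by (intro conjI O.mfd' Cs fs'c reg' int' exI[of _ "%j. fst (P j)"] exI[of _ "%j. snd (P j)"] exI[of _ U] exI[of _ \<omega>] allI impI lt I eq)
 then show ?thesis unfolding manifold_with_corners_def using Bs nz by (intro conjI exI)
qed

section \<open>Limits of regular systems\<close>

text \<open>As for intersections, an isomorphic copy extends the universal property from test
  objects of standard type to every \<open>T\<close>, which allows \<open>T\<close> to be
  \<open>L\<close> itself.\<close>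

lemma limit_univ:
 assumes l: "is_limit D r B \<rho> L \<iota>" and B: "\<And>i. i \<in> D ==> cinf_ring (B i)" and T: "cinf_scheme T"
  and k: "\<forall>i\<in>D. \<kappa> i \<in> chom (B i) T" "\<forall>(i, j)\<in>r. \<forall>x\<in>carrier (B i). \<kappa> j (\<rho> i j x) = \<kappa> i x"
  and r: "r \<subseteq> D \<times> D" "\<And>i j x. (i, j) \<in> r ==> x \<in> carrier (B i) ==> \<rho> i j x \<in> carrier (B j)"
 shows "\<exists>u\<in>chom L T. \<forall>i\<in>D. \<forall>x\<in>carrier (B i). u (\<iota> i x) = \<kappa> i x"
  "u \<in> chom L T ==> v \<in> chom L T ==> (\<And>i x. i \<in> D ==> x \<in> carrier (B i) ==> u (\<iota> i x) = \<kappa> i x \<and> v (\<iota> i x) = \<kappa> i x) ==> u = v"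
proof -
 have L: "cinf_scheme L" and io: "\<forall>i\<in>D. \<iota> i \<in> chom (B i) L"
  and U: "\<forall>T :: std cinf. cinf_scheme T -->
    (\<forall>\<kappa>. (\<forall>i\<in>D. \<kappa> i \<in> chom (B i) T) \<and>
       (\<forall>(i, j)\<in>r. \<forall>x\<in>carrier (B i). \<kappa> j (\<rho> i j x) = \<kappa> i x) -->
       (\<exists>!u. u \<in> chom L T \<and> (\<forall>i\<in>D. \<forall>x\<in>carrier (B i). u (\<iota> i x) = \<kappa> i x)))"
  by (rule conjunct1[OF l[unfolded is_limit_def]], rule conjunct1[OF conjunct2[OF l[unfolded is_limit_def]]],
   rule conjunct2[OF conjunct2[OF conjunct2[OF l[unfolded is_limit_def]]]])
 note L' = schemeD[OF L] and T' = schemeD[OF T]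
 obtain S :: "std cinf" and h where S: "cinf_scheme S" and h: "h \<in> ciso T S" using scheme_std[OF T] .
 note S' = schemeD[OF S]
 obtain g where g: "g \<in> ciso S T" "\<forall>x\<in>carrier T. g (h x) = x" using ciso_inverse[OF T' S' h] by blast
 have hc: "h \<in> chom T S" and gc: "g \<in> chom S T" using h g(1) by (auto simp: ciso_def)
 define \<kappa>' where "\<kappa>' i = (\<lambda>y\<in>carrier (B i). h (\<kappa> i y))" for i
 have c: "\<forall>i\<in>D. \<kappa>' i \<in> chom (B i) S" unfolding \<kappa>'_def using k(1) by (intro ballI chom_compose[OF _ hc B S']) blast+
 have d: "\<forall>(i, j)\<in>r. \<forall>x\<in>carrier (B i). \<kappa>' j (\<rho> i j x) = \<kappa>' i x"
 proof clarify
  fix i j x assume ij: "(i, j) \<in> r" and x: "x \<in> carrier (B i)"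
  have "\<kappa> j (\<rho> i j x) = \<kappa> i x" using bspec[OF k(2) ij] x by simp
  then show "\<kappa>' j (\<rho> i j x) = \<kappa>' i x" using r(2)[OF ij x] x by (simp add: \<kappa>'_def)
 qed
 from U[THEN spec, THEN mp, OF S, THEN spec, THEN mp, OF conjI[OF c d]]
 have ex: "\<exists>!u. u \<in> chom L S \<and> (\<forall>i\<in>D. \<forall>x\<in>carrier (B i). u (\<iota> i x) = \<kappa>' i x)" .
 then obtain u where u: "u \<in> chom L S" "\<forall>i\<in>D. \<forall>x\<in>carrier (B i). u (\<iota> i x) = \<kappa>' i x" by (elim ex1E conjE)
 show "\<exists>u\<in>chom L T. \<forall>i\<in>D. \<forall>x\<in>carrier (B i). u (\<iota> i x) = \<kappa> i x"
 proof (intro bexI[of _ "\<lambda>y\<in>carrier L. g (u y)"] ballI)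
  show "(\<lambda>y\<in>carrier L. g (u y)) \<in> chom L T" by (rule chom_compose[OF u(1) gc L' T'])
  fix i x assume i: "i \<in> D" and x: "x \<in> carrier (B i)"
  have "\<iota> i x \<in> carrier L" "\<kappa> i x \<in> carrier T" using chomD(1)[OF bspec[OF io i] x] chomD(1)[OF bspec[OF k(1) i] x] by blast+
  then show "(\<lambda>y\<in>carrier L. g (u y)) (\<iota> i x) = \<kappa> i x" using bspec[OF bspec[OF u(2) i] x] g(2) x by (simp add: \<kappa>'_def)
 qed
 show "u = v" if u: "u \<in> chom L T" and v: "v \<in> chom L T"
  and e: "\<And>i x. i \<in> D ==> x \<in> carrier (B i) ==> u (\<iota> i x) = \<kappa> i x \<and> v (\<iota> i x) = \<kappa> i x" for u v
 proof -
  let ?h = "%w. \<lambda>y\<in>carrier L. h (w y)"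
  have P: "?h w \<in> chom L S \<and> (\<forall>i\<in>D. \<forall>x\<in>carrier (B i). ?h w (\<iota> i x) = \<kappa>' i x)"
   if w: "w \<in> chom L T" "\<forall>i\<in>D. \<forall>x\<in>carrier (B i). w (\<iota> i x) = \<kappa> i x" for w
  proof (intro conjI ballI)
   show "?h w \<in> chom L S" by (rule chom_compose[OF w(1) hc L' S'])
   fix i x assume i: "i \<in> D" and x: "x \<in> carrier (B i)"
   show "?h w (\<iota> i x) = \<kappa>' i x" using bspec[OF bspec[OF w(2) i] x] chomD(1)[OF bspec[OF io i] x] x by (simp add: \<kappa>'_def)
  qed
  have E: "\<forall>i\<in>D. \<forall>x\<in>carrier (B i). u (\<iota> i x) = \<kappa> i x" "\<forall>i\<in>D. \<forall>x\<in>carrier (B i). v (\<iota> i x) = \<kappa> i x"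
   using e by simp_all
  have "?h u = ?h v"
   by (rule trans[OF sym[OF the1_equality[OF ex, OF P[OF u E(1)]]] the1_equality[OF ex, OF P[OF v E(2)]]])
  then have "h (u y) = h (v y)" if "y \<in> carrier L" for y using that by (metis restrict_apply')
  then have "u y = v y" if "y \<in> carrier L" for y
   using inj_onD[of h "carrier T" "u y" "v y"] h chomD(1)[OF u that] chomD(1)[OF v that] that
   by (simp add: ciso_def bij_betw_def)
  then show ?thesis by (rule chom_eqI[OF u v])
 qed
qed

locale presented =
 fixes n M D r and B :: "'i => std cinf" and \<phi> \<rho> and L :: "'c cinf" and \<iota> \<kappa>
 assumes M: "manifold_with_corners n (M :: std cinf)" and kappa: "\<kappa> \<in> chom M L" and rs: "regular_system M D r B \<phi> \<rho>"
  and lim: "is_limit D r B \<rho> L \<iota>" and comm: "\<And>i x. i \<in> D ==> x \<in> carrier M ==> \<iota> i (\<phi> i x) = \<kappa> x"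
begin

lemma M_ring: "cinf_scheme M" "cinf_ring M"
 using M schemeD unfolding manifold_with_corners_def by blast+

lemma poset: "D \<noteq> {}" "r \<subseteq> D \<times> D" "\<And>i. i \<in> D ==> (i, i) \<in> r" "\<And>i j k. (i, j) \<in> r ==> (j, k) \<in> r ==> (i, k) \<in> r"
 "\<And>i j. i \<in> D ==> j \<in> D ==> \<exists>k\<in>D. (i, k) \<in> r \<and> (j, k) \<in> r"
proof -
 have "D \<noteq> {} \<and> partial_order_on D r \<and> (\<forall>i\<in>D. \<forall>j\<in>D. \<exists>k\<in>D. (i, k) \<in> r \<and> (j, k) \<in> r)"
  using rs unfolding regular_system_def by (elim conjE) (intro conjI)
 then show "D \<noteq> {}" "r \<subseteq> D \<times> D" "\<And>i. i \<in> D ==> (i, i) \<in> r" "\<And>i j k. (i, j) \<in> r ==> (j, k) \<in> r ==> (i, k) \<in> r"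
  "\<And>i j. i \<in> D ==> j \<in> D ==> \<exists>k\<in>D. (i, k) \<in> r \<and> (j, k) \<in> r"
  unfolding partial_order_on_def preorder_on_def refl_on_def trans_def by blast+
qed

lemma opens:
 assumes "i \<in> D" shows "is_open_subscheme M (B i) (\<phi> i)" "\<not> zero_ring (B i)"
proof -
 have "\<forall>i\<in>D. is_open_subscheme M (B i) (\<phi> i) \<and> \<not> zero_ring (B i)"
  using rs unfolding regular_system_def by (elim conjE)
 from bspec[OF this assms] show "is_open_subscheme M (B i) (\<phi> i)" "\<not> zero_ring (B i)" by simp_all
qed

lemma local_ring:
 assumes i: "i \<in> D"
 obtains a where "a \<in> carrier M" "is_localization M a (B i) (\<phi> i)"
 using opens(1)[OF i] unfolding is_open_subscheme_def by (elim bexE)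

lemma B_ring: "i \<in> D ==> cinf_scheme (B i)" "i \<in> D ==> cinf_ring (B i)" "i \<in> D ==> \<phi> i \<in> chom M (B i)" "i \<in> D ==> \<not> zero_ring (B i)"
proof -
 assume i: "i \<in> D"
 obtain a where "is_localization M a (B i) (\<phi> i)" using local_ring[OF i] .
 from localizationD[OF this] show "cinf_scheme (B i)" "cinf_ring (B i)" "\<phi> i \<in> chom M (B i)" using schemeD by blast+
 show "\<not> zero_ring (B i)" by (rule opens(2)[OF i])
qed

lemma rho:
 assumes "(i, j) \<in> r"
 shows "\<rho> i j \<in> chom (B i) (B j)" "\<And>x. x \<in> carrier M ==> \<rho> i j (\<phi> i x) = \<phi> j x"
proof -
 have "\<forall>(i, j)\<in>r. \<rho> i j \<in> chom (B i) (B j) \<and> (\<forall>x\<in>carrier M. \<rho> i j (\<phi> i x) = \<phi> j x)"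
  using rs unfolding regular_system_def by (elim conjE)
 from bspec[OF this assms] show "\<rho> i j \<in> chom (B i) (B j)" "\<And>x. x \<in> carrier M ==> \<rho> i j (\<phi> i x) = \<phi> j x" by simp_all
qed

lemma L_ring: "cinf_scheme L" "cinf_ring L" "i \<in> D ==> \<iota> i \<in> chom (B i) L"
  "(i, j) \<in> r ==> x \<in> carrier (B i) ==> \<iota> j (\<rho> i j x) = \<iota> i x"
proof -
 have *: "cinf_scheme L \<and> (\<forall>i\<in>D. \<iota> i \<in> chom (B i) L) \<and> (\<forall>(i, j)\<in>r. \<forall>x\<in>carrier (B i). \<iota> j (\<rho> i j x) = \<iota> i x)"
  using lim unfolding is_limit_def by (elim conjE) (intro conjI)
 show "cinf_scheme L" "cinf_ring L" "i \<in> D ==> \<iota> i \<in> chom (B i) L" using * schemeD by blast+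
 show "(i, j) \<in> r ==> x \<in> carrier (B i) ==> \<iota> j (\<rho> i j x) = \<iota> i x" using conjunct2[OF conjunct2[OF *]] by fast
qed

lemma epi:
 assumes i: "i \<in> D" and T: "cinf_scheme T" and uv: "u \<in> chom (B i) T" "v \<in> chom (B i) T" "\<And>x. x \<in> carrier M ==> u (\<phi> i x) = v (\<phi> i x)"
 shows "u = v"
proof -
 obtain a where a: "a \<in> carrier M" "is_localization M a (B i) (\<phi> i)" using local_ring[OF i] .
 show ?thesis by (rule localization_epi[OF a(2) M_ring(2) a(1) T uv])
qed

lemma rho_closed: "(i, j) \<in> r ==> x \<in> carrier (B i) ==> \<rho> i j x \<in> carrier (B j)"
 using chomD(1)[OF rho(1)] .

text \<open>If \<open>i < j\<close>, restriction from \<open>U\<^sub>i\<close> to \<open>U\<^sub>j\<close> factors through the closure of \<open>U\<^sub>j\<close>, onto which \<open>C\<^sup>\<infinity>(M)\<close> maps surjectively.\<close>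

lemma image_in_kappa:
 assumes ij: "(i, j) \<in> r" "i \<noteq> j" and y: "y \<in> carrier (B i)"
 shows "\<iota> i y \<in> \<kappa> ` carrier M"
proof -
 have D: "i \<in> D" "j \<in> D" using poset(2) ij by auto
 let ?C = "closure_ideal M (B j) (\<phi> j)"
 have "\<forall>(i, j)\<in>r. i \<noteq> j --> subscheme_le M (quot M (closure_ideal M (B j) (\<phi> j)))
     (quot_map M (closure_ideal M (B j) (\<phi> j))) (B i) (\<phi> i)"
  using rs unfolding regular_system_def by (elim conjE)
 from bspec[OF this ij(1)] have "subscheme_le M (quot M ?C) (quot_map M ?C) (B i) (\<phi> i)" using ij(2) by simp
 then obtain u where u: "u \<in> chom (B i) (quot M ?C)" "\<forall>x\<in>carrier M. u (\<phi> i x) = quot_map M ?C x"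
  unfolding subscheme_le_def by blast
 have "ideal ?C (as_ring M)" unfolding closure_ideal_ker by (rule ker_ideal[OF B_ring(3)[OF D(2)] M_ring(2) B_ring(2)[OF D(2)]])
 note q = quot_basics[OF M_ring(2) this]
 have "ker M (quot M ?C) (quot_map M ?C) \<subseteq> ker M (B j) (\<phi> j)" using q(4) unfolding closure_ideal_ker by simp
 from chom_factor[OF M_ring(2) q(1) B_ring(2)[OF D(2)] q(2,3) B_ring(3)[OF D(2)] this]
 obtain v where v: "v \<in> chom (quot M ?C) (B j)" "\<forall>x\<in>carrier M. v (quot_map M ?C x) = \<phi> j x" by blast
 have "(\<lambda>y\<in>carrier (B i). v (u y)) = \<rho> i j"
  by (rule epi[OF D(1) B_ring(1)[OF D(2)] chom_compose[OF u(1) v(1) B_ring(2)[OF D(1)] B_ring(2)[OF D(2)]] rho(1)[OF ij(1)]])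
   (use u(2) v(2) rho(2)[OF ij(1)] chomD(1)[OF B_ring(3)[OF D(1)]] in simp)
 then have e: "\<rho> i j y = v (u y)" using y by (metis restrict_apply')
 have "u y \<in> quot_map M ?C ` carrier M" using chomD(1)[OF u(1) y] q(3) by simp
 then obtain x where x: "x \<in> carrier M" "u y = quot_map M ?C x" by blast
 have "\<iota> i y = \<iota> j (\<phi> j x)" using L_ring(4)[OF ij(1) y] e x v(2) by simp
 then show ?thesis using comm[OF D(2) x(1)] x(1) by (intro image_eqI[of _ _ x]) simp_all
qed

text \<open>By \<open>image_in_kappa\<close> the image of \<open>\<kappa>\<close>, in a copy of
  standard type, receives compatible maps from all \<open>B i\<close>. The universal property gives
  a map from \<open>L\<close> to it whose composite with the inclusion is the identity of
  \<open>L\<close>.\<close>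

lemma kappa_surj:
 assumes no_top: "\<And>i. i \<in> D ==> \<exists>j. (i, j) \<in> r \<and> i \<noteq> j"
 shows "\<kappa> ` carrier M = carrier L"
proof -
 obtain N x where gen: "generates M N x" using M_ring(1) scheme_iff by blast
 note x = generatesD(1)[OF gen]
 have kx: "\<kappa> (x i) \<in> carrier L" if "i < N" for i using chomD(1)[OF kappa] x that by blast
 have im: "{app L N g (%i. \<kappa> (x i)) | g. Sm N g} = \<kappa> ` carrier M"
 proof (intro equalityI subsetI)
  interpret M: cinf M by unfold_locales (rule M_ring)
  fix z assume "z \<in> {app L N g (%i. \<kappa> (x i)) | g. Sm N g}"
  then obtain g where g: "Sm N g" "z = app L N g (%i. \<kappa> (x i))" by blast
  show "z \<in> \<kappa> ` carrier M" unfolding g(2) chom_app'[OF kappa g(1) x, symmetric] by (rule imageI[OF M.app_closed'[OF g(1) x]])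
 next
  fix z assume "z \<in> \<kappa> ` carrier M"
  then obtain f where f: "f \<in> carrier M" "z = \<kappa> f" by blast
  obtain g where g: "Sm N g" "f = app M N g x" using generatesD(2)[OF gen f(1)] by blast
  show "z \<in> {app L N g (%i. \<kappa> (x i)) | g. Sm N g}" using f(2) g chom_app'[OF kappa g(1) x] by blast
 qed
 obtain T :: "std cinf" and j where T: "cinf_scheme T" and j: "j \<in> chom T L" "inj_on j (carrier T)" and jim0: "j ` carrier T = {app L N g (%i. \<kappa> (x i)) | g. Sm N g}"
  using subring_std[OF L_ring(2) kx] .
 note jim = trans[OF jim0 im]
 note T' = schemeD[OF T]
 have "\<forall>i\<in>D. \<exists>k. k \<in> chom (B i) T \<and> (\<forall>y\<in>carrier (B i). j (k y) = \<iota> i y)"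
 proof
  fix i assume i: "i \<in> D"
  have "\<iota> i ` carrier (B i) \<subseteq> j ` carrier T" unfolding jim using image_in_kappa no_top[OF i] by blast
  from chom_lift[OF j L_ring(3)[OF i] this T' L_ring(2) B_ring(2)[OF i]]
  show "\<exists>k. k \<in> chom (B i) T \<and> (\<forall>y\<in>carrier (B i). j (k y) = \<iota> i y)" by blast
 qed
 from bchoice[OF this] obtain k where k: "\<forall>i\<in>D. k i \<in> chom (B i) T \<and> (\<forall>y\<in>carrier (B i). j (k i y) = \<iota> i y)" by (rule exE)
 have k1: "\<forall>i\<in>D. k i \<in> chom (B i) T" and k2: "\<And>i y. i \<in> D ==> y \<in> carrier (B i) ==> j (k i y) = \<iota> i y" using k by simp_all
 have comp: "\<forall>(i, i')\<in>r. \<forall>y\<in>carrier (B i). k i' (\<rho> i i' y) = k i y"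
 proof clarify
  fix i i' y assume ii: "(i, i') \<in> r" and y: "y \<in> carrier (B i)"
  have D: "i \<in> D" "i' \<in> D" using poset(2) ii by auto
  note ry = rho_closed[OF ii y]
  have "j (k i' (\<rho> i i' y)) = j (k i y)" using k2[OF D(2) ry] k2[OF D(1) y] L_ring(4)[OF ii y] by simp
  then show "k i' (\<rho> i i' y) = k i y"
   using inj_onD[OF j(2)] chomD(1)[OF bspec[OF k1 D(2)] ry] chomD(1)[OF bspec[OF k1 D(1)] y] by blast
 qed
 from limit_univ(1)[OF lim B_ring(2) T k1 comp poset(2) rho_closed]
 obtain u where u: "u \<in> chom L T" "\<forall>i\<in>D. \<forall>y\<in>carrier (B i). u (\<iota> i y) = k i y" by blast
 have "(\<lambda>y\<in>carrier L. j (u y)) = (\<lambda>y\<in>carrier L. y)"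
 proof (rule limit_univ(2)[OF lim B_ring(2) L_ring(1) _ _ poset(2) rho_closed])
  show "\<forall>i\<in>D. \<iota> i \<in> chom (B i) L" using L_ring(3) by blast
  show "\<forall>(i, j)\<in>r. \<forall>x\<in>carrier (B i). \<iota> j (\<rho> i j x) = \<iota> i x" using L_ring(4) by fast
  show "(\<lambda>y\<in>carrier L. j (u y)) \<in> chom L L" by (rule chom_compose[OF u(1) j(1) L_ring(2) L_ring(2)])
  show "(\<lambda>y\<in>carrier L. y) \<in> chom L L" by (rule chom_id[OF L_ring(2)])
  fix i x assume i: "i \<in> D" and x: "x \<in> carrier (B i)"
  show "(\<lambda>y\<in>carrier L. j (u y)) (\<iota> i x) = \<iota> i x \<and> (\<lambda>y\<in>carrier L. y) (\<iota> i x) = \<iota> i x"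
   using chomD(1)[OF L_ring(3)[OF i] x] bspec[OF bspec[OF u(2) i] x] k2[OF i x] by simp
 qed
 then have "j (u y) = y" if "y \<in> carrier L" for y using that by (metis restrict_apply')
 then have "y \<in> j ` carrier T" if "y \<in> carrier L" for y using that chomD(1)[OF u(1) that] by (metis imageI)
 then show ?thesis unfolding jim using chomD(1)[OF kappa] by blast
qed

text \<open>The maps \<open>\<rho> i k\<close> into the ring of the smallest open subscheme are
  compatible, and \<open>\<rho> k k\<close> is the identity because localizations are
  epimorphisms.\<close>

lemma top_iso:
 assumes k: "k \<in> D" and top: "\<And>i. i \<in> D ==> (i, k) \<in> r"
 obtains u where "u \<in> chom L (B k)" "\<And>y. y \<in> carrier (B k) ==> u (\<iota> k y) = y" "\<And>z. z \<in> carrier L ==> \<iota> k (u z) = z"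
proof -
 have 1: "\<forall>i\<in>D. \<rho> i k \<in> chom (B i) (B k)" using rho(1)[OF top] by blast
 have 2: "\<forall>(i, j)\<in>r. \<forall>x\<in>carrier (B i). \<rho> j k (\<rho> i j x) = \<rho> i k x"
 proof clarify
  fix i j x assume ij: "(i, j) \<in> r" and x: "x \<in> carrier (B i)"
  have D: "i \<in> D" "j \<in> D" using poset(2) ij by auto
  have "(\<lambda>x\<in>carrier (B i). \<rho> j k (\<rho> i j x)) = \<rho> i k"
   by (rule epi[OF D(1) B_ring(1)[OF k] chom_compose[OF rho(1)[OF ij] rho(1)[OF top[OF D(2)]] B_ring(2)[OF D(1)] B_ring(2)[OF k]] rho(1)[OF top[OF D(1)]]])
    (use rho(2)[OF ij] rho(2)[OF top[OF D(2)]] rho(2)[OF top[OF D(1)]] chomD(1)[OF B_ring(3)[OF D(1)]] in simp)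
  then show "\<rho> j k (\<rho> i j x) = \<rho> i k x" using x by (metis restrict_apply')
 qed
 have "(\<lambda>x\<in>carrier (B k). x) = \<rho> k k"
  by (rule epi[OF k B_ring(1)[OF k] chom_id[OF B_ring(2)[OF k]] rho(1)[OF top[OF k]]])
   (use rho(2)[OF top[OF k]] chomD(1)[OF B_ring(3)[OF k]] in simp)
 then have kk: "\<rho> k k y = y" if "y \<in> carrier (B k)" for y using that by (metis restrict_apply')
 from limit_univ(1)[OF lim B_ring(2) B_ring(1)[OF k] 1 2 poset(2) rho_closed]
 obtain u where u: "u \<in> chom L (B k)" "\<forall>i\<in>D. \<forall>y\<in>carrier (B i). u (\<iota> i y) = \<rho> i k y" by blast
 have "(\<lambda>z\<in>carrier L. \<iota> k (u z)) = (\<lambda>z\<in>carrier L. z)"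
 proof (rule limit_univ(2)[OF lim B_ring(2) L_ring(1) _ _ poset(2) rho_closed])
  show "\<forall>i\<in>D. \<iota> i \<in> chom (B i) L" using L_ring(3) by blast
  show "\<forall>(i, j)\<in>r. \<forall>x\<in>carrier (B i). \<iota> j (\<rho> i j x) = \<iota> i x" using L_ring(4) by fast
  show "(\<lambda>z\<in>carrier L. \<iota> k (u z)) \<in> chom L L" by (rule chom_compose[OF u(1) L_ring(3)[OF k] L_ring(2) L_ring(2)])
  show "(\<lambda>y\<in>carrier L. y) \<in> chom L L" by (rule chom_id[OF L_ring(2)])
  fix i x assume i: "i \<in> D" and x: "x \<in> carrier (B i)"
  show "(\<lambda>z\<in>carrier L. \<iota> k (u z)) (\<iota> i x) = \<iota> i x \<and> (\<lambda>y\<in>carrier L. y) (\<iota> i x) = \<iota> i x"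
   using chomD(1)[OF L_ring(3)[OF i] x] bspec[OF bspec[OF u(2) i] x] L_ring(4)[OF top[OF i] x] by simp
 qed
 then have z: "\<iota> k (u z) = z" if "z \<in> carrier L" for z using that by (metis restrict_apply')
 have "u (\<iota> k y) = y" if "y \<in> carrier (B k)" for y using bspec[OF bspec[OF u(2) k] that] kk[OF that] by simp
 then show thesis by (rule that[OF u(1) _ z])
qed

end

text \<open>With a single index the closure condition is void, so \<open>M\<close> may be its own
  only open subscheme, as the localization at 1. Any isomorphism between \<open>M\<close> and the
  reduction of \<open>X\<close> then presents \<open>X\<close>.\<close>

lemma trivial_presentation:
 fixes X :: "'a cinf" and M :: "std cinf"
 assumes M: "manifold_with_corners n M" and nz: "\<not> zero_ring M" and k: "\<kappa> \<in> chom M (red X)" and X: "cinf_scheme (red X)"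
  and u: "u \<in> chom (red X) M" "\<And>y. y \<in> carrier M ==> u (\<kappa> y) = y" "\<And>z. z \<in> carrier (red X) ==> \<kappa> (u z) = z"
 shows "presentation n X M {{}} {({}, {})} (%_. M) (%_. \<lambda>x\<in>carrier M. x) \<kappa>"
proof -
 let ?id = "\<lambda>x\<in>carrier M. x"
 have Ms: "cinf_scheme M" using M unfolding manifold_with_corners_def by blast
 note M' = schemeD[OF Ms] and X' = schemeD[OF X]
 interpret M: cinf M by unfold_locales (rule M')
 have id: "?id \<in> chom M M" by (rule chom_id[OF M'])
 have one: "const M 1 \<in> Units (as_ring M)" unfolding M.Units_iff by (auto intro!: bexI[of _ "const M 1"])
 have "is_localization M (const M 1) M ?id"
 proof (rule localizationI[OF Ms id])
  show "?id (const M 1) \<in> Units (as_ring M)" using one by simp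
  fix T :: "std cinf" and \<tau> assume t: "\<tau> \<in> chom M T"
  show "\<exists>!u. u \<in> chom M T \<and> (\<forall>x\<in>carrier M. u (?id x) = \<tau> x)"
  proof (rule ex1I[of _ \<tau>])
   fix v assume v: "v \<in> chom M T \<and> (\<forall>x\<in>carrier M. v (?id x) = \<tau> x)"
   show "v = \<tau>" by (rule chom_eqI[OF conjunct1[OF v] t]) (use v in simp)
  qed (use t in simp)
 qed
 then have open': "is_open_subscheme M M ?id" unfolding is_open_subscheme_def using M.const_closed by blast
 have po: "partial_order_on {{}} {({}, {})}"
  by (auto simp: partial_order_on_def preorder_on_def refl_on_def trans_def antisym_def)
 have rs: "regular_system M {{}} {({}, {})} (%_. M) (%_. ?id) (%_ _. ?id)"
  unfolding regular_system_def using po open' nz id by simp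
 have "is_limit {{}} {({}, {})} (%_. M) (%_ _. ?id) (red X) (%_. \<kappa>)"
  unfolding is_limit_def
 proof (intro conjI X ballI allI impI)
  show "\<kappa> \<in> chom M (red X)" by (rule k)
  show "case p of (i, j) => \<forall>x\<in>carrier M. \<kappa> (?id x) = \<kappa> x" for p :: "'b set \<times> 'b set" by (simp split: prod.split)
  fix T :: "std cinf" and c :: "'b set => std => std" assume Ts: "cinf_scheme T"
   and c: "(\<forall>i\<in>{{}}. c i \<in> chom M T) \<and> (\<forall>(i, j)\<in>{({}, {})}. \<forall>x\<in>carrier M. c j (?id x) = c i x)"
  have c0: "c {} \<in> chom M T" using c by simp
  show "\<exists>!v. v \<in> chom (red X) T \<and> (\<forall>i\<in>{{}}. \<forall>x\<in>carrier M. v (\<kappa> x) = c i x)"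
  proof (rule ex1I[of _ "\<lambda>z\<in>carrier (red X). c {} (u z)"], intro conjI ballI)
   show "(\<lambda>z\<in>carrier (red X). c {} (u z)) \<in> chom (red X) T" by (rule chom_compose[OF u(1) c0 X' schemeD[OF Ts]])
   show "(\<lambda>z\<in>carrier (red X). c {} (u z)) (\<kappa> x) = c i x" if "i \<in> {{}}" "x \<in> carrier M" for i x
    using that chomD(1)[OF k that(2)] u(2) by simp
   fix v assume v: "v \<in> chom (red X) T \<and> (\<forall>i\<in>{{}}. \<forall>x\<in>carrier M. v (\<kappa> x) = c i x)"
   show "v = (\<lambda>z\<in>carrier (red X). c {} (u z))"
   proof (rule chom_eqI[OF conjunct1[OF v] chom_compose[OF u(1) c0 X' schemeD[OF Ts]]])
    fix z assume z: "z \<in> carrier (red X)"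
    have "v (\<kappa> (u z)) = c {} (u z)" using v chomD(1)[OF u(1) z] by simp
    then show "v z = (\<lambda>z\<in>carrier (red X). c {} (u z)) z" using u(3)[OF z] z by simp
   qed
  qed
 qed
 then show ?thesis unfolding presentation_def using M k rs
  by (intro conjI exI[of _ "%_ _. ?id"] exI[of _ "%_. \<kappa>"]) auto
qed

theorem proposition2:
 fixes X :: "'a cinf" and f :: 'a
 assumes "asymptotic_manifold X" and "f \<in> carrier X"
 shows "UNIV - Reg X f \<in> null_sets lebesgue"
proof (cases "zero_ring X")
 case True
 then have "Reg X f = UNIV" unfolding Reg_def by simp
 then show ?thesis by simp
next
 case False
 then obtain n M D r B \<phi> \<kappa> where P: "presentation n X M D r B \<phi> \<kappa>" and Xs: "cinf_scheme X"
  using assms(1) unfolding asymptotic_manifold_def asymptotic_manifold_dim_def by blast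
 have fr: "red_map X f \<in> carrier (red X)" using chomD(1)[OF red_basics(3)[OF Xs] assms(2)] .
 \<comment> \<open>The presentation is free to vary: any one through which \<open>f\<close> comes
   from the ambient manifold with corners will do.\<close>
 have conclude: ?thesis if P: "presentation n' X M' D' r' B' \<phi>' \<kappa>'" and F: "F \<in> carrier M'" "\<kappa>' F = red_map X f"
  for n' M' D' r' B' \<phi>' \<kappa>' F
 proof -
  have "manifold_with_corners n' M'" using P unfolding presentation_def by blast
  from corners_critical_negligible[OF this F(1)] have "negligible {t. \<not> corners_regular_value M' F t}" .
  moreover have "UNIV - Reg X f \<subseteq> {t. \<not> corners_regular_value M' F t}"
  proof
   fix t assume "t \<in> UNIV - Reg X f"
   then show "t \<in> {t. \<not> corners_regular_value M' F t}" unfolding Reg_def using P F by blast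
  qed
  ultimately show ?thesis using negligible_subset negligible_iff_null_sets by blast
 qed
 obtain \<rho> \<iota> where S: "presented n M D r B \<phi> \<rho> (red X) \<iota> \<kappa>"
  using P unfolding presentation_def by (elim conjE exE) (rule that, unfold_locales, assumption+, blast)
 interpret presented n M D r B \<phi> \<rho> "red X" \<iota> \<kappa> by (rule S)
 show ?thesis
 proof (cases "\<exists>k\<in>D. \<forall>i\<in>D. (i, k) \<in> r")
  case True
  then obtain k where k: "k \<in> D" "\<And>i. i \<in> D ==> (i, k) \<in> r" by blast
  obtain u where u: "u \<in> chom (red X) (B k)" "\<And>y. y \<in> carrier (B k) ==> u (\<iota> k y) = y"
   "\<And>z. z \<in> carrier (red X) ==> \<iota> k (u z) = z" using top_iso[OF k] by blast
  \<comment> \<open>Functions on the smallest open subscheme need not extend to \<open>M\<close>, so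
    this subscheme replaces \<open>M\<close>.\<close>
  obtain a where a: "a \<in> carrier M" "is_localization M a (B k) (\<phi> k)" using local_ring[OF k(1)] .
  have "manifold_with_corners n (B k)" by (rule manifold_with_corners_open[OF M a B_ring(4)[OF k(1)]])
  from trivial_presentation[OF this B_ring(4)[OF k(1)] L_ring(3)[OF k(1)] L_ring(1) u]
  have "presentation n X (B k) {{}} {({}, {})} (%_. B k) (%_. \<lambda>x\<in>carrier (B k). x) (\<iota> k)" .
  from conclude[OF this chomD(1)[OF u(1) fr]] u(3)[OF fr] show ?thesis by blast
 next
  case False
  have "\<exists>j. (i, j) \<in> r \<and> i \<noteq> j" if i: "i \<in> D" for i
  proof -
   obtain i' where i': "i' \<in> D" "(i', i) \<notin> r" using False i by blast
   \<comment> \<open>\<open>j\<close> differs from \<open>i\<close>, because it lies above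
     \<open>i'\<close> and \<open>i\<close> does not.\<close>
   obtain j where j: "(i, j) \<in> r" "(i', j) \<in> r" using poset(5)[OF i i'(1)] by blast
   then show ?thesis using i'(2) by blast
  qed
  from kappa_surj[OF this] have "red_map X f \<in> \<kappa> ` carrier M" using fr by simp
  then obtain F where F: "F \<in> carrier M" "\<kappa> F = red_map X f" by (elim imageE) simp
  show ?thesis by (rule conclude[OF P F])
 qed
qed

end
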